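(* Fix $k\in\mathbb{Z}_{\ge 1}$, $\alpha\in(0,1/2]$ and a finite set $P$ of primes. For each $n\ge 1$ let $M_1,\dots,M_k$ be independent random $n\times n$ matrices over $\mathbb{Z}$, each of which is $\alpha,P$-balanced. Let $\mathbf{G}=(G_k\twoheadrightarrow\dots\twoheadrightarrow G_1)$ be a surjective $k$-flag of finite abelian $P$-groups. Then $$\lim_{n\to\infty}\mathbf{P}\big(\mathbf{cok}(M_1,\dots,M_k)_P\simeq\mathbf{G}\big)=\frac{1}{|\mathrm{Aut}(\mathbf{G})|}\Big(\prod_{p\in P}\prod_{i=1}^\infty(1-p^{-i})\Big)^k,$$ where $\mathrm{Aut}(\mathbf{G})$ is the automorphism group of $\mathbf{G}$ as a flag and $\simeq$ is isomorphism of flags.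
   Context: Balancedness: a $\mathbb{Z}$-valued random variable $\xi$ is $\alpha,P$-balanced if $\max_{r\in\mathbb{Z}/p\mathbb{Z}}\mathbf{P}(\xi\equiv r \pmod p)\le 1-\alpha$ for every $p\in P$. A random integer matrix is $\alpha,P$-balanced if its entries are independent (not necessarily identically distributed) and each entry is $\alpha,P$-balanced. $\mathbb{Z}_{(P)}=\mathbb{Z}[s^{-1}:\gcd(s,\prod_{p\in P}p)=1]$. A finite abelian $P$-group is a finite abelian group whose order has only prime factors in $P$ (equivalently, a finite $\mathbb{Z}_{(P)}$-module). For an abelian group $A$, $A_P:=A\otimes_{\mathbb{Z}}\mathbb{Z}_{(P)}$ (for finite $A$, the product of the $p$-Sylow subgroups, $p\in P$). A surjective $k$-flag of finite abelian $P$-groups is a chain of surjections $G_k\twoheadrightarrow\dots\twoheadrightarrow G_1$ of finite abelian $P$-groups. A morphism of flags $\mathbf{G}\to\mathbf{G}'$ is a tuple of homomorphisms $\alpha_i:G_i\to G_i'$ ($1\le i\le k$) commuting with the surjections of the flags; isomorphisms and automorphisms are understood accordingly (the same notion of isomorphism is used for chains of finitely generated $\mathbb{Z}_{(P)}$-modules). For $M\in\mathrm{Mat}_n(\mathbb{Z})$, $\mathrm{cok}(M)=\mathbb{Z}^n/M\mathbb{Z}^n$. $\mathbf{cok}(M_1,\dots,M_k)_P$ is the chain $\mathrm{cok}(M_1\cdots M_k)_P\twoheadrightarrow\dots\twoheadrightarrow\mathrm{cok}(M_1M_2)_P\twoheadrightarrow\mathrm{cok}(M_1)_P$ with the natural maps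 induced by the inclusions $\mathrm{im}(M_1\cdots M_i)\subseteq\mathrm{im}(M_1\cdots M_{i-1})$. *)

theory Defs
  imports
    "HOL-Algebra.Algebra"
    "HOL-Probability.Probability"
    "Jordan_Normal_Form.Matrix"
begin

hide_const (open) Divisibility.prime

section \<open>Balanced random matrices\<close>

definition (in prob_space) balanced :: "real \<Rightarrow> nat set \<Rightarrow> ('a \<Rightarrow> int) \<Rightarrow> bool" where
  "balanced \<alpha> P \<xi> \<longleftrightarrow>
     random_variable (count_space UNIV) \<xi> \<and>
     (\<forall>p\<in>P. (MAX r\<in>{0..<int p}. prob {\<omega> \<in> space M. \<xi> \<omega> mod int p = r}) \<le> 1 - \<alpha>)"

definition (in prob_space) balanced_matrix ::
    "real \<Rightarrow> nat set \<Rightarrow> nat \<Rightarrow> ('a \<Rightarrow> int mat) \<Rightarrow> bool" where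
  "balanced_matrix \<alpha> P n A \<longleftrightarrow>
     (\<forall>\<omega>\<in>space M. A \<omega> \<in> carrier_mat n n) \<and>
     indep_vars (\<lambda>_. count_space UNIV) (\<lambda>(a, b) \<omega>. A \<omega> $$ (a, b)) ({..<n} \<times> {..<n}) \<and>
     (\<forall>a<n. \<forall>b<n. balanced \<alpha> P (\<lambda>\<omega>. A \<omega> $$ (a, b)))"

section \<open>Induced maps, tensor products and the localisation of the integers\<close>

text \<open>The map from the quotient of some group to \<^term>\<open>G' Mod H'\<close> that \<^term>\<open>f\<close>, a homomorphism
  to \<^term>\<open>G'\<close>, induces when it sends the kernel of the first quotient into \<^term>\<open>H'\<close>.
  All the cosets in the union are then equal.\<close>

definition quot_map ::
    "('b, 'm) monoid_scheme \<Rightarrow> 'b set \<Rightarrow> ('a \<Rightarrow> 'b) \<Rightarrow> 'a set \<Rightarrow> 'b set" where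
  "quot_map G' H' f C = (\<Union>x\<in>C. H' #>\<^bsub>G'\<^esub> f x)"

text \<open>The tensor product over the integers of two abelian groups, both written multiplicatively:
  the free abelian group on the pairs modulo the biadditivity relations.\<close>

definition tensor_rels ::
    "('a, 'm) monoid_scheme \<Rightarrow> ('b, 'l) monoid_scheme \<Rightarrow> ('a \<times> 'b \<Rightarrow>\<^sub>0 int) set" where
  "tensor_rels A B = generate (free_Abelian_group (carrier A \<times> carrier B))
     ({frag_of (a \<otimes>\<^bsub>A\<^esub> a', b) - frag_of (a, b) - frag_of (a', b) | a a' b.
         a \<in> carrier A \<and> a' \<in> carrier A \<and> b \<in> carrier B} \<union>
      {frag_of (a, b \<otimes>\<^bsub>B\<^esub> b') - frag_of (a, b) - frag_of (a, b') | a b b'.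
         a \<in> carrier A \<and> b \<in> carrier B \<and> b' \<in> carrier B})"

definition tensor ::
    "('a, 'm) monoid_scheme \<Rightarrow> ('b, 'l) monoid_scheme \<Rightarrow> ('a \<times> 'b \<Rightarrow>\<^sub>0 int) set monoid" where
  "tensor A B = free_Abelian_group (carrier A \<times> carrier B) Mod tensor_rels A B"

text \<open>\<^term>\<open>tensor_map A' B f\<close> is the map \<open>f \<otimes> id\<close> into \<^term>\<open>tensor A' B\<close>.\<close>

definition tensor_map ::
    "('c, 'm) monoid_scheme \<Rightarrow> ('b, 'l) monoid_scheme \<Rightarrow> ('a \<Rightarrow> 'c) \<Rightarrow>
     ('a \<times> 'b \<Rightarrow>\<^sub>0 int) set \<Rightarrow> ('c \<times> 'b \<Rightarrow>\<^sub>0 int) set" where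
  "tensor_map A' B f =
     quot_map (free_Abelian_group (carrier A' \<times> carrier B)) (tensor_rels A' B)
       (frag_extend (\<lambda>(a, b). frag_of (f a, b)))"

text \<open>The additive group of the localisation of the integers at the integers prime to all
  elements of \<^term>\<open>P\<close>, as classes of fractions \<open>a / s\<close>. The factor \<open>u\<close> matters only
  for empty \<^term>\<open>P\<close>: then \<open>0\<close> is prime to the empty product and gets inverted,
  and the localisation is the zero ring.\<close>

definition loc_denoms :: "nat set \<Rightarrow> int set" where
  "loc_denoms P = {s. coprime s (int (\<Prod>p\<in>P. p))}"

definition loc_rel :: "nat set \<Rightarrow> ((int \<times> int) \<times> (int \<times> int)) set" where
  "loc_rel P = {((a, s), (b, t)) | a s b t.
     s \<in> loc_denoms P \<and> t \<in> loc_denoms P \<and> (\<exists>u\<in>loc_denoms P. u * (a * t - b * s) = 0)}"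

definition loc_int :: "nat set \<Rightarrow> (int \<times> int) set monoid" where
  "loc_int P = \<lparr>
     carrier = (UNIV \<times> loc_denoms P) // loc_rel P,
     monoid.mult = (\<lambda>q q'. \<Union>(a, s)\<in>q. \<Union>(b, t)\<in>q'. loc_rel P `` {(a * t + b * s, s * t)}),
     one = loc_rel P `` {(0, 1)}\<rparr>"

section \<open>Flags of groups\<close>

text \<open>A chain \<open>G\<^sub>k \<rightarrow> \<dots> \<rightarrow> G\<^sub>1\<close>, whose length \<open>k\<close> is a separate parameter:
  \<^term>\<open>proj F i\<close> is the map from \<^term>\<open>grp F (Suc i)\<close> to \<^term>\<open>grp F i\<close>, and only
  the groups with index in \<open>{1..k}\<close> and the maps with index in \<open>{1..<k}\<close> are relevant.\<close>

record 'a flag =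
  grp :: "nat \<Rightarrow> 'a monoid"
  proj :: "nat \<Rightarrow> 'a \<Rightarrow> 'a"

definition finite_abelian_P_group :: "nat set \<Rightarrow> ('a, 'm) monoid_scheme \<Rightarrow> bool" where
  "finite_abelian_P_group P G \<longleftrightarrow>
     comm_group G \<and> finite (carrier G) \<and> (\<forall>p. prime p \<and> p dvd Coset.order G \<longrightarrow> p \<in> P)"

definition surjective_P_flag :: "nat set \<Rightarrow> nat \<Rightarrow> 'a flag \<Rightarrow> bool" where
  "surjective_P_flag P k F \<longleftrightarrow>
     (\<forall>i\<in>{1..k}. finite_abelian_P_group P (grp F i)) \<and>
     (\<forall>i\<in>{1..<k}. proj F i \<in> epi (grp F (Suc i)) (grp F i))"

text \<open>A homomorphism between modules over the localisation of the integers is automatically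
  linear, so that morphisms of chains of such modules are morphisms of the underlying groups.\<close>

definition flag_hom :: "nat \<Rightarrow> 'a flag \<Rightarrow> 'b flag \<Rightarrow> (nat \<Rightarrow> 'a \<Rightarrow> 'b) set" where
  "flag_hom k F F' = {f. (\<forall>i\<in>{1..k}. f i \<in> hom (grp F i) (grp F' i)) \<and>
     (\<forall>i\<in>{1..<k}. \<forall>x\<in>carrier (grp F (Suc i)). f i (proj F i x) = proj F' i (f (Suc i) x))}"

definition flag_iso :: "nat \<Rightarrow> 'a flag \<Rightarrow> 'b flag \<Rightarrow> (nat \<Rightarrow> 'a \<Rightarrow> 'b) set" where
  "flag_iso k F F' = {f \<in> flag_hom k F F'. \<forall>i\<in>{1..k}. f i \<in> iso (grp F i) (grp F' i)}"

definition flag_isomorphic :: "nat \<Rightarrow> 'a flag \<Rightarrow> 'b flag \<Rightarrow> bool" where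
  "flag_isomorphic k F F' \<longleftrightarrow> flag_iso k F F' \<noteq> {}"

text \<open>The maps are extensional, so that each automorphism is counted once.\<close>

definition flag_auto :: "nat \<Rightarrow> 'a flag \<Rightarrow> (nat \<Rightarrow> 'a \<Rightarrow> 'a) set" where
  "flag_auto k F =
     flag_iso k F F \<inter> extensional {1..k} \<inter> {f. \<forall>i\<in>{1..k}. f i \<in> extensional (carrier (grp F i))}"

section \<open>Flags of cokernels\<close>

definition mat_image :: "nat \<Rightarrow> int mat \<Rightarrow> int vec set" where
  "mat_image n A = (\<lambda>v. A *\<^sub>v v) ` carrier_vec n"

definition cok :: "nat \<Rightarrow> int mat \<Rightarrow> int vec set monoid" where
  "cok n A = monoid_vec TYPE(int) n Mod mat_image n A"

text \<open>The product \<open>A\<^sub>1 \<cdots> A\<^sub>i\<close>.\<close>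

primrec mat_prod :: "nat \<Rightarrow> (nat \<Rightarrow> int mat) \<Rightarrow> nat \<Rightarrow> int mat" where
  "mat_prod n A 0 = 1\<^sub>m n"
| "mat_prod n A (Suc i) = mat_prod n A i * A (Suc i)"

definition cok_flag ::
    "nat set \<Rightarrow> nat \<Rightarrow> (nat \<Rightarrow> int mat) \<Rightarrow> (int vec set \<times> (int \<times> int) set \<Rightarrow>\<^sub>0 int) set flag" where
  "cok_flag P n A = \<lparr>
     grp = (\<lambda>i. tensor (cok n (mat_prod n A i)) (loc_int P)),
     proj = (\<lambda>i. tensor_map (cok n (mat_prod n A i)) (loc_int P)
       (quot_map (monoid_vec TYPE(int) n) (mat_image n (mat_prod n A i)) (\<lambda>v. v)))\<rparr>"

end

theory Submission
  imports Defs "Jordan_Normal_Form.Determinant"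
begin

text \<open>
  Let \<open>a\<close> be the product of the primes in \<open>P\<close> times the order of \<open>G\<^sub>k\<close>. The flag of cokernels is isomorphic
  to \<open>G\<close> iff there are surjections \<open>H\<^sub>i\<close> from the free group of rank \<open>n\<close> to the \<open>G\<^sub>i\<close>, compatible with
  the maps of \<open>G\<close>, such that the kernel of \<open>H\<^sub>i\<close> is the lattice spanned by the columns of
  \<open>M\<^sub>1 \<cdots> M\<^sub>i\<close> and by \<open>a\<close> times the unit vectors; if there are such families at all, the automorphism group of \<open>G\<close>
  permutes them simply transitively. So the probability is the expected number of these families
  divided by the number of automorphisms, and it suffices that lengthening the chain by one
  group multiplies the expected number by a factor tending to the Euler product,
  uniformly in the given matrices and surjections.

  For one step, condition on all columns of the new matrix except the last \<open>m\<close>. With overwhelming probability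
  (a union bound over Fourier estimates) these columns are independent modulo every prime of
  \<open>P\<close> and annihilated only by dense vectors. Then the number of lifts of the given
  surjection killing them is known exactly, and the images of the remaining columns are almost
  uniform in the quotient. The kernel condition says that these \<open>m\<close> images generate a certain
  finite group whose quotient modulo each \<open>p \<in> P\<close> has rank \<open>m\<close>, which happens with probability \<open>\<Prod>\<^sub>p \<Prod>\<^sub>i\<^sub>\<le>\<^sub>m (1 - p\<^sup>-\<^sup>i)\<close>
  divided by the number of lifts. Finally let \<open>n\<close> and then \<open>m\<close> tend to infinity.
\<close>

section \<open>Characters modulo an integer\<close>

text \<open>The product of the primes is included in \<open>a\<close> so that reduction modulo
  \<open>a\<close> loses nothing. If a localised cokernel modulo \<open>b * g\<close> is killed by
  \<open>g\<close>, then \<open>g\<close> times it equals \<open>b * g\<close> times it and vanishes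
  by Nakayama; modulo \<open>g\<close> alone only its quotient by \<open>g\<close> would be seen.
  The same factor fixes ranks: the group to be generated contains all \<open>p\<close>-torsion of
  its ambient quotient, so its \<open>p\<close>-rank is \<open>m\<close> whatever the flag is. The
  kernel condition at a level involves the whole product of matrices. Precomposing with the product
  \<open>R\<close> of the earlier ones turns it into a condition on the new matrix alone, with
  values in the kernel of one map of the flag (\<open>sat_mult_iff\<close>). Columns are held back
  because a square matrix stays singular modulo \<open>p\<close> with positive probability in the
  limit, while without \<open>m\<close> columns it fails to be injective with probability of order
  at most \<open>2 ^ -m\<close>. The price is a factor \<open>a ^ (m * m)\<close> in the error, so
  \<open>m\<close> stays fixed while \<open>n\<close> grows. \<open>R\<close> itself may be singular
  modulo \<open>p\<close>, but its kernel there is bounded in terms of the preceding group, so the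
  union bounds survive.\<close>

definition ec :: "int \<Rightarrow> int \<Rightarrow> complex" where
  "ec a t = cis (2 * pi * of_int t / of_int a)"

lemma ec_0 [simp]: "ec a 0 = 1"
  by (simp add: ec_def)

lemma norm_ec [simp]: "norm (ec a t) = 1"
  by (simp add: ec_def)

lemma ec_add: "ec a (s + t) = ec a s * ec a t"
  by (simp add: ec_def cis_mult add_divide_distrib ring_distribs)

lemma ec_sum: "ec a (sum f A) = (\<Prod>x\<in>A. ec a (f x))"
  by (induction A rule: infinite_finite_induct) (auto simp: ec_add)

lemma ec_power: "ec a t ^ n = ec a (int n * t)"
  by (induction n) (auto simp: ec_add ring_distribs)

lemma ec_eq_1_iff:
  assumes "a > 0" shows "ec a t = 1 \<longleftrightarrow> a dvd t"
proof
  assume "ec a t = 1"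
  then have "cos (2 * pi * of_int t / of_int a) = 1"
    by (simp add: ec_def complex_eq_iff)
  then obtain n :: int where "2 * pi * of_int t / of_int a = of_int n * 2 * pi"
    using cos_one_2pi_int by blast
  then have "of_int t = of_int n * (of_int a :: real)"
    using assms by (simp add: field_simps)
  then have "t = n * a"
    by (metis of_int_eq_iff of_int_mult)
  then show "a dvd t" by simp
next
  assume "a dvd t"
  then obtain n where "t = a * n" by blast
  with assms have "2 * pi * real_of_int t / real_of_int a = 2 * pi * real_of_int n"
    by simp
  then have "ec a t = cis (2 * pi * real_of_int n)"
    unfolding ec_def by (rule arg_cong)
  also have "\<dots> = 1"
    by (rule cis_multiple_2pi) simp
  finally show "ec a t = 1" .
qed

lemma ec_cong:
  assumes "a > 0" "a dvd s - t" shows "ec a s = ec a t"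
  using ec_add[of a "s - t" t] assms by (simp add: ec_eq_1_iff)

lemma sum_ec:
  assumes "a > 0"
  shows "(\<Sum>x\<in>{0..<a}. ec a (x * t)) = (if a dvd t then of_int a else 0)"
proof -
  define N where "N = nat a"
  have a: "a = int N" using assms by (simp add: N_def)
  have "(\<Sum>x\<in>{0..<a}. ec a (x * t)) = (\<Sum>i<N. ec a t ^ i)"
    unfolding a by (rule sum.reindex_bij_witness[of _ int nat]) (auto simp: ec_power)
  also have "\<dots> = (if a dvd t then of_int a else 0)"
  proof (cases "a dvd t")
    case True
    then show ?thesis using assms by (simp add: ec_eq_1_iff[symmetric] a)
  next
    case False
    have "ec a t ^ N = 1"
      using assms by (simp add: ec_power ec_eq_1_iff a)
    then show ?thesis
      using False assms by (simp add: geometric_sum ec_eq_1_iff)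
  qed
  finally show ?thesis .
qed

section \<open>Linear systems modulo an integer, counted by characters\<close>

abbreviation residues_fun :: "nat \<Rightarrow> int \<Rightarrow> (nat \<Rightarrow> int) set" where
  "residues_fun n a \<equiv> {..<n} \<rightarrow>\<^sub>E {0..<a}"

lemma finite_residues_fun [simp]: "finite (residues_fun n a)"
  by (simp add: finite_PiE)

lemma card_residues_fun: "a \<ge> 0 \<Longrightarrow> card (residues_fun n a) = nat a ^ n"
  by (simp add: card_PiE)

lemma sum_ec_vector:
  assumes "a > 0"
  shows "(\<Sum>x\<in>residues_fun n a. ec a (\<Sum>r<n. x r * t r)) =
    (if \<forall>r<n. a dvd t r then of_int a ^ n else 0)"
proof -
  have "(\<Sum>x\<in>residues_fun n a. ec a (\<Sum>r<n. x r * t r)) =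
      (\<Prod>r<n. \<Sum>x\<in>{0..<a}. ec a (x * t r))"
    by (subst prod_sum_PiE) (auto simp: ec_sum)
  also have "\<dots> = (\<Prod>r<n. if a dvd t r then of_int a else 0)"
    using assms by (simp add: sum_ec)
  also have "\<dots> = (if \<forall>r<n. a dvd t r then of_int a ^ n else 0)"
    by (auto simp: prod_zero_iff)
  finally show ?thesis .
qed

text \<open>The sum of \<open>ec a (x . (C y - w))\<close> over all \<open>x\<close> and
  \<open>y\<close> is evaluated in both orders: summing over \<open>x\<close> first detects the
  solutions of \<open>C y = w\<close>, summing over \<open>y\<close> first detects the vectors
  \<open>x\<close> that annihilate \<open>C\<close>. Sizes of annihilators, kernels and cosets below
  are read off from this duality.\<close>

lemma count_solutions:
  fixes C :: "nat \<Rightarrow> nat \<Rightarrow> int" and w :: "nat \<Rightarrow> int"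
  assumes "a > 0"
  shows "of_nat (card {y\<in>residues_fun k a. \<forall>r<n. a dvd (\<Sum>c<k. C r c * y c) - w r}) * of_int a ^ n =
    of_int a ^ k * (\<Sum>x\<in>{x\<in>residues_fun n a. \<forall>c<k. a dvd (\<Sum>r<n. x r * C r c)}. ec a (- (\<Sum>r<n. x r * w r)))"
    (is "of_nat (card ?Y) * _ = _ * sum _ ?X")
proof -
  let ?S = "\<Sum>y\<in>residues_fun k a. \<Sum>x\<in>residues_fun n a. ec a (\<Sum>r<n. x r * ((\<Sum>c<k. C r c * y c) - w r))"
  have "?S = (\<Sum>y\<in>residues_fun k a. if y \<in> ?Y then of_int a ^ n else 0)"
    using assms by (intro sum.cong) (auto simp: sum_ec_vector)
  also have "\<dots> = of_nat (card ?Y) * of_int a ^ n"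
    by (subst sum.If_cases) (auto simp: Int_def)
  finally have 1: "?S = of_nat (card ?Y) * of_int a ^ n" .
  have eq: "(\<Sum>r<n. x r * ((\<Sum>c<k. C r c * y c) - w r)) =
      (\<Sum>c<k. y c * (\<Sum>r<n. x r * C r c)) + (- (\<Sum>r<n. x r * w r))" for x y :: "nat \<Rightarrow> int"
  proof -
    have "(\<Sum>r<n. x r * (\<Sum>c<k. C r c * y c)) = (\<Sum>r<n. \<Sum>c<k. x r * (C r c * y c))"
      by (simp add: sum_distrib_left)
    also have "\<dots> = (\<Sum>c<k. \<Sum>r<n. x r * (C r c * y c))"
      by (rule sum.swap)
    also have "\<dots> = (\<Sum>c<k. y c * (\<Sum>r<n. x r * C r c))"
      by (simp add: sum_distrib_left mult_ac)
    finally show ?thesis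
      by (simp add: right_diff_distrib sum_subtractf)
  qed
  have "?S = (\<Sum>x\<in>residues_fun n a. \<Sum>y\<in>residues_fun k a.
      ec a (\<Sum>c<k. y c * (\<Sum>r<n. x r * C r c)) * ec a (- (\<Sum>r<n. x r * w r)))"
    unfolding eq ec_add by (rule sum.swap)
  also have "\<dots> = (\<Sum>x\<in>residues_fun n a. (if x \<in> ?X then of_int a ^ k * ec a (- (\<Sum>r<n. x r * w r)) else 0))"
    unfolding sum_distrib_right[symmetric] using assms
    by (intro sum.cong refl) (auto simp: sum_ec_vector)
  also have "\<dots> = of_int a ^ k * (\<Sum>x\<in>?X. ec a (- (\<Sum>r<n. x r * w r)))"
    by (subst sum.If_cases) (auto simp: Int_def sum_distrib_left)
  finally show ?thesis using 1 by simp
qed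

text \<open>A system without nontrivial kernel over any residue field at a prime factor of \<open>a\<close> has
  trivial kernel modulo every product of such primes.\<close>

definition inj_mod :: "int \<Rightarrow> nat \<Rightarrow> nat \<Rightarrow> (nat \<Rightarrow> nat \<Rightarrow> int) \<Rightarrow> bool" where
  "inj_mod a n k C \<longleftrightarrow>
    (\<forall>y. (\<forall>r<n. a dvd (\<Sum>c<k. C r c * y c)) \<longrightarrow> (\<forall>c<k. a dvd y c))"

lemma inj_modD:
  "inj_mod a n k C \<Longrightarrow> (\<And>r. r < n \<Longrightarrow> a dvd (\<Sum>c<k. C r c * y c)) \<Longrightarrow> c < k \<Longrightarrow> a dvd y c"
  by (auto simp: inj_mod_def)

lemma inj_mod_1: "inj_mod 1 n k C"
  by (simp add: inj_mod_def)

text \<open>A kernel vector modulo \<open>a * b\<close> is divisible by \<open>a\<close> by the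
  first assumption; dividing the system by \<open>a\<close> leaves a kernel vector modulo
  \<open>b\<close>.\<close>

lemma inj_mod_mult:
  assumes "inj_mod a n k C" "inj_mod b n k C" "a \<noteq> 0"
  shows "inj_mod (a * b) n k C"
  unfolding inj_mod_def
proof (intro allI impI)
  fix y c assume y: "\<forall>r<n. a * b dvd (\<Sum>c<k. C r c * y c)" and c: "c < k"
  then have "\<forall>r<n. a dvd (\<Sum>c<k. C r c * y c)"
    by (meson dvd_mult_left)
  then have ay: "\<forall>c<k. a dvd y c"
    using assms(1) by (auto simp: inj_mod_def)
  define z where "z c = y c div a" for c
  have yz: "y c = a * z c" if "c < k" for c
    using ay that by (auto simp: z_def)
  have "(\<Sum>c<k. C r c * y c) = a * (\<Sum>c<k. C r c * z c)" for r
    by (auto simp: sum_distrib_left yz intro!: sum.cong)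
  then have "\<forall>r<n. b dvd (\<Sum>c<k. C r c * z c)"
    using y assms(3) by simp
  then have "b dvd z c"
    using assms(2) c by (auto simp: inj_mod_def)
  then show "a * b dvd y c"
    using c by (simp add: yz)
qed

lemma inj_mod_primes:
  assumes "m > 0" "\<And>p. prime p \<Longrightarrow> p dvd m \<Longrightarrow> inj_mod (int p) n k C"
  shows "inj_mod (int m) n k C"
  using assms
proof (induction m rule: nat_less_induct)
  case (1 m)
  show ?case
  proof (cases "m = 1")
    case False
    then obtain p where p: "prime p" "p dvd m"
      using prime_factor_nat by blast
    then obtain l where l: "m = p * l" by blast
    have "l < m" "l > 0" using p(1) "1.prems"(1) l prime_gt_1_nat[of p] by auto
    then have "inj_mod (int l) n k C"
      using "1.IH" "1.prems" l by auto
    then show ?thesis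
      using "1.prems"(2)[OF p] p(1) l by (auto intro!: inj_mod_mult)
  qed (simp add: inj_mod_1)
qed

lemma card_zero_or_one:
  assumes "inj_mod a n k C" "a > 0"
  shows "card {y\<in>residues_fun k a. \<forall>r<n. a dvd (\<Sum>c<k. C r c * y c) - w r} =
    (if \<exists>y. \<forall>r<n. a dvd (\<Sum>c<k. C r c * y c) - w r then 1 else 0)"
proof (cases "\<exists>y. \<forall>r<n. a dvd (\<Sum>c<k. C r c * y c) - w r")
  case True
  then obtain y where y: "\<forall>r<n. a dvd (\<Sum>c<k. C r c * y c) - w r" by blast
  define z where "z = restrict (\<lambda>c. y c mod a) {..<k}"
  have z: "z \<in> residues_fun k a"
    using assms by (auto simp: z_def)
  have "a dvd (\<Sum>c<k. C r c * z c) - w r" if "r < n" for r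
  proof -
    have "(\<Sum>c<k. C r c * y c) - (\<Sum>c<k. C r c * z c) = (\<Sum>c<k. a * (C r c * (y c div a)))"
      unfolding sum_subtractf[symmetric]
    proof (intro sum.cong refl)
      fix c assume "c \<in> {..<k}"
      then have z: "z c = y c - a * (y c div a)"
        by (simp add: z_def minus_mult_div_eq_mod)
      show "C r c * y c - C r c * z c = a * (C r c * (y c div a))"
        unfolding z by (simp add: algebra_simps)
    qed
    then have "a dvd (\<Sum>c<k. C r c * y c) - (\<Sum>c<k. C r c * z c)"
      by (metis dvd_triv_left sum_distrib_left)
    moreover have "a dvd (\<Sum>c<k. C r c * y c) - w r" using y that by blast
    moreover have "(\<Sum>c<k. C r c * z c) - w r =
        ((\<Sum>c<k. C r c * y c) - w r) - ((\<Sum>c<k. C r c * y c) - (\<Sum>c<k. C r c * z c))"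
      by simp
    ultimately show ?thesis by (metis dvd_diff)
  qed
  note zC = this
  have "u = z" if u: "u \<in> residues_fun k a" "\<forall>r<n. a dvd (\<Sum>c<k. C r c * u c) - w r" for u
  proof -
    have "\<forall>r<n. a dvd (\<Sum>c<k. C r c * (u c - z c))"
    proof (intro allI impI)
      fix r assume "r < n"
      then have "a dvd ((\<Sum>c<k. C r c * u c) - w r) - ((\<Sum>c<k. C r c * z c) - w r)"
        using u zC by (meson dvd_diff)
      then show "a dvd (\<Sum>c<k. C r c * (u c - z c))"
        by (simp add: right_diff_distrib sum_subtractf)
    qed
    then have d: "a dvd u c - z c" if "c < k" for c
      using inj_modD[OF assms(1), of "\<lambda>c. u c - z c"] that by blast
    show ?thesis
    proof (rule PiE_ext[OF u(1) z])
      fix c assume c: "c \<in> {..<k}"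
      have "u c \<in> {0..<a}" "z c \<in> {0..<a}" using PiE_mem[OF u(1) c] PiE_mem[OF z c] by auto
      moreover have "u c mod a = z c mod a"
        using d[of c] c by (simp add: mod_eq_dvd_iff)
      ultimately show "u c = z c"
        by (metis atLeastLessThan_iff mod_pos_pos_trivial)
    qed
  qed
  with z zC have "{y\<in>residues_fun k a. \<forall>r<n. a dvd (\<Sum>c<k. C r c * y c) - w r} = {z}"
    by blast
  then show ?thesis using True by simp
next
  case False
  then have "{y\<in>residues_fun k a. \<forall>r<n. a dvd (\<Sum>c<k. C r c * y c) - w r} = {}" by blast
  then show ?thesis using False by (simp only: card.empty if_False)
qed

text \<open>The left kernel of \<open>C\<close> modulo \<open>a\<close> in normalised
  representatives. Its elements are the characters of the group of \<open>n\<close>-tuples modulo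
  \<open>a\<close> that are trivial on the columns of \<open>C\<close>.\<close>

definition annihilator :: "int \<Rightarrow> nat \<Rightarrow> nat \<Rightarrow> (nat \<Rightarrow> nat \<Rightarrow> int) \<Rightarrow> (nat \<Rightarrow> int) set" where
  "annihilator a n k C = {x\<in>residues_fun n a. \<forall>c<k. a dvd (\<Sum>r<n. x r * C r c)}"

lemma finite_annihilator [simp]: "finite (annihilator a n k C)"
  unfolding annihilator_def
  by (rule finite_subset[OF Collect_restrict finite_residues_fun])

text \<open>The duality count with right-hand side 0, where injectivity leaves exactly one
  solution.\<close>

lemma card_annihilator:
  assumes "inj_mod a n k C" "a > 0" "k \<le> n"
  shows "card (annihilator a n k C) = nat a ^ (n - k)"
proof -
  have ex: "\<exists>y. \<forall>r<n. a dvd (\<Sum>c<k. C r c * y c) - 0"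
    by (rule exI[of _ "\<lambda>_. 0"]) simp
  have c1: "card {y\<in>residues_fun k a. \<forall>r<n. a dvd (\<Sum>c<k. C r c * y c) - 0} = 1"
    using card_zero_or_one[OF assms(1,2), of "\<lambda>_. 0"] ex by (simp only: if_True)
  have "(of_nat 1 :: complex) * of_int a ^ n = of_int a ^ k * of_nat (card (annihilator a n k C))"
    using count_solutions[OF assms(2), of k n C "\<lambda>_. 0"]
    unfolding c1 annihilator_def by simp
  also have "of_int a ^ n = (of_int a ^ k * of_int a ^ (n - k) :: complex)"
    using assms(3) by (simp add: power_add[symmetric])
  finally have "(of_int a ^ (n - k) :: complex) = of_nat (card (annihilator a n k C))"
    using assms(2) by simp
  moreover have "of_int a = (of_nat (nat a) :: complex)"
    using assms(2) by simp
  ultimately show ?thesis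
    by (metis of_nat_eq_iff of_nat_power)
qed

text \<open>Fourier expansion of the indicator function of the image of \<open>C\<close> modulo
  \<open>a\<close>. It turns membership in a coset of a lattice into a sum of characters, whose
  expectations factor over independent coordinates.\<close>

lemma indicator_solvable:
  assumes "inj_mod a n k C" "a > 0" "k \<le> n"
  shows "of_bool (\<exists>y. \<forall>r<n. a dvd (\<Sum>c<k. C r c * y c) - w r) * of_int a ^ (n - k) =
    (\<Sum>x\<in>annihilator a n k C. ec a (- (\<Sum>r<n. x r * w r)))"
proof -
  have c: "card {y\<in>residues_fun k a. \<forall>r<n. a dvd (\<Sum>c<k. C r c * y c) - w r} =
      of_bool (\<exists>y. \<forall>r<n. a dvd (\<Sum>c<k. C r c * y c) - w r)"
    unfolding card_zero_or_one[OF assms(1,2)] of_bool_def ..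
  have "of_bool (\<exists>y. \<forall>r<n. a dvd (\<Sum>c<k. C r c * y c) - w r) * (of_int a ^ n :: complex) =
      of_int a ^ k * (\<Sum>x\<in>annihilator a n k C. ec a (- (\<Sum>r<n. x r * w r)))"
    using count_solutions[OF assms(2), of k n C w]
    unfolding c annihilator_def by (simp only: of_nat_of_bool)
  also have "of_int a ^ n = (of_int a ^ k * of_int a ^ (n - k) :: complex)"
    using assms(3) by (simp add: power_add[symmetric])
  finally show ?thesis
    using assms(2) by simp
qed

text \<open>Row \<open>i\<close> of the left inverse solves the transposed system with the
  \<open>i\<close>-th unit vector as right-hand side. In the duality count for the transpose the
  annihilator is the kernel of \<open>C\<close>, hence trivial, so the number of solutions cannot be
  zero.\<close>

lemma left_inverse_mod:
  assumes "inj_mod a n k C" "a > 0"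
  shows "\<exists>D. \<forall>i<k. \<forall>c<k. a dvd (\<Sum>r<n. D i r * C r c) - (if i = c then 1 else 0)"
proof -
  have "\<exists>x. \<forall>c<k. a dvd (\<Sum>r<n. x r * C r c) - w c" for w
  proof -
    let ?Y = "{y\<in>residues_fun n a. \<forall>c<k. a dvd (\<Sum>r<n. C r c * y r) - w c}"
    let ?X = "{x\<in>residues_fun k a. \<forall>r<n. a dvd (\<Sum>c<k. x c * C r c)}"
    have "x = restrict (\<lambda>_. 0) {..<k}" if "x \<in> ?X" for x
    proof (rule PiE_ext[of _ "{..<k}" "\<lambda>_. {0..<a}"])
      fix c assume c: "c \<in> {..<k}"
      have "a dvd (\<Sum>c<k. C r c * x c)" if "r < n" for r
        using \<open>x \<in> ?X\<close> that by (simp add: mult.commute)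
      then have "a dvd x c"
        using inj_modD[OF assms(1), of x] c by blast
      moreover have "x c \<in> {0..<a}"
        using that c PiE_mem[of x "{..<k}" "\<lambda>_. {0..<a}" c] by blast
      ultimately show "x c = restrict (\<lambda>_. 0) {..<k} c"
        using c by (auto dest: zdvd_imp_le)
    qed (use that assms in auto)
    moreover have "restrict (\<lambda>_. 0) {..<k} \<in> ?X"
      using assms by auto
    ultimately have "?X = {restrict (\<lambda>_. 0) {..<k}}"
      by blast
    note X = this
    have "of_nat (card ?Y) * (of_int a :: complex) ^ k =
        of_int a ^ n * (\<Sum>x\<in>?X. ec a (- (\<Sum>c<k. x c * w c)))"
      by (rule count_solutions[OF assms(2)])
    also have "\<dots> = of_int a ^ n"
      unfolding X by simp
    finally have "of_nat (card ?Y) * (of_int a :: complex) ^ k = of_int a ^ n" .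
    moreover have "(of_int a :: complex) ^ n \<noteq> 0"
      using assms(2) by simp
    ultimately have Y: "card ?Y \<noteq> 0"
      by (metis mult_zero_left of_nat_0)
    have "\<exists>x. x \<in> ?Y"
    proof (rule ccontr)
      assume "\<not> (\<exists>x. x \<in> ?Y)"
      then have "?Y = {}" by (simp only: ex_in_conv not_not)
      with Y show False by (simp only: card.empty)
    qed
    then obtain x where "x \<in> ?Y" ..
    then have "\<forall>c<k. a dvd (\<Sum>r<n. C r c * x r) - w c"
      unfolding mem_Collect_eq by (rule conjunct2)
    then show ?thesis
      by (intro exI[of _ x]) (simp add: mult.commute)
  qed
  then have "\<exists>x. \<forall>c<k. a dvd (\<Sum>r<n. x r * C r c) - (if i = c then 1 else 0)" for i .
  then have "\<forall>i. \<exists>x. \<forall>c<k. a dvd (\<Sum>r<n. x r * C r c) - (if i = c then 1 else 0)"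
    by (rule allI)
  from choice[OF this] obtain D where
    D: "\<forall>i. \<forall>c<k. a dvd (\<Sum>r<n. D i r * C r c) - (if i = c then 1 else 0)" ..
  show ?thesis
    by (rule exI[of _ D]) (use D in simp)
qed

section \<open>Balanced random variables\<close>

text \<open>The laws used later are those of entries reduced modulo \<open>a\<close>, so finite
  support is available and expectations are finite sums.\<close>

definition balanced_pmf :: "real \<Rightarrow> int \<Rightarrow> int pmf \<Rightarrow> bool" where
  "balanced_pmf \<alpha> p q \<longleftrightarrow> finite (set_pmf q) \<and> (\<forall>r. measure_pmf.prob q {v. p dvd v - r} \<le> 1 - \<alpha>)"

text \<open>Bound for the modulus of a nontrivial Fourier coefficient of a balanced variable:
  \<open>cos (2 * pi / a)\<close> is the largest real part of an \<open>a\<close>-th root of unity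
  other than 1, and two independent copies of the variable differ modulo \<open>p\<close> with
  probability at least \<open>\<alpha>\<close>.\<close>

definition decay :: "real \<Rightarrow> int \<Rightarrow> real" where
  "decay \<alpha> a = sqrt (1 - \<alpha> * (1 - cos (2 * pi / of_int a)))"

lemma cos_le_cos_nontrivial:
  assumes "a \<ge> 2" "\<not> a dvd j"
  shows "cos (2 * pi * of_int j / of_int a) \<le> cos (2 * pi / of_int a)"
proof -
  define r where "r = j mod a"
  have r0: "r \<noteq> 0"
    using assms by (simp add: r_def dvd_eq_mod_eq_0)
  have "0 \<le> r" "r < a"
    using assms by (auto simp: r_def)
  then have r: "1 \<le> r" "r \<le> a - 1"
    using r0 by linarith+
  have "ec a j = ec a r"
    using assms by (intro ec_cong) (auto simp: r_def minus_mod_eq_mult_div)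
  then have eq: "cos (2 * pi * of_int j / of_int a) = cos (2 * pi * of_int r / of_int a)"
    by (simp add: ec_def complex_eq_iff)
  have mono: "cos (2 * pi * of_int s / of_int a) \<le> cos (2 * pi / of_int a)"
    if "1 \<le> s" "2 * s \<le> a" for s
  proof (rule cos_monotone_0_pi_le)
    show "0 \<le> 2 * pi / real_of_int a" using assms by simp
    have "2 * pi * 1 \<le> 2 * pi * real_of_int s"
      using that by (intro mult_left_mono) auto
    then show "2 * pi / real_of_int a \<le> 2 * pi * real_of_int s / real_of_int a"
      using assms by (simp add: divide_right_mono)
    have "2 * real_of_int s \<le> real_of_int a"
      using that by linarith
    then have "pi * (2 * real_of_int s) \<le> pi * real_of_int a"
      by (intro mult_left_mono) auto
    then show "2 * pi * real_of_int s / real_of_int a \<le> pi"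
      using assms by (simp add: field_simps)
  qed
  show ?thesis
  proof (cases "2 * r \<le> a")
    case True
    then show ?thesis using mono[of r] r eq by simp
  next
    case False
    \<comment> \<open>Residues above \<open>a / 2\<close> are reflected to \<open>a - r\<close>,
      which has the same cosine and lies where the cosine decreases.\<close>
    have "2 * pi * of_int r / of_int a = 2 * pi - 2 * pi * of_int (a - r) / real_of_int a"
      using assms by (simp add: field_simps)
    then have "cos (2 * pi * of_int r / of_int a) = cos (2 * pi * of_int (a - r) / of_int a)"
      by (simp only: cos_2pi_minus)
    then show ?thesis using mono[of "a - r"] r False eq by simp
  qed
qed

lemma decay_nonneg: "0 \<le> \<alpha> \<Longrightarrow> \<alpha> \<le> 1/2 \<Longrightarrow> 0 \<le> decay \<alpha> a"
proof -
  assume a: "0 \<le> \<alpha>" "\<alpha> \<le> 1/2"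
  have "1 - cos (2 * pi / of_int a) \<le> 2" "0 \<le> 1 - cos (2 * pi / of_int a)"
    using cos_ge_minus_one[of "2 * pi / of_int a"] by auto
  then have "\<alpha> * (1 - cos (2 * pi / of_int a)) \<le> 1/2 * 2"
    using a by (intro mult_mono) auto
  then show ?thesis by (simp add: decay_def)
qed

lemma decay_less_1:
  assumes "0 < \<alpha>" "a \<ge> 2" shows "decay \<alpha> a < 1"
proof -
  have "2 * pi / of_int a \<le> pi"
    using assms by (simp add: field_simps)
  then have "cos (2 * pi / of_int a) < cos 0"
    using assms by (intro cos_monotone_0_pi) auto
  then show ?thesis
    using assms by (simp add: decay_def)
qed

text \<open>Lets the constant at \<open>a\<close> serve every prime factor of \<open>a\<close> at
  once.\<close>

lemma decay_mono:
  assumes "0 \<le> \<alpha>" "2 \<le> p" "p \<le> a" shows "decay \<alpha> p \<le> decay \<alpha> a"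
proof -
  have "cos (2 * pi / of_int p) \<le> cos (2 * pi / of_int a)"
  proof (rule cos_monotone_0_pi_le)
    show "2 * pi / real_of_int a \<le> 2 * pi / real_of_int p"
      using assms by (intro divide_left_mono) auto
    show "2 * pi / real_of_int p \<le> pi"
      using assms by (simp add: field_simps)
  qed (use assms in auto)
  then show ?thesis
    using assms by (simp add: decay_def mult_left_mono)
qed

lemma sum_pmf_divisible_le:
  assumes "balanced_pmf \<alpha> p q"
  shows "(\<Sum>v\<in>{v\<in>set_pmf q. p dvd v - r}. pmf q v) \<le> 1 - \<alpha>"
proof -
  have "(\<Sum>v\<in>{v\<in>set_pmf q. p dvd v - r}. pmf q v) = measure_pmf.prob q {v\<in>set_pmf q. p dvd v - r}"
    using assms by (subst measure_measure_pmf_finite) (auto simp: balanced_pmf_def)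
  also have "\<dots> \<le> measure_pmf.prob q {v. p dvd v - r}"
    by (intro measure_pmf.finite_measure_mono) auto
  finally show ?thesis
    using assms unfolding balanced_pmf_def by (meson order_trans)
qed

text \<open>The squared modulus is the expectation of \<open>cos (2 * pi * t * (u - v) / a)\<close>
  for two independent copies \<open>u\<close> and \<open>v\<close>. By the assumption on
  \<open>t\<close> the angle is nontrivial unless \<open>u\<close> and \<open>v\<close> agree modulo
  \<open>p\<close>, and they agree with probability at most \<open>1 - \<alpha>\<close>.\<close>

lemma norm_character_le:
  assumes "balanced_pmf \<alpha> p q" "0 \<le> \<alpha>" "a \<ge> 2" and t: "\<And>d. a dvd t * d \<Longrightarrow> p dvd d"
  shows "norm (measure_pmf.expectation q (\<lambda>v. ec a (t * v))) \<le> decay \<alpha> a"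
proof -
  define S where "S = set_pmf q"
  have fin: "finite S" using assms(1) by (simp add: S_def balanced_pmf_def)
  define z where "z = measure_pmf.expectation q (\<lambda>v. ec a (t * v))"
  have z: "z = (\<Sum>v\<in>S. of_real (pmf q v) * ec a (t * v))"
    unfolding z_def using fin
    by (subst integral_measure_pmf[of S]) (auto simp: S_def scaleR_conv_of_real)
  define c where "c = cos (2 * pi / of_int a)"
  have c: "c \<le> 1" by (simp add: c_def)
  have sum1: "(\<Sum>v\<in>S. pmf q v) = 1"
    using fin unfolding S_def by (rule sum_pmf_eq_1) simp
  have "(norm z)\<^sup>2 = Re (z * cnj z)"
    by (metis Re_complex_of_real complex_norm_square)
  also have "\<dots> = (\<Sum>u\<in>S. \<Sum>v\<in>S. pmf q u * pmf q v * cos (2 * pi * of_int (t * (u - v)) / of_int a))"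
  proof -
    have e: "Re (of_real x * ec a (t * u) * (of_real y * cnj (ec a (t * v)))) =
        x * y * cos (2 * pi * of_int (t * (u - v)) / of_int a)" for x y u v
    proof -
      have "ec a (t * u) * cnj (ec a (t * v)) = ec a (t * (u - v))"
        by (simp add: ec_def cis_cnj cis_mult diff_divide_distrib ring_distribs)
      moreover have "of_real x * ec a (t * u) * (of_real y * cnj (ec a (t * v))) =
          of_real (x * y) * (ec a (t * u) * cnj (ec a (t * v)))"
        by simp
      ultimately have "of_real x * ec a (t * u) * (of_real y * cnj (ec a (t * v))) =
          of_real (x * y) * ec a (t * (u - v))"
        by (simp only:)
      moreover have "Re (of_real (x * y) * w) = x * y * Re w" for w
        by simp
      ultimately show ?thesis
        by (simp only:) (simp add: ec_def)
    qed
    have "z * cnj z = (\<Sum>u\<in>S. \<Sum>v\<in>S. of_real (pmf q u) * ec a (t * u) * (of_real (pmf q v) * cnj (ec a (t * v))))"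
      unfolding z by (simp add: sum_product)
    then show ?thesis
      by (simp only: Re_sum e)
  qed
  \<comment> \<open>The cosine is at most 1 on a collision modulo \<open>p\<close> and at most
    \<open>c\<close> otherwise.\<close>
  also have "\<dots> \<le> (\<Sum>u\<in>S. \<Sum>v\<in>S. pmf q u * pmf q v * (c + (1 - c) * of_bool (p dvd v - u)))"
  proof (intro sum_mono mult_left_mono)
    fix u v
    show "cos (2 * pi * of_int (t * (u - v)) / of_int a) \<le> c + (1 - c) * of_bool (p dvd v - u)"
    proof (cases "p dvd v - u")
      case False
      then have "\<not> a dvd t * (u - v)"
        using t[of "u - v"] by (metis dvd_minus_iff minus_diff_eq)
      then show ?thesis
        using cos_le_cos_nontrivial[OF assms(3), of "t * (u - v)"] False by (simp add: c_def)
    qed simp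
  qed simp
  also have "\<dots> = (\<Sum>u\<in>S. pmf q u * (c + (1 - c) * (\<Sum>v\<in>{v\<in>S. p dvd v - u}. pmf q v)))"
  proof (intro sum.cong refl)
    fix u
    have "(\<Sum>v\<in>S. pmf q v * (c + (1 - c) * of_bool (p dvd v - u))) =
        c * (\<Sum>v\<in>S. pmf q v) + (1 - c) * (\<Sum>v\<in>S. pmf q v * of_bool (p dvd v - u))"
      by (simp add: sum_distrib_left sum.distrib ring_distribs mult_ac)
    also have "(\<Sum>v\<in>S. pmf q v * of_bool (p dvd v - u)) = (\<Sum>v\<in>{v\<in>S. p dvd v - u}. pmf q v)"
      using fin by (simp add: sum.inter_filter of_bool_def if_distrib cong: if_cong)
    finally show "(\<Sum>v\<in>S. pmf q u * pmf q v * (c + (1 - c) * of_bool (p dvd v - u))) =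
        pmf q u * (c + (1 - c) * (\<Sum>v\<in>{v\<in>S. p dvd v - u}. pmf q v))"
      unfolding mult.assoc sum_distrib_left[symmetric] by (simp add: sum1)
  qed
  also have "\<dots> \<le> (\<Sum>u\<in>S. pmf q u * (c + (1 - c) * (1 - \<alpha>)))"
    using sum_pmf_divisible_le[OF assms(1)] c
    by (intro sum_mono mult_left_mono add_left_mono) (auto simp: S_def)
  also have "\<dots> = 1 - \<alpha> * (1 - c)"
    unfolding sum_distrib_right[symmetric] sum1 by (simp add: algebra_simps)
  finally have "(norm z)\<^sup>2 \<le> 1 - \<alpha> * (1 - c)" .
  then show ?thesis
    unfolding decay_def c_def[symmetric] z_def[symmetric] by (rule real_le_rsqrt)
qed

lemma expectation_prod_Pi_pmf_complex:
  fixes g :: "'i \<Rightarrow> 'b \<Rightarrow> complex"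
  assumes "finite A" "\<And>x v. norm (g x v) \<le> B"
  shows "measure_pmf.expectation (Pi_pmf A d p) (\<lambda>f. \<Prod>x\<in>A. g x (f x)) =
    (\<Prod>x\<in>A. measure_pmf.expectation (p x) (g x))"
proof -
  let ?M = "measure_pmf (Pi_pmf A d p)"
  have ind: "prob_space.indep_vars ?M (\<lambda>_. borel) (\<lambda>x f. g x (f x)) A"
    by (rule prob_space.indep_vars_compose2[OF measure_pmf.prob_space_axioms indep_vars_Pi_pmf[OF assms(1)]])
      auto
  have "measure_pmf.expectation (Pi_pmf A d p) (\<lambda>f. \<Prod>x\<in>A. g x (f x)) =
      (\<Prod>x\<in>A. measure_pmf.expectation (Pi_pmf A d p) (\<lambda>f. g x (f x)))"
    by (rule prob_space.indep_vars_lebesgue_integral[OF measure_pmf.prob_space_axioms assms(1) ind])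
      (auto intro!: measure_pmf.integrable_const_bound[where B=B] assms(2))
  also have "\<dots> = (\<Prod>x\<in>A. measure_pmf.expectation (p x) (g x))"
  proof (intro prod.cong refl)
    fix x assume "x \<in> A"
    have "measure_pmf.expectation (Pi_pmf A d p) (\<lambda>f. g x (f x)) =
        measure_pmf.expectation (map_pmf (\<lambda>f. f x) (Pi_pmf A d p)) (g x)"
      by simp
    then show "measure_pmf.expectation (Pi_pmf A d p) (\<lambda>f. g x (f x)) = measure_pmf.expectation (p x) (g x)"
      using \<open>x \<in> A\<close> assms(1) by (simp add: Pi_pmf_component)
  qed
  finally show ?thesis .
qed

text \<open>The expectation factors over the coordinates; those meeting the divisibility condition
  of \<open>norm_character_le\<close> contribute a factor \<open>decay \<alpha> a\<close> each, the
  others at most 1.\<close>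

lemma norm_character_vector_le:
  fixes n :: nat
  assumes q: "\<And>r. r < n \<Longrightarrow> balanced_pmf \<alpha> p (q r)" and "0 \<le> \<alpha>" "\<alpha> \<le> 1/2" "a \<ge> 2"
  shows "norm (measure_pmf.expectation (Pi_pmf {..<n} 0 q) (\<lambda>b. ec a (\<Sum>r<n. x r * b r)))
    \<le> decay \<alpha> a ^ card {r\<in>{..<n}. \<forall>d. a dvd x r * d \<longrightarrow> p dvd d}"
proof -
  have "norm (measure_pmf.expectation (Pi_pmf {..<n} 0 q) (\<lambda>b. ec a (\<Sum>r<n. x r * b r))) =
      (\<Prod>r<n. norm (measure_pmf.expectation (q r) (\<lambda>v. ec a (x r * v))))"
    using expectation_prod_Pi_pmf_complex[of "{..<n}" "\<lambda>r v. ec a (x r * v)" 1 0 q]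
    by (simp add: ec_sum prod_norm)
  also have "\<dots> \<le> (\<Prod>r<n. if \<forall>d. a dvd x r * d \<longrightarrow> p dvd d then decay \<alpha> a else 1)"
  proof (intro prod_mono conjI norm_ge_zero)
    fix r assume "r \<in> {..<n}"
    show "norm (measure_pmf.expectation (q r) (\<lambda>v. ec a (x r * v))) \<le>
        (if \<forall>d. a dvd x r * d \<longrightarrow> p dvd d then decay \<alpha> a else 1)"
    proof (cases "\<forall>d. a dvd x r * d \<longrightarrow> p dvd d")
      case True
      then show ?thesis
        using norm_character_le[OF q assms(2,4)] \<open>r \<in> {..<n}\<close> by auto
    next
      case False
      have "norm (measure_pmf.expectation (q r) (\<lambda>v. ec a (x r * v))) \<le>
          measure_pmf.expectation (q r) (\<lambda>v. norm (ec a (x r * v)))"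
        by (rule integral_norm_bound)
      then show ?thesis using False by (simp only: if_False norm_ec) simp
    qed
  qed
  also have "\<dots> = decay \<alpha> a ^ card {r\<in>{..<n}. \<forall>d. a dvd x r * d \<longrightarrow> p dvd d}"
    by (subst prod.If_cases) (simp_all add: Int_def)
  finally show ?thesis .
qed

section \<open>Linear forms modulo a prime, and vectors of small Hamming weight\<close>

definition weight :: "int \<Rightarrow> nat \<Rightarrow> (nat \<Rightarrow> int) \<Rightarrow> nat" where
  "weight p n x = card {r\<in>{..<n}. \<not> p dvd x r}"

text \<open>Fourier inversion modulo \<open>p\<close>: the trivial character contributes
  \<open>1 / p\<close>, and each of the other \<open>p - 1\<close> is bounded by the decay at the
  coordinates of \<open>y\<close> that are nonzero modulo \<open>p\<close>. Multiplying
  \<open>y\<close> by a unit \<open>x\<close> does not change which coordinates these are.\<close>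

lemma prob_linear_form_le:
  assumes q: "\<And>r. r < n \<Longrightarrow> balanced_pmf \<alpha> p (q r)" and "0 \<le> \<alpha>" "\<alpha> \<le> 1/2"
    and p: "prime p" "p \<le> a"
  shows "measure_pmf.prob (Pi_pmf {..<n} 0 q) {b. p dvd (\<Sum>r<n. y r * b r) - d}
    \<le> 1 / of_int p + (1 - 1 / of_int p) * decay \<alpha> a ^ weight p n y"
proof -
  let ?Q = "Pi_pmf {..<n} 0 q"
  have p2: "p \<ge> 2" using p by (simp add: prime_ge_2_int)
  define \<beta> where "\<beta> = decay \<alpha> a ^ weight p n y"
  have ind: "of_bool (p dvd S - d) = (1 / of_int p) * (\<Sum>x\<in>{0..<p}. ec p (x * (S - d)))" for S
    using sum_ec[of p "S - d"] p2 by simp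
  have eq: "complex_of_real (measure_pmf.prob ?Q {b. p dvd (\<Sum>r<n. y r * b r) - d}) =
      (1 / of_int p) * (\<Sum>x\<in>{0..<p}. ec p (- (x * d)) *
        measure_pmf.expectation ?Q (\<lambda>b. ec p (\<Sum>r<n. (x * y r) * b r)))"
  proof -
    have "complex_of_real (measure_pmf.prob ?Q {b. p dvd (\<Sum>r<n. y r * b r) - d}) =
        measure_pmf.expectation ?Q (\<lambda>b. of_real (indicator {b. p dvd (\<Sum>r<n. y r * b r) - d} b))"
      by (subst integral_complex_of_real) simp
    also have "\<dots> = measure_pmf.expectation ?Q (\<lambda>b. (1 / of_int p) *
        (\<Sum>x\<in>{0..<p}. ec p (x * ((\<Sum>r<n. y r * b r) - d))))"
      by (intro Bochner_Integration.integral_cong refl, subst ind[symmetric]) (simp add: indicator_def)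
    also have "\<dots> = (1 / of_int p) * (\<Sum>x\<in>{0..<p}. measure_pmf.expectation ?Q
        (\<lambda>b. ec p (x * ((\<Sum>r<n. y r * b r) - d))))"
      by (subst integral_mult_right_zero, subst Bochner_Integration.integral_sum)
        (auto intro!: measure_pmf.integrable_const_bound[where B=1])
    also have "\<dots> = (1 / of_int p) * (\<Sum>x\<in>{0..<p}. ec p (- (x * d)) *
        measure_pmf.expectation ?Q (\<lambda>b. ec p (\<Sum>r<n. (x * y r) * b r)))"
    proof -
      have "ec p (x * ((\<Sum>r<n. y r * b r) - d)) = ec p (- (x * d)) * ec p (\<Sum>r<n. (x * y r) * b r)"
        for x and b :: "nat \<Rightarrow> int"
        by (simp add: ec_add[symmetric] sum_distrib_left mult.assoc right_diff_distrib)
      then show ?thesis by simp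
    qed
    finally show ?thesis .
  qed
  have le: "norm (measure_pmf.expectation ?Q (\<lambda>b. ec p (\<Sum>r<n. (x * y r) * b r))) \<le> \<beta>"
    if "x \<in> {1..<p}" for x
  proof -
    have px: "\<not> p dvd x"
      using that by (auto dest: zdvd_imp_le)
    have "(\<forall>d. p dvd x * y r * d \<longrightarrow> p dvd d) \<longleftrightarrow> \<not> p dvd y r" for r
    proof
      assume *: "\<forall>d. p dvd x * y r * d \<longrightarrow> p dvd d"
      show "\<not> p dvd y r"
      proof
        assume "p dvd y r"
        then have "p dvd 1" using *[rule_format, of 1] by simp
        then show False using p2 by auto
      qed
    qed (use px p in \<open>auto simp: prime_dvd_mult_iff\<close>)
    then have "norm (measure_pmf.expectation ?Q (\<lambda>b. ec p (\<Sum>r<n. (x * y r) * b r))) \<le> decay \<alpha> p ^ weight p n y"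
      using norm_character_vector_le[OF q assms(2,3) p2, where x="\<lambda>r. x * y r"] by (simp add: weight_def)
    also have "\<dots> \<le> \<beta>"
      unfolding \<beta>_def using assms p2 by (intro power_mono decay_mono decay_nonneg) auto
    finally show ?thesis .
  qed
  have "measure_pmf.prob ?Q {b. p dvd (\<Sum>r<n. y r * b r) - d} =
      norm (complex_of_real (measure_pmf.prob ?Q {b. p dvd (\<Sum>r<n. y r * b r) - d}))"
    by simp
  also have "\<dots> = (1 / of_int p) * norm (\<Sum>x\<in>{0..<p}. ec p (- (x * d)) *
        measure_pmf.expectation ?Q (\<lambda>b. ec p (\<Sum>r<n. (x * y r) * b r)))"
    unfolding eq using p2 by (simp add: norm_mult norm_divide)
  also have "\<dots> \<le> (1 / of_int p) * (\<Sum>x\<in>{0..<p}. norm (measure_pmf.expectation ?Q (\<lambda>b. ec p (\<Sum>r<n. (x * y r) * b r))))"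
    using p2 by (intro mult_left_mono order.trans[OF norm_sum]) (auto simp: norm_mult)
  also have "{0..<p} = insert 0 {1..<p}" using p2 by auto
  also have "(\<Sum>x\<in>insert 0 {1..<p}. norm (measure_pmf.expectation ?Q (\<lambda>b. ec p (\<Sum>r<n. (x * y r) * b r)))) \<le>
      1 + (\<Sum>x\<in>{1..<p}. \<beta>)"
    by (subst sum.insert) (auto intro!: add_mono sum_mono le simp del: sum_constant)
  also have "(1 / of_int p) * (1 + (\<Sum>x\<in>{1..<p}. \<beta>)) = 1 / of_int p + (1 - 1 / of_int p) * \<beta>"
    using p2 by (simp add: field_simps of_nat_diff)
  finally show ?thesis
    using p2 by (simp add: \<beta>_def divide_right_mono)
qed

text \<open>Exponential Markov inequality: a vector of weight below \<open>s\<close> satisfies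
  \<open>l powr s \<le> l ^ weight\<close>, and the sum of \<open>l ^ weight\<close> over all
  vectors factors over the coordinates.\<close>

lemma card_sparse_le:
  assumes "0 < l" "l \<le> 1" "p \<ge> 1"
  shows "real (card {y\<in>residues_fun k p. real (weight p k y) < s}) \<le> l powr (- s) * (1 + of_int p * l) ^ k"
proof -
  let ?S = "{y\<in>residues_fun k p. real (weight p k y) < s}"
  have "real (card ?S) * l powr s = (\<Sum>y\<in>?S. l powr s)"
    by simp
  also have "\<dots> \<le> (\<Sum>y\<in>?S. l ^ weight p k y)"
  proof (rule sum_mono)
    fix y assume "y \<in> ?S"
    then have "l powr s \<le> l powr (real (weight p k y))"
      using assms by (intro powr_mono') auto
    then show "l powr s \<le> l ^ weight p k y"
      using assms by (simp add: powr_realpow)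
  qed
  also have "\<dots> \<le> (\<Sum>y\<in>residues_fun k p. l ^ weight p k y)"
    using assms by (intro sum_mono2) auto
  also have "\<dots> = (\<Sum>y\<in>residues_fun k p. \<Prod>c<k. if p dvd y c then 1 else l)"
    by (intro sum.cong refl, subst prod.If_cases) (auto simp: weight_def Int_def)
  also have "\<dots> = (\<Prod>c<k. \<Sum>v\<in>{0..<p}. if p dvd v then 1 else l)"
    by (subst prod_sum_PiE) auto
  also have "(\<Sum>v\<in>{0..<p}. if p dvd v then 1 else l) \<le> 1 + of_int p * l"
  proof -
    have "{0..<p} = insert 0 {1..<p}" using assms by auto
    then have "(\<Sum>v\<in>{0..<p}. if p dvd v then 1 else l) = 1 + (\<Sum>v\<in>{1..<p}. if p dvd v then 1 else l)"
      by simp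
    also have "(\<Sum>v\<in>{1..<p}. if p dvd v then 1 else l) = (\<Sum>v\<in>{1..<p}. l)"
      by (intro sum.cong) (auto dest: zdvd_imp_le)
    also have "\<dots> \<le> of_int p * l"
      using assms by (simp add: mult_right_mono of_nat_diff)
    finally show ?thesis by simp
  qed
  then have "(\<Prod>c<k. \<Sum>v\<in>{0..<p}. if p dvd v then 1 else l) \<le> (1 + of_int p * l) ^ k"
    using assms by (auto intro!: power_mono sum_nonneg)
  finally show ?thesis
    using assms by (simp add: powr_minus field_simps)
qed

section \<open>Generating tuples of finite abelian groups\<close>

context comm_group
begin

definition pows :: "nat \<Rightarrow> 'a set" where
  "pows d = (\<lambda>x. x [^] d) ` carrier G"

lemma subgroup_pows: "subgroup (pows d) G"
proof (rule subgroupI)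
  show "pows d \<noteq> {}" by (auto simp: pows_def)
  fix x y assume "x \<in> pows d" "y \<in> pows d"
  then obtain u v where *: "u \<in> carrier G" "v \<in> carrier G" "x = u [^] d" "y = v [^] d"
    by (auto simp: pows_def)
  then show "x \<otimes> y \<in> pows d"
    by (auto simp: pows_def pow_mult_distrib m_comm intro!: image_eqI[of _ _ "u \<otimes> v"])
  show "inv x \<in> pows d"
    using * by (auto simp: pows_def nat_pow_inv intro!: image_eqI[of _ _ "inv u"])
qed (auto simp: pows_def)

lemma pows_subset: "pows d \<subseteq> carrier G"
  by (auto simp: pows_def)

lemma generate_insert_generate:
  assumes "S \<subseteq> carrier G" "x \<in> carrier G"
  shows "generate G (insert x (generate G S)) = generate G (insert x S)"
proof
  have "generate G S \<subseteq> generate G (insert x S)"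
    by (rule mono_generate) auto
  then show "generate G (insert x (generate G S)) \<subseteq> generate G (insert x S)"
    using assms by (intro generate_subgroup_incl generate_is_subgroup) (auto intro: generate.incl)
  show "generate G (insert x S) \<subseteq> generate G (insert x (generate G S))"
    by (rule mono_generate) (auto intro: generate.incl)
qed

lemma generate_subgroup_id:
  assumes "subgroup H G" shows "generate G H = H"
proof
  show "generate G H \<subseteq> H" using order_refl assms by (rule generate_subgroup_incl)
  show "H \<subseteq> generate G H" by (auto intro: generate.incl)
qed

lemma subgroup_pow_closed:
  assumes "subgroup H G" "x \<in> H" shows "x [^] (n::nat) \<in> H"
  by (induction n) (use assms in \<open>auto simp: subgroup.one_closed subgroup.m_closed\<close>)

text \<open>Since all \<open>p\<close>-th powers lie in \<open>H\<close>, the element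
  \<open>x\<close> has order \<open>p\<close> modulo \<open>H\<close>, so the new subgroup is the
  disjoint union of \<open>p\<close> cosets of \<open>H\<close>.\<close>

lemma card_generate_insert:
  assumes H: "subgroup H G" "finite H" and p: "prime p" and ph: "pows p \<subseteq> H"
    and x: "x \<in> carrier G" "x \<notin> H"
  shows "card (generate G (insert x H)) = p * card H"
proof -
  have p0: "p > 0" using p by (simp add: prime_gt_0_nat)
  let ?f = "\<lambda>(h, i). h \<otimes> x [^] (i::nat)"
  let ?S = "?f ` (H \<times> {..<p})"
  have hc: "h \<in> carrier G" if "h \<in> H" for h
    using H that by (simp add: subgroup.mem_carrier)
  have xp: "x [^] p \<in> H"
    using ph x by (auto simp: pows_def)
  have inS: "h \<otimes> x [^] (k::nat) \<in> ?S" if "h \<in> H" for h k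
  proof -
    have "x [^] k = (x [^] p) [^] (k div p) \<otimes> x [^] (k mod p)"
      using x by (simp add: nat_pow_pow nat_pow_mult mult.commute)
    then have "h \<otimes> x [^] k = (h \<otimes> (x [^] p) [^] (k div p)) \<otimes> x [^] (k mod p)"
      using x hc[OF that] by (simp add: m_assoc)
    moreover have "h \<otimes> (x [^] p) [^] (k div p) \<in> H"
      using that xp H(1) by (simp add: subgroup.m_closed subgroup_pow_closed)
    ultimately show ?thesis
      using p0 by (intro image_eqI[of _ _ "(h \<otimes> (x [^] p) [^] (k div p), k mod p)"]) auto
  qed
  have sub: "subgroup ?S G"
  proof (rule subgroupI)
    show "?S \<subseteq> carrier G" using hc x by auto
    show "?S \<noteq> {}" using p0 subgroup.one_closed[OF H(1)] by auto
  next
    fix a assume "a \<in> ?S"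
    then obtain h i where a: "a = h \<otimes> x [^] i" "h \<in> H" "i < p" by auto
    \<comment> \<open>The inverse of the \<open>i\<close>-th power is written as the inverse of the
      \<open>p\<close>-th power, which lies in \<open>H\<close>, times the power with exponent
      \<open>p - i\<close>.\<close>
    have e: "x [^] (p - i) \<otimes> x [^] i = x [^] p"
      using x a(3) by (simp add: nat_pow_mult)
    have "inv (x [^] i) = inv (x [^] p) \<otimes> x [^] (p - i)"
    proof (rule inv_equality)
      have "(inv (x [^] p) \<otimes> x [^] (p - i)) \<otimes> x [^] i = inv (x [^] p) \<otimes> x [^] p"
        using x by (simp add: m_assoc e)
      then show "(inv (x [^] p) \<otimes> x [^] (p - i)) \<otimes> x [^] i = \<one>"
        using x by simp
    qed (use x in auto)
    then have "inv a = (inv h \<otimes> inv (x [^] p)) \<otimes> x [^] (p - i)"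
      using a hc[OF a(2)] x by (simp add: inv_mult m_assoc)
    moreover have "inv h \<otimes> inv (x [^] p) \<in> H"
      using a xp H(1) by (simp add: subgroup.m_closed subgroup.m_inv_closed)
    ultimately show "inv a \<in> ?S" using inS by simp
  next
    fix a b assume "a \<in> ?S" "b \<in> ?S"
    obtain h and i :: nat where a: "a = h \<otimes> x [^] i" "h \<in> H"
      using \<open>a \<in> ?S\<close> by auto
    obtain h' and i' :: nat where b: "b = h' \<otimes> x [^] i'" "h' \<in> H"
      using \<open>b \<in> ?S\<close> by auto
    have "a \<otimes> b = (h \<otimes> h') \<otimes> x [^] (i + i')"
      using a b hc x by (simp add: nat_pow_mult[symmetric] m_ac)
    then show "a \<otimes> b \<in> ?S"
      using inS[of "h \<otimes> h'" "i + i'"] subgroup.m_closed[OF H(1) a(2) b(2)] by (simp only:)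
  qed
  have "generate G (insert x H) = ?S"
  proof
    have "x \<in> ?S"
      using inS[OF subgroup.one_closed[OF H(1)], of 1] x by (simp only: nat_pow_eone l_one)
    moreover have "h \<in> ?S" if "h \<in> H" for h
      using inS[OF that, of 0] hc[OF that] by (simp only: nat_pow_0 r_one)
    ultimately have "insert x H \<subseteq> ?S"
      by blast
    then show "generate G (insert x H) \<subseteq> ?S"
      using sub by (rule generate_subgroup_incl)
    have *: "subgroup (generate G (insert x H)) G"
      using x hc by (intro generate_is_subgroup) auto
    have "h \<otimes> x [^] i \<in> generate G (insert x H)" if "h \<in> H" for h and i :: nat
      using that by (intro subgroup.m_closed[OF *] subgroup_pow_closed[OF *] generate.incl) auto
    then show "?S \<subseteq> generate G (insert x H)" by auto
  qed
  moreover have "inj_on ?f (H \<times> {..<p})"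
  proof -
    have nle: "\<not> i < j" if h: "h \<in> H" "h' \<in> H" and ij: "j < p" and eq: "h \<otimes> x [^] i = h' \<otimes> x [^] j" for h h' and i j :: nat
    proof
      assume "i < j"
      have "h \<otimes> x [^] i = (h' \<otimes> x [^] (j - i)) \<otimes> x [^] i"
        using eq \<open>i < j\<close> x hc[OF h(2)] by (simp add: m_assoc nat_pow_mult)
      then have "h = h' \<otimes> x [^] (j - i)"
        using x hc h by simp
      then have "x [^] (j - i) = inv h' \<otimes> h"
        using x hc h by (simp add: inv_solve_left)
      then have xH: "x [^] (j - i) \<in> H"
        using h H(1) by (simp add: subgroup.m_closed subgroup.m_inv_closed)
      have "coprime (j - i) p"
        using p \<open>i < j\<close> ij by (metis coprime_commute nat_dvd_not_less prime_imp_coprime zero_less_diff less_imp_diff_less)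
      \<comment> \<open>A power of \<open>x\<close> in \<open>H\<close> with exponent strictly
        between 0 and \<open>p\<close> would, by Bezout with the exponent \<open>p\<close>, put
        \<open>x\<close> itself into \<open>H\<close>.\<close>
      then obtain u v where "u * int (j - i) + v * int p = 1"
        by (metis bezout_int coprime_int_iff coprime_imp_gcd_eq_1 mult.commute)
      then have "x = x [^] (int (j - i) * u + int p * v)"
        using x by (simp add: mult.commute)
      also have "\<dots> = (x [^] (j - i)) [^] u \<otimes> (x [^] p) [^] v"
        using x by (simp add: int_pow_mult int_pow_pow int_pow_int[symmetric])
      also have "\<dots> \<in> H"
        using xH xp H(1) by (intro subgroup.m_closed subgroup_int_pow_closed)
      finally show False using x by blast
    qed
    show ?thesis
    proof (rule inj_onI, clarsimp)
      fix h i h' j assume *: "h \<in> H" "h' \<in> H" "i < p" "j < p" "h \<otimes> x [^] i = h' \<otimes> x [^] j"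
      then have "i = j" using nle[of h h' j i] nle[of h' h i j] by (metis linorder_neqE_nat)
      then show "h = h' \<and> i = j" using * hc x by simp
    qed
  qed
  ultimately show ?thesis
    by (simp add: card_image card_cartesian_product mult.commute)
qed

section \<open>Ranks and generation modulo one prime\<close>

definition modp_span :: "nat \<Rightarrow> (nat \<Rightarrow> 'a) \<Rightarrow> nat \<Rightarrow> 'a set" where
  "modp_span p t j = generate G (t ` {..<j} \<union> pows p)"

lemma modp_span_subgroup:
  assumes "t ` {..<j} \<subseteq> carrier G"
  shows "subgroup (modp_span p t j) G" "pows p \<subseteq> modp_span p t j"
  using assms pows_subset[of p] unfolding modp_span_def
  by (auto intro!: generate_is_subgroup intro: generate.incl)

lemma modp_span_0: "modp_span p t 0 = pows p"
  by (simp add: modp_span_def generate_subgroup_id subgroup_pows)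

lemma modp_span_Suc:
  assumes "t ` {..<Suc j} \<subseteq> carrier G"
  shows "modp_span p t (Suc j) = generate G (insert (t j) (modp_span p t j))"
proof -
  have "t ` {..<Suc j} \<union> pows p = insert (t j) (t ` {..<j} \<union> pows p)"
    by (auto simp: less_Suc_eq)
  then show ?thesis
    using assms pows_subset[of p] unfolding modp_span_def
    by (subst generate_insert_generate) auto
qed

text \<open>In the quotient by the \<open>p\<close>-th powers, a vector space over the field with
  \<open>p\<close> elements, the rank of a tuple is the number of entries outside the span of their
  predecessors. Each of these multiplies the order of the span by \<open>p\<close>.\<close>

lemma card_modp_span:
  assumes "finite (carrier G)" "prime p" "t ` {..<j} \<subseteq> carrier G"
  shows "card (modp_span p t j) = p ^ card {i\<in>{..<j}. t i \<notin> modp_span p t i} * card (pows p)"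
  using assms(3)
proof (induction j)
  case 0
  then show ?case by (simp add: modp_span_0)
next
  case (Suc j)
  then have j: "t ` {..<j} \<subseteq> carrier G" "t j \<in> carrier G" by auto
  note sub = modp_span_subgroup[OF j(1)]
  have fin: "finite (modp_span p t j)"
    using sub(1) assms(1) by (meson finite_subset subgroup.subset)
  show ?case
  proof (cases "t j \<in> modp_span p t j")
    case True
    then have "modp_span p t (Suc j) = modp_span p t j"
      using modp_span_Suc[OF Suc.prems] by (simp add: insert_absorb generate_subgroup_id sub)
    moreover have "{i\<in>{..<Suc j}. t i \<notin> modp_span p t i} = {i\<in>{..<j}. t i \<notin> modp_span p t i}"
      using True by (auto simp: less_Suc_eq)
    ultimately show ?thesis using Suc.IH[OF j(1)] by simp
  next
    case False
    then have "card (modp_span p t (Suc j)) = p * card (modp_span p t j)"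
      using modp_span_Suc[OF Suc.prems] card_generate_insert[OF sub(1) fin assms(2) sub(2) j(2)] by simp
    moreover have "{i\<in>{..<Suc j}. t i \<notin> modp_span p t i} = insert j {i\<in>{..<j}. t i \<notin> modp_span p t i}"
      using False by (auto simp: less_Suc_eq)
    ultimately show ?thesis using Suc.IH[OF j(1)] by simp
  qed
qed

text \<open>The assumption on the order says that the quotient by the \<open>p\<close>-th powers has
  dimension \<open>m\<close>, so \<open>m\<close> vectors span it exactly when they are
  independent.\<close>

lemma modp_span_eq_carrier_iff:
  assumes "finite (carrier G)" "prime p" "t ` {..<m} \<subseteq> carrier G"
    and "card (carrier G) = p ^ m * card (pows p)"
  shows "modp_span p t m = carrier G \<longleftrightarrow> (\<forall>i<m. t i \<notin> modp_span p t i)"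
proof -
  have c0: "card (pows p) > 0"
    using assms(1) subgroup_pows[of p] by (metis card_gt_0_iff empty_iff finite_subset pows_subset subgroup.one_closed)
  have "modp_span p t m = carrier G \<longleftrightarrow> card (modp_span p t m) = card (carrier G)"
    using assms(1) modp_span_subgroup(1)[OF assms(3), of p]
    by (metis card_subset_eq subgroup.subset)
  also have "\<dots> \<longleftrightarrow> card {i\<in>{..<m}. t i \<notin> modp_span p t i} = m"
    using c0 prime_gt_1_nat[OF assms(2)] by (simp add: card_modp_span[OF assms(1-3)] assms(4))
  also have "(card {i\<in>{..<m}. t i \<notin> modp_span p t i} = m) \<longleftrightarrow> {i\<in>{..<m}. t i \<notin> modp_span p t i} = {..<m}"
  proof
    assume "card {i\<in>{..<m}. t i \<notin> modp_span p t i} = m"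
    then show "{i\<in>{..<m}. t i \<notin> modp_span p t i} = {..<m}"
      by (intro card_subset_eq) auto
  qed simp
  finally show ?thesis by auto
qed

lemma modp_span_cong:
  "(\<And>i. i < j \<Longrightarrow> t i = t' i) \<Longrightarrow> modp_span p t j = modp_span p t' j"
  unfolding modp_span_def by (intro arg_cong[of _ _ "generate G"]) auto

lemma card_independent_tuples:
  assumes "finite (carrier G)" "prime p"
  shows "card {t\<in>{..<j} \<rightarrow>\<^sub>E carrier G. \<forall>i<j. t i \<notin> modp_span p t i} =
    (\<Prod>i<j. card (carrier G) - p ^ i * card (pows p))"
proof (induction j)
  case (Suc j)
  let ?A = "\<lambda>j. {t\<in>{..<j} \<rightarrow>\<^sub>E carrier G. \<forall>i<j. t i \<notin> modp_span p t i}"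
  have "bij_betw (\<lambda>u. (fst u)(j := snd u)) (SIGMA t:?A j. carrier G - modp_span p t j) (?A (Suc j))"
  proof (rule bij_betw_byWitness[where f' = "\<lambda>t. (restrict t {..<j}, t j)"])
    show "\<forall>u\<in>(SIGMA t:?A j. carrier G - modp_span p t j).
        (restrict ((fst u)(j := snd u)) {..<j}, ((fst u)(j := snd u)) j) = u"
    proof
      fix u assume "u \<in> (SIGMA t:?A j. carrier G - modp_span p t j)"
      then have "fst u \<in> {..<j} \<rightarrow>\<^sub>E carrier G" by auto
      then have "restrict (fst u) {..<j} = fst u" by (rule PiE_restrict)
      moreover have "restrict ((fst u)(j := snd u)) {..<j} = restrict (fst u) {..<j}"
        by (auto simp: fun_eq_iff)
      ultimately show "(restrict ((fst u)(j := snd u)) {..<j}, ((fst u)(j := snd u)) j) = u"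
        by (simp add: prod_eq_iff)
    qed
    show "\<forall>t\<in>?A (Suc j). (fst (restrict t {..<j}, t j))(j := snd (restrict t {..<j}, t j)) = t"
    proof
      fix t assume t: "t \<in> ?A (Suc j)"
      then have "t \<in> extensional {..<Suc j}" by (simp add: PiE_def)
      then show "(fst (restrict t {..<j}, t j))(j := snd (restrict t {..<j}, t j)) = t"
        by (simp add: fun_eq_iff extensional_def)
    qed
    show "(\<lambda>u. (fst u)(j := snd u)) ` (SIGMA t:?A j. carrier G - modp_span p t j) \<subseteq> ?A (Suc j)"
    proof (rule image_subsetI)
      fix u assume u: "u \<in> (SIGMA t:?A j. carrier G - modp_span p t j)"
      define t x where "t = fst u" and "x = snd u"
      have t: "t \<in> {..<j} \<rightarrow>\<^sub>E carrier G" "\<And>i. i < j \<Longrightarrow> t i \<notin> modp_span p t i"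
        and x: "x \<in> carrier G" "x \<notin> modp_span p t j"
        using u by (auto simp: t_def x_def)
      have eq: "modp_span p (t(j := x)) i = modp_span p t i" if "i \<le> j" for i
        using that by (intro modp_span_cong) auto
      have "t(j := x) \<in> {..<Suc j} \<rightarrow>\<^sub>E carrier G"
        using t(1) x(1) by (simp add: lessThan_Suc PiE_fun_upd)
      moreover have "(t(j := x)) i \<notin> modp_span p (t(j := x)) i" if "i < Suc j" for i
        using that t(2) x(2) eq[of i] by (cases "i = j") auto
      ultimately show "(fst u)(j := snd u) \<in> ?A (Suc j)"
        unfolding t_def[symmetric] x_def[symmetric] by blast
    qed
    show "(\<lambda>t. (restrict t {..<j}, t j)) ` ?A (Suc j) \<subseteq> (SIGMA t:?A j. carrier G - modp_span p t j)"
    proof (rule image_subsetI)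
      fix t assume t: "t \<in> ?A (Suc j)"
      have eq: "modp_span p (restrict t {..<j}) i = modp_span p t i" if "i \<le> j" for i
        using that by (intro modp_span_cong) auto
      have "restrict t {..<j} \<in> {..<j} \<rightarrow>\<^sub>E carrier G" "t j \<in> carrier G"
        using t by auto
      then show "(restrict t {..<j}, t j) \<in> (SIGMA t:?A j. carrier G - modp_span p t j)"
        using t eq by auto
    qed
  qed
  then have "card (?A (Suc j)) = card (SIGMA t:?A j. carrier G - modp_span p t j)"
    by (simp add: bij_betw_same_card)
  also have "\<dots> = (\<Sum>t\<in>?A j. card (carrier G - modp_span p t j))"
    using assms by (intro card_SigmaI) (auto intro!: finite_PiE)
  also have "\<dots> = (\<Sum>t\<in>?A j. card (carrier G) - p ^ j * card (pows p))"
  proof (intro sum.cong refl)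
    fix t assume t: "t \<in> ?A j"
    then have im: "t ` {..<j} \<subseteq> carrier G" by auto
    have "{i\<in>{..<j}. t i \<notin> modp_span p t i} = {..<j}" using t by auto
    then have "card (modp_span p t j) = p ^ j * card (pows p)"
      using card_modp_span[OF assms im] by simp
    moreover have "modp_span p t j \<subseteq> carrier G"
      using modp_span_subgroup(1)[OF im] by (rule subgroup.subset)
    ultimately show "card (carrier G - modp_span p t j) = card (carrier G) - p ^ j * card (pows p)"
      using assms(1) by (simp add: card_Diff_subset finite_subset)
  qed
  also have "\<dots> = (\<Prod>i<Suc j. card (carrier G) - p ^ i * card (pows p))"
    by (simp add: Suc.IH)
  finally show ?case .
qed simp

lemma card_modp_generating:
  assumes "finite (carrier G)" "prime p" "card (carrier G) = p ^ m * card (pows p)"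
  shows "real (card {t\<in>{..<m} \<rightarrow>\<^sub>E carrier G. modp_span p t m = carrier G}) =
    real (card (carrier G)) ^ m * (\<Prod>i<m. 1 - 1 / real p ^ Suc i)"
proof -
  have p1: "p > 1" using assms(2) by (rule prime_gt_1_nat)
  have "{t\<in>{..<m} \<rightarrow>\<^sub>E carrier G. modp_span p t m = carrier G} =
      {t\<in>{..<m} \<rightarrow>\<^sub>E carrier G. \<forall>i<m. t i \<notin> modp_span p t i}"
  proof (intro Collect_cong conj_cong refl)
    fix t assume "t \<in> {..<m} \<rightarrow>\<^sub>E carrier G"
    then have "t ` {..<m} \<subseteq> carrier G" by auto
    then show "modp_span p t m = carrier G \<longleftrightarrow> (\<forall>i<m. t i \<notin> modp_span p t i)"
      using modp_span_eq_carrier_iff[OF assms(1,2) _ assms(3)] by blast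
  qed
  then have "real (card {t\<in>{..<m} \<rightarrow>\<^sub>E carrier G. modp_span p t m = carrier G}) =
      (\<Prod>i<m. real (card (carrier G) - p ^ i * card (pows p)))"
    by (simp add: card_independent_tuples[OF assms(1,2)])
  also have "\<dots> = (\<Prod>i<m. real (card (carrier G)) * (1 - 1 / real p ^ (m - i)))"
  proof (intro prod.cong refl)
    fix i assume i: "i \<in> {..<m}"
    have "p ^ i * card (pows p) \<le> card (carrier G)"
      unfolding assms(3) using i p1 by (intro mult_right_mono power_increasing) auto
    moreover have "real p ^ m = real p ^ i * real p ^ (m - i)"
      using i by (simp add: power_add[symmetric])
    ultimately show "real (card (carrier G) - p ^ i * card (pows p)) = real (card (carrier G)) * (1 - 1 / real p ^ (m - i))"
      using p1 by (simp add: of_nat_diff assms(3) field_simps)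
  qed
  also have "\<dots> = real (card (carrier G)) ^ m * (\<Prod>i<m. 1 - 1 / real p ^ (m - i))"
    by (simp add: prod.distrib)
  \<comment> \<open>At position \<open>i\<close> the span of the predecessors has codimension
    \<open>m - i\<close>; reversing the order gives the exponents of the Euler product.\<close>
  also have "(\<Prod>i<m. 1 - 1 / real p ^ (m - i)) = (\<Prod>i<m. 1 - 1 / real p ^ Suc i)"
    by (subst prod.nat_diff_reindex[symmetric]) (intro prod.cong refl, auto simp: Suc_diff_Suc)
  finally show ?thesis .
qed

text \<open>Sets of tuples that are unions of cosets of the \<open>d\<close>-th powers. For coprime \<open>d\<close> and \<open>d'\<close>
  such sets are independent events, because the idempotents of the coprime factorisation of the
  group order exchange coordinates between two independent tuples.\<close>

definition periodic :: "nat \<Rightarrow> nat \<Rightarrow> (nat \<Rightarrow> 'a) set \<Rightarrow> bool" where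
  "periodic d m E \<longleftrightarrow> E \<subseteq> ({..<m} \<rightarrow>\<^sub>E carrier G) \<and>
    (\<forall>x\<in>E. \<forall>y\<in>{..<m} \<rightarrow>\<^sub>E carrier G. (\<forall>i<m. inv (x i) \<otimes> y i \<in> pows d) \<longrightarrow> y \<in> E)"

lemma int_pow_in_pows:
  assumes "x \<in> carrier G" "int d dvd k" shows "x [^] (k::int) \<in> pows d"
proof -
  obtain l where "k = l * int d" using assms(2) by (metis dvdE mult.commute)
  then have "x [^] k = (x [^] l) [^] d"
    using assms(1) by (simp add: int_pow_pow[symmetric] int_pow_int)
  then show ?thesis
    using assms(1) by (auto simp: pows_def)
qed

lemma periodic_iff:
  assumes "periodic d m E" "x \<in> {..<m} \<rightarrow>\<^sub>E carrier G" "y \<in> {..<m} \<rightarrow>\<^sub>E carrier G"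
    and *: "\<And>i. i < m \<Longrightarrow> inv (x i) \<otimes> y i \<in> pows d"
  shows "x \<in> E \<longleftrightarrow> y \<in> E"
proof
  assume "x \<in> E" then show "y \<in> E" using assms unfolding periodic_def by blast
next
  have "inv (y i) \<otimes> x i \<in> pows d" if "i < m" for i
  proof -
    have "x i \<in> carrier G" "y i \<in> carrier G" using that assms(2,3) by auto
    then have "inv (y i) \<otimes> x i = inv (inv (x i) \<otimes> y i)"
      by (simp add: inv_mult m_comm)
    then show ?thesis
      using subgroup.m_inv_closed[OF subgroup_pows *[OF that]] by simp
  qed
  moreover assume "y \<in> E"
  ultimately show "x \<in> E" using assms(1,2) unfolding periodic_def by blast
qed

lemma card_periodic_Int:
  assumes fin: "finite (carrier G)" and p: "prime p" "coprime p d"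
    and E: "periodic p m E" "periodic d m E'"
  shows "card (E \<inter> E') * card (carrier G) ^ m = card E * card E'"
proof -
  define N where "N = card (carrier G)"
  have N: "N > 0" using fin by (auto simp: N_def card_gt_0_iff)
  define s where "s = multiplicity p N"
  obtain N' where N': "N = p ^ s * N'" "\<not> p dvd N'"
    using multiplicity_decompose'[of N p] N p(1) by (metis s_def not_prime_unit not_gr0)
  \<comment> \<open>The exponent \<open>Suc s\<close> makes \<open>1 - e\<close> divisible by
    \<open>p\<close> even if \<open>p\<close> does not divide \<open>N\<close>. The number
    \<open>e\<close> found from it is 1 modulo \<open>p ^ Suc s\<close> and 0 modulo
    \<open>d * N'\<close>: an idempotent modulo the group order that is adapted to \<open>d\<close>
    as well.\<close>
  have "coprime (p ^ Suc s) (d * N')"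
    using p N'(2) by (simp add: prime_imp_coprime)
  then have "coprime (int (p ^ Suc s)) (int (d * N'))"
    by (simp only: coprime_int_iff)
  then obtain u v where "u * int (p ^ Suc s) + v * int (d * N') = 1"
    by (metis bezout_int coprime_imp_gcd_eq_1)
  moreover define e where "e = v * int (d * N')"
  ultimately have "1 - e = int p ^ Suc s * u" "e = int d * int N' * v"
    by (simp_all add: algebra_simps)
  then have e1: "int p ^ Suc s dvd 1 - e" and e0: "int d * int N' dvd e"
    by simp_all
  have pe: "int p dvd 1 - e" using e1 by (metis dvd_mult_left power_Suc)
  have de: "int d dvd e" using e0 by (rule dvd_mult_left)
  have Ne: "int N dvd (1 - e) * e"
  proof -
    have "int p ^ s dvd 1 - e" using e1 by (metis dvd_mult_right power_Suc)
    moreover have "int N' dvd e" using e0 by (rule dvd_mult_right)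
    ultimately show ?thesis unfolding N'(1) by (simp add: mult_dvd_mono)
  qed
  have N1: "x [^] (k::int) = \<one>" if x: "x \<in> carrier G" and k: "int N dvd k" for x k
  proof -
    obtain l where "k = int N * l" using k by (rule dvdE)
    then have "x [^] k = (x [^] N) [^] l"
      using x by (simp add: int_pow_pow[symmetric] int_pow_int)
    also have "x [^] N = \<one>" using x pow_order_eq_1[of x] by (simp add: N_def Coset.order_def)
    finally show ?thesis by simp
  qed
  let ?T = "{..<m} \<rightarrow>\<^sub>E carrier G"
  \<comment> \<open>Written additively, \<open>\<sigma> x y\<close> is
    \<open>e x + (1 - e) y\<close>: it agrees with \<open>x\<close> up to \<open>p\<close>-th powers
    and with \<open>y\<close> up to \<open>d\<close>-th powers. So \<open>\<Phi>\<close>, its own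
    inverse, matches the pairs whose first entry lies in both sets with the pairs having one entry
    in each set.\<close>
  define \<sigma> where "\<sigma> x y = restrict (\<lambda>i. x i [^] e \<otimes> y i [^] (1 - e)) {..<m}" for x y :: "nat \<Rightarrow> 'a"
  define \<Phi> where "\<Phi> u = (\<sigma> (fst u) (snd u), \<sigma> (snd u) (fst u))" for u
  have \<sigma>T: "\<sigma> x y \<in> ?T" if "x \<in> ?T" "y \<in> ?T" for x y
    using that by (auto simp: \<sigma>_def)
  have \<sigma>\<sigma>: "\<sigma> (\<sigma> x y) (\<sigma> y x) = x" if "x \<in> ?T" "y \<in> ?T" for x y
  proof (rule PiE_ext[OF \<sigma>T[OF \<sigma>T[OF that] \<sigma>T[OF that(2,1)]] that(1)])
    fix i assume i: "i \<in> {..<m}"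
    have c: "x i \<in> carrier G" "y i \<in> carrier G" using that i by auto
    have "\<sigma> (\<sigma> x y) (\<sigma> y x) i = (x i [^] e \<otimes> y i [^] (1 - e)) [^] e \<otimes> (y i [^] e \<otimes> x i [^] (1 - e)) [^] (1 - e)"
      using i by (simp add: \<sigma>_def)
    also have "\<dots> = (x i [^] (e * e) \<otimes> x i [^] ((1 - e) * (1 - e))) \<otimes> (y i [^] ((1 - e) * e) \<otimes> y i [^] (e * (1 - e)))"
      using c by (simp add: int_pow_distrib int_pow_pow m_ac)
    also have "y i [^] ((1 - e) * e) = \<one>" using N1[OF c(2) Ne] .
    also have "y i [^] (e * (1 - e)) = \<one>" using N1[OF c(2) Ne] by (simp add: mult.commute)
    \<comment> \<open>Uses \<open>e * e + (1 - e) * (1 - e) = 1 - 2 * (1 - e) * e\<close>, where the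
      last term is a multiple of the group order.\<close>
    also have "x i [^] (e * e) \<otimes> x i [^] ((1 - e) * (1 - e)) = x i [^] (1 + (- 2) * ((1 - e) * e))"
      using c by (subst int_pow_mult[symmetric]) (auto simp: algebra_simps)
    also have "\<dots> = x i [^] (1::int) \<otimes> x i [^] ((- 2) * ((1 - e) * e))"
      using c by (subst int_pow_mult) auto
    also have "x i [^] ((- 2) * ((1 - e) * e)) = \<one>"
      by (intro N1[OF c(1)] dvd_mult Ne)
    finally show "\<sigma> (\<sigma> x y) (\<sigma> y x) i = x i" using c by simp
  qed
  have \<sigma>p: "x \<in> E \<longleftrightarrow> \<sigma> x y \<in> E" if "x \<in> ?T" "y \<in> ?T" for x y
  proof (rule periodic_iff[OF E(1) that(1) \<sigma>T[OF that]])
    fix i assume "i < m"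
    then have c: "x i \<in> carrier G" "y i \<in> carrier G" using that by auto
    have "inv (x i) \<otimes> \<sigma> x y i = (x i [^] (- 1 :: int) \<otimes> x i [^] e) \<otimes> y i [^] (1 - e)"
      using c \<open>i < m\<close> by (simp add: \<sigma>_def int_pow_neg m_assoc)
    also have "x i [^] (- 1 :: int) \<otimes> x i [^] e = x i [^] (- (1 - e))"
      using c by (subst int_pow_mult[symmetric]) auto
    also have "\<dots> \<otimes> y i [^] (1 - e) \<in> pows p"
      using c pe by (intro subgroup.m_closed[OF subgroup_pows] int_pow_in_pows) (auto simp del: minus_diff_eq)
    finally show "inv (x i) \<otimes> \<sigma> x y i \<in> pows p" .
  qed
  have \<sigma>d: "x \<in> E' \<longleftrightarrow> \<sigma> y x \<in> E'" if "x \<in> ?T" "y \<in> ?T" for x y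
  proof (rule periodic_iff[OF E(2) that(1) \<sigma>T[OF that(2,1)]])
    fix i assume "i < m"
    then have c: "x i \<in> carrier G" "y i \<in> carrier G" using that by auto
    have "inv (x i) \<otimes> \<sigma> y x i = y i [^] e \<otimes> (x i [^] (- 1 :: int) \<otimes> x i [^] (1 - e))"
      using c \<open>i < m\<close> by (simp add: \<sigma>_def int_pow_neg m_ac)
    also have "x i [^] (- 1 :: int) \<otimes> x i [^] (1 - e) = x i [^] (- e)"
      using c by (subst int_pow_mult[symmetric]) auto
    also have "y i [^] e \<otimes> \<dots> \<in> pows d"
      using c de by (intro subgroup.m_closed[OF subgroup_pows] int_pow_in_pows) auto
    finally show "inv (x i) \<otimes> \<sigma> y x i \<in> pows d" .
  qed
  have sub: "E \<subseteq> ?T" "E' \<subseteq> ?T" using E by (auto simp: periodic_def)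
  have \<Phi>\<Phi>: "\<Phi> (\<Phi> u) = u" if "fst u \<in> ?T" "snd u \<in> ?T" for u
    using \<sigma>\<sigma>[OF that] \<sigma>\<sigma>[OF that(2,1)] by (simp add: \<Phi>_def)
  have "bij_betw \<Phi> ((E \<inter> E') \<times> ?T) (E \<times> E')"
  proof (rule bij_betw_byWitness[where f' = \<Phi>])
    show "\<forall>u\<in>(E \<inter> E') \<times> ?T. \<Phi> (\<Phi> u) = u"
    proof
      fix u assume "u \<in> (E \<inter> E') \<times> ?T"
      then have u: "fst u \<in> E" "snd u \<in> ?T" unfolding mem_Times_iff by (meson IntD1)+
      show "\<Phi> (\<Phi> u) = u" by (rule \<Phi>\<Phi>[OF subsetD[OF sub(1) u(1)] u(2)])
    qed
    show "\<forall>u\<in>E \<times> E'. \<Phi> (\<Phi> u) = u"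
    proof
      fix u assume "u \<in> E \<times> E'"
      then have u: "fst u \<in> E" "snd u \<in> E'" unfolding mem_Times_iff by blast+
      show "\<Phi> (\<Phi> u) = u" by (rule \<Phi>\<Phi>[OF subsetD[OF sub(1) u(1)] subsetD[OF sub(2) u(2)]])
    qed
    show "\<Phi> ` ((E \<inter> E') \<times> ?T) \<subseteq> E \<times> E'"
    proof (rule image_subsetI)
      fix u assume "u \<in> (E \<inter> E') \<times> ?T"
      then have u: "fst u \<in> E" "fst u \<in> E'" "fst u \<in> ?T" "snd u \<in> ?T"
        using sub unfolding mem_Times_iff by (meson IntD1 IntD2 subsetD)+
      then show "\<Phi> u \<in> E \<times> E'"
        using \<sigma>p[OF u(3,4)] \<sigma>d[OF u(3,4)] by (simp add: \<Phi>_def)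
    qed
    show "\<Phi> ` (E \<times> E') \<subseteq> (E \<inter> E') \<times> ?T"
    proof (rule image_subsetI)
      fix u assume "u \<in> E \<times> E'"
      then have u: "fst u \<in> E" "snd u \<in> E'" by auto
      then have u: "fst u \<in> E" "snd u \<in> E'" "fst u \<in> ?T" "snd u \<in> ?T" using sub by blast+
      then show "\<Phi> u \<in> (E \<inter> E') \<times> ?T"
        using \<sigma>p[OF u(3,4)] \<sigma>d[OF u(4,3)] \<sigma>T by (simp add: \<Phi>_def)
    qed
  qed
  then have "card ((E \<inter> E') \<times> ?T) = card (E \<times> E')"
    by (rule bij_betw_same_card)
  then show ?thesis
    by (simp add: card_cartesian_product card_PiE)
qed

lemma periodic_modp_generating:
  "periodic p m {t\<in>{..<m} \<rightarrow>\<^sub>E carrier G. modp_span p t m = carrier G}"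
  unfolding periodic_def
proof (intro conjI ballI impI)
  fix x y assume x: "x \<in> {t\<in>{..<m} \<rightarrow>\<^sub>E carrier G. modp_span p t m = carrier G}"
    and y: "y \<in> {..<m} \<rightarrow>\<^sub>E carrier G" and xy: "\<forall>i<m. inv (x i) \<otimes> y i \<in> pows p"
  have imy: "y ` {..<m} \<subseteq> carrier G" using y by auto
  note sub = modp_span_subgroup[OF imy, of p]
  have "x i \<in> modp_span p y m" if "i < m" for i
  proof -
    have c: "x i \<in> carrier G" "y i \<in> carrier G" using x y that by auto
    have "y i \<in> modp_span p y m"
      using that by (auto simp: modp_span_def intro: generate.incl)
    moreover have "inv (inv (x i) \<otimes> y i) \<in> modp_span p y m"
      using xy that sub by (meson subgroup.m_inv_closed subsetD)
    ultimately have "y i \<otimes> inv (inv (x i) \<otimes> y i) \<in> modp_span p y m"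
      using sub(1) by (simp add: subgroup.m_closed)
    also have "y i \<otimes> inv (inv (x i) \<otimes> y i) = x i"
      using c by (simp add: inv_mult m_ac)
    finally show ?thesis .
  qed
  then have "modp_span p x m \<subseteq> modp_span p y m"
    unfolding modp_span_def[of p x] using sub by (intro generate_subgroup_incl) auto
  moreover have "modp_span p y m \<subseteq> carrier G"
    using sub(1) by (rule subgroup.subset)
  ultimately show "y \<in> {t\<in>{..<m} \<rightarrow>\<^sub>E carrier G. modp_span p t m = carrier G}"
    using x y by auto
qed auto

lemma pows_dvd: "d dvd d' \<Longrightarrow> pows d' \<subseteq> pows d"
  by (auto simp: pows_def nat_pow_pow[symmetric] dvd_def mult.commute intro!: imageI)

lemma periodicI:
  assumes "E \<subseteq> ({..<m} \<rightarrow>\<^sub>E carrier G)"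
    and "\<And>x y. x \<in> E \<Longrightarrow> y \<in> {..<m} \<rightarrow>\<^sub>E carrier G \<Longrightarrow> (\<And>i. i < m \<Longrightarrow> inv (x i) \<otimes> y i \<in> pows d) \<Longrightarrow> y \<in> E"
  shows "periodic d m E"
  using assms by (simp add: periodic_def)

lemma periodicD:
  assumes "periodic d m E" "x \<in> E" "y \<in> {..<m} \<rightarrow>\<^sub>E carrier G" "\<And>i. i < m \<Longrightarrow> inv (x i) \<otimes> y i \<in> pows d"
  shows "y \<in> E"
  using assms by (simp add: periodic_def)

lemma periodic_dvd:
  assumes "periodic d m E" "d dvd d'" shows "periodic d' m E"
proof (rule periodicI)
  show "E \<subseteq> ({..<m} \<rightarrow>\<^sub>E carrier G)" using assms(1) by (simp add: periodic_def)
qed (use periodicD[OF assms(1)] pows_dvd[OF assms(2)] in \<open>meson subsetD\<close>)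

lemma periodic_Int:
  assumes "periodic d m E" "periodic d m E'" shows "periodic d m (E \<inter> E')"
proof (rule periodicI)
  show "E \<inter> E' \<subseteq> ({..<m} \<rightarrow>\<^sub>E carrier G)" using assms(1) by (auto simp: periodic_def)
qed (use periodicD[OF assms(1)] periodicD[OF assms(2)] in \<open>meson IntE IntI\<close>)

text \<open>Periodicity modulo the product of the primes treated so far is carried through the
  induction because the next prime is coprime to that product, which is what the independence
  statement \<open>card_periodic_Int\<close> asks for.\<close>

lemma card_generating_all_primes:
  assumes fin: "finite (carrier G)" "finite P" and P: "\<And>p. p \<in> P \<Longrightarrow> prime p"
    and card: "\<And>p. p \<in> P \<Longrightarrow> card (carrier G) = p ^ m * card (pows p)"
  shows "real (card {t\<in>{..<m} \<rightarrow>\<^sub>E carrier G. \<forall>p\<in>P. modp_span p t m = carrier G}) =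
      real (card (carrier G)) ^ m * (\<Prod>p\<in>P. \<Prod>i<m. 1 - 1 / real p ^ Suc i)
    \<and> periodic (\<Prod>P) m {t\<in>{..<m} \<rightarrow>\<^sub>E carrier G. \<forall>p\<in>P. modp_span p t m = carrier G}"
  using fin(2) P card
proof (induction P rule: finite_induct)
  case empty
  then show ?case by (auto simp: card_PiE periodic_def)
next
  case (insert p P)
  let ?E = "\<lambda>p. {t\<in>{..<m} \<rightarrow>\<^sub>E carrier G. modp_span p t m = carrier G}"
  let ?A = "\<lambda>P. {t\<in>{..<m} \<rightarrow>\<^sub>E carrier G. \<forall>p\<in>P. modp_span p t m = carrier G}"
  have eq: "?A (insert p P) = ?E p \<inter> ?A P" by auto
  have IH: "real (card (?A P)) = real (card (carrier G)) ^ m * (\<Prod>p\<in>P. \<Prod>i<m. 1 - 1 / real p ^ Suc i)"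
      "periodic (\<Prod>P) m (?A P)"
    using insert by auto
  have p: "prime p" and cp: "card (carrier G) = p ^ m * card (pows p)"
    using insert.prems by (meson insertI1)+
  have "coprime p (\<Prod>P)"
  proof (rule prod_coprime_right)
    fix q assume "q \<in> P"
    then show "coprime p q" using insert.prems insert.hyps by (metis insert_iff primes_coprime)
  qed
  then have "card (?E p \<inter> ?A P) * card (carrier G) ^ m = card (?E p) * card (?A P)"
    by (intro card_periodic_Int[OF fin(1) p]) (use periodic_modp_generating IH in auto)
  then have "real (card (?E p \<inter> ?A P)) * real (card (carrier G)) ^ m = real (card (?E p)) * real (card (?A P))"
    by (simp only: of_nat_mult[symmetric] of_nat_power[symmetric])
  also have "\<dots> = (real (card (carrier G)) ^ m * (\<Prod>i<m. 1 - 1 / real p ^ Suc i)) * real (card (?A P))"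
    by (simp only: card_modp_generating[OF fin(1) p cp])
  also have "\<dots> = (real (card (carrier G)) ^ m * (\<Prod>p\<in>insert p P. \<Prod>i<m. 1 - 1 / real p ^ Suc i)) * real (card (carrier G)) ^ m"
    using IH insert.hyps by (simp add: mult_ac)
  finally have "real (card (?E p \<inter> ?A P)) = real (card (carrier G)) ^ m * (\<Prod>p\<in>insert p P. \<Prod>i<m. 1 - 1 / real p ^ Suc i)"
    using fin(1) by (auto simp: card_gt_0_iff)
  moreover have "periodic (\<Prod>(insert p P)) m (?E p \<inter> ?A P)"
    using insert.hyps
    by (intro periodic_Int periodic_dvd[OF periodic_modp_generating] periodic_dvd[OF IH(2)]) auto
  ultimately show ?case unfolding eq by simp
qed

text \<open>Writing the elements as products of a generated element and a \<open>p\<close>-th power, one prime after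
  the other, turns the \<open>p\<close>-th power into a power with exponent the group order.\<close>

lemma generate_iff_modp_span:
  assumes fin: "finite (carrier G)" and P: "\<And>p. prime p \<Longrightarrow> p dvd card (carrier G) \<Longrightarrow> p \<in> P"
    and t: "t ` {..<m} \<subseteq> carrier G"
  shows "generate G (t ` {..<m}) = carrier G \<longleftrightarrow> (\<forall>p\<in>P. modp_span p t m = carrier G)"
proof
  assume "generate G (t ` {..<m}) = carrier G"
  moreover have "generate G (t ` {..<m}) \<subseteq> modp_span p t m" for p
    unfolding modp_span_def by (rule mono_generate) auto
  ultimately show "\<forall>p\<in>P. modp_span p t m = carrier G"
    using subgroup.subset[OF modp_span_subgroup(1)[OF t]] by blast
next
  assume *: "\<forall>p\<in>P. modp_span p t m = carrier G"
  define H where "H = generate G (t ` {..<m})"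
  have H: "subgroup H G" unfolding H_def using t by (rule generate_is_subgroup)
  have step: "carrier G \<subseteq> H <#> pows p" if "p \<in> P" for p
  proof -
    have sub: "subgroup (H <#> pows p) G"
      using H subgroup_pows by (rule mult_subgroups)
    have "x \<in> H <#> pows p" if "x \<in> H" for x
    proof -
      have "x \<otimes> \<one> \<in> H <#> pows p"
        using that subgroup.one_closed[OF subgroup_pows[of p]] unfolding set_mult_def by blast
      then show ?thesis using subgroup.mem_carrier[OF H that] by simp
    qed
    moreover have "x \<in> H <#> pows p" if "x \<in> pows p" for x
    proof -
      have "\<one> \<otimes> x \<in> H <#> pows p"
        using that subgroup.one_closed[OF H] unfolding set_mult_def by blast
      then show ?thesis using that pows_subset[of p] by (simp add: subset_iff)
    qed
    moreover have "t ` {..<m} \<subseteq> H" unfolding H_def by (auto intro: generate.incl)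
    ultimately have "modp_span p t m \<subseteq> H <#> pows p"
      unfolding modp_span_def using sub by (intro generate_subgroup_incl) auto
    then show ?thesis using * that by blast
  qed
  have all: "\<exists>h\<in>H. \<exists>z\<in>carrier G. x = h \<otimes> z [^] d" if "x \<in> carrier G" "d dvd card (carrier G)" "d > 0" for x d
    using that
  proof (induction d arbitrary: x rule: less_induct)
    case (less d)
    show ?case
    proof (cases "d = 1")
      case True
      then show ?thesis using less.prems subgroup.one_closed[OF H] by (intro bexI[of _ \<one>] bexI[of _ x]) auto
    next
      case False
      then obtain p where p: "prime p" "p dvd d" using prime_factor_nat by blast
      then obtain l where l: "d = p * l" by blast
      have "l < d" "l > 0" using p(1) less.prems(3) l prime_gt_1_nat[of p] by auto
      then obtain h z where hz: "h \<in> H" "z \<in> carrier G" "x = h \<otimes> z [^] l"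
        using less.IH[of l x] less.prems l by (metis dvd_mult_right)
      have "p \<in> P" using P p less.prems(2) by (meson dvd_trans)
      then have "z \<in> H <#> pows p" using step hz(2) by blast
      then obtain h' w where w: "h' \<in> H" "w \<in> carrier G" "z = h' \<otimes> w [^] p"
        by (auto simp: set_mult_def pows_def)
      have c: "h \<in> carrier G" "h' \<in> carrier G" using hz w subgroup.mem_carrier[OF H] by auto
      have "x = (h \<otimes> h' [^] l) \<otimes> w [^] d"
        using hz w c nat_pow_distrib[of h' "w [^] p" l] by (simp add: nat_pow_pow l m_assoc)
      moreover have "h \<otimes> h' [^] l \<in> H"
        using hz w H by (simp add: subgroup.m_closed subgroup_pow_closed)
      ultimately show ?thesis using w by blast
    qed
  qed
  have "x \<in> H" if x: "x \<in> carrier G" for x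
  proof -
    have "card (carrier G) > 0" using fin x by (auto simp: card_gt_0_iff)
    then obtain h z where "h \<in> H" "z \<in> carrier G" "x = h \<otimes> z [^] card (carrier G)"
      using all[OF x dvd_refl] by blast
    moreover have "z [^] card (carrier G) = \<one>"
      using pow_order_eq_1[of z] \<open>z \<in> carrier G\<close> by (simp add: Coset.order_def)
    ultimately show ?thesis using subgroup.mem_carrier[OF H] by simp
  qed
  then show "generate G (t ` {..<m}) = carrier G"
    using subgroup.subset[OF H] unfolding H_def by blast
qed

text \<open>Only the ranks at the primes enter: generation may be checked modulo each prime
  separately, and these events are independent.\<close>

theorem card_generating_tuples:
  assumes "finite (carrier G)" "finite P" "\<And>p. p \<in> P \<Longrightarrow> prime p"
    and "\<And>p. p \<in> P \<Longrightarrow> card (carrier G) = p ^ m * card (pows p)"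
    and "\<And>p. prime p \<Longrightarrow> p dvd card (carrier G) \<Longrightarrow> p \<in> P"
  shows "real (card {t\<in>{..<m} \<rightarrow>\<^sub>E carrier G. generate G (t ` {..<m}) = carrier G}) =
    real (card (carrier G)) ^ m * (\<Prod>p\<in>P. \<Prod>i<m. 1 - 1 / real p ^ Suc i)"
proof -
  have "{t\<in>{..<m} \<rightarrow>\<^sub>E carrier G. generate G (t ` {..<m}) = carrier G} =
      {t\<in>{..<m} \<rightarrow>\<^sub>E carrier G. \<forall>p\<in>P. modp_span p t m = carrier G}"
  proof (intro Collect_cong conj_cong refl)
    fix t assume "t \<in> {..<m} \<rightarrow>\<^sub>E carrier G"
    then have "t ` {..<m} \<subseteq> carrier G" by auto
    then show "generate G (t ` {..<m}) = carrier G \<longleftrightarrow> (\<forall>p\<in>P. modp_span p t m = carrier G)"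
      by (intro generate_iff_modp_span assms(1,5))
  qed
  then show ?thesis
    using card_generating_all_primes[OF assms(1-4)] by simp
qed

end

section \<open>Lattices and kernels of homomorphisms\<close>

abbreviation Zn :: "nat \<Rightarrow> int vec monoid" where "Zn n \<equiv> monoid_vec TYPE(int) n"

lemma Zn_simps [simp]:
  "carrier (Zn n) = carrier_vec n" "x \<otimes>\<^bsub>Zn n\<^esub> y = x + y" "\<one>\<^bsub>Zn n\<^esub> = 0\<^sub>v n"
  by (simp_all add: monoid_vec_simps)

lemma comm_group_Zn: "comm_group (Zn n)"
  by (rule comm_group_vec)

lemma group_Zn: "group (Zn n)"
  using comm_group_Zn by (rule comm_group.axioms)

lemma Zn_inv: "v \<in> carrier_vec n \<Longrightarrow> inv\<^bsub>Zn n\<^esub> v = - v"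
  by (rule group.inv_equality[OF group_Zn]) simp_all

lemma Zn_pow: "v \<in> carrier_vec n \<Longrightarrow> v [^]\<^bsub>Zn n\<^esub> (k::nat) = int k \<cdot>\<^sub>v v"
proof (induction k)
  case 0
  interpret group "Zn n" by (rule group_Zn)
  show ?case using 0 by auto
next
  case (Suc k)
  interpret group "Zn n" by (rule group_Zn)
  have "v [^]\<^bsub>Zn n\<^esub> (Suc k) = int k \<cdot>\<^sub>v v + v"
    using Suc by simp
  also have "\<dots> = int (Suc k) \<cdot>\<^sub>v v"
    using Suc.prems by (intro eq_vecI) (auto simp: algebra_simps)
  finally show ?case .
qed

lemma Zn_int_pow: "v \<in> carrier_vec n \<Longrightarrow> v [^]\<^bsub>Zn n\<^esub> (k::int) = k \<cdot>\<^sub>v v"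
proof -
  assume v: "v \<in> carrier_vec n"
  interpret group "Zn n" by (rule group_Zn)
  show ?thesis
  proof (cases "k \<ge> 0")
    case True
    have "v [^]\<^bsub>Zn n\<^esub> int (nat k) = int (nat k) \<cdot>\<^sub>v v"
      by (simp only: int_pow_int Zn_pow[OF v])
    then show ?thesis using True by simp
  next
    case False
    define m where "m = nat (- k)"
    have k: "k = - int m" "k < 0" using False by (auto simp: m_def)
    have "v [^]\<^bsub>Zn n\<^esub> k = inv\<^bsub>Zn n\<^esub> (v [^]\<^bsub>Zn n\<^esub> m)"
      unfolding k(1) using v by (simp only: int_pow_neg Zn_simps int_pow_int)
    also have "\<dots> = - (int m \<cdot>\<^sub>v v)"
      using v by (simp add: Zn_pow Zn_inv)
    also have "\<dots> = k \<cdot>\<^sub>v v"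
      unfolding k(1) using v by (intro eq_vecI) auto
    finally show ?thesis .
  qed
qed

lemma mult_mat_smult_vec:
  fixes A :: "int mat"
  assumes "A \<in> carrier_mat nr nc" "v \<in> carrier_vec nc"
  shows "A *\<^sub>v (k \<cdot>\<^sub>v v) = k \<cdot>\<^sub>v (A *\<^sub>v v)"
  using assms by (intro eq_vecI) (auto simp: scalar_prod_smult_right)

locale Zn_hom = comm_group G for G (structure) + fixes n :: nat and F :: "int vec \<Rightarrow> 'a"
  assumes hom: "F \<in> hom (Zn n) G"
begin

lemma group_hom: "group_hom (Zn n) G F"
  using group_Zn hom is_group by (simp add: group_hom_def group_hom_axioms_def)

lemma closed [simp]: "v \<in> carrier_vec n \<Longrightarrow> F v \<in> carrier G"
  using hom by (auto simp: hom_def)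

lemma add [simp]: "v \<in> carrier_vec n \<Longrightarrow> w \<in> carrier_vec n \<Longrightarrow> F (v + w) = F v \<otimes> F w"
  using hom by (auto simp: hom_def)

lemma zero [simp]: "F (0\<^sub>v n) = \<one>"
  using group_hom.hom_one[OF group_hom] by simp

lemma smult [simp]: "v \<in> carrier_vec n \<Longrightarrow> F (k \<cdot>\<^sub>v v) = F v [^] k"
  using group_hom.hom_int_pow[OF group_hom, of v k] by (simp add: Zn_int_pow)

lemma minus:
  assumes "v \<in> carrier_vec n" "w \<in> carrier_vec n"
  shows "F (v - w) = F v \<otimes> inv F w"
proof -
  have "v - w = v + (- 1) \<cdot>\<^sub>v w" using assms by (intro eq_vecI) auto
  then have "F (v - w) = F v \<otimes> F w [^] (- 1 :: int)" using assms by simp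
  also have "F w [^] (- 1 :: int) = inv F w" using assms int_pow_neg[of "F w" 1] by simp
  finally show ?thesis .
qed

end

lemma Zn_homI: "comm_group G \<Longrightarrow> F \<in> hom (Zn n) G \<Longrightarrow> Zn_hom G n F"
  by (simp add: Zn_hom_def Zn_hom_axioms_def)

section \<open>Kernels, lattices and saturations\<close>

definition ker :: "('a, 'm) monoid_scheme \<Rightarrow> nat \<Rightarrow> (int vec \<Rightarrow> 'a) \<Rightarrow> int vec set" where
  "ker G n F = {v \<in> carrier_vec n. F v = \<one>\<^bsub>G\<^esub>}"

definition lat :: "nat \<Rightarrow> int mat \<Rightarrow> int \<Rightarrow> int vec set" where
  "lat n A a = {A *\<^sub>v y + a \<cdot>\<^sub>v z | y z. y \<in> carrier_vec (dim_col A) \<and> z \<in> carrier_vec n}"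

text \<open>The vectors of \<open>Z^n\<close> that fall into the image of \<open>A\<close> once all
  integers coprime to \<open>a\<close> are inverted, that is, the kernel of the map to the localised
  cokernel. In contrast, \<open>lat\<close> depends on \<open>A\<close> modulo \<open>a\<close>
  only.\<close>

definition sat :: "nat \<Rightarrow> int mat \<Rightarrow> int \<Rightarrow> int vec set" where
  "sat n A a = {v \<in> carrier_vec n. \<exists>s. coprime s a \<and> s \<cdot>\<^sub>v v \<in> mat_image n A}"

lemma mat_image_iff: "x \<in> mat_image n A \<longleftrightarrow> (\<exists>v\<in>carrier_vec n. x = A *\<^sub>v v)"
  by (auto simp: mat_image_def)

lemma (in group) pow_eq_one_coprime:
  assumes "x \<in> carrier G" "x [^] (s::int) = \<one>" "x [^] (g::int) = \<one>" "coprime s g"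
  shows "x = \<one>"
proof -
  obtain u v where uv: "s * u + g * v = 1"
    using assms(4) by (metis bezout_int coprime_imp_gcd_eq_1 mult.commute)
  then have "x = x [^] (s * u + g * v)"
    using assms(1) by (metis int_pow_1)
  also have "\<dots> = (x [^] s) [^] u \<otimes> (x [^] g) [^] v"
    using assms(1) by (simp add: int_pow_mult int_pow_pow)
  finally show ?thesis
    using assms by simp
qed

lemma det_cong_mod:
  assumes A: "A \<in> carrier_mat n n" and B: "B \<in> carrier_mat n n"
    and *: "\<And>i j. i < n \<Longrightarrow> j < n \<Longrightarrow> A $$ (i,j) mod b = B $$ (i,j) mod (b::int)"
  shows "det A mod b = det B mod b"
proof -
  have "(signof p * (\<Prod>i = 0..<n. A $$ (i, p i))) mod b = (signof p * (\<Prod>i = 0..<n. B $$ (i, p i))) mod b"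
    if "p permutes {0..<n}" for p
  proof -
    have "(\<Prod>i = 0..<n. A $$ (i, p i) mod b) = (\<Prod>i = 0..<n. B $$ (i, p i) mod b)"
      using permutes_in_image[OF that] by (intro prod.cong refl *) auto
    from arg_cong[OF this, of "\<lambda>x. x mod b"]
    have "(\<Prod>i = 0..<n. A $$ (i, p i)) mod b = (\<Prod>i = 0..<n. B $$ (i, p i)) mod b"
      unfolding mod_prod_eq .
    then show ?thesis by (rule mod_mult_cong[OF refl])
  qed
  then have "(\<Sum>p\<in>{p. p permutes {0..<n}}. (signof p * (\<Prod>i = 0..<n. A $$ (i, p i))) mod b) =
      (\<Sum>p\<in>{p. p permutes {0..<n}}. (signof p * (\<Prod>i = 0..<n. B $$ (i, p i))) mod b)"
    by (intro sum.cong refl) simp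
  from arg_cong[OF this, of "\<lambda>x. x mod b"] show ?thesis
    unfolding det_def'[OF A] det_def'[OF B] mod_sum_eq .
qed

text \<open>Nakayama's lemma by the determinant: \<open>g = M Y + b g Z\<close> gives \<open>g (1 - b Z) = M Y\<close>.\<close>

lemma nakayama:
  assumes M: "M \<in> carrier_mat n n"
    and *: "\<And>v. v \<in> carrier_vec n \<Longrightarrow> g \<cdot>\<^sub>v v \<in> lat n M (b * g)"
  shows "\<exists>d W. d mod b = 1 mod b \<and> W \<in> carrier_mat n n \<and> M * W = (g * d) \<cdot>\<^sub>m 1\<^sub>m n"
proof -
  have "\<exists>y z. y \<in> carrier_vec n \<and> z \<in> carrier_vec n \<and> g \<cdot>\<^sub>v unit_vec n i = M *\<^sub>v y + (b * g) \<cdot>\<^sub>v z" for i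
    using *[of "unit_vec n i"] M by (auto simp: lat_def)
  then obtain y z where y: "\<And>i. y i \<in> carrier_vec n" and z: "\<And>i. z i \<in> carrier_vec n"
    and yz: "\<And>i. g \<cdot>\<^sub>v unit_vec n i = M *\<^sub>v y i + (b * g) \<cdot>\<^sub>v z i"
    by metis
  define Y where "Y = mat n n (\<lambda>(r, c). y c $ r)"
  define Z where "Z = mat n n (\<lambda>(r, c). z c $ r)"
  have YZ: "Y \<in> carrier_mat n n" "Z \<in> carrier_mat n n" by (auto simp: Y_def Z_def)
  define T where "T = 1\<^sub>m n - b \<cdot>\<^sub>m Z"
  have T: "T \<in> carrier_mat n n" using YZ by (auto simp: T_def)
  have MY: "M * Y = g \<cdot>\<^sub>m T"
  proof (rule eq_matI)
    fix i j assume "i < dim_row (g \<cdot>\<^sub>m T)" "j < dim_col (g \<cdot>\<^sub>m T)"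
    then have ij: "i < n" "j < n" using T by auto
    have colY: "col Y j = y j" using ij y[of j] by (auto simp: Y_def)
    have "(M *\<^sub>v y j + (b * g) \<cdot>\<^sub>v z j) $ i = (g \<cdot>\<^sub>v unit_vec n j) $ i" using yz by simp
    then have "row M i \<bullet> y j + b * g * z j $ i = g * (if i = j then 1 else 0)"
      using ij M y[of j] z[of j] by (auto simp: carrier_vecD)
    then show "(M * Y) $$ (i, j) = (g \<cdot>\<^sub>m T) $$ (i, j)"
      using ij M YZ colY by (auto simp: T_def Z_def algebra_simps)
  qed (use M YZ T in auto)
  \<comment> \<open>Multiplying \<open>M Y = g T\<close> by the adjugate of \<open>T\<close>
    replaces \<open>T\<close> by the scalar \<open>det T\<close>, which is 1 modulo \<open>b\<close>
    because \<open>T\<close> is the identity modulo \<open>b\<close>.\<close>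
  define W where "W = Y * adj_mat T"
  have adj: "adj_mat T \<in> carrier_mat n n" "T * adj_mat T = det T \<cdot>\<^sub>m 1\<^sub>m n"
    using adj_mat[OF T] by auto
  have "M * W = (M * Y) * adj_mat T"
    unfolding W_def using M YZ adj by (intro assoc_mult_mat[symmetric]) auto
  also have "\<dots> = g \<cdot>\<^sub>m (T * adj_mat T)"
    unfolding MY by (rule mult_smult_assoc_mat[OF T adj(1)])
  also have "\<dots> = (g * det T) \<cdot>\<^sub>m 1\<^sub>m n"
    unfolding adj by (rule eq_matI) auto
  finally have "M * W = (g * det T) \<cdot>\<^sub>m 1\<^sub>m n" .
  moreover have "det T mod b = det (1\<^sub>m n :: int mat) mod b"
    using YZ by (intro det_cong_mod[OF T]) (auto simp: T_def mod_diff_right_eq[symmetric])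
  ultimately show ?thesis
    using YZ adj by (intro exI[of _ "det T"] exI[of _ W]) (auto simp: W_def)
qed

lemma mult_scalar_mat_vec: "v \<in> carrier_vec n \<Longrightarrow> (c \<cdot>\<^sub>m 1\<^sub>m n) *\<^sub>v v = c \<cdot>\<^sub>v (v :: int vec)"
  by (intro eq_vecI) auto

lemma coprime_of_mod_1: "d mod b = 1 mod b \<Longrightarrow> coprime d (b::int)"
  by (metis coprime_1_left coprime_mod_left_iff mod_by_0 coprime_0_right_iff)

text \<open>\<open>b\<close> will be the product of the primes in \<open>P\<close>, and
  \<open>g\<close> a common exponent of the groups of the flag, all of whose prime factors divide
  \<open>b\<close>.\<close>

locale P_exponent =
  fixes b g :: int
  assumes bg: "b > 0" "g > 0" and coprime_bg: "coprime s b \<Longrightarrow> coprime s g"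
begin

lemma coprime_iff: "coprime s (b * g) \<longleftrightarrow> coprime s b"
  using coprime_bg by auto

text \<open>Since \<open>g\<close> kills \<open>K\<close>, equality with the lattice puts
  \<open>g\<close> times every vector into \<open>M Z^n + b g Z^n\<close>. Nakayama then gives
  \<open>d\<close> coprime to \<open>b\<close> with \<open>d g Z^n\<close> inside the image of
  \<open>M\<close>, so that the summand \<open>b g Z^n\<close> of the lattice is saturated too.
  Conversely, Bezout writes a saturated vector as an image vector plus a multiple of
  \<open>b * g\<close>.\<close>

lemma ker_eq_lat_iff_sat:
  assumes K: "comm_group K" "\<And>x. x \<in> carrier K \<Longrightarrow> x [^]\<^bsub>K\<^esub> g = \<one>\<^bsub>K\<^esub>"
    and H: "H \<in> hom (Zn n) K" and M: "M \<in> carrier_mat n n"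
  shows "ker K n H = lat n M (b * g) \<longleftrightarrow> ker K n H = sat n M (b * g)"
proof -
  interpret K: comm_group K by (rule K(1))
  interpret H: Zn_hom K n H using K(1) H by (rule Zn_homI)
  have killed: "H (g \<cdot>\<^sub>v v) = \<one>\<^bsub>K\<^esub>" if "v \<in> carrier_vec n" for v
    using that K(2) by simp
  show ?thesis
  proof
    assume eq: "ker K n H = lat n M (b * g)"
    have "g \<cdot>\<^sub>v v \<in> lat n M (b * g)" if "v \<in> carrier_vec n" for v
      using that killed unfolding eq[symmetric] by (simp add: ker_def)
    then obtain d W where d: "d mod b = 1 mod b" and W: "W \<in> carrier_mat n n" "M * W = (g * d) \<cdot>\<^sub>m 1\<^sub>m n"
      using nakayama[OF M, of g b] by blast
    have d': "coprime d (b * g)" using coprime_of_mod_1[OF d] coprime_iff by blast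
    show "ker K n H = sat n M (b * g)"
    proof (intro equalityI subsetI)
      fix v assume "v \<in> ker K n H"
      then obtain y z where yz: "v = M *\<^sub>v y + (b * g) \<cdot>\<^sub>v z" "y \<in> carrier_vec n" "z \<in> carrier_vec n"
        using M unfolding eq by (auto simp: lat_def)
      have "d \<cdot>\<^sub>v v = d \<cdot>\<^sub>v (M *\<^sub>v y) + b \<cdot>\<^sub>v ((g * d) \<cdot>\<^sub>v z)"
        using yz M by (simp add: smult_add_distrib_vec[of _ n] smult_smult_assoc mult_ac)
      also have "(g * d) \<cdot>\<^sub>v z = (M * W) *\<^sub>v z"
        unfolding W(2) by (rule mult_scalar_mat_vec[OF yz(3), symmetric])
      also have "(M * W) *\<^sub>v z = M *\<^sub>v (W *\<^sub>v z)"
        by (rule assoc_mult_mat_vec[OF M W(1) yz(3)])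
      also have "d \<cdot>\<^sub>v (M *\<^sub>v y) + b \<cdot>\<^sub>v (M *\<^sub>v (W *\<^sub>v z)) = M *\<^sub>v (d \<cdot>\<^sub>v y + b \<cdot>\<^sub>v (W *\<^sub>v z))"
        using M W yz by (simp add: mult_add_distrib_mat_vec[of _ n n] mult_mat_smult_vec[of _ n n])
      finally have "d \<cdot>\<^sub>v v \<in> mat_image n M"
        unfolding mat_image_iff using yz W by (intro bexI[of _ "d \<cdot>\<^sub>v y + b \<cdot>\<^sub>v (W *\<^sub>v z)"]) auto
      moreover have "v \<in> carrier_vec n" using yz M by auto
      ultimately show "v \<in> sat n M (b * g)" using d' by (auto simp: sat_def)
    next
      fix v assume "v \<in> sat n M (b * g)"
      then obtain s y where v: "v \<in> carrier_vec n" and s: "coprime s (b * g)" and y: "y \<in> carrier_vec n" "s \<cdot>\<^sub>v v = M *\<^sub>v y"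
        by (auto simp: sat_def mat_image_iff)
      have "M *\<^sub>v y + (b * g) \<cdot>\<^sub>v 0\<^sub>v n = M *\<^sub>v y" using M y by auto
      then have "M *\<^sub>v y \<in> lat n M (b * g)"
        unfolding lat_def mem_Collect_eq using M y
        by (intro exI[of _ y] exI[of _ "0\<^sub>v n"]) auto
      then have "H v [^]\<^bsub>K\<^esub> s = \<one>\<^bsub>K\<^esub>"
        using v unfolding eq[symmetric] y(2)[symmetric] by (simp add: ker_def)
      moreover have "coprime s g" using s by simp
      ultimately show "v \<in> ker K n H"
        using v K(2) K.pow_eq_one_coprime[of "H v" s g] by (simp add: ker_def)
    qed
  next
    assume eq: "ker K n H = sat n M (b * g)"
    show "ker K n H = lat n M (b * g)"
    proof (intro equalityI subsetI)
      fix v assume "v \<in> ker K n H"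
      then obtain s y where v: "v \<in> carrier_vec n" and s: "coprime s (b * g)" and y: "y \<in> carrier_vec n" "s \<cdot>\<^sub>v v = M *\<^sub>v y"
        unfolding eq by (auto simp: sat_def mat_image_iff)
      obtain u w where uw: "u * s + w * (b * g) = 1"
        using s by (metis bezout_int coprime_imp_gcd_eq_1)
      have "v = (u * s + w * (b * g)) \<cdot>\<^sub>v v" unfolding uw by simp
      also have "\<dots> = u \<cdot>\<^sub>v (s \<cdot>\<^sub>v v) + (b * g) \<cdot>\<^sub>v (w \<cdot>\<^sub>v v)"
        using v by (intro eq_vecI) (auto simp: algebra_simps)
      also have "u \<cdot>\<^sub>v (s \<cdot>\<^sub>v v) = M *\<^sub>v (u \<cdot>\<^sub>v y)"
        using M y by (simp add: mult_mat_smult_vec[of _ n n])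
      finally have "v = M *\<^sub>v (u \<cdot>\<^sub>v y) + (b * g) \<cdot>\<^sub>v (w \<cdot>\<^sub>v v)" .
      moreover have "u \<cdot>\<^sub>v y \<in> carrier_vec (dim_col M)" "w \<cdot>\<^sub>v v \<in> carrier_vec n"
        using M y v by auto
      ultimately show "v \<in> lat n M (b * g)"
        unfolding lat_def by blast
    next
      fix v assume "v \<in> lat n M (b * g)"
      then obtain y z where yz: "v = M *\<^sub>v y + (b * g) \<cdot>\<^sub>v z" "y \<in> carrier_vec n" "z \<in> carrier_vec n"
        using M by (auto simp: lat_def)
      have My: "M *\<^sub>v y \<in> carrier_vec n" using M yz by auto
      have "M *\<^sub>v y \<in> sat n M (b * g)"
        unfolding sat_def mat_image_iff using M yz My by (auto intro!: exI[of _ 1] bexI[of _ y])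
      then have "H (M *\<^sub>v y) = \<one>\<^bsub>K\<^esub>" unfolding eq[symmetric] by (simp add: ker_def)
      moreover have "H ((b * g) \<cdot>\<^sub>v z) = \<one>\<^bsub>K\<^esub>"
        using killed[of "b \<cdot>\<^sub>v z"] yz by (simp add: smult_smult_assoc mult.commute)
      ultimately show "v \<in> ker K n H"
        using yz My H.add[of "M *\<^sub>v y" "(b * g) \<cdot>\<^sub>v z"] by (simp add: ker_def)
    qed
  qed
qed

text \<open>Trades a condition on the product \<open>A * M\<close> for one on \<open>M\<close>
  alone. In terms of saturations: a vector of \<open>ker F\<close> is killed by the composite with
  \<open>\<pi>\<close>, so a multiple of it by a unit is of the form \<open>A w\<close>, and the
  condition becomes one on \<open>w\<close>. The other direction cancels \<open>A\<close>, for which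
  \<open>det A\<close> must be nonzero.\<close>

lemma sat_mult_iff:
  assumes G: "comm_group G" "\<And>x. x \<in> carrier G \<Longrightarrow> x [^]\<^bsub>G\<^esub> g = \<one>\<^bsub>G\<^esub>"
    and G': "comm_group G'" "\<And>x. x \<in> carrier G' \<Longrightarrow> x [^]\<^bsub>G'\<^esub> g = \<one>\<^bsub>G'\<^esub>"
    and F: "F \<in> hom (Zn n) G" and \<pi>: "\<pi> \<in> hom G G'"
    and A: "A \<in> carrier_mat n n" and M: "M \<in> carrier_mat n n"
    and kerA: "ker G' n (\<lambda>v. \<pi> (F v)) = lat n A (b * g)"
  shows "ker G n F = lat n (A * M) (b * g) \<longleftrightarrow> ker G n (\<lambda>v. F (A *\<^sub>v v)) = lat n M (b * g)"
proof -
  interpret G: comm_group G by (rule G(1))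
  interpret G': comm_group G' by (rule G'(1))
  interpret F: Zn_hom G n F using G(1) F by (rule Zn_homI)
  interpret \<pi>: group_hom G G' \<pi> using \<pi> G.is_group G'.is_group by (simp add: group_hom_def group_hom_axioms_def)
  have F': "(\<lambda>v. \<pi> (F v)) \<in> hom (Zn n) G'"
    using F \<pi> by (auto simp: hom_def)
  have FA: "(\<lambda>v. F (A *\<^sub>v v)) \<in> hom (Zn n) G"
    using A by (auto simp: hom_def mult_add_distrib_mat_vec[of _ n n])
  interpret FA: Zn_hom G n "\<lambda>v. F (A *\<^sub>v v)" using G(1) FA by (rule Zn_homI)
  interpret F': Zn_hom G' n "\<lambda>v. \<pi> (F v)" using G'(1) F' by (rule Zn_homI)
  have satA: "ker G' n (\<lambda>v. \<pi> (F v)) = sat n A (b * g)"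
    using ker_eq_lat_iff_sat[OF G' F' A] kerA by simp
  show ?thesis
  proof (cases "b * g = 1")
    \<comment> \<open>Modulo 1 even 0 counts as coprime, so the argument for
      \<open>det A \<noteq> 0\<close> breaks down; but then all kernels and lattices are the whole
      of \<open>Z^n\<close>.\<close>
    case True
    have "b = 1" "g = 1" using True bg by (auto simp: pos_zmult_eq_1_iff)
    have all: "lat n B (b * g) = carrier_vec n" if B: "B \<in> carrier_mat n n" for B
    proof
      have "v \<in> lat n B 1" if "v \<in> carrier_vec n" for v
        unfolding lat_def mem_Collect_eq using that B
        by (intro exI[of _ "0\<^sub>v n"] exI[of _ v]) auto
      then show "carrier_vec n \<subseteq> lat n B (b * g)" using True by auto
    qed (use B in \<open>auto simp: lat_def\<close>)
    have "F v = \<one>\<^bsub>G\<^esub>" if "v \<in> carrier_vec n" for v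
      using G(2)[of "F v"] that \<open>g = 1\<close> by simp
    then have "ker G n F = carrier_vec n" "ker G n (\<lambda>v. F (A *\<^sub>v v)) = carrier_vec n"
      using A by (auto simp: ker_def)
    then show ?thesis using all[of M] all[of "A * M"] A M by simp
  next
    case False
    have nz: "s \<noteq> 0" if "coprime s (b * g)" for s
    proof
      assume "s = 0"
      then have "is_unit (b * g)" using that by (simp only: coprime_0_left_iff)
      moreover have "b * g > 0" using bg by simp
      ultimately show False using False by (metis zdvd1_eq abs_of_pos)
    qed
    have "g \<cdot>\<^sub>v v \<in> lat n A (b * g)" if "v \<in> carrier_vec n" for v
      using that G'(2)[of "\<pi> (F v)"] F'.smult[OF that, of g] unfolding kerA[symmetric]
      by (simp add: ker_def del: F.smult)
    then obtain d W where d: "d mod b = 1 mod b" and W: "W \<in> carrier_mat n n" "A * W = (g * d) \<cdot>\<^sub>m 1\<^sub>m n"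
      using nakayama[OF A, of g b] by blast
    \<comment> \<open>\<open>A * W\<close> is then a nonzero multiple of the identity, which makes
      \<open>A\<close> nonsingular.\<close>
    have "d \<noteq> 0" using coprime_of_mod_1[OF d] coprime_iff nz by blast
    then have "det (A * W) \<noteq> 0" unfolding W(2) using bg by simp
    then have detA: "det A \<noteq> 0" using det_mult[OF A W(1)] by auto
    have inj: "x = 0\<^sub>v n" if x: "x \<in> carrier_vec n" "A *\<^sub>v x = 0\<^sub>v n" for x
    proof -
      have "det A \<cdot>\<^sub>v x = (adj_mat A * A) *\<^sub>v x"
        using adj_mat[OF A] x by (simp add: mult_scalar_mat_vec)
      also have "\<dots> = adj_mat A *\<^sub>v (A *\<^sub>v x)"
        using adj_mat(1)[OF A] A x by (intro assoc_mult_mat_vec) auto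
      also have "\<dots> = 0\<^sub>v n"
        unfolding x(2) using adj_mat(1)[OF A] by (intro eq_vecI) auto
      finally have e: "det A \<cdot>\<^sub>v x = 0\<^sub>v n" .
      show ?thesis
      proof (rule eq_vecI)
        fix i assume "i < dim_vec (0\<^sub>v n :: int vec)"
        then have i: "i < n" by simp
        then have "(det A \<cdot>\<^sub>v x) $ i = 0" using e by simp
        then show "x $ i = 0\<^sub>v n $ i" using detA i x(1) by auto
      qed (use x in auto)
    qed
    have inj': "x = y" if "x \<in> carrier_vec n" "y \<in> carrier_vec n" "A *\<^sub>v x = A *\<^sub>v y" for x y
    proof -
      have "A *\<^sub>v (x - y) = 0\<^sub>v n"
        using that A by (simp add: mult_minus_distrib_mat_vec[of _ n n])
      then have e: "x - y = 0\<^sub>v n" using inj[of "x - y"] that by simp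
      show ?thesis
      proof (rule eq_vecI)
        fix i assume i: "i < dim_vec y"
        then have "(x - y) $ i = 0" using e that by simp
        then show "x $ i = y $ i" using i by simp
      qed (use that in auto)
    qed
    have AM: "A * M \<in> carrier_mat n n" using A M by simp
    have "ker G n F = sat n (A * M) (b * g) \<longleftrightarrow> ker G n (\<lambda>v. F (A *\<^sub>v v)) = sat n M (b * g)"
    proof
      assume eq: "ker G n F = sat n (A * M) (b * g)"
      show "ker G n (\<lambda>v. F (A *\<^sub>v v)) = sat n M (b * g)"
      proof (intro equalityI subsetI)
        fix v assume "v \<in> ker G n (\<lambda>v. F (A *\<^sub>v v))"
        then have v: "v \<in> carrier_vec n" "A *\<^sub>v v \<in> ker G n F" using A by (auto simp: ker_def)
        then obtain s y where s: "coprime s (b * g)" and y: "y \<in> carrier_vec n" "s \<cdot>\<^sub>v (A *\<^sub>v v) = (A * M) *\<^sub>v y"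
          unfolding eq by (auto simp: sat_def mat_image_iff)
        have "A *\<^sub>v (s \<cdot>\<^sub>v v) = A *\<^sub>v (M *\<^sub>v y)"
          using y v A M by (simp add: mult_mat_smult_vec[of _ n n] assoc_mult_mat_vec[of _ n n _ n])
        then have "s \<cdot>\<^sub>v v = M *\<^sub>v y" using inj' v y M by auto
        then show "v \<in> sat n M (b * g)"
          using s v y by (auto simp: sat_def mat_image_iff)
      next
        fix v assume "v \<in> sat n M (b * g)"
        then obtain s y where v: "v \<in> carrier_vec n" and s: "coprime s (b * g)" and y: "y \<in> carrier_vec n" "s \<cdot>\<^sub>v v = M *\<^sub>v y"
          by (auto simp: sat_def mat_image_iff)
        have Av: "A *\<^sub>v v \<in> carrier_vec n" using A v by auto
        have "s \<cdot>\<^sub>v (A *\<^sub>v v) = (A * M) *\<^sub>v y"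
          using y v A M by (simp add: mult_mat_smult_vec[of _ n n, symmetric] assoc_mult_mat_vec[of _ n n _ n])
        then have "A *\<^sub>v v \<in> ker G n F"
          unfolding eq using s y Av by (auto simp: sat_def mat_image_iff)
        then show "v \<in> ker G n (\<lambda>v. F (A *\<^sub>v v))" using v by (simp add: ker_def)
      qed
    next
      assume eq: "ker G n (\<lambda>v. F (A *\<^sub>v v)) = sat n M (b * g)"
      show "ker G n F = sat n (A * M) (b * g)"
      proof (intro equalityI subsetI)
        fix v assume v: "v \<in> ker G n F"
        then have "v \<in> ker G' n (\<lambda>v. \<pi> (F v))" by (simp add: ker_def)
        then obtain s w where v': "v \<in> carrier_vec n" and s: "coprime s (b * g)" and w: "w \<in> carrier_vec n" "s \<cdot>\<^sub>v v = A *\<^sub>v w"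
          unfolding satA by (auto simp: sat_def mat_image_iff)
        have "F (A *\<^sub>v w) = \<one>\<^bsub>G\<^esub>"
          using v v' unfolding w(2)[symmetric] by (simp add: ker_def)
        then have "w \<in> sat n M (b * g)" unfolding eq[symmetric] using w by (simp add: ker_def)
        then obtain s' y where s': "coprime s' (b * g)" and y: "y \<in> carrier_vec n" "s' \<cdot>\<^sub>v w = M *\<^sub>v y"
          by (auto simp: sat_def mat_image_iff)
        have "(s' * s) \<cdot>\<^sub>v v = s' \<cdot>\<^sub>v (A *\<^sub>v w)" by (simp add: smult_smult_assoc w(2)[symmetric])
        also have "\<dots> = A *\<^sub>v (M *\<^sub>v y)"
          using A w y by (simp add: mult_mat_smult_vec[of _ n n, symmetric])
        also have "\<dots> = (A * M) *\<^sub>v y"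
          using A M y by (simp add: assoc_mult_mat_vec[of _ n n _ n])
        finally show "v \<in> sat n (A * M) (b * g)"
          using s s' y v' by (auto simp: sat_def mat_image_iff intro!: exI[of _ "s' * s"])
      next
        fix v assume "v \<in> sat n (A * M) (b * g)"
        then obtain s y where v: "v \<in> carrier_vec n" and s: "coprime s (b * g)" and y: "y \<in> carrier_vec n" "s \<cdot>\<^sub>v v = (A * M) *\<^sub>v y"
          by (auto simp: sat_def mat_image_iff)
        have My: "M *\<^sub>v y \<in> carrier_vec n" using M y by auto
        have "M *\<^sub>v y \<in> sat n M (b * g)"
          unfolding sat_def mat_image_iff using y My by (auto intro!: exI[of _ 1] bexI[of _ y])
        then have "F (A *\<^sub>v (M *\<^sub>v y)) = \<one>\<^bsub>G\<^esub>" unfolding eq[symmetric] by (simp add: ker_def)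
        then have "F (s \<cdot>\<^sub>v v) = \<one>\<^bsub>G\<^esub>" using y A M by (simp add: assoc_mult_mat_vec[of _ n n _ n])
        then have "F v [^]\<^bsub>G\<^esub> s = \<one>\<^bsub>G\<^esub>" using v by simp
        then show "v \<in> ker G n F"
          using v G(2) s G.pow_eq_one_coprime[of "F v" s g] by (simp add: ker_def)
      qed
    qed
    then show ?thesis
      using ker_eq_lat_iff_sat[OF G F AM] ker_eq_lat_iff_sat[OF G FA M] by simp
  qed
qed

end

section \<open>Lifts of homomorphisms\<close>

text \<open>Extensionality identifies a homomorphism with its values on \<open>Z^n\<close>, so that
  cardinalities of sets of homomorphisms are meaningful.\<close>

definition Hom :: "nat \<Rightarrow> ('a, 'm) monoid_scheme \<Rightarrow> (int vec \<Rightarrow> 'a) set" where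
  "Hom n G = hom (Zn n) G \<inter> extensional (carrier_vec n)"

text \<open>Induction over the truncations of \<open>v\<close> to its first \<open>j\<close>
  coordinates.\<close>

lemma (in Zn_hom) determined:
  assumes F': "Zn_hom G n F'" and eq: "\<And>i. i < n \<Longrightarrow> F (unit_vec n i) = F' (unit_vec n i)"
    and v: "v \<in> carrier_vec n"
  shows "F v = F' v"
proof -
  interpret F': Zn_hom G n F' by (rule F')
  have "F (vec n (\<lambda>i. if i < j then v $ i else 0)) = F' (vec n (\<lambda>i. if i < j then v $ i else 0))" if "j \<le> n" for j
    using that
  proof (induction j)
    case 0
    have "vec n (\<lambda>i. if i < 0 then v $ i else 0) = 0\<^sub>v n" by (intro eq_vecI) auto
    then show ?case by (metis zero F'.zero)
  next
    case (Suc j)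
    have e: "vec n (\<lambda>i. if i < Suc j then v $ i else 0) =
        vec n (\<lambda>i. if i < j then v $ i else 0) + v $ j \<cdot>\<^sub>v unit_vec n j"
      using Suc.prems by (intro eq_vecI) (auto simp: less_Suc_eq)
    show ?case unfolding e using Suc eq[of j] by simp
  qed
  from this[of n] have "F (vec n (\<lambda>i. if i < n then v $ i else 0)) = F' (vec n (\<lambda>i. if i < n then v $ i else 0))"
    by simp
  moreover have "vec n (\<lambda>i. if i < n then v $ i else 0) = v" using v by (intro eq_vecI) auto
  ultimately show ?thesis by simp
qed

lemma (in comm_group) hom_of_basis:
  assumes g: "\<And>i. i < n \<Longrightarrow> g i \<in> carrier G"
  shows "\<exists>F. F \<in> Hom n G \<and> (\<forall>i<n. F (unit_vec n i) = g i)"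
proof -
  define F where "F = restrict (\<lambda>v. finprod G (\<lambda>i. g i [^] (v $ i :: int)) {..<n}) (carrier_vec n)"
  have "F \<in> hom (Zn n) G"
  proof (rule homI)
    fix v w assume v: "v \<in> carrier (Zn n)" and w: "w \<in> carrier (Zn n)"
    have "finprod G (\<lambda>i. g i [^] ((v + w) $ i)) {..<n} = finprod G (\<lambda>i. g i [^] (v $ i) \<otimes> g i [^] (w $ i)) {..<n}"
      using g v w by (intro finprod_cong) (auto simp: int_pow_mult)
    also have "\<dots> = finprod G (\<lambda>i. g i [^] (v $ i)) {..<n} \<otimes> finprod G (\<lambda>i. g i [^] (w $ i)) {..<n}"
      using g by (intro finprod_multf) auto
    finally show "F (v \<otimes>\<^bsub>Zn n\<^esub> w) = F v \<otimes> F w"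
      using v w by (simp add: F_def)
  qed (use g in \<open>auto simp: F_def\<close>)
  moreover have "F (unit_vec n i) = g i" if i: "i < n" for i
  proof -
    have gj: "g j [^] (unit_vec n i $ j :: int) = (if i = j then g j else \<one>)" if "j < n" for j
      using g[OF that] that i by (cases "i = j") auto
    have "F (unit_vec n i) = finprod G (\<lambda>j. if i = j then g j else \<one>) {..<n}"
      unfolding F_def using g by (simp add: gj cong: finprod_cong)
    also have "\<dots> = g i"
      using g i by (intro finprod_singleton) auto
    finally show ?thesis .
  qed
  ultimately show ?thesis
    by (intro exI[of _ F]) (auto simp: Hom_def F_def)
qed

definition Lifts :: "nat \<Rightarrow> ('a, 'm) monoid_scheme \<Rightarrow> ('a \<Rightarrow> 'b) \<Rightarrow> (int vec \<Rightarrow> 'b) \<Rightarrow> (int vec \<Rightarrow> 'a) set" where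
  "Lifts n G \<pi> F' = {F \<in> Hom n G. \<forall>v\<in>carrier_vec n. \<pi> (F v) = F' v}"

lemma (in group_hom) card_fiber:
  assumes "x \<in> carrier G"
  shows "card {y \<in> carrier G. h y = h x} = card (kernel G H h)"
proof (rule bij_betw_same_card[symmetric])
  show "bij_betw (\<lambda>z. x \<otimes> z) (kernel G H h) {y \<in> carrier G. h y = h x}"
    using assms
    by (intro bij_betw_byWitness[where f' = "\<lambda>y. inv x \<otimes> y"])
      (auto simp: kernel_def G.m_assoc[symmetric])
qed

text \<open>The images of the unit vectors can be chosen freely in fibres of \<open>\<pi>\<close>,
  each of which has the size of the kernel.\<close>

lemma card_Lifts:
  assumes G: "comm_group G" "finite (carrier G)" and \<pi>: "group_hom G G' \<pi>" "\<pi> ` carrier G = carrier G'"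
    and G': "comm_group G'" and F': "F' \<in> hom (Zn n) G'"
  shows "card (Lifts n G \<pi> F') = card (kernel G G' \<pi>) ^ n"
    and "finite (Lifts n G \<pi> F')"
proof -
  interpret G: comm_group G by (rule G(1))
  interpret \<pi>: group_hom G G' \<pi> by (rule \<pi>(1))
  interpret F': Zn_hom G' n F' using G' F' by (rule Zn_homI)
  let ?S = "PiE {..<n} (\<lambda>i. {y \<in> carrier G. \<pi> y = F' (unit_vec n i)})"
  have "bij_betw (\<lambda>F. restrict (\<lambda>i. F (unit_vec n i)) {..<n}) (Lifts n G \<pi> F') ?S"
    unfolding bij_betw_def
  proof (intro conjI equalityI subsetI)
    show "inj_on (\<lambda>F. restrict (\<lambda>i. F (unit_vec n i)) {..<n}) (Lifts n G \<pi> F')"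
    proof (rule inj_onI)
      fix F1 F2 assume F: "F1 \<in> Lifts n G \<pi> F'" "F2 \<in> Lifts n G \<pi> F'"
        and eq: "restrict (\<lambda>i. F1 (unit_vec n i)) {..<n} = restrict (\<lambda>i. F2 (unit_vec n i)) {..<n}"
      have h: "Zn_hom G n F1" "Zn_hom G n F2"
        using F G(1) by (auto simp: Lifts_def Hom_def intro: Zn_homI)
      have eqi: "F1 (unit_vec n i) = F2 (unit_vec n i)" if "i < n" for i
        using fun_cong[OF eq, of i] that by simp
      have "F1 v = F2 v" if "v \<in> carrier_vec n" for v
        by (rule Zn_hom.determined[OF h eqi that])
      then show "F1 = F2"
        using F by (intro extensionalityI[of _ "carrier_vec n"]) (auto simp: Lifts_def Hom_def)
    qed
    fix g assume "g \<in> (\<lambda>F. restrict (\<lambda>i. F (unit_vec n i)) {..<n}) ` Lifts n G \<pi> F'"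
    then obtain F where F: "g = restrict (\<lambda>i. F (unit_vec n i)) {..<n}" "F \<in> Lifts n G \<pi> F'"
      by blast
    have "F (unit_vec n i) \<in> carrier G" "\<pi> (F (unit_vec n i)) = F' (unit_vec n i)" for i
      using F(2) by (auto simp: Lifts_def Hom_def hom_def)
    then show "g \<in> ?S" unfolding F(1) by simp
  next
    fix g assume g: "g \<in> ?S"
    then have "g i \<in> carrier G" if "i < n" for i using that by auto
    then obtain F where F: "F \<in> Hom n G" "\<forall>i<n. F (unit_vec n i) = g i"
      using G.hom_of_basis[of n g] by blast
    interpret F: Zn_hom G n F using F(1) G(1) by (auto simp: Hom_def intro: Zn_homI)
    have h: "Zn_hom G' n (\<lambda>v. \<pi> (F v))"
      by (intro Zn_homI[OF G'] homI) auto
    have eqi: "\<pi> (F (unit_vec n i)) = F' (unit_vec n i)" if "i < n" for i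
      using F(2) PiE_mem[OF g, of i] that by simp
    have "\<pi> (F v) = F' v" if "v \<in> carrier_vec n" for v
      by (rule Zn_hom.determined[OF h F'.Zn_hom_axioms eqi that])
    then have "F \<in> Lifts n G \<pi> F'" using F(1) by (simp add: Lifts_def)
    moreover have "g = restrict (\<lambda>i. F (unit_vec n i)) {..<n}"
      using g F(2) by (auto simp: fun_eq_iff PiE_def extensional_def)
    ultimately show "g \<in> (\<lambda>F. restrict (\<lambda>i. F (unit_vec n i)) {..<n}) ` Lifts n G \<pi> F'"
      by blast
  qed
  then have "card (Lifts n G \<pi> F') = card ?S" and "finite (Lifts n G \<pi> F') = finite ?S"
    by (rule bij_betw_same_card, rule bij_betw_finite)
  moreover have "card {y \<in> carrier G. \<pi> y = F' (unit_vec n i)} = card (kernel G G' \<pi>)" for i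
  proof -
    have "F' (unit_vec n i) \<in> \<pi> ` carrier G" unfolding \<pi>(2) by simp
    then obtain x where "x \<in> carrier G" "F' (unit_vec n i) = \<pi> x" by blast
    then show ?thesis by (simp add: \<pi>.card_fiber)
  qed
  moreover have "finite ?S" using G(2) by (intro finite_PiE) auto
  ultimately show "card (Lifts n G \<pi> F') = card (kernel G G' \<pi>) ^ n" "finite (Lifts n G \<pi> F')"
    by (simp_all add: card_PiE)
qed

text \<open>Given a left inverse \<open>D\<close> of \<open>C\<close> modulo the exponent, a lift splits uniquely into a lift that
  vanishes on the image of \<open>C\<close> and a homomorphism factoring through \<open>D\<close>.\<close>

lemma card_Lifts_vanishing:
  assumes G: "comm_group G" "finite (carrier G)" and \<pi>: "group_hom G G' \<pi>" "\<pi> ` carrier G = carrier G'"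
    and G': "comm_group G'" and F': "F' \<in> hom (Zn n) G'"
    and exp: "\<And>x. x \<in> carrier G \<Longrightarrow> x [^]\<^bsub>G\<^esub> (a::int) = \<one>\<^bsub>G\<^esub>"
    and C: "C \<in> carrier_mat n k" "inj_mod a n k (\<lambda>r c. C $$ (r, c))" "a > 0"
    and van: "\<And>y. y \<in> carrier_vec k \<Longrightarrow> F' (C *\<^sub>v y) = \<one>\<^bsub>G'\<^esub>" and kn: "k \<le> n"
  shows "card {F \<in> Lifts n G \<pi> F'. \<forall>y\<in>carrier_vec k. F (C *\<^sub>v y) = \<one>\<^bsub>G\<^esub>} = card (kernel G G' \<pi>) ^ (n - k)"
proof -
  interpret G: comm_group G by (rule G(1))
  interpret \<pi>: group_hom G G' \<pi> by (rule \<pi>(1))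
  interpret F': Zn_hom G' n F' using G' F' by (rule Zn_homI)
  let ?X = "{F \<in> Lifts n G \<pi> F'. \<forall>y\<in>carrier_vec k. F (C *\<^sub>v y) = \<one>\<^bsub>G\<^esub>}"
  let ?L = "Lifts k G \<pi> (\<lambda>_. \<one>\<^bsub>G'\<^esub>)"
  obtain D' where D': "\<forall>i<k. \<forall>c<k. a dvd (\<Sum>r<n. D' i r * C $$ (r, c)) - (if i = c then 1 else 0)"
    using left_inverse_mod[OF C(2,3)] by blast
  define D where "D = mat k n (\<lambda>(i, r). D' i r)"
  define E where "E = mat k k (\<lambda>(i, c). ((\<Sum>r<n. D' i r * C $$ (r, c)) - (if i = c then 1 else 0)) div a)"
  have D: "D \<in> carrier_mat k n" and E: "E \<in> carrier_mat k k" by (auto simp: D_def E_def)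
  have DC: "D * C = 1\<^sub>m k + a \<cdot>\<^sub>m E"
  proof (rule eq_matI)
    fix i c assume "i < dim_row (1\<^sub>m k + a \<cdot>\<^sub>m E)" "c < dim_col (1\<^sub>m k + a \<cdot>\<^sub>m E)"
    then have ic: "i < k" "c < k" using E by auto
    have "(D * C) $$ (i, c) = (\<Sum>r<n. D' i r * C $$ (r, c))"
      using ic D C(1) by (auto simp: scalar_prod_def D_def atLeast0LessThan intro!: sum.cong)
    moreover have "a * (((\<Sum>r<n. D' i r * C $$ (r, c)) - (if i = c then 1 else 0)) div a) =
        (\<Sum>r<n. D' i r * C $$ (r, c)) - (if i = c then 1 else 0)"
      using D' ic by (intro dvd_mult_div_cancel) blast
    ultimately show "(D * C) $$ (i, c) = (1\<^sub>m k + a \<cdot>\<^sub>m E) $$ (i, c)"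
      using ic by (simp add: E_def)
  qed (use D C(1) E in auto)
  have DCy: "D *\<^sub>v (C *\<^sub>v y) = y + a \<cdot>\<^sub>v (E *\<^sub>v y)" if y: "y \<in> carrier_vec k" for y
  proof -
    have "D *\<^sub>v (C *\<^sub>v y) = (D * C) *\<^sub>v y"
      using D C(1) y by (rule assoc_mult_mat_vec[symmetric])
    also have "\<dots> = 1\<^sub>m k *\<^sub>v y + (a \<cdot>\<^sub>m E) *\<^sub>v y"
      unfolding DC using E y by (intro add_mult_distrib_mat_vec[of _ k k]) auto
    also have "(a \<cdot>\<^sub>m E) *\<^sub>v y = a \<cdot>\<^sub>v (E *\<^sub>v y)"
      using E y by (intro eq_vecI) auto
    finally show ?thesis using y by simp
  qed
  have KD: "K (D *\<^sub>v (C *\<^sub>v y)) = K y" if K: "Zn_hom G k K" and y: "y \<in> carrier_vec k" for K y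
  proof -
    interpret K: Zn_hom G k K by (rule K)
    have "E *\<^sub>v y \<in> carrier_vec k" using E y by auto
    then show ?thesis using y by (simp add: DCy exp)
  qed
  \<comment> \<open>Additively, \<open>\<Phi>\<close> sends \<open>(F, K)\<close> to
    \<open>F + K D\<close>, and \<open>\<Psi>\<close> sends \<open>F\<close> to
    \<open>(F - F C D, F C)\<close>. They are mutually inverse because \<open>D * C\<close> is the
    identity modulo the exponent \<open>a\<close>.\<close>
  define \<Phi> where "\<Phi> u = restrict (\<lambda>v. fst u v \<otimes>\<^bsub>G\<^esub> snd u (D *\<^sub>v v)) (carrier_vec n)" for u
  define \<kappa> where "\<kappa> F = restrict (\<lambda>y. F (C *\<^sub>v y)) (carrier_vec k)" for F :: "int vec \<Rightarrow> 'a"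
  define \<Psi> where "\<Psi> F = (restrict (\<lambda>v. F v \<otimes>\<^bsub>G\<^esub> inv\<^bsub>G\<^esub> (F (C *\<^sub>v (D *\<^sub>v v)))) (carrier_vec n), \<kappa> F)" for F
  have Cv: "C *\<^sub>v y \<in> carrier_vec n" if "y \<in> carrier_vec k" for y using that C(1) by auto
  have Dv: "D *\<^sub>v v \<in> carrier_vec k" if "v \<in> carrier_vec n" for v using that D by auto
  have CDadd: "C *\<^sub>v (D *\<^sub>v v + D *\<^sub>v w) = C *\<^sub>v (D *\<^sub>v v) + C *\<^sub>v (D *\<^sub>v w)"
      "D *\<^sub>v (v + w) = D *\<^sub>v v + D *\<^sub>v w" if "v \<in> carrier_vec n" "w \<in> carrier_vec n" for v w
    using that C(1) D Dv by (simp_all add: mult_add_distrib_mat_vec[of _ k n] mult_add_distrib_mat_vec[of _ n k])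
  have LH: "Zn_hom G n F" if "F \<in> Lifts n G \<pi> F''" for F F'' and n
    using that G(1) by (auto simp: Lifts_def Hom_def intro: Zn_homI)
  have "bij_betw \<Phi> (?X \<times> ?L) (Lifts n G \<pi> F')"
  proof (rule bij_betw_byWitness[where f' = \<Psi>])
    show "\<forall>u\<in>?X \<times> ?L. \<Psi> (\<Phi> u) = u"
    proof
      fix u assume "u \<in> ?X \<times> ?L"
      then obtain F K where u: "u = (F, K)" "F \<in> Lifts n G \<pi> F'" "K \<in> ?L"
        and FC: "\<And>y. y \<in> carrier_vec k \<Longrightarrow> F (C *\<^sub>v y) = \<one>\<^bsub>G\<^esub>" by blast
      interpret F: Zn_hom G n F using u(2) by (rule LH)
      interpret K: Zn_hom G k K using u(3) by (rule LH)
      have \<Phi>C: "\<Phi> u (C *\<^sub>v y) = K y" if "y \<in> carrier_vec k" for y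
        using that Cv u(1) FC KD[OF K.Zn_hom_axioms] by (simp add: \<Phi>_def)
      have "\<kappa> (\<Phi> u) = K"
        using u(3) \<Phi>C by (intro extensionalityI[of _ "carrier_vec k"]) (auto simp: \<kappa>_def Lifts_def Hom_def)
      moreover have "fst (\<Psi> (\<Phi> u)) = F"
      proof (rule extensionalityI[of _ "carrier_vec n"])
        fix v :: "int vec" assume v: "v \<in> carrier_vec n"
        have "fst (\<Psi> (\<Phi> u)) v = (F v \<otimes>\<^bsub>G\<^esub> K (D *\<^sub>v v)) \<otimes>\<^bsub>G\<^esub> inv\<^bsub>G\<^esub> (K (D *\<^sub>v v))"
          using v \<Phi>C[OF Dv[OF v]] u(1) by (simp add: \<Psi>_def) (simp add: \<Phi>_def)
        then show "fst (\<Psi> (\<Phi> u)) v = F v"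
          using v Dv[OF v] by (simp add: G.m_assoc)
      qed (use u in \<open>auto simp: \<Psi>_def Lifts_def Hom_def\<close>)
      moreover have "snd (\<Psi> (\<Phi> u)) = \<kappa> (\<Phi> u)" by (simp add: \<Psi>_def)
      ultimately show "\<Psi> (\<Phi> u) = u" by (metis prod_eqI fst_conv snd_conv u(1))
    qed
    show "\<forall>F\<in>Lifts n G \<pi> F'. \<Phi> (\<Psi> F) = F"
    proof
      fix F assume F: "F \<in> Lifts n G \<pi> F'"
      interpret F: Zn_hom G n F using F by (rule LH)
      show "\<Phi> (\<Psi> F) = F"
        using F Dv Cv by (intro extensionalityI[of _ "carrier_vec n"])
          (auto simp: \<Phi>_def \<Psi>_def \<kappa>_def Lifts_def Hom_def G.m_assoc)
    qed
    show "\<Phi> ` (?X \<times> ?L) \<subseteq> Lifts n G \<pi> F'"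
    proof (rule image_subsetI)
      fix u assume "u \<in> ?X \<times> ?L"
      then obtain F K where u: "u = (F, K)" "F \<in> Lifts n G \<pi> F'" "K \<in> ?L" by blast
      interpret F: Zn_hom G n F using u(2) by (rule LH)
      interpret K: Zn_hom G k K using u(3) by (rule LH)
      have "\<Phi> u \<in> hom (Zn n) G"
        using u(1) Dv by (intro homI) (auto simp: \<Phi>_def CDadd G.m_ac)
      moreover have "\<pi> (\<Phi> u v) = F' v" if "v \<in> carrier_vec n" for v
        using that u Dv by (simp add: \<Phi>_def Lifts_def)
      ultimately show "\<Phi> u \<in> Lifts n G \<pi> F'"
        by (auto simp: Lifts_def Hom_def \<Phi>_def)
    qed
    show "\<Psi> ` Lifts n G \<pi> F' \<subseteq> ?X \<times> ?L"
    proof (rule image_subsetI)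
      fix F assume FL: "F \<in> Lifts n G \<pi> F'"
      interpret F: Zn_hom G n F using FL by (rule LH)
      have \<pi>F: "\<pi> (F v) = F' v" if "v \<in> carrier_vec n" for v using that FL by (simp add: Lifts_def)
      have Fh: "Zn_hom G k (\<lambda>y. F (C *\<^sub>v y))"
        using C(1) Cv by (intro Zn_homI[OF G(1)] homI) (auto simp: mult_add_distrib_mat_vec[of _ n k])
      have "fst (\<Psi> F) \<in> hom (Zn n) G"
        using Dv Cv by (intro homI) (auto simp: \<Psi>_def CDadd G.inv_mult G.m_ac)
      moreover have "\<pi> (fst (\<Psi> F) v) = F' v" if "v \<in> carrier_vec n" for v
        using that Dv Cv \<pi>F van by (simp add: \<Psi>_def)
      moreover have "fst (\<Psi> F) (C *\<^sub>v y) = \<one>\<^bsub>G\<^esub>" if "y \<in> carrier_vec k" for y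
        using that Dv Cv KD[OF Fh] by (simp add: \<Psi>_def)
      ultimately have "fst (\<Psi> F) \<in> ?X" by (auto simp: Lifts_def Hom_def \<Psi>_def)
      moreover have "\<kappa> F \<in> ?L"
        using Fh van \<pi>F Cv by (auto simp: Lifts_def Hom_def \<kappa>_def hom_def Zn_hom_def Zn_hom_axioms_def)
      ultimately show "\<Psi> F \<in> ?X \<times> ?L" by (simp add: \<Psi>_def)
    qed
  qed
  then have "card (?X \<times> ?L) = card (Lifts n G \<pi> F')" by (rule bij_betw_same_card)
  moreover have "(\<lambda>_. \<one>\<^bsub>G'\<^esub>) \<in> hom (Zn k) G'" by (auto simp: hom_def)
  \<comment> \<open>Homomorphisms from \<open>Z^k\<close> into the kernel of \<open>\<pi>\<close>
    are the lifts of the trivial map, so \<open>card_Lifts\<close> counts both \<open>?L\<close> and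
    the set of all lifts.\<close>
  ultimately have "card ?X * card (kernel G G' \<pi>) ^ k = card (kernel G G' \<pi>) ^ n"
    by (simp add: card_cartesian_product card_Lifts[OF G \<pi> G'] F')
  also have "\<dots> = card (kernel G G' \<pi>) ^ (n - k) * card (kernel G G' \<pi>) ^ k"
    using kn by (simp add: power_add[symmetric])
  finally have "card ?X * card (kernel G G' \<pi>) ^ k = card (kernel G G' \<pi>) ^ (n - k) * card (kernel G G' \<pi>) ^ k" .
  moreover have "card (kernel G G' \<pi>) > 0"
    using G(2) subgroup.one_closed[OF \<pi>.subgroup_kernel] by (auto simp: card_gt_0_iff kernel_def)
  ultimately show ?thesis by simp
qed

section \<open>Random cosets of a lattice\<close>

lemma (in group_hom) card_image_kernel:
  assumes "finite (carrier G)"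
  shows "card (carrier G) = card (h ` carrier G) * card (kernel G H h)"
proof -
  have "card (carrier G) = (\<Sum>y\<in>h ` carrier G. card {x \<in> carrier G. h x = y})"
    using assms by (subst card_UN_disjoint[symmetric]) (auto intro!: arg_cong[of _ _ card])
  also have "\<dots> = (\<Sum>y\<in>h ` carrier G. card (kernel G H h))"
    using card_fiber by (intro sum.cong) auto
  finally show ?thesis by simp
qed

lemma (in comm_group) subgroup_comm_group:
  assumes "subgroup H G" shows "comm_group (G\<lparr>carrier := H\<rparr>)"
  using subgroup.subgroup_is_group[OF assms is_group]
  by (intro group.group_comm_groupI) (use subgroup.mem_carrier[OF assms] m_comm in auto)

section \<open>Quotients by the columns of an injective matrix\<close>

locale column_setup =
  fixes n k :: nat and a :: int and A :: "int mat"
  assumes A: "A \<in> carrier_mat n k" and kn: "k \<le> n" and a_pos: "a > 0"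
    and inj: "\<And>p. prime p \<Longrightarrow> int p dvd a \<Longrightarrow> inj_mod (int p) n k (\<lambda>r c. A $$ (r, c))"
begin

lemma inj_dvd:
  assumes "b > 0" "b dvd a" shows "inj_mod b n k (\<lambda>r c. A $$ (r, c))"
proof -
  have "inj_mod (int (nat b)) n k (\<lambda>r c. A $$ (r, c))"
  proof (rule inj_mod_primes)
    fix p assume "prime p" "p dvd nat b"
    then have "int p dvd a" using assms by (metis dvd_trans int_dvd_int_iff nat_0_le less_imp_le)
    with \<open>prime p\<close> show "inj_mod (int p) n k (\<lambda>r c. A $$ (r, c))" by (rule inj)
  qed (use assms in simp)
  then show ?thesis using assms by simp
qed

lemma mult_vec_index: "y \<in> carrier_vec k \<Longrightarrow> r < n \<Longrightarrow> (A *\<^sub>v y) $ r = (\<Sum>c<k. A $$ (r, c) * y $ c)"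
  using A by (auto simp: scalar_prod_def atLeast0LessThan intro!: sum.cong)

lemma lat_iff:
  assumes "w \<in> carrier_vec n"
  shows "w \<in> lat n A b \<longleftrightarrow> (\<exists>y. \<forall>r<n. b dvd (\<Sum>c<k. A $$ (r, c) * y c) - w $ r)"
proof
  assume "w \<in> lat n A b"
  then obtain y z where yz: "w = A *\<^sub>v y + b \<cdot>\<^sub>v z" "y \<in> carrier_vec k" "z \<in> carrier_vec n"
    using A by (auto simp: lat_def)
  have "(\<Sum>c<k. A $$ (r, c) * y $ c) - w $ r = b * (- z $ r)" if "r < n" for r
    using that yz A mult_vec_index[OF yz(2) that] by simp
  then show "\<exists>y. \<forall>r<n. b dvd (\<Sum>c<k. A $$ (r, c) * y c) - w $ r"
    by (intro exI[of _ "\<lambda>c. y $ c"] allI impI) (rule dvdI)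
next
  assume "\<exists>y. \<forall>r<n. b dvd (\<Sum>c<k. A $$ (r, c) * y c) - w $ r"
  then obtain y where y: "\<And>r. r < n \<Longrightarrow> b dvd (\<Sum>c<k. A $$ (r, c) * y c) - w $ r" by blast
  define z where "z = vec n (\<lambda>r. (w $ r - (\<Sum>c<k. A $$ (r, c) * y c)) div b)"
  have vy: "vec k y \<in> carrier_vec k" by simp
  have "w = A *\<^sub>v vec k y + b \<cdot>\<^sub>v z"
  proof (rule eq_vecI)
    fix r assume "r < dim_vec (A *\<^sub>v vec k y + b \<cdot>\<^sub>v z)"
    then have r: "r < n" by (simp add: z_def)
    have "b dvd w $ r - (\<Sum>c<k. A $$ (r, c) * y c)"
      using y[OF r] by (subst dvd_diff_commute)
    then have "b * z $ r = w $ r - (\<Sum>c<k. A $$ (r, c) * y c)"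
      using r by (simp add: z_def)
    then show "w $ r = (A *\<^sub>v vec k y + b \<cdot>\<^sub>v z) $ r"
      using r A mult_vec_index[OF vy r] by (simp add: z_def)
  qed (use assms in \<open>simp add: z_def\<close>)
  then show "w \<in> lat n A b"
    unfolding lat_def mem_Collect_eq using A
    by (intro exI[of _ "vec k y"] exI[of _ z]) (simp add: z_def)
qed

lemma lat_iff_fun:
  assumes "w \<in> carrier_vec n" and f: "\<And>r. r < n \<Longrightarrow> w $ r = f r"
  shows "w \<in> lat n A b \<longleftrightarrow> (\<exists>y. \<forall>r<n. b dvd (\<Sum>c<k. A $$ (r, c) * y c) - f r)"
proof -
  have "(\<forall>r<n. b dvd h r - w $ r) \<longleftrightarrow> (\<forall>r<n. b dvd h r - f r)" for h
    by (intro all_cong1 imp_cong refl) (simp only: f)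
  then show ?thesis unfolding lat_iff[OF assms(1)] by (simp only:)
qed

end

lemma lat_subgroup:
  assumes M: "M \<in> carrier_mat n k" shows "subgroup (lat n M b) (Zn n)"
proof -
  interpret group "Zn n" by (rule group_Zn)
  show ?thesis
  proof (rule subgroupI)
    show "lat n M b \<subseteq> carrier (Zn n)" using M by (auto simp: lat_def)
    have "M *\<^sub>v 0\<^sub>v k + b \<cdot>\<^sub>v 0\<^sub>v n \<in> lat n M b"
      unfolding lat_def mem_Collect_eq using M by (intro exI[of _ "0\<^sub>v k"] exI[of _ "0\<^sub>v n"]) simp
    then show "lat n M b \<noteq> {}" by blast
  next
    fix v assume "v \<in> lat n M b"
    then obtain y z where yz: "v = M *\<^sub>v y + b \<cdot>\<^sub>v z" "y \<in> carrier_vec k" "z \<in> carrier_vec n"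
      using M by (auto simp: lat_def)
    have My: "M *\<^sub>v y \<in> carrier_vec n" using M yz by auto
    have neg: "- (u + b \<cdot>\<^sub>v z) = (-1) \<cdot>\<^sub>v u + b \<cdot>\<^sub>v ((-1) \<cdot>\<^sub>v z)" if "u \<in> carrier_vec n" for u
      using that yz(3) by (intro eq_vecI) auto
    have "- v = M *\<^sub>v ((-1) \<cdot>\<^sub>v y) + b \<cdot>\<^sub>v ((-1) \<cdot>\<^sub>v z)"
      unfolding mult_mat_smult_vec[OF M yz(2)] yz(1) by (rule neg[OF My])
    then have "- v \<in> lat n M b"
      unfolding lat_def mem_Collect_eq using yz M
      by (intro exI[of _ "(-1) \<cdot>\<^sub>v y"] exI[of _ "(-1) \<cdot>\<^sub>v z"]) auto
    then show "inv\<^bsub>Zn n\<^esub> v \<in> lat n M b" using yz My by (simp add: Zn_inv)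
  next
    fix v v' assume "v \<in> lat n M b" "v' \<in> lat n M b"
    then obtain y z y' z' where yz: "v = M *\<^sub>v y + b \<cdot>\<^sub>v z" "y \<in> carrier_vec k" "z \<in> carrier_vec n"
      and yz': "v' = M *\<^sub>v y' + b \<cdot>\<^sub>v z'" "y' \<in> carrier_vec k" "z' \<in> carrier_vec n"
      using M by (auto simp: lat_def)
    have My: "M *\<^sub>v y \<in> carrier_vec n" "M *\<^sub>v y' \<in> carrier_vec n" using M yz yz' by auto
    have "v + v' = M *\<^sub>v (y + y') + b \<cdot>\<^sub>v (z + z')"
      unfolding mult_add_distrib_mat_vec[OF M yz(2) yz'(2)] using yz(1,3) yz'(1,3) My
      by (intro eq_vecI) (auto simp: ring_distribs)
    then have "v + v' \<in> lat n M b"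
      unfolding lat_def mem_Collect_eq using yz yz' M
      by (intro exI[of _ "y + y'"] exI[of _ "z + z'"]) auto
    then show "v \<otimes>\<^bsub>Zn n\<^esub> v' \<in> lat n M b" by simp
  qed
qed

lemma mem_coset_iff:
  assumes "subgroup S (Zn n)" "w \<in> carrier_vec n" "v \<in> carrier_vec n"
  shows "v \<in> S #>\<^bsub>Zn n\<^esub> w \<longleftrightarrow> v - w \<in> S"
proof -
  have "v - w = v + - w" using assms by auto
  then show ?thesis
    using subgroup.rcos_module[OF assms(1) group_Zn, of w v] assms by (simp add: Zn_inv)
qed

lemma coset_eq_iff:
  assumes "subgroup S (Zn n)" "w \<in> carrier_vec n" "v \<in> carrier_vec n"
  shows "S #>\<^bsub>Zn n\<^esub> v = S #>\<^bsub>Zn n\<^esub> w \<longleftrightarrow> v - w \<in> S"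
  using group.repr_independence[OF group_Zn, of v n S w] group.rcos_self[OF group_Zn, of v n S]
    mem_coset_iff[OF assms] assms by auto

lemma card_image_eq_cosets:
  assumes S: "subgroup S (Zn n)"
    and h: "\<And>v w. v \<in> carrier_vec n \<Longrightarrow> w \<in> carrier_vec n \<Longrightarrow> h v = h w \<longleftrightarrow> v - w \<in> S"
  shows "card (h ` carrier_vec n) = card (carrier (Zn n Mod S))"
proof -
  let ?\<phi> = "\<lambda>v. S #>\<^bsub>Zn n\<^esub> v"
  have eq: "?\<phi> v = ?\<phi> w \<longleftrightarrow> h v = h w" if "v \<in> carrier_vec n" "w \<in> carrier_vec n" for v w
    using that h coset_eq_iff[OF S] by simp
  have "bij_betw (\<lambda>t. h (inv_into (carrier_vec n) ?\<phi> t)) (?\<phi> ` carrier_vec n) (h ` carrier_vec n)"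
  proof (rule bij_betwI')
    fix t u assume "t \<in> ?\<phi> ` carrier_vec n" "u \<in> ?\<phi> ` carrier_vec n"
    then show "h (inv_into (carrier_vec n) ?\<phi> t) = h (inv_into (carrier_vec n) ?\<phi> u) \<longleftrightarrow> t = u"
      using eq[of "inv_into (carrier_vec n) ?\<phi> t" "inv_into (carrier_vec n) ?\<phi> u"]
      by (metis f_inv_into_f inv_into_into)
  next
    fix t assume "t \<in> ?\<phi> ` carrier_vec n"
    then show "h (inv_into (carrier_vec n) ?\<phi> t) \<in> h ` carrier_vec n"
      by (intro imageI inv_into_into)
  next
    fix y assume "y \<in> h ` carrier_vec n"
    then obtain v where v: "v \<in> carrier_vec n" "y = h v" by blast
    have "?\<phi> (inv_into (carrier_vec n) ?\<phi> (?\<phi> v)) = ?\<phi> v"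
      by (rule f_inv_into_f[of _ ?\<phi>]) (use v in blast)
    then have "h (inv_into (carrier_vec n) ?\<phi> (?\<phi> v)) = y"
      using eq v inv_into_into[of "?\<phi> v" ?\<phi> "carrier_vec n"] by blast
    then show "\<exists>t\<in>?\<phi> ` carrier_vec n. y = h (inv_into (carrier_vec n) ?\<phi> t)"
      using v by blast
  qed
  moreover have "carrier (Zn n Mod S) = ?\<phi> ` carrier_vec n" by (auto simp: carrier_FactGroup)
  ultimately show ?thesis by (simp add: bij_betw_same_card)
qed

context column_setup
begin

text \<open>Membership in the coset is expanded in characters from the annihilator. Summing over all
  residue vectors \<open>v\<close> removes every character but the trivial one, leaving
  \<open>b ^ n\<close> against the normalisation \<open>b ^ (n - k)\<close>.\<close>

lemma card_residues_in_coset: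
  assumes b: "b > 0" "b dvd a" and w: "w \<in> carrier_vec n"
  shows "card {v \<in> residues_fun n b. vec n v - w \<in> lat n A b} = nat b ^ k"
proof -
  let ?ann = "annihilator b n k (\<lambda>r c. A $$ (r, c))"
  let ?V = "{v \<in> residues_fun n b. vec n v - w \<in> lat n A b}"
  have eq: "of_bool (vec n v - w \<in> lat n A b) * (of_int b :: complex) ^ (n - k) =
      (\<Sum>x\<in>?ann. ec b (\<Sum>r<n. x r * w $ r) * ec b (\<Sum>r<n. v r * (- x r)))" for v
  proof -
    have c: "vec n v - w \<in> carrier_vec n" using w by auto
    have "(vec n v - w) $ r = v r - w $ r" if "r < n" for r using that w by auto
    then have "vec n v - w \<in> lat n A b \<longleftrightarrow> (\<exists>y. \<forall>r<n. b dvd (\<Sum>c<k. A $$ (r, c) * y c) - (v r - w $ r))"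
      by (rule lat_iff_fun[OF c])
    then have "of_bool (vec n v - w \<in> lat n A b) * (of_int b :: complex) ^ (n - k) =
        (\<Sum>x\<in>?ann. ec b (- (\<Sum>r<n. x r * (v r - w $ r))))"
      using indicator_solvable[OF inj_dvd[OF b] b(1) kn, of "\<lambda>r. v r - w $ r"] by (simp only:)
    also have "\<dots> = (\<Sum>x\<in>?ann. ec b (\<Sum>r<n. x r * w $ r) * ec b (\<Sum>r<n. v r * (- x r)))"
    proof (intro sum.cong refl)
      fix x
      have "(- (\<Sum>r<n. x r * (v r - w $ r))) = (\<Sum>r<n. x r * w $ r) + (\<Sum>r<n. v r * (- x r))"
        by (simp add: right_diff_distrib sum_subtractf sum_negf mult.commute)
      then show "ec b (- (\<Sum>r<n. x r * (v r - w $ r))) = ec b (\<Sum>r<n. x r * w $ r) * ec b (\<Sum>r<n. v r * (- x r))"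
        by (simp only: ec_add)
    qed
    finally show ?thesis .
  qed
  have zero_mem: "restrict (\<lambda>_. 0) {..<n} \<in> ?ann"
    using b by (auto simp: annihilator_def)
  have only_zero: "x = restrict (\<lambda>_. 0) {..<n}" if "x \<in> ?ann" "\<forall>r<n. b dvd - x r" for x
  proof (rule PiE_ext[of _ "{..<n}" "\<lambda>_. {0..<b}"])
    show x: "x \<in> residues_fun n b" using that(1) by (simp add: annihilator_def)
    fix r assume r: "r \<in> {..<n}"
    have "b dvd x r" using that(2) r by simp
    moreover have "x r \<in> {0..<b}" using PiE_mem[OF x r] .
    ultimately show "x r = restrict (\<lambda>_. 0) {..<n} r"
      using r by (auto dest: zdvd_imp_le)
  qed (use b in auto)
  have "of_nat (card ?V) * (of_int b :: complex) ^ (n - k) =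
      (\<Sum>v\<in>residues_fun n b. of_bool (vec n v - w \<in> lat n A b) * (of_int b :: complex) ^ (n - k))"
  proof -
    have "of_nat (card ?V) = (\<Sum>v\<in>?V. 1 :: complex)" by simp
    also have "\<dots> = (\<Sum>v\<in>residues_fun n b. if vec n v - w \<in> lat n A b then 1 else 0)"
      by (rule sum.inter_filter) simp
    finally show ?thesis unfolding of_bool_def sum_distrib_right[symmetric] by (rule arg_cong)
  qed
  also have "\<dots> = (\<Sum>x\<in>?ann. ec b (\<Sum>r<n. x r * w $ r) * (\<Sum>v\<in>residues_fun n b. ec b (\<Sum>r<n. v r * (- x r))))"
    unfolding eq by (subst sum.swap) (simp add: sum_distrib_left)
  also have "\<dots> = (\<Sum>x\<in>?ann. if x = restrict (\<lambda>_. 0) {..<n} then of_int b ^ n else 0)"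
  proof (intro sum.cong refl)
    fix x assume x: "x \<in> ?ann"
    show "ec b (\<Sum>r<n. x r * w $ r) * (\<Sum>v\<in>residues_fun n b. ec b (\<Sum>r<n. v r * (- x r))) =
        (if x = restrict (\<lambda>_. 0) {..<n} then of_int b ^ n else 0)"
    proof (cases "x = restrict (\<lambda>_. 0) {..<n}")
      case True
      then show ?thesis unfolding sum_ec_vector[OF b(1)] by simp
    next
      case False
      then show ?thesis unfolding sum_ec_vector[OF b(1)] using only_zero[OF x] by auto
    qed
  qed
  also have "\<dots> = of_int b ^ n" using zero_mem by (simp add: sum.delta)
  also have "\<dots> = of_int b ^ k * of_int b ^ (n - k)" using kn by (simp add: power_add[symmetric])
  finally have "of_nat (card ?V) = (of_int b :: complex) ^ k" using b by simp
  also have "\<dots> = of_nat (nat b ^ k)" using b by simp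
  finally show ?thesis by (simp only: of_nat_eq_iff)
qed

text \<open>The \<open>b ^ n\<close> residue vectors are distributed over the cosets,
  \<open>b ^ k\<close> in each.\<close>

lemma card_Mod_lat:
  assumes b: "b > 0" "b dvd a"
  shows "card (carrier (Zn n Mod lat n A b)) = nat b ^ (n - k)"
    and "finite (carrier (Zn n Mod lat n A b))"
proof -
  let ?S = "lat n A b" and ?Y = "carrier (Zn n Mod lat n A b)"
  let ?\<phi> = "\<lambda>v. ?S #>\<^bsub>Zn n\<^esub> vec n v"
  have S: "subgroup ?S (Zn n)" using A by (rule lat_subgroup)
  have Y: "?Y = (\<lambda>w. ?S #>\<^bsub>Zn n\<^esub> w) ` carrier_vec n"
    by (auto simp: carrier_FactGroup)
  have surj: "?\<phi> ` residues_fun n b = ?Y"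
  proof (intro equalityI subsetI)
    fix t assume "t \<in> ?Y"
    then obtain w where w: "w \<in> carrier_vec n" "t = ?S #>\<^bsub>Zn n\<^esub> w" by (auto simp: Y)
    have "card {v \<in> residues_fun n b. vec n v - w \<in> ?S} \<noteq> 0"
      using card_residues_in_coset[OF b w(1)] b by simp
    then obtain v where "v \<in> residues_fun n b" "vec n v - w \<in> ?S"
      by (metis (no_types, lifting) card.empty equals0I mem_Collect_eq)
    then show "t \<in> ?\<phi> ` residues_fun n b"
      using w coset_eq_iff[OF S w(1), of "vec n v"] by auto
  qed (auto simp: Y)
  then show fin: "finite ?Y" by (metis finite_imageI finite_residues_fun)
  have "nat b ^ n = card (residues_fun n b)" using b by (simp add: card_residues_fun)
  also have "\<dots> = (\<Sum>t\<in>?Y. card {v \<in> residues_fun n b. ?\<phi> v = t})"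
    using fin surj by (subst card_UN_disjoint[symmetric]) (auto intro!: arg_cong[of _ _ card])
  also have "\<dots> = (\<Sum>t\<in>?Y. nat b ^ k)"
  proof (intro sum.cong refl)
    fix t assume "t \<in> ?Y"
    then obtain w where w: "w \<in> carrier_vec n" "t = ?S #>\<^bsub>Zn n\<^esub> w" by (auto simp: Y)
    then show "card {v \<in> residues_fun n b. ?\<phi> v = t} = nat b ^ k"
      using card_residues_in_coset[OF b w(1)] coset_eq_iff[OF S w(1)] by simp
  qed
  finally have "nat b ^ (n - k) * nat b ^ k = card ?Y * nat b ^ k"
    using kn by (simp add: power_add[symmetric])
  then show "card ?Y = nat b ^ (n - k)" using b by simp
qed

text \<open>The annihilator of \<open>A\<close> is the dual group of the quotient. A nontrivial character has a
  multiple of prime order, whose coordinates form a vector annihilating \<open>A\<close> modulo that prime.\<close>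

lemma annihilator_reduce:
  assumes x: "x \<in> annihilator a n k (\<lambda>r c. A $$ (r, c))" "x \<noteq> restrict (\<lambda>_. 0) {..<n}"
    and dense: "\<And>p x. prime p \<Longrightarrow> int p dvd a \<Longrightarrow> weight (int p) n x > 0 \<Longrightarrow>
      \<forall>c<k. int p dvd (\<Sum>r<n. x r * A $$ (r, c)) \<Longrightarrow> s \<le> weight (int p) n x"
  shows "\<exists>p. prime p \<and> int p dvd a \<and> s \<le> card {r\<in>{..<n}. \<forall>d. a dvd x r * d \<longrightarrow> int p dvd d}"
proof -
  \<comment> \<open>\<open>a = g * l\<close>, where \<open>l\<close> is the order of the character
    given by \<open>x\<close>. Its multiple of prime order \<open>p\<close> is given by the
    coordinates \<open>x' = x / g\<close> modulo \<open>p\<close>.\<close>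
  define g where "g = Gcd (insert a (x ` {..<n}))"
  have ga: "g dvd a" unfolding g_def by (rule Gcd_dvd) simp
  have gx: "g dvd x r" if "r < n" for r unfolding g_def by (rule Gcd_dvd) (use that in simp)
  have g0: "g > 0" using a_pos ga by (metis Gcd_int_greater_eq_0 dvd_0_left_iff g_def less_le)
  obtain l where l: "a = g * l" using ga by blast
  have l0: "l > 0" using a_pos g0 l by (metis zero_less_mult_pos)
  define x' where "x' r = x r div g" for r
  have x': "x r = g * x' r" if "r < n" for r using gx[OF that] by (simp add: x'_def)
  have xr: "x \<in> residues_fun n a" using x(1) by (simp add: annihilator_def)
  have "l \<noteq> 1"
  proof
    assume "l = 1"
    then have "a dvd x r" if "r < n" for r using gx[OF that] l by simp
    moreover have "x r \<in> {0..<a}" if "r < n" for r using PiE_mem[OF xr, of r] that by simp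
    ultimately have "x r = 0" if "r < n" for r
      using that by (metis atLeastLessThan_iff mod_pos_pos_trivial dvd_imp_mod_0)
    then have "x = restrict (\<lambda>_. 0) {..<n}"
      using xr by (intro PiE_ext[of x "{..<n}" "\<lambda>_. {0..<a}"]) (use a_pos in auto)
    with x(2) show False by blast
  qed
  then have "nat l \<noteq> 1" using l0 by linarith
  then obtain p where p: "prime p" "p dvd nat l" using prime_factor_nat by blast
  have pl: "int p dvd l" using p(2) l0 by (metis int_dvd_int_iff nat_0_le less_imp_le)
  then have pa: "int p dvd a" using l by simp
  \<comment> \<open>Otherwise \<open>g * p\<close> would divide \<open>a\<close> and all coordinates
    of \<open>x\<close>, although \<open>g\<close> is their greatest common divisor.\<close>
  have "weight (int p) n x' > 0"
  proof (rule ccontr)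
    assume "\<not> weight (int p) n x' > 0"
    then have px: "int p dvd x' r" if "r < n" for r
      using that by (auto simp: weight_def card_eq_0_iff)
    have "g * int p dvd g"
      unfolding g_def[symmetric] using pl l px x'
      by (subst (2) g_def, intro Gcd_greatest) (auto intro: mult_dvd_mono)
    then have "int p dvd 1" using g0 by (metis dvd_mult_cancel_left less_irrefl mult.right_neutral)
    then show False using p(1) by (metis int_dvd_int_iff not_prime_unit of_nat_1)
  qed
  moreover have "\<forall>c<k. int p dvd (\<Sum>r<n. x' r * A $$ (r, c))"
  proof (intro allI impI)
    fix c assume c: "c < k"
    have "a dvd (\<Sum>r<n. x r * A $$ (r, c))" using x(1) c by (simp add: annihilator_def)
    also have "(\<Sum>r<n. x r * A $$ (r, c)) = g * (\<Sum>r<n. x' r * A $$ (r, c))"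
      by (simp add: sum_distrib_left x' mult.assoc)
    finally have "l dvd (\<Sum>r<n. x' r * A $$ (r, c))" using l g0 by simp
    then show "int p dvd (\<Sum>r<n. x' r * A $$ (r, c))" using pl by (rule dvd_trans[rotated])
  qed
  ultimately have "s \<le> weight (int p) n x'" by (rule dense[OF p(1) pa])
  also have "\<dots> \<le> card {r\<in>{..<n}. \<forall>d. a dvd x r * d \<longrightarrow> int p dvd d}"
    unfolding weight_def
  proof (rule card_mono)
    show "{r\<in>{..<n}. \<not> int p dvd x' r} \<subseteq> {r\<in>{..<n}. \<forall>d. a dvd x r * d \<longrightarrow> int p dvd d}"
    proof (intro subsetI CollectI conjI allI impI)
      fix r d assume r: "r \<in> {r\<in>{..<n}. \<not> int p dvd x' r}" and d: "a dvd x r * d"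
      have "l dvd x' r * d" using d r l g0 x'[of r] by (simp add: mult.assoc)
      then have "int p dvd x' r * d" using pl by (rule dvd_trans[rotated])
      then show "int p dvd d" using r p(1) by (simp add: prime_dvd_mult_iff)
    qed auto
  qed simp
  finally show ?thesis using p pa by blast
qed

text \<open>Fourier inversion on the quotient of order \<open>a ^ (n - k)\<close>. Each nontrivial
  character has at least \<open>s\<close> coordinates at which the decay applies, by
  \<open>annihilator_reduce\<close>, and the number of characters cancels against the normalising
  factor, so the error for a single coset carries no factor growing with \<open>a\<close>.\<close>

lemma near_uniform:
  assumes q: "\<And>p r. prime p \<Longrightarrow> int p dvd a \<Longrightarrow> r < n \<Longrightarrow> balanced_pmf \<alpha> (int p) (q r)"
    and \<alpha>: "0 \<le> \<alpha>" "\<alpha> \<le> 1/2"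
    and dense: "\<And>p x. prime p \<Longrightarrow> int p dvd a \<Longrightarrow> weight (int p) n x > 0 \<Longrightarrow>
      \<forall>c<k. int p dvd (\<Sum>r<n. x r * A $$ (r, c)) \<Longrightarrow> s \<le> weight (int p) n x"
    and w: "w \<in> carrier_vec n"
  shows "\<bar>measure_pmf.prob (Pi_pmf {..<n} 0 q) {b. vec n b \<in> lat n A a #>\<^bsub>Zn n\<^esub> w} - 1 / of_int a ^ (n - k)\<bar>
    \<le> decay \<alpha> a ^ s"
proof -
  let ?Q = "Pi_pmf {..<n} 0 q"
  let ?ann = "annihilator a n k (\<lambda>r c. A $$ (r, c))"
  let ?E = "\<lambda>x. measure_pmf.expectation ?Q (\<lambda>b. ec a (\<Sum>r<n. (- x r) * b r))"
  define P where "P = measure_pmf.prob ?Q {b. vec n b \<in> lat n A a #>\<^bsub>Zn n\<^esub> w}"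
  have S: "subgroup (lat n A a) (Zn n)" using A by (rule lat_subgroup)
  have zero_mem: "restrict (\<lambda>_. 0) {..<n} \<in> ?ann"
    using a_pos by (auto simp: annihilator_def)
  have a0: "(of_int a :: complex) ^ (n - k) \<noteq> 0" using a_pos by simp
  have ind: "of_bool (vec n b \<in> lat n A a #>\<^bsub>Zn n\<^esub> w) * (of_int a :: complex) ^ (n - k) =
      (\<Sum>x\<in>?ann. ec a (\<Sum>r<n. x r * w $ r) * ec a (\<Sum>r<n. (- x r) * b r))" for b
  proof -
    have c: "vec n b - w \<in> carrier_vec n" using w by auto
    have "(vec n b - w) $ r = b r - w $ r" if "r < n" for r using that w by auto
    then have "vec n b - w \<in> lat n A a \<longleftrightarrow> (\<exists>y. \<forall>r<n. a dvd (\<Sum>c<k. A $$ (r, c) * y c) - (b r - w $ r))"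
      by (rule lat_iff_fun[OF c])
    moreover have "vec n b \<in> lat n A a #>\<^bsub>Zn n\<^esub> w \<longleftrightarrow> vec n b - w \<in> lat n A a"
      using S w by (intro mem_coset_iff) auto
    ultimately have "of_bool (vec n b \<in> lat n A a #>\<^bsub>Zn n\<^esub> w) * (of_int a :: complex) ^ (n - k) =
        (\<Sum>x\<in>?ann. ec a (- (\<Sum>r<n. x r * (b r - w $ r))))"
      using indicator_solvable[OF inj_dvd[OF a_pos dvd_refl] a_pos kn, of "\<lambda>r. b r - w $ r"] by (simp only:)
    also have "\<dots> = (\<Sum>x\<in>?ann. ec a (\<Sum>r<n. x r * w $ r) * ec a (\<Sum>r<n. (- x r) * b r))"
    proof (intro sum.cong refl)
      fix x
      have "(- (\<Sum>r<n. x r * (b r - w $ r))) = (\<Sum>r<n. x r * w $ r) + (\<Sum>r<n. (- x r) * b r)"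
        by (simp add: right_diff_distrib sum_subtractf sum_negf)
      then show "ec a (- (\<Sum>r<n. x r * (b r - w $ r))) = ec a (\<Sum>r<n. x r * w $ r) * ec a (\<Sum>r<n. (- x r) * b r)"
        by (simp only: ec_add)
    qed
    finally show ?thesis .
  qed
  have "complex_of_real P * of_int a ^ (n - k) =
      measure_pmf.expectation ?Q (\<lambda>b. of_real (indicator {b. vec n b \<in> lat n A a #>\<^bsub>Zn n\<^esub> w} b) * of_int a ^ (n - k))"
    unfolding P_def by (subst integral_mult_left_zero, subst integral_complex_of_real) simp
  also have "\<dots> = measure_pmf.expectation ?Q (\<lambda>b. \<Sum>x\<in>?ann. ec a (\<Sum>r<n. x r * w $ r) * ec a (\<Sum>r<n. (- x r) * b r))"
    by (intro Bochner_Integration.integral_cong refl, subst ind[symmetric]) (simp add: indicator_def)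
  also have "\<dots> = (\<Sum>x\<in>?ann. ec a (\<Sum>r<n. x r * w $ r) * ?E x)"
    by (subst Bochner_Integration.integral_sum)
      (auto intro!: measure_pmf.integrable_const_bound[where B=1] simp: norm_mult)
  also have "\<dots> = 1 + (\<Sum>x\<in>?ann - {restrict (\<lambda>_. 0) {..<n}}. ec a (\<Sum>r<n. x r * w $ r) * ?E x)"
    using zero_mem by (subst sum.remove[OF _ zero_mem]) simp_all
  finally have eq: "complex_of_real (P * of_int a ^ (n - k) - 1) =
      (\<Sum>x\<in>?ann - {restrict (\<lambda>_. 0) {..<n}}. ec a (\<Sum>r<n. x r * w $ r) * ?E x)"
    by simp
  have le: "norm (?E x) \<le> decay \<alpha> a ^ s" if x: "x \<in> ?ann - {restrict (\<lambda>_. 0) {..<n}}" for x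
  proof -
    obtain p where p: "prime p" "int p dvd a" "s \<le> card {r\<in>{..<n}. \<forall>d. a dvd x r * d \<longrightarrow> int p dvd d}"
      using annihilator_reduce[of x s] x dense by blast
    have a2: "a \<ge> 2" using p(1,2) a_pos prime_ge_2_nat[OF p(1)] by (auto dest: zdvd_imp_le)
    have "norm (?E x) \<le> decay \<alpha> a ^ card {r\<in>{..<n}. \<forall>d. a dvd (- x r) * d \<longrightarrow> int p dvd d}"
      using p q \<alpha> a2 by (intro norm_character_vector_le) auto
    also have "\<dots> \<le> decay \<alpha> a ^ s"
      using p(3) \<alpha> decay_nonneg[of \<alpha> a] a2 by (intro power_decreasing) (auto simp: decay_def)
    finally show ?thesis .
  qed
  have "\<bar>P * of_int a ^ (n - k) - 1\<bar> = norm (complex_of_real (P * of_int a ^ (n - k) - 1))"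
    by (simp only: norm_of_real)
  also have "\<dots> \<le> (\<Sum>x\<in>?ann - {restrict (\<lambda>_. 0) {..<n}}. decay \<alpha> a ^ s)"
    unfolding eq by (rule order.trans[OF norm_sum], rule sum_mono) (use le in \<open>auto simp: norm_mult\<close>)
  also have "\<dots> \<le> of_int a ^ (n - k) * decay \<alpha> a ^ s"
  proof -
    have "card (?ann - {restrict (\<lambda>_. 0) {..<n}}) \<le> card ?ann"
      by (rule card_mono) auto
    also have "card ?ann = nat a ^ (n - k)"
      using inj_dvd[OF a_pos dvd_refl] a_pos kn by (rule card_annihilator)
    finally have "real (card (?ann - {restrict (\<lambda>_. 0) {..<n}})) \<le> real (nat a ^ (n - k))"
      by (simp only: of_nat_le_iff)
    also have "\<dots> = of_int a ^ (n - k)" using a_pos by simp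
    finally have "real (card (?ann - {restrict (\<lambda>_. 0) {..<n}})) * decay \<alpha> a ^ s \<le> of_int a ^ (n - k) * decay \<alpha> a ^ s"
      using \<alpha> by (intro mult_right_mono) (auto simp: decay_nonneg)
    then show ?thesis by (simp only: sum_constant)
  qed
  finally have *: "\<bar>P * of_int a ^ (n - k) - 1\<bar> \<le> of_int a ^ (n - k) * decay \<alpha> a ^ s" .
  have apos: "(of_int a :: real) ^ (n - k) > 0" using a_pos by simp
  have "P - 1 / of_int a ^ (n - k) = (P * of_int a ^ (n - k) - 1) / of_int a ^ (n - k)"
    using less_imp_neq[OF apos] by (subst diff_divide_distrib, subst nonzero_mult_div_cancel_right) simp_all
  then have "\<bar>P - 1 / of_int a ^ (n - k)\<bar> = \<bar>P * of_int a ^ (n - k) - 1\<bar> / of_int a ^ (n - k)"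
    using apos by simp
  also have "\<dots> \<le> decay \<alpha> a ^ s"
    using * apos by (simp add: pos_divide_le_eq mult.commute)
  finally show ?thesis unfolding P_def .
qed

end

lemma mult_mat_unit_vec:
  fixes B :: "int mat"
  shows "B \<in> carrier_mat n l \<Longrightarrow> i < l \<Longrightarrow> B *\<^sub>v unit_vec l i = col B i"
  by (intro eq_vecI) auto

text \<open>Modulo \<open>T\<close>, multiplication by \<open>B\<close> agrees with the trivial
  homomorphism on the unit vectors.\<close>

lemma mat_mult_in_subgroup:
  assumes T: "subgroup T (Zn n)" and B: "B \<in> carrier_mat n l"
    and cols: "\<And>c. c < l \<Longrightarrow> col B c \<in> T" and y: "y \<in> carrier_vec l"
  shows "B *\<^sub>v y \<in> T"
proof -
  interpret Zn: comm_group "Zn n" by (rule comm_group_Zn)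
  interpret Q: comm_group "Zn n Mod T" using T by (rule Zn.abelian_FactGroup)
  have TN: "T \<lhd> Zn n" using T by (rule Zn.subgroup_imp_normal)
  have \<phi>: "(\<lambda>v. T #>\<^bsub>Zn n\<^esub> v) \<in> hom (Zn n) (Zn n Mod T)"
    using TN by (rule normal.r_coset_hom_Mod)
  then interpret \<phi>: Zn_hom "Zn n Mod T" n "\<lambda>v. T #>\<^bsub>Zn n\<^esub> v"
    by (rule Zn_homI[OF Q.comm_group_axioms])
  have Bv: "B *\<^sub>v v \<in> carrier_vec n" if "v \<in> carrier_vec l" for v using B that by auto
  have 1: "Zn_hom (Zn n Mod T) l (\<lambda>y. T #>\<^bsub>Zn n\<^esub> (B *\<^sub>v y))"
    using B Bv by (intro Zn_homI[OF Q.comm_group_axioms] homI) (auto simp: mult_add_distrib_mat_vec[of _ n l])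
  have 2: "Zn_hom (Zn n Mod T) l (\<lambda>y. \<one>\<^bsub>Zn n Mod T\<^esub>)"
    by (intro Zn_homI[OF Q.comm_group_axioms] homI) (rule Q.one_closed, rule Q.l_one[OF Q.one_closed, symmetric])
  have T0: "T #>\<^bsub>Zn n\<^esub> v = \<one>\<^bsub>Zn n Mod T\<^esub> \<longleftrightarrow> v \<in> T" if "v \<in> carrier_vec n" for v
    using coset_eq_iff[OF T zero_carrier_vec that] that T
    by (simp add: subgroup.subset Zn.coset_mult_one[OF subgroup.subset[OF T], simplified])
  have "T #>\<^bsub>Zn n\<^esub> (B *\<^sub>v unit_vec l i) = \<one>\<^bsub>Zn n Mod T\<^esub>" if "i < l" for i
  proof -
    have "B *\<^sub>v unit_vec l i = col B i" using B that by (simp add: mult_mat_unit_vec)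
    then show ?thesis using T0[of "col B i"] cols[OF that] B by auto
  qed
  then have "T #>\<^bsub>Zn n\<^esub> (B *\<^sub>v y) = \<one>\<^bsub>Zn n Mod T\<^esub>"
    by (rule Zn_hom.determined[OF 1 2 _ y])
  then show ?thesis using T0[OF Bv[OF y]] by simp
qed

lemma card_tuples_reindex:
  assumes h: "bij_betw h J I"
  shows "card {t \<in> I \<rightarrow>\<^sub>E L. Q (t ` I)} = card {t \<in> J \<rightarrow>\<^sub>E L. Q (t ` J)}"
proof (rule bij_betw_same_card)
  define h' where "h' = inv_into J h"
  have h': "bij_betw h' I J" unfolding h'_def using h by (rule bij_betw_inv_into)
  have hh': "h (h' i) = i" if "i \<in> I" for i
    using h that by (simp add: h'_def bij_betw_inv_into_right)
  have h'h: "h' (h j) = j" if "j \<in> J" for j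
    using h that by (simp add: h'_def bij_betw_inv_into_left)
  have hI: "h j \<in> I" if "j \<in> J" for j using h that by (auto simp: bij_betw_def)
  have h'J: "h' i \<in> J" if "i \<in> I" for i using h' that by (auto simp: bij_betw_def)
  have im: "restrict (t \<circ> h) J ` J = t ` I" for t
    using h by (auto simp: bij_betw_def image_image[symmetric])
  have im': "restrict (t \<circ> h') I ` I = t ` J" for t
    using h' by (auto simp: bij_betw_def image_image[symmetric])
  show "bij_betw (\<lambda>t. restrict (t \<circ> h) J) {t \<in> I \<rightarrow>\<^sub>E L. Q (t ` I)} {t \<in> J \<rightarrow>\<^sub>E L. Q (t ` J)}"
  proof (rule bij_betw_byWitness[where f' = "\<lambda>t. restrict (t \<circ> h') I"])
    show "\<forall>t\<in>{t \<in> I \<rightarrow>\<^sub>E L. Q (t ` I)}. restrict (restrict (t \<circ> h) J \<circ> h') I = t"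
    proof
      fix t assume "t \<in> {t \<in> I \<rightarrow>\<^sub>E L. Q (t ` I)}"
      then have "t \<in> extensional I" by (simp add: PiE_def)
      then show "restrict (restrict (t \<circ> h) J \<circ> h') I = t"
        by (intro extensionalityI[of _ I]) (auto simp: hh' h'J)
    qed
    show "\<forall>t\<in>{t \<in> J \<rightarrow>\<^sub>E L. Q (t ` J)}. restrict (restrict (t \<circ> h') I \<circ> h) J = t"
    proof
      fix t assume "t \<in> {t \<in> J \<rightarrow>\<^sub>E L. Q (t ` J)}"
      then have "t \<in> extensional J" by (simp add: PiE_def)
      then show "restrict (restrict (t \<circ> h') I \<circ> h) J = t"
        by (intro extensionalityI[of _ J]) (auto simp: h'h hI)
    qed
    show "(\<lambda>t. restrict (t \<circ> h) J) ` {t \<in> I \<rightarrow>\<^sub>E L. Q (t ` I)} \<subseteq> {t \<in> J \<rightarrow>\<^sub>E L. Q (t ` J)}"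
      using hI by (auto simp only: im mem_Collect_eq) auto
    show "(\<lambda>t. restrict (t \<circ> h') I) ` {t \<in> J \<rightarrow>\<^sub>E L. Q (t ` J)} \<subseteq> {t \<in> I \<rightarrow>\<^sub>E L. Q (t ` I)}"
      using h'J by (auto simp only: im' mem_Collect_eq) auto
  qed
qed

section \<open>The finite group that the remaining columns must generate\<close>

locale column_hom = column_setup n k a A + G: comm_group G
  for n k a A and G :: "('g, 'h) monoid_scheme" (structure) +
  fixes b g :: int and H :: "int vec \<Rightarrow> 'g" and P :: "nat set"
  assumes finite_G: "finite (carrier G)" and exp: "\<And>x. x \<in> carrier G \<Longrightarrow> x [^] g = \<one>"
    and abg: "a = b * g" and bg0: "b > 0" "g > 0"
    and H: "H \<in> hom (Zn n) G" and HA: "\<And>y. y \<in> carrier_vec k \<Longrightarrow> H (A *\<^sub>v y) = \<one>"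
    and P: "finite P" "\<And>p. p \<in> P \<Longrightarrow> prime p \<and> int p dvd b"
    "\<And>p. prime p \<Longrightarrow> int p dvd a \<Longrightarrow> p \<in> P"
begin

sublocale H: Zn_hom G n H using G.comm_group_axioms H by (rule Zn_homI)

abbreviation "S \<equiv> lat n A a"
abbreviation "Y \<equiv> Zn n Mod S"
abbreviation "\<phi> v \<equiv> S #>\<^bsub>Zn n\<^esub> v"

lemma S: "subgroup S (Zn n)" using A by (rule lat_subgroup)

sublocale Zn: comm_group "Zn n" by (rule comm_group_Zn)
sublocale Y: comm_group Y using S by (rule Zn.abelian_FactGroup)

lemma phi_hom: "\<phi> \<in> hom (Zn n) Y"
  using Zn.subgroup_imp_normal[OF S] by (rule normal.r_coset_hom_Mod)

sublocale \<phi>: Zn_hom Y n \<phi> using Y.comm_group_axioms phi_hom by (rule Zn_homI)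

lemma carrier_Y: "carrier Y = \<phi> ` carrier_vec n"
  by (auto simp: carrier_FactGroup)

lemma phi_eq_iff: "v \<in> carrier_vec n \<Longrightarrow> w \<in> carrier_vec n \<Longrightarrow> \<phi> v = \<phi> w \<longleftrightarrow> v - w \<in> S"
  using coset_eq_iff[OF S] by simp

lemma phi_eq_one_iff: "v \<in> carrier_vec n \<Longrightarrow> \<phi> v = \<one>\<^bsub>Y\<^esub> \<longleftrightarrow> v \<in> S"
  using phi_eq_iff[of v "0\<^sub>v n"] \<phi>.zero by simp

lemma finite_Y: "finite (carrier Y)" and card_Y: "card (carrier Y) = nat a ^ (n - k)"
  using card_Mod_lat[OF a_pos dvd_refl] by auto

lemma smult_g: "v \<in> carrier_vec n \<Longrightarrow> g dvd c \<Longrightarrow> H (c \<cdot>\<^sub>v v) = \<one>"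
  by (auto elim!: dvdE simp: G.int_pow_pow[symmetric] exp)

lemma S_ker: "S \<subseteq> ker G n H"
proof
  fix v assume "v \<in> S"
  then obtain y z where yz: "v = A *\<^sub>v y + a \<cdot>\<^sub>v z" "y \<in> carrier_vec k" "z \<in> carrier_vec n"
    using A by (auto simp: lat_def)
  have "A *\<^sub>v y \<in> carrier_vec n" using A yz by auto
  moreover have "H (a \<cdot>\<^sub>v z) = \<one>" using yz(3) abg by (intro smult_g) auto
  ultimately show "v \<in> ker G n H"
    using yz HA H.add[of "A *\<^sub>v y" "a \<cdot>\<^sub>v z"] by (simp add: ker_def)
qed

text \<open>The kernel of the homomorphism from \<open>Y\<close> to \<open>G\<close> induced by
  \<open>H\<close>.\<close>

definition L where "L = \<phi> ` ker G n H"

lemma phi_in_L_iff: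
  assumes "v \<in> carrier_vec n" shows "\<phi> v \<in> L \<longleftrightarrow> v \<in> ker G n H"
proof
  assume "\<phi> v \<in> L"
  then obtain w where w: "w \<in> ker G n H" "\<phi> v = \<phi> w" by (auto simp: L_def)
  then have wc: "w \<in> carrier_vec n" by (simp add: ker_def)
  have "v - w \<in> S" using w phi_eq_iff[OF assms wc] by simp
  then have "H (v - w) = \<one>" using S_ker by (auto simp: ker_def)
  moreover have "v = (v - w) + w" using assms wc by (intro eq_vecI) auto
  ultimately have "H v = H w" using assms wc H.add[of "v - w" w] by simp
  then show "v \<in> ker G n H" using w assms by (simp add: ker_def)
qed (auto simp: L_def)

lemma L_props: "subgroup L Y" "card (carrier Y) = card (H ` carrier_vec n) * card L"
proof -
  have gh: "group_hom (Zn n) G H" by (rule H.group_hom)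
  have "S \<subseteq> kernel (Zn n) G H" using S_ker by (auto simp: kernel_def ker_def)
  then obtain h where h: "h \<in> hom Y G" "\<And>x. x \<in> carrier (Zn n) \<Longrightarrow> h (\<phi> x) = H x"
    using group_hom.FactGroup_universal_kernel[OF gh Zn.subgroup_imp_normal[OF S]] by blast
  interpret h: group_hom Y G h
    using h(1) Y.is_group G.is_group by (simp add: group_hom_def group_hom_axioms_def)
  have k: "kernel Y G h = L"
    unfolding kernel_def carrier_Y using h(2) by (auto simp: L_def ker_def)
  show "subgroup L Y" using h.subgroup_kernel unfolding k .
  have "h ` carrier Y = H ` carrier_vec n"
    unfolding carrier_Y using h(2) by (auto simp: image_image)
  then show "card (carrier Y) = card (H ` carrier_vec n) * card L"
    using h.card_image_kernel[OF finite_Y] k by simp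
qed

lemma L_sub: "L \<subseteq> carrier Y" using L_props(1) by (rule subgroup.subset)

lemma finite_L: "finite L" using L_sub finite_Y by (rule finite_subset)

text \<open>Modulo \<open>e\<close> the equation reads \<open>A y = 0\<close>, so injectivity makes
  \<open>y\<close> divisible by \<open>e\<close>, and the factor \<open>e\<close> cancels.\<close>

lemma divide_out:
  assumes e: "e > 0" "e dvd a" and eq: "e \<cdot>\<^sub>v u = A *\<^sub>v y + (e * d) \<cdot>\<^sub>v z"
    and c: "u \<in> carrier_vec n" "y \<in> carrier_vec k" "z \<in> carrier_vec n"
  shows "\<exists>y'\<in>carrier_vec k. u = A *\<^sub>v y' + d \<cdot>\<^sub>v z"
proof -
  have "e dvd (\<Sum>c<k. A $$ (r, c) * y $ c)" if r: "r < n" for r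
  proof -
    have "(A *\<^sub>v y) $ r = e * (u $ r - d * z $ r)"
      using arg_cong[OF eq, of "\<lambda>v. v $ r"] r c A by (simp add: algebra_simps)
    then show ?thesis using mult_vec_index[OF c(2) r] by (metis dvd_triv_left)
  qed
  then have ey: "e dvd y $ c" if "c < k" for c
    using inj_modD[OF inj_dvd[OF e], of "\<lambda>c. y $ c"] that by blast
  define y' where "y' = vec k (\<lambda>c. y $ c div e)"
  have y': "y' \<in> carrier_vec k" by (simp add: y'_def)
  have "y = e \<cdot>\<^sub>v y'" using c(2) ey by (intro eq_vecI) (auto simp: y'_def)
  then have Ay: "A *\<^sub>v y = e \<cdot>\<^sub>v (A *\<^sub>v y')" using A y' by (simp add: mult_mat_smult_vec)
  have "u = A *\<^sub>v y' + d \<cdot>\<^sub>v z"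
  proof (rule eq_vecI)
    fix r assume "r < dim_vec (A *\<^sub>v y' + d \<cdot>\<^sub>v z)"
    then have r: "r < n" using c by simp
    have "e * u $ r = (e \<cdot>\<^sub>v (A *\<^sub>v y') + (e * d) \<cdot>\<^sub>v z) $ r"
      using arg_cong[OF eq, of "\<lambda>v. v $ r"] r c unfolding Ay by simp
    also have "\<dots> = e * (A *\<^sub>v y' + d \<cdot>\<^sub>v z) $ r"
      using r c A by (simp add: ring_distribs)
    finally show "u $ r = (A *\<^sub>v y' + d \<cdot>\<^sub>v z) $ r" using e by simp
  qed (use c in simp)
  with y' show ?thesis by blast
qed

text \<open>The \<open>p\<close>-th power map on \<open>L\<close> has as kernel the
  \<open>p\<close>-torsion of all of \<open>Y\<close>, namely the classes of \<open>e Z^n\<close>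
  with \<open>e = a / p\<close>: these lie in \<open>L\<close> because \<open>g\<close> divides
  \<open>e\<close>, thanks to the factor \<open>b\<close> of \<open>a\<close>. The torsion is a copy
  of \<open>Z^n / (A Z^k + p Z^n)\<close>, of order \<open>p ^ (n - k)\<close>. Hence the rank of
  \<open>L\<close> at \<open>p\<close> depends neither on \<open>G\<close> nor on
  \<open>H\<close>.\<close>

lemma card_L_pows:
  assumes p: "p \<in> P"
  shows "card L = p ^ (n - k) * card (comm_group.pows (Y\<lparr>carrier := L\<rparr>) p)"
proof -
  interpret LL: comm_group "Y\<lparr>carrier := L\<rparr>" using L_props(1) by (rule Y.subgroup_comm_group)
  have pp: "prime p" "int p dvd b" using P(2)[OF p] by auto
  then have pa: "int p dvd a" using abg by simp
  define e where "e = b div int p * g"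
  have ea: "a = int p * e" using pp abg by (simp add: e_def)
  have e0: "e > 0" using ea a_pos pp(1) by (simp add: zero_less_mult_iff prime_gt_0_nat)
  have ge: "g dvd e" by (simp add: e_def)
  have p0: "int p > 0" using pp(1) by (simp add: prime_gt_0_nat)
  have pow: "x [^]\<^bsub>Y\<lparr>carrier := L\<rparr>\<^esub> p = x [^]\<^bsub>Y\<^esub> p" for x
    by (simp add: Y.nat_pow_consistent[symmetric])
  have hom: "group_hom (Y\<lparr>carrier := L\<rparr>) (Y\<lparr>carrier := L\<rparr>) (\<lambda>x. x [^]\<^bsub>Y\<lparr>carrier := L\<rparr>\<^esub> p)"
    by (intro group_hom.intro group_hom_axioms.intro homI LL.is_group LL.nat_pow_closed LL.nat_pow_distrib; assumption)
  have phip: "\<phi> v [^]\<^bsub>Y\<^esub> p = \<phi> (int p \<cdot>\<^sub>v v)" if "v \<in> carrier_vec n" for v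
    using that by (simp add: int_pow_int)
  have "kernel (Y\<lparr>carrier := L\<rparr>) (Y\<lparr>carrier := L\<rparr>) (\<lambda>x. x [^]\<^bsub>Y\<lparr>carrier := L\<rparr>\<^esub> p) =
      (\<lambda>z. \<phi> (e \<cdot>\<^sub>v z)) ` carrier_vec n"
  proof (intro equalityI subsetI)
    fix t assume "t \<in> kernel (Y\<lparr>carrier := L\<rparr>) (Y\<lparr>carrier := L\<rparr>) (\<lambda>x. x [^]\<^bsub>Y\<lparr>carrier := L\<rparr>\<^esub> p)"
    then have t: "t \<in> L" "t [^]\<^bsub>Y\<^esub> p = \<one>\<^bsub>Y\<^esub>" by (auto simp: kernel_def pow)
    then obtain v where v: "v \<in> carrier_vec n" "t = \<phi> v" using L_sub carrier_Y by blast
    have "int p \<cdot>\<^sub>v v \<in> S"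
      using t(2) v phip[of v] phi_eq_one_iff[of "int p \<cdot>\<^sub>v v"] by simp
    then obtain y z where yz: "int p \<cdot>\<^sub>v v = A *\<^sub>v y + a \<cdot>\<^sub>v z" "y \<in> carrier_vec k" "z \<in> carrier_vec n"
      using A by (auto simp: lat_def)
    then obtain y' where y': "y' \<in> carrier_vec k" "v = A *\<^sub>v y' + e \<cdot>\<^sub>v z"
      using divide_out[OF p0 pa, of v y e z] v ea by auto
    have Ay': "A *\<^sub>v y' \<in> carrier_vec n" using A y' by auto
    have "A *\<^sub>v y' \<in> S"
      unfolding lat_def mem_Collect_eq using A y' Ay'
      by (intro exI[of _ y'] exI[of _ "0\<^sub>v n"]) auto
    then have 1: "\<phi> (A *\<^sub>v y') = \<one>\<^bsub>Y\<^esub>" using phi_eq_one_iff[OF Ay'] by simp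
    have ez: "e \<cdot>\<^sub>v z \<in> carrier_vec n" using yz(3) by simp
    have "\<phi> v = \<phi> (A *\<^sub>v y') \<otimes>\<^bsub>Y\<^esub> \<phi> (e \<cdot>\<^sub>v z)"
      unfolding y'(2) by (rule \<phi>.add[OF Ay' ez])
    then have "\<phi> v = \<phi> (e \<cdot>\<^sub>v z)"
      unfolding 1 Y.l_one[OF \<phi>.closed[OF ez]] .
    then show "t \<in> (\<lambda>z. \<phi> (e \<cdot>\<^sub>v z)) ` carrier_vec n" using v yz(3) by blast
  next
    fix t assume "t \<in> (\<lambda>z. \<phi> (e \<cdot>\<^sub>v z)) ` carrier_vec n"
    then obtain z where z: "z \<in> carrier_vec n" "t = \<phi> (e \<cdot>\<^sub>v z)" by blast
    have "H (e \<cdot>\<^sub>v z) = \<one>" using z(1) ge by (rule smult_g)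
    then have "t \<in> L" using z phi_in_L_iff[of "e \<cdot>\<^sub>v z"] by (simp add: ker_def)
    moreover have "a \<cdot>\<^sub>v z \<in> S"
      unfolding lat_def mem_Collect_eq using A z
      by (intro exI[of _ "0\<^sub>v k"] exI[of _ z]) auto
    then have "\<phi> (a \<cdot>\<^sub>v z) = \<one>\<^bsub>Y\<^esub>" using phi_eq_one_iff[of "a \<cdot>\<^sub>v z"] z by simp
    then have "t [^]\<^bsub>Y\<^esub> p = \<one>\<^bsub>Y\<^esub>"
      using phip[of "e \<cdot>\<^sub>v z"] z ea by (simp add: smult_smult_assoc)
    ultimately show "t \<in> kernel (Y\<lparr>carrier := L\<rparr>) (Y\<lparr>carrier := L\<rparr>) (\<lambda>x. x [^]\<^bsub>Y\<lparr>carrier := L\<rparr>\<^esub> p)"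
      by (simp add: kernel_def pow)
  qed
  moreover have "card ((\<lambda>z. \<phi> (e \<cdot>\<^sub>v z)) ` carrier_vec n) = card (carrier (Zn n Mod lat n A (int p)))"
  proof (rule card_image_eq_cosets[OF lat_subgroup[OF A]])
    fix v w :: "int vec" assume vw: "v \<in> carrier_vec n" "w \<in> carrier_vec n"
    have "\<phi> (e \<cdot>\<^sub>v v) = \<phi> (e \<cdot>\<^sub>v w) \<longleftrightarrow> e \<cdot>\<^sub>v v - e \<cdot>\<^sub>v w \<in> S"
      using vw by (intro phi_eq_iff) auto
    also have "e \<cdot>\<^sub>v v - e \<cdot>\<^sub>v w = e \<cdot>\<^sub>v (v - w)"
      using vw by (intro eq_vecI) (auto simp: right_diff_distrib)
    also have "e \<cdot>\<^sub>v (v - w) \<in> S \<longleftrightarrow> v - w \<in> lat n A (int p)"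
    proof
      assume "e \<cdot>\<^sub>v (v - w) \<in> S"
      then obtain y z where yz: "e \<cdot>\<^sub>v (v - w) = A *\<^sub>v y + (e * int p) \<cdot>\<^sub>v z" "y \<in> carrier_vec k" "z \<in> carrier_vec n"
        using A ea by (auto simp: lat_def mult.commute)
      then show "v - w \<in> lat n A (int p)"
        using divide_out[OF e0 _ yz(1)] vw ea A unfolding lat_def by auto
    next
      assume "v - w \<in> lat n A (int p)"
      then obtain y z where yz: "v - w = A *\<^sub>v y + int p \<cdot>\<^sub>v z" "y \<in> carrier_vec k" "z \<in> carrier_vec n"
        using A by (auto simp: lat_def)
      have Ay: "A *\<^sub>v y \<in> carrier_vec n" using A yz by auto
      have "e \<cdot>\<^sub>v (v - w) = A *\<^sub>v (e \<cdot>\<^sub>v y) + a \<cdot>\<^sub>v z"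
        unfolding yz(1) mult_mat_smult_vec[OF A yz(2)] ea
        using Ay yz(3) by (simp add: smult_add_distrib_vec[of _ n] smult_smult_assoc mult.commute)
      then show "e \<cdot>\<^sub>v (v - w) \<in> S"
        unfolding lat_def mem_Collect_eq using A yz by (intro exI[of _ "e \<cdot>\<^sub>v y"] exI[of _ z]) simp
    qed
    finally show "\<phi> (e \<cdot>\<^sub>v v) = \<phi> (e \<cdot>\<^sub>v w) \<longleftrightarrow> v - w \<in> lat n A (int p)" .
  qed
  ultimately show ?thesis
    using group_hom.card_image_kernel[OF hom] finite_L card_Mod_lat(1)[OF p0 pa]
    by (simp add: LL.pows_def mult.commute)
qed

lemma card_generating_L:
  "real (card {t \<in> {..<m} \<rightarrow>\<^sub>E L. generate Y (t ` {..<m}) = L}) =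
    real (card L) ^ m * (\<Prod>p\<in>P. \<Prod>i<m. 1 - 1 / real p ^ Suc i)" if "m = n - k"
proof -
  interpret LL: comm_group "Y\<lparr>carrier := L\<rparr>" using L_props(1) by (rule Y.subgroup_comm_group)
  have "{t \<in> {..<m} \<rightarrow>\<^sub>E L. generate Y (t ` {..<m}) = L} =
      {t \<in> {..<m} \<rightarrow>\<^sub>E carrier (Y\<lparr>carrier := L\<rparr>). generate (Y\<lparr>carrier := L\<rparr>) (t ` {..<m}) = carrier (Y\<lparr>carrier := L\<rparr>)}"
  proof (simp, intro Collect_cong conj_cong refl)
    fix t assume "t \<in> {..<m} \<rightarrow>\<^sub>E L"
    then have "t ` {..<m} \<subseteq> L" by auto
    then show "generate Y (t ` {..<m}) = L \<longleftrightarrow> generate (Y\<lparr>carrier := L\<rparr>) (t ` {..<m}) = L"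
      using Y.generate_consistent[OF _ L_props(1)] by simp
  qed
  moreover have "real (card {t \<in> {..<m} \<rightarrow>\<^sub>E carrier (Y\<lparr>carrier := L\<rparr>).
        generate (Y\<lparr>carrier := L\<rparr>) (t ` {..<m}) = carrier (Y\<lparr>carrier := L\<rparr>)}) =
      real (card (carrier (Y\<lparr>carrier := L\<rparr>))) ^ m * (\<Prod>p\<in>P. \<Prod>i<m. 1 - 1 / real p ^ Suc i)"
  proof (rule LL.card_generating_tuples)
    show "finite (carrier (Y\<lparr>carrier := L\<rparr>))" using finite_L by simp
    show "finite P" by (rule P(1))
    show "prime p" if "p \<in> P" for p using P(2)[OF that] ..
    show "card (carrier (Y\<lparr>carrier := L\<rparr>)) = p ^ m * card (LL.pows p)" if "p \<in> P" for p
      using card_L_pows[OF that] \<open>m = n - k\<close> by simp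
    show "p \<in> P" if p: "prime p" "p dvd card (carrier (Y\<lparr>carrier := L\<rparr>))" for p
    proof -
      have "p dvd card L" using p(2) by simp
      then have "p dvd nat a ^ (n - k)" using L_props(2) card_Y by (metis dvd_mult)
      then have "p dvd nat a" using p(1) by (rule prime_dvd_power_nat[rotated])
      then have "int p dvd a" using a_pos by (metis int_dvd_int_iff nat_0_le less_imp_le)
      then show ?thesis using P(3) p(1) by blast
    qed
  qed
  ultimately show ?thesis by simp
qed

text \<open>\<open>S\<close> is contained in both lattices, and the preimage in \<open>Z^n\<close>
  of the subgroup generated by the classes of the remaining columns is the lattice of
  \<open>M\<close>, while the preimage of \<open>L\<close> is the kernel of
  \<open>H\<close>.\<close>

lemma ker_eq_lat_iff_generate:
  assumes M: "M \<in> carrier_mat n n" and MA: "\<And>c. c < k \<Longrightarrow> col M c = col A c"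
  shows "ker G n H = lat n M a \<longleftrightarrow> generate Y ((\<lambda>c. \<phi> (col M c)) ` {k..<n}) = L"
proof -
  define U where "U = generate Y ((\<lambda>c. \<phi> (col M c)) ` {k..<n})"
  have colM: "col M c \<in> carrier_vec n" if "c < n" for c using M that by auto
  have U: "subgroup U Y" unfolding U_def using colM by (intro Y.generate_is_subgroup) auto
  have latM: "subgroup (lat n M a) (Zn n)" using M by (rule lat_subgroup)
  have lat_sub: "lat n M a \<subseteq> carrier_vec n" using subgroup.subset[OF latM] by simp
  have colin: "col B c \<in> lat n B a" if B: "B \<in> carrier_mat n l" "c < l" for B l c
  proof -
    have "col B c = B *\<^sub>v unit_vec l c + a \<cdot>\<^sub>v 0\<^sub>v n"
      using B by (auto simp: mult_mat_unit_vec[of _ n l])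
    then show ?thesis unfolding lat_def mem_Collect_eq using B
      by (intro exI[of _ "unit_vec l c"] exI[of _ "0\<^sub>v n"]) simp
  qed
  have az: "a \<cdot>\<^sub>v z \<in> lat n B a" if B: "B \<in> carrier_mat n l" and "z \<in> carrier_vec n" for B l z
    unfolding lat_def mem_Collect_eq using that
    by (intro exI[of _ "0\<^sub>v l"] exI[of _ z]) auto
  have SM: "S \<subseteq> lat n M a"
  proof
    fix v assume "v \<in> S"
    then obtain y z where yz: "v = A *\<^sub>v y + a \<cdot>\<^sub>v z" "y \<in> carrier_vec k" "z \<in> carrier_vec n"
      using A by (auto simp: lat_def)
    have "A *\<^sub>v y \<in> lat n M a"
    proof (rule mat_mult_in_subgroup[OF latM A _ yz(2)])
      fix c assume "c < k"
      then show "col A c \<in> lat n M a" using MA[of c] colin[OF M, of c] kn by simp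
    qed
    then show "v \<in> lat n M a" using yz az[OF M yz(3)] subgroup.m_closed[OF latM] by simp
  qed
  have T: "{v \<in> carrier_vec n. \<phi> v \<in> U} = lat n M a"
  proof (intro equalityI subsetI)
    have "subgroup (\<phi> ` lat n M a) Y"
      using group_hom.subgroup_img_is_subgroup[OF \<phi>.group_hom latM] .
    then have "U \<subseteq> \<phi> ` lat n M a"
      unfolding U_def using colin[OF M] by (intro Y.generate_subgroup_incl) auto
    fix v assume v: "v \<in> {v \<in> carrier_vec n. \<phi> v \<in> U}"
    then obtain w where w: "w \<in> lat n M a" "\<phi> v = \<phi> w" using \<open>U \<subseteq> \<phi> ` lat n M a\<close> by blast
    then have wc: "w \<in> carrier_vec n" using lat_sub by blast
    have "v - w \<in> lat n M a" using w(2) phi_eq_iff[of v w] v wc SM by auto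
    then have "(v - w) + w \<in> lat n M a" using w(1) subgroup.m_closed[OF latM] by fastforce
    moreover have "(v - w) + w = v" using v wc by (intro eq_vecI) auto
    ultimately show "v \<in> lat n M a" by simp
  next
    have sub: "subgroup {v \<in> carrier_vec n. \<phi> v \<in> U} (Zn n)"
      using subgroup.one_closed[OF U] subgroup.m_closed[OF U] subgroup.m_inv_closed[OF U]
        group_hom.hom_inv[OF \<phi>.group_hom]
      by (intro Zn.subgroupI) (auto simp: Zn_inv intro!: exI[of _ "0\<^sub>v n"])
    have SU: "v \<in> {v \<in> carrier_vec n. \<phi> v \<in> U}" if "v \<in> S" for v
      using that subgroup.mem_carrier[OF S that] phi_eq_one_iff[of v] subgroup.one_closed[OF U] by simp
    fix v assume "v \<in> lat n M a"
    then obtain y z where yz: "v = M *\<^sub>v y + a \<cdot>\<^sub>v z" "y \<in> carrier_vec n" "z \<in> carrier_vec n"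
      using M by (auto simp: lat_def)
    have "M *\<^sub>v y \<in> {v \<in> carrier_vec n. \<phi> v \<in> U}"
    proof (rule mat_mult_in_subgroup[OF sub M _ yz(2)])
      fix c assume c: "c < n"
      show "col M c \<in> {v \<in> carrier_vec n. \<phi> v \<in> U}"
      proof (cases "c < k")
        case True
        then show ?thesis using SU[OF colin[OF A]] MA by simp
      next
        case False
        then show ?thesis using c colM[OF c] by (auto simp: U_def intro: generate.incl)
      qed
    qed
    moreover have "a \<cdot>\<^sub>v z \<in> {v \<in> carrier_vec n. \<phi> v \<in> U}"
      using SU az[OF A yz(3)] by blast
    ultimately have "M *\<^sub>v y \<otimes>\<^bsub>Zn n\<^esub> (a \<cdot>\<^sub>v z) \<in> {v \<in> carrier_vec n. \<phi> v \<in> U}"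
      by (rule subgroup.m_closed[OF sub])
    then show "v \<in> {v \<in> carrier_vec n. \<phi> v \<in> U}"
      unfolding yz(1) Zn_simps .
  qed
  have kerL: "ker G n H = {v \<in> carrier_vec n. \<phi> v \<in> L}"
    using phi_in_L_iff by (auto simp: ker_def)
  show ?thesis
    unfolding U_def[symmetric]
  proof
    assume eq: "ker G n H = lat n M a"
    have "L = \<phi> ` {v \<in> carrier_vec n. \<phi> v \<in> U}" unfolding L_def T eq ..
    also have "\<dots> = U" using subgroup.subset[OF U] carrier_Y by auto
    finally show "U = L" ..
  next
    assume "U = L" then show "ker G n H = lat n M a" using T kerL by simp
  qed
qed

end

context column_hom
begin

text \<open>The event is the disjoint union, over the \<open>m\<close>-tuples \<open>t\<close>
  generating \<open>L\<close>, of the events that the classes of the columns form \<open>t\<close>.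
  For exactly uniform columns each has probability \<open>u ^ m\<close> with
  \<open>1 / u = |Y|\<close>, and \<open>|Y|\<close> is the order of the image of \<open>H\<close>
  times that of \<open>L\<close>, so the count of generating tuples gives the main term. The error
  is summed over at most \<open>(a ^ m) ^ m\<close> tuples.\<close>

lemma prob_ker_eq_lat:
  fixes q :: "nat \<Rightarrow> nat \<Rightarrow> int pmf" and X0 :: "nat \<Rightarrow> nat \<Rightarrow> int"
  assumes q: "\<And>p c r. prime p \<Longrightarrow> int p dvd a \<Longrightarrow> c \<in> {k..<n} \<Longrightarrow> r < n \<Longrightarrow> balanced_pmf \<alpha> (int p) (q c r)"
    and \<alpha>: "0 \<le> \<alpha>" "\<alpha> \<le> 1/2"
    and dense: "\<And>p x. prime p \<Longrightarrow> int p dvd a \<Longrightarrow> weight (int p) n x > 0 \<Longrightarrow>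
      \<forall>c<k. int p dvd (\<Sum>r<n. x r * A $$ (r, c)) \<Longrightarrow> s \<le> weight (int p) n x"
    and X0: "A = mat n k (\<lambda>(r, c). X0 c r)" and m: "m = n - k"
  shows "\<bar>measure_pmf.prob (Pi_pmf {k..<n} d (\<lambda>c. Pi_pmf {..<n} 0 (q c)))
        {B. ker G n H = lat n (mat n n (\<lambda>(r, c). if c < k then X0 c r else B c r)) a}
      - (\<Prod>p\<in>P. \<Prod>i<m. 1 - 1 / real p ^ Suc i) / real (card (H ` carrier_vec n)) ^ m\<bar>
    \<le> (of_int a ^ m) ^ m * (real m * decay \<alpha> a ^ s)"
proof -
  let ?Q = "Pi_pmf {k..<n} d (\<lambda>c. Pi_pmf {..<n} 0 (q c))"
  let ?M = "\<lambda>B. mat n n (\<lambda>(r, c). if c < k then X0 c r else B c r)"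
  define T where "T = {t \<in> {k..<n} \<rightarrow>\<^sub>E L. generate Y (t ` {k..<n}) = L}"
  define E where "E t = Pi {k..<n} (\<lambda>c. {b. \<phi> (vec n b) = t c})" for t :: "nat \<Rightarrow> int vec set"
  define u where "u = 1 / (of_int a :: real) ^ m"
  define \<epsilon> where "\<epsilon> = decay \<alpha> a ^ s"
  have am: "(of_int a :: real) ^ m \<ge> 1" using a_pos by (intro one_le_power) simp
  have u: "0 \<le> u" "u \<le> 1" using am by (auto simp: u_def)
  have colM: "col (?M B) c = vec n (B c)" if "c \<in> {k..<n}" for B c
    using that by (intro eq_vecI) auto
  have "ker G n H = lat n (?M B) a \<longleftrightarrow> (\<exists>t\<in>T. B \<in> E t)" for B
  proof -
    have M: "?M B \<in> carrier_mat n n" by simp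
    have "col (?M B) c = col A c" if "c < k" for c
      using that kn unfolding X0 by (intro eq_vecI) auto
    then have "ker G n H = lat n (?M B) a \<longleftrightarrow> generate Y ((\<lambda>c. \<phi> (col (?M B) c)) ` {k..<n}) = L"
      by (rule ker_eq_lat_iff_generate[OF M])
    also have "(\<lambda>c. \<phi> (col (?M B) c)) ` {k..<n} = (\<lambda>c. \<phi> (vec n (B c))) ` {k..<n}"
      using colM by (intro image_cong refl) simp
    also have "generate Y ((\<lambda>c. \<phi> (vec n (B c))) ` {k..<n}) = L \<longleftrightarrow> (\<exists>t\<in>T. B \<in> E t)"
    proof
      assume gen: "generate Y ((\<lambda>c. \<phi> (vec n (B c))) ` {k..<n}) = L"
      define t where "t = restrict (\<lambda>c. \<phi> (vec n (B c))) {k..<n}"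
      have im: "t ` {k..<n} = (\<lambda>c. \<phi> (vec n (B c))) ` {k..<n}" by (simp add: t_def)
      have "\<phi> (vec n (B c)) \<in> L" if "c \<in> {k..<n}" for c
        unfolding gen[symmetric] using that by (intro generate.incl) blast
      then have "t \<in> {k..<n} \<rightarrow>\<^sub>E L" by (simp add: t_def)
      then have "t \<in> T" using gen im by (simp add: T_def)
      moreover have "B \<in> E t" by (simp add: E_def t_def)
      ultimately show "\<exists>t\<in>T. B \<in> E t" by (intro bexI)
    next
      assume "\<exists>t\<in>T. B \<in> E t"
      then obtain t where t: "t \<in> T" "B \<in> E t" by (rule bexE)
      have "(\<lambda>c. \<phi> (vec n (B c))) ` {k..<n} = t ` {k..<n}"
        using t(2) unfolding E_def by (intro image_cong refl) (simp add: Pi_iff)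
      then show "generate Y ((\<lambda>c. \<phi> (vec n (B c))) ` {k..<n}) = L"
        using t(1) by (simp add: T_def)
    qed
    finally show ?thesis .
  qed
  then have ev: "{B. ker G n H = lat n (?M B) a} = (\<Union>t\<in>T. E t)" by blast
  have finT: "finite T"
    unfolding T_def by (rule finite_subset[OF Collect_restrict]) (simp add: finite_PiE finite_L)
  have "disjoint_family_on E T"
    unfolding disjoint_family_on_def
  proof (intro ballI impI)
    fix t t' assume t: "t \<in> T" "t' \<in> T" "t \<noteq> t'"
    have "t = t'" if B: "B \<in> E t" "B \<in> E t'" for B
    proof (rule PiE_ext[of t "{k..<n}" "\<lambda>_. L"])
      show "t \<in> {k..<n} \<rightarrow>\<^sub>E L" "t' \<in> {k..<n} \<rightarrow>\<^sub>E L" using t by (auto simp: T_def)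
      fix c assume "c \<in> {k..<n}"
      then show "t c = t' c" using B by (auto simp: E_def Pi_iff)
    qed
    then show "E t \<inter> E t' = {}" using t(3) by blast
  qed
  then have sum: "measure_pmf.prob ?Q {B. ker G n H = lat n (?M B) a} = (\<Sum>t\<in>T. measure_pmf.prob ?Q (E t))"
    unfolding ev using finT by (intro measure_pmf.finite_measure_finite_Union) auto
  have near: "\<bar>measure_pmf.prob ?Q (E t) - u ^ m\<bar> \<le> real m * \<epsilon>" if t: "t \<in> T" for t
  proof -
    have PE: "measure_pmf.prob ?Q (E t) = (\<Prod>c\<in>{k..<n}. measure_pmf.prob (Pi_pmf {..<n} 0 (q c)) {b. \<phi> (vec n b) = t c})"
      unfolding E_def by (rule measure_Pi_pmf_Pi) simp
    have each: "\<bar>measure_pmf.prob (Pi_pmf {..<n} 0 (q c)) {b. \<phi> (vec n b) = t c} - u\<bar> \<le> \<epsilon>" if c: "c \<in> {k..<n}" for c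
    proof -
      have "t c \<in> carrier Y" using t c L_sub by (auto simp: T_def)
      then obtain w where w: "w \<in> carrier_vec n" "t c = \<phi> w" using carrier_Y by blast
      have "{b. \<phi> (vec n b) = t c} = {b. vec n b \<in> \<phi> w}"
        using w phi_eq_iff[of "vec n _" w] mem_coset_iff[OF S w(1), of "vec n _"] by simp
      moreover have "\<bar>measure_pmf.prob (Pi_pmf {..<n} 0 (q c)) {b. vec n b \<in> \<phi> w} - 1 / of_int a ^ (n - k)\<bar> \<le> decay \<alpha> a ^ s"
      proof (rule near_uniform)
        show "balanced_pmf \<alpha> (int p) (q c r)" if "prime p" "int p dvd a" "r < n" for p r
          by (rule q[OF that(1,2) c that(3)])
      qed (use \<alpha> w in simp_all, rule dense, assumption+)
      ultimately show ?thesis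
        unfolding u_def \<epsilon>_def m by (simp only:)
    qed
    \<comment> \<open>Both products have factors in the unit interval; replacing these one at a time
      adds up the individual errors.\<close>
    have "\<bar>(\<Prod>c\<in>{k..<n}. measure_pmf.prob (Pi_pmf {..<n} 0 (q c)) {b. \<phi> (vec n b) = t c}) - (\<Prod>c\<in>{k..<n}. u)\<bar>
        \<le> (\<Sum>c\<in>{k..<n}. \<bar>measure_pmf.prob (Pi_pmf {..<n} 0 (q c)) {b. \<phi> (vec n b) = t c} - u\<bar>)"
      using norm_prod_diff[of "{k..<n}" "\<lambda>c. measure_pmf.prob (Pi_pmf {..<n} 0 (q c)) {b. \<phi> (vec n b) = t c}" "\<lambda>_. u"] u
      by (simp only: real_norm_def abs_of_nonneg measure_nonneg measure_pmf.prob_le_1)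
    also have "\<dots> \<le> (\<Sum>c\<in>{k..<n}. \<epsilon>)" by (rule sum_mono) (rule each)
    finally show ?thesis unfolding PE by (simp add: m)
  qed
  have cT: "real (card T) = real (card L) ^ m * (\<Prod>p\<in>P. \<Prod>i<m. 1 - 1 / real p ^ Suc i)"
  proof -
    have "bij_betw (\<lambda>j. j + k) {..<m} {k..<n}"
      using kn by (intro bij_betw_byWitness[where f' = "\<lambda>j. j - k"]) (auto simp: m)
    then have "card T = card {t \<in> {..<m} \<rightarrow>\<^sub>E L. generate Y (t ` {..<m}) = L}"
      unfolding T_def by (rule card_tuples_reindex)
    then show ?thesis using card_generating_L[OF m] by simp
  qed
  have cardY: "(of_int a :: real) ^ m = real (card (H ` carrier_vec n)) * real (card L)"
  proof -
    have "(of_int a :: real) ^ m = real (nat a ^ m)" using a_pos by simp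
    also have "nat a ^ m = card (H ` carrier_vec n) * card L"
      using card_Y L_props(2) m by simp
    finally show ?thesis by simp
  qed
  then have "real (card (H ` carrier_vec n)) * real (card L) \<ge> 1" using am by simp
  then have pos: "real (card (H ` carrier_vec n)) > 0" "real (card L) > 0"
    by (cases "card (H ` carrier_vec n) = 0"; cases "card L = 0"; simp)+
  have main: "real (card T) * u ^ m = (\<Prod>p\<in>P. \<Prod>i<m. 1 - 1 / real p ^ Suc i) / real (card (H ` carrier_vec n)) ^ m"
    unfolding cT u_def cardY using pos by (simp add: power_divide power_mult_distrib)
  have "card T \<le> card ({k..<n} \<rightarrow>\<^sub>E L)"
    unfolding T_def by (rule card_mono[OF _ Collect_restrict]) (simp add: finite_PiE finite_L)
  also have "\<dots> = card L ^ m" by (simp add: card_PiE m)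
  also have "\<dots> \<le> (card (H ` carrier_vec n) * card L) ^ m"
    using pos by (intro power_mono) auto
  finally have "real (card T) \<le> real ((card (H ` carrier_vec n) * card L) ^ m)"
    by (simp only: of_nat_le_iff)
  then have cT_le: "real (card T) \<le> (of_int a ^ m) ^ m"
    by (simp add: cardY)
  have "\<bar>measure_pmf.prob ?Q {B. ker G n H = lat n (?M B) a} - real (card T) * u ^ m\<bar>
      = \<bar>\<Sum>t\<in>T. (measure_pmf.prob ?Q (E t) - u ^ m)\<bar>"
    unfolding sum by (simp add: sum_subtractf)
  also have "\<dots> \<le> (\<Sum>t\<in>T. real m * \<epsilon>)"
    by (rule order.trans[OF sum_abs], rule sum_mono) (rule near)
  also have "\<dots> = real (card T) * (real m * \<epsilon>)" by simp
  also have "\<dots> \<le> (of_int a ^ m) ^ m * (real m * \<epsilon>)"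
    using cT_le \<alpha> by (intro mult_right_mono) (auto simp: \<epsilon>_def decay_nonneg)
  finally show ?thesis unfolding main \<epsilon>_def .
qed

end

section \<open>Random columns\<close>

lemma prob_pair_pmf_finite:
  assumes "finite (set_pmf p)"
  shows "measure_pmf.prob (pair_pmf p q) {z. R (fst z) (snd z)} =
    (\<Sum>x\<in>set_pmf p. pmf p x * measure_pmf.prob q {y. R x y})"
proof -
  let ?E = "\<lambda>x. {x} \<times> {y \<in> set_pmf q. R x y}"
  have "measure_pmf.prob (pair_pmf p q) {z. R (fst z) (snd z)} =
      measure_pmf.prob (pair_pmf p q) ({z. R (fst z) (snd z)} \<inter> set_pmf (pair_pmf p q))"
    by (rule measure_Int_set_pmf[symmetric])
  also have "{z. R (fst z) (snd z)} \<inter> set_pmf (pair_pmf p q) = (\<Union>x\<in>set_pmf p. ?E x)"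
    by (auto simp: set_pair_pmf)
  also have "measure_pmf.prob (pair_pmf p q) \<dots> = (\<Sum>x\<in>set_pmf p. measure_pmf.prob (pair_pmf p q) (?E x))"
    by (rule measure_pmf.finite_measure_finite_Union)
      (use assms in \<open>auto simp: disjoint_family_on_def\<close>)
  also have "\<dots> = (\<Sum>x\<in>set_pmf p. pmf p x * measure_pmf.prob q {y. R x y})"
  proof (intro sum.cong refl)
    fix x
    have "measure_pmf.prob (pair_pmf p q) (?E x) = measure_pmf.prob p {x} * measure_pmf.prob q {y \<in> set_pmf q. R x y}"
      by (rule measure_pmf_prob_product) (auto intro: countable_subset[OF _ countable_set_pmf])
    moreover have "{y \<in> set_pmf q. R x y} = {y. R x y} \<inter> set_pmf q" by auto
    then have "measure_pmf.prob q {y \<in> set_pmf q. R x y} = measure_pmf.prob q {y. R x y}"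
      by (simp only: measure_Int_set_pmf)
    ultimately show "measure_pmf.prob (pair_pmf p q) (?E x) = pmf p x * measure_pmf.prob q {y. R x y}"
      by (simp only: measure_pmf_single)
  qed
  finally show ?thesis .
qed

text \<open>The laws are built column by column, but the entries of a product with a fixed vector
  \<open>y\<close> are independent row by row.\<close>

lemma Pi_pmf_transpose:
  assumes "finite A" "finite B"
  shows "map_pmf (\<lambda>f b a. f a b) (Pi_pmf A (\<lambda>_. d) (\<lambda>a. Pi_pmf B d (q a))) =
    Pi_pmf B (\<lambda>_. d) (\<lambda>b. Pi_pmf A d (\<lambda>a. q a b))"
proof (rule pmf_eqI)
  fix h :: "'b \<Rightarrow> 'a \<Rightarrow> 'c"
  let ?t = "\<lambda>f b a. f a b"
  have "pmf (map_pmf ?t (Pi_pmf A (\<lambda>_. d) (\<lambda>a. Pi_pmf B d (q a)))) (?t (\<lambda>a b. h b a)) =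
      pmf (Pi_pmf A (\<lambda>_. d) (\<lambda>a. Pi_pmf B d (q a))) (\<lambda>a b. h b a)"
    by (rule pmf_map_inj') (auto simp: inj_def fun_eq_iff)
  also have "\<dots> = pmf (Pi_pmf B (\<lambda>_. d) (\<lambda>b. Pi_pmf A d (\<lambda>a. q a b))) h"
  proof (cases "\<forall>a b. (a \<notin> A \<or> b \<notin> B) \<longrightarrow> h b a = d")
    case True
    have "pmf (Pi_pmf A (\<lambda>_. d) (\<lambda>a. Pi_pmf B d (q a))) (\<lambda>a b. h b a) = (\<Prod>a\<in>A. \<Prod>b\<in>B. pmf (q a b) (h b a))"
      using assms True by (subst pmf_Pi') (auto simp: pmf_Pi' fun_eq_iff intro!: prod.cong)
    also have "\<dots> = (\<Prod>b\<in>B. \<Prod>a\<in>A. pmf (q a b) (h b a))" by (rule prod.swap)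
    also have "\<dots> = pmf (Pi_pmf B (\<lambda>_. d) (\<lambda>b. Pi_pmf A d (\<lambda>a. q a b))) h"
      using assms True by (subst pmf_Pi') (auto simp: pmf_Pi' fun_eq_iff intro!: prod.cong)
    finally show ?thesis .
  next
    case False
    then obtain a b where ab: "a \<notin> A \<or> b \<notin> B" "h b a \<noteq> d" by blast
    have "pmf (Pi_pmf A (\<lambda>_. d) (\<lambda>a. Pi_pmf B d (q a))) (\<lambda>a b. h b a) = 0"
    proof (cases "a \<in> A")
      case True
      then have "pmf (Pi_pmf B d (q a)) (\<lambda>b. h b a) = 0" using ab assms by (intro pmf_Pi_outside) auto
      then have "(\<Prod>a\<in>A. pmf (Pi_pmf B d (q a)) (\<lambda>b. h b a)) = 0"
        using True assms(1) by (intro prod_zero bexI[of _ a])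
      then show ?thesis by (simp only: pmf_Pi[OF assms(1)] if_cancel)
    next
      case False
      then show ?thesis using ab assms by (intro pmf_Pi_outside) (auto simp: fun_eq_iff)
    qed
    moreover have "pmf (Pi_pmf B (\<lambda>_. d) (\<lambda>b. Pi_pmf A d (\<lambda>a. q a b))) h = 0"
    proof (cases "b \<in> B")
      case True
      then have "pmf (Pi_pmf A d (\<lambda>a. q a b)) (h b) = 0" using ab assms by (intro pmf_Pi_outside) auto
      then have "(\<Prod>b\<in>B. pmf (Pi_pmf A d (\<lambda>a. q a b)) (h b)) = 0"
        using True assms(2) by (intro prod_zero bexI[of _ b])
      then show ?thesis by (simp only: pmf_Pi[OF assms(2)] if_cancel)
    next
      case False
      then show ?thesis using ab assms by (intro pmf_Pi_outside) (auto simp: fun_eq_iff)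
    qed
    ultimately show ?thesis by simp
  qed
  finally show "pmf (map_pmf ?t (Pi_pmf A (\<lambda>_. d) (\<lambda>a. Pi_pmf B d (q a)))) h =
      pmf (Pi_pmf B (\<lambda>_. d) (\<lambda>b. Pi_pmf A d (\<lambda>a. q a b))) h" .
qed

lemma weight_mod: "weight p n (\<lambda>r. x r mod p) = weight p n x"
  by (simp add: weight_def dvd_eq_mod_eq_0)

lemma weight_cong: "(\<And>r. r < n \<Longrightarrow> x r = y r) \<Longrightarrow> weight p n x = weight p n y"
  unfolding weight_def by (intro arg_cong[of _ _ card]) auto

lemma dvd_sum_mod:
  fixes p :: int
  shows "p dvd (\<Sum>c<k. (y c mod p) * z c) - d \<longleftrightarrow> p dvd (\<Sum>c<k. y c * z c) - d"
proof -
  have "(\<Sum>c<k. y c * z c) - (\<Sum>c<k. (y c mod p) * z c) = (\<Sum>c<k. p * (y c div p * z c))"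
    unfolding sum_subtractf[symmetric]
    by (intro sum.cong refl) (metis left_diff_distrib minus_mod_eq_mult_div mult.assoc)
  then have "p dvd (\<Sum>c<k. y c * z c) - (\<Sum>c<k. (y c mod p) * z c)"
    by (simp add: dvd_sum)
  from dvd_add_right_iff[OF this, of "(\<Sum>c<k. (y c mod p) * z c) - d"] show ?thesis by simp
qed

section \<open>Union bounds for kernels and annihilators of random columns\<close>

locale random_columns =
  fixes n :: nat and a :: int and \<alpha> :: real and P :: "nat set" and q :: "nat \<Rightarrow> nat \<Rightarrow> int pmf"
  assumes \<alpha>: "0 < \<alpha>" "\<alpha> \<le> 1/2" and a_pos: "a > 0"
    and finite_P: "finite P" and P: "\<And>p. p \<in> P \<Longrightarrow> prime p \<and> int p dvd a"
    and q: "\<And>p c r. p \<in> P \<Longrightarrow> c < n \<Longrightarrow> r < n \<Longrightarrow> balanced_pmf \<alpha> (int p) (q c r)"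
begin

definition col_law :: "nat set \<Rightarrow> (nat \<Rightarrow> nat \<Rightarrow> int) pmf" where
  "col_law J = Pi_pmf J (\<lambda>_. 0) (\<lambda>c. Pi_pmf {..<n} 0 (q c))"

abbreviation "\<beta> \<equiv> decay \<alpha> a"

text \<open>The worst case of \<open>prob_linear_form_le\<close> for a form that is nonzero modulo
  \<open>p\<close>, attained by the bound at \<open>p = 2\<close> and weight 1.\<close>

definition \<gamma> :: real where "\<gamma> = (1 + \<beta>) / 2"

lemma beta: "0 \<le> \<beta>" "P \<noteq> {} \<Longrightarrow> \<beta> < 1"
proof -
  show "0 \<le> \<beta>" using \<alpha> by (intro decay_nonneg) auto
  assume "P \<noteq> {}"
  then obtain p where "p \<in> P" by blast
  then have "int p \<ge> 2" "int p dvd a" using P prime_ge_2_nat[of p] by auto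
  then have "a \<ge> 2" using a_pos by (auto dest: zdvd_imp_le)
  then show "\<beta> < 1" using \<alpha> by (intro decay_less_1) auto
qed

lemma p_bounds: "p \<in> P \<Longrightarrow> prime (int p) \<and> int p \<le> a \<and> p \<ge> 2"
  using P[of p] a_pos by (auto dest: zdvd_imp_le simp: prime_ge_2_nat)

lemma linear_form_sparse:
  assumes p: "p \<in> P" and w: "w > 0"
  shows "1 / real p + (1 - 1 / real p) * \<beta> ^ w \<le> \<gamma>"
proof -
  have "\<beta> < 1" using beta(2) p by blast
  then have "\<beta> ^ w \<le> \<beta>" using w beta(1) power_decreasing[of 1 w \<beta>] by simp
  then have "1 / real p + (1 - 1 / real p) * \<beta> ^ w \<le> 1 / real p + (1 - 1 / real p) * \<beta>"
    using p_bounds[OF p] by (intro add_left_mono mult_left_mono) auto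
  also have "\<dots> = \<beta> + (1 - \<beta>) * (1 / real p)" by (simp add: algebra_simps)
  also have "\<dots> \<le> \<beta> + (1 - \<beta>) * (1 / 2)"
    using p_bounds[OF p] \<open>\<beta> < 1\<close> by (intro add_left_mono mult_left_mono divide_left_mono) auto
  finally show ?thesis by (simp add: \<gamma>_def field_simps)
qed

lemma linear_form_dense:
  assumes p: "p \<in> P" and w: "s \<le> w"
  shows "1 / real p + (1 - 1 / real p) * \<beta> ^ w \<le> 1 / real p + \<beta> ^ s"
proof -
  have "\<beta> < 1" using beta(2) p by blast
  then have "(1 - 1 / real p) * \<beta> ^ w \<le> 1 * \<beta> ^ s"
    using beta(1) w p_bounds[OF p] by (intro mult_mono power_decreasing) auto
  then show ?thesis by simp
qed

lemma linear_form_nonneg: "p \<in> P \<Longrightarrow> 0 \<le> 1 / real p + (1 - 1 / real p) * \<beta> ^ w"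
  using p_bounds[of p] beta(1) by simp

text \<open>After transposition the \<open>n\<close> rows are the independent factors, hence the
  exponent \<open>n\<close>; in \<open>prob_annihilated_le\<close> they are the \<open>k\<close>
  columns.\<close>

lemma prob_product_vector_le:
  assumes p: "p \<in> P" and k: "k \<le> n"
  shows "measure_pmf.prob (col_law {..<k}) {M. \<forall>r<n. int p dvd (\<Sum>c<k. y c * M c r) - d r}
    \<le> (1 / real p + (1 - 1 / real p) * \<beta> ^ weight (int p) k y) ^ n"
proof -
  let ?Q = "Pi_pmf {..<n} (\<lambda>_. 0) (\<lambda>r. Pi_pmf {..<k} 0 (\<lambda>c. q c r))"
  have "measure_pmf.prob (col_law {..<k}) {M. \<forall>r<n. int p dvd (\<Sum>c<k. y c * M c r) - d r} =
      measure_pmf.prob (map_pmf (\<lambda>f b a. f a b) (col_law {..<k})) {M. \<forall>r<n. int p dvd (\<Sum>c<k. y c * M r c) - d r}"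
    by (simp add: vimage_def)
  also have "map_pmf (\<lambda>f b a. f a b) (col_law {..<k}) = Pi_pmf {..<n} (\<lambda>_. 0) (\<lambda>r. Pi_pmf {..<k} 0 (\<lambda>c. q c r))"
    unfolding col_law_def by (rule Pi_pmf_transpose) auto
  also have "{M. \<forall>r<n. int p dvd (\<Sum>c<k. y c * M r c) - d r} = Pi {..<n} (\<lambda>r. {b. int p dvd (\<Sum>c<k. y c * b c) - d r})"
    by (auto simp: Pi_iff)
  also have "measure_pmf.prob (Pi_pmf {..<n} (\<lambda>_. 0) (\<lambda>r. Pi_pmf {..<k} 0 (\<lambda>c. q c r))) \<dots> =
      (\<Prod>r<n. measure_pmf.prob (Pi_pmf {..<k} 0 (\<lambda>c. q c r)) {b. int p dvd (\<Sum>c<k. y c * b c) - d r})"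
    by (rule measure_Pi_pmf_Pi) simp
  also have "\<dots> \<le> (\<Prod>r<n. 1 / real p + (1 - 1 / real p) * \<beta> ^ weight (int p) k y)"
  proof (intro prod_mono conjI measure_nonneg)
    fix r assume "r \<in> {..<n}"
    then show "measure_pmf.prob (Pi_pmf {..<k} 0 (\<lambda>c. q c r)) {b. int p dvd (\<Sum>c<k. y c * b c) - d r}
        \<le> 1 / real p + (1 - 1 / real p) * \<beta> ^ weight (int p) k y"
      using prob_linear_form_le[of k \<alpha> "int p" "\<lambda>c. q c r" a y "d r"] q p k \<alpha> p_bounds[OF p] by simp
  qed
  finally show ?thesis by simp
qed

lemma prob_annihilated_le:
  assumes p: "p \<in> P" and k: "k \<le> n"
  shows "measure_pmf.prob (col_law {..<k}) {M. \<forall>c<k. int p dvd (\<Sum>r<n. x r * M c r)}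
    \<le> (1 / real p + (1 - 1 / real p) * \<beta> ^ weight (int p) n x) ^ k"
proof -
  have "{M. \<forall>c<k. int p dvd (\<Sum>r<n. x r * M c r)} = Pi {..<k} (\<lambda>c. {b. int p dvd (\<Sum>r<n. x r * b r) - 0})"
    by (auto simp: Pi_iff)
  then have "measure_pmf.prob (col_law {..<k}) {M. \<forall>c<k. int p dvd (\<Sum>r<n. x r * M c r)} =
      (\<Prod>c<k. measure_pmf.prob (Pi_pmf {..<n} 0 (q c)) {b. int p dvd (\<Sum>r<n. x r * b r) - 0})"
    unfolding col_law_def by (simp only: measure_Pi_pmf_Pi finite_lessThan)
  also have "\<dots> \<le> (\<Prod>c<k. 1 / real p + (1 - 1 / real p) * \<beta> ^ weight (int p) n x)"
  proof (intro prod_mono conjI measure_nonneg)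
    fix c assume "c \<in> {..<k}"
    then show "measure_pmf.prob (Pi_pmf {..<n} 0 (q c)) {b. int p dvd (\<Sum>r<n. x r * b r) - 0}
        \<le> 1 / real p + (1 - 1 / real p) * \<beta> ^ weight (int p) n x"
      using prob_linear_form_le[of n \<alpha> "int p" "q c" a x 0] q p k \<alpha> p_bounds[OF p] by simp
  qed
  finally show ?thesis by simp
qed

definition sparse :: "nat \<Rightarrow> nat \<Rightarrow> nat \<Rightarrow> (nat \<Rightarrow> int) set" where
  "sparse k p s = {y \<in> residues_fun k (int p). weight (int p) k y < s}"

lemma finite_sparse: "finite (sparse k p s)"
  unfolding sparse_def by (rule finite_subset[OF Collect_restrict finite_residues_fun])

lemma reduce_vector:
  assumes p: "p \<in> P" and y: "weight (int p) k y > 0"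
  shows "\<exists>y'\<in>residues_fun k (int p). weight (int p) k y' = weight (int p) k y \<and>
    (\<forall>z d. int p dvd (\<Sum>c<k. y' c * z c) - d \<longleftrightarrow> int p dvd (\<Sum>c<k. y c * z c) - d)"
proof (intro bexI conjI allI)
  let ?y = "restrict (\<lambda>c. y c mod int p) {..<k}"
  show "?y \<in> residues_fun k (int p)" using p_bounds[OF p] by auto
  have "weight (int p) k ?y = weight (int p) k (\<lambda>c. y c mod int p)" by (rule weight_cong) simp
  then show "weight (int p) k ?y = weight (int p) k y" by (simp only: weight_mod)
  fix z d
  have "(\<Sum>c<k. ?y c * z c) = (\<Sum>c<k. (y c mod int p) * z c)" by (rule sum.cong) auto
  then show "int p dvd (\<Sum>c<k. ?y c * z c) - d \<longleftrightarrow> int p dvd (\<Sum>c<k. y c * z c) - d"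
    by (simp only: dvd_sum_mod)
qed

text \<open>Union bound over the right-hand sides in \<open>D\<close>, later the kernel of
  \<open>R\<close> modulo \<open>p\<close>, and over \<open>y\<close>, split at weight
  \<open>s\<close>. Sparse vectors are few and cost at most \<open>\<gamma> ^ n\<close> each; the at
  most \<open>p ^ k\<close> dense ones have probability close to \<open>p ^ -n\<close> each,
  together about \<open>p ^ -(n - k)\<close>.\<close>

lemma prob_kernel_le:
  assumes p: "p \<in> P" and k: "k \<le> n" and D: "finite D"
  shows "measure_pmf.prob (col_law {..<k})
      {M. \<exists>y. weight (int p) k y > 0 \<and> (\<exists>d\<in>D. \<forall>r<n. int p dvd (\<Sum>c<k. y c * M c r) - d r)}
    \<le> real (card D) * (real (card (sparse k p s)) * \<gamma> ^ n + real p ^ k * (1 / real p + \<beta> ^ s) ^ n)"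
proof -
  let ?Y = "{y \<in> residues_fun k (int p). weight (int p) k y > 0}"
  let ?E = "\<lambda>(y, d). {M. \<forall>r<n. int p dvd (\<Sum>c<k. y c * M c r) - d r}"
  have finY: "finite ?Y" by (rule finite_subset[OF Collect_restrict finite_residues_fun])
  have "measure_pmf.prob (col_law {..<k})
      {M. \<exists>y. weight (int p) k y > 0 \<and> (\<exists>d\<in>D. \<forall>r<n. int p dvd (\<Sum>c<k. y c * M c r) - d r)}
      \<le> measure_pmf.prob (col_law {..<k}) (\<Union>u\<in>?Y \<times> D. ?E u)"
  proof (rule measure_pmf.finite_measure_mono)
    show "{M. \<exists>y. weight (int p) k y > 0 \<and> (\<exists>d\<in>D. \<forall>r<n. int p dvd (\<Sum>c<k. y c * M c r) - d r)}
        \<subseteq> (\<Union>u\<in>?Y \<times> D. ?E u)"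
    proof
      fix M assume "M \<in> {M. \<exists>y. weight (int p) k y > 0 \<and> (\<exists>d\<in>D. \<forall>r<n. int p dvd (\<Sum>c<k. y c * M c r) - d r)}"
      then obtain y d where y: "weight (int p) k y > 0" and d: "d \<in> D" "\<forall>r<n. int p dvd (\<Sum>c<k. y c * M c r) - d r"
        by blast
      obtain y' where y': "y' \<in> residues_fun k (int p)" "weight (int p) k y' = weight (int p) k y \<and>
          (\<forall>z d. int p dvd (\<Sum>c<k. y' c * z c) - d \<longleftrightarrow> int p dvd (\<Sum>c<k. y c * z c) - d)"
        using reduce_vector[OF p y] ..
      note y' = y'(1) conjunct1[OF y'(2)] conjunct2[OF y'(2), rule_format]
      have "M \<in> ?E (y', d)" using d(2) y'(3)[of "\<lambda>c. M c _"] by simp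
      moreover have "(y', d) \<in> ?Y \<times> D" using y'(1,2) y d(1) by simp
      ultimately show "M \<in> (\<Union>u\<in>?Y \<times> D. ?E u)" by (rule UN_I[rotated])
    qed
  qed simp
  also have "\<dots> \<le> (\<Sum>u\<in>?Y \<times> D. measure_pmf.prob (col_law {..<k}) (?E u))"
    using finY D by (intro measure_pmf.finite_measure_subadditive_finite) auto
  also have "\<dots> \<le> (\<Sum>u\<in>?Y \<times> D. (1 / real p + (1 - 1 / real p) * \<beta> ^ weight (int p) k (fst u)) ^ n)"
    by (rule sum_mono) (use prob_product_vector_le[OF p k] in \<open>simp add: split_beta\<close>)
  also have "\<dots> = (\<Sum>y\<in>?Y. \<Sum>d\<in>D. (1 / real p + (1 - 1 / real p) * \<beta> ^ weight (int p) k y) ^ n)"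
    unfolding sum.cartesian_product case_prod_unfold ..
  also have "\<dots> = real (card D) * (\<Sum>y\<in>?Y. (1 / real p + (1 - 1 / real p) * \<beta> ^ weight (int p) k y) ^ n)"
    by (simp add: sum_distrib_left)
  also have "(\<Sum>y\<in>?Y. (1 / real p + (1 - 1 / real p) * \<beta> ^ weight (int p) k y) ^ n) \<le>
      (\<Sum>y\<in>?Y. (if y \<in> sparse k p s then \<gamma> ^ n else 0) + (1 / real p + \<beta> ^ s) ^ n)"
  proof (rule sum_mono)
    fix y assume y: "y \<in> ?Y"
    have nn: "0 \<le> (1 / real p + \<beta> ^ s) ^ n" "0 \<le> \<gamma> ^ n"
      using beta(1) by (auto simp: \<gamma>_def)
    show "(1 / real p + (1 - 1 / real p) * \<beta> ^ weight (int p) k y) ^ n \<le>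
        (if y \<in> sparse k p s then \<gamma> ^ n else 0) + (1 / real p + \<beta> ^ s) ^ n"
    proof (cases "y \<in> sparse k p s")
      case True
      have "(1 / real p + (1 - 1 / real p) * \<beta> ^ weight (int p) k y) ^ n \<le> \<gamma> ^ n"
        using y by (intro power_mono linear_form_sparse[OF p] linear_form_nonneg[OF p]) auto
      then show ?thesis using True nn by simp
    next
      case False
      then have "s \<le> weight (int p) k y" using y by (auto simp: sparse_def)
      then have "(1 / real p + (1 - 1 / real p) * \<beta> ^ weight (int p) k y) ^ n \<le> (1 / real p + \<beta> ^ s) ^ n"
        by (intro power_mono linear_form_dense[OF p] linear_form_nonneg[OF p])
      then show ?thesis using False by simp
    qed
  qed
  also have "\<dots> = real (card (?Y \<inter> sparse k p s)) * \<gamma> ^ n + real (card ?Y) * (1 / real p + \<beta> ^ s) ^ n"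
    using finY by (simp add: sum.distrib sum.If_cases)
  also have "\<dots> \<le> real (card (sparse k p s)) * \<gamma> ^ n + real p ^ k * (1 / real p + \<beta> ^ s) ^ n"
  proof (intro add_mono mult_right_mono)
    show "real (card (?Y \<inter> sparse k p s)) \<le> real (card (sparse k p s))"
      by (simp add: card_mono finite_sparse)
    have "card ?Y \<le> card (residues_fun k (int p))" by (rule card_mono) auto
    then have "card ?Y \<le> p ^ k" by (simp add: card_residues_fun)
    then show "real (card ?Y) \<le> real p ^ k" by (metis of_nat_le_iff of_nat_power)
  qed (use beta(1) in \<open>auto simp: \<gamma>_def\<close>)
  finally show ?thesis by (simp add: mult_left_mono)
qed

text \<open>The union bound runs over sparse vectors only, so the weaker bound
  \<open>\<gamma> ^ k\<close> for each of them is enough.\<close>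

lemma prob_not_dense_le:
  assumes p: "p \<in> P" and k: "k \<le> n"
  shows "measure_pmf.prob (col_law {..<k})
      {M. \<exists>x. 0 < weight (int p) n x \<and> weight (int p) n x < s \<and> (\<forall>c<k. int p dvd (\<Sum>r<n. x r * M c r))}
    \<le> real (card (sparse n p s)) * \<gamma> ^ k"
proof -
  let ?Y = "{x \<in> sparse n p s. weight (int p) n x > 0}"
  let ?E = "\<lambda>x. {M. \<forall>c<k. int p dvd (\<Sum>r<n. x r * M c r)}"
  have finY: "finite ?Y" by (rule finite_subset[OF Collect_restrict finite_sparse])
  have "measure_pmf.prob (col_law {..<k})
      {M. \<exists>x. 0 < weight (int p) n x \<and> weight (int p) n x < s \<and> (\<forall>c<k. int p dvd (\<Sum>r<n. x r * M c r))}
      \<le> measure_pmf.prob (col_law {..<k}) (\<Union>u\<in>?Y. ?E u)"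
  proof (rule measure_pmf.finite_measure_mono)
    show "{M. \<exists>x. 0 < weight (int p) n x \<and> weight (int p) n x < s \<and> (\<forall>c<k. int p dvd (\<Sum>r<n. x r * M c r))}
        \<subseteq> (\<Union>u\<in>?Y. ?E u)"
    proof
      fix M assume "M \<in> {M. \<exists>x. 0 < weight (int p) n x \<and> weight (int p) n x < s \<and> (\<forall>c<k. int p dvd (\<Sum>r<n. x r * M c r))}"
      then obtain x where x: "weight (int p) n x > 0" "weight (int p) n x < s"
        and d: "\<And>c. c < k \<Longrightarrow> int p dvd (\<Sum>r<n. x r * M c r)"
        by blast
      obtain x' where x': "x' \<in> residues_fun n (int p)" "weight (int p) n x' = weight (int p) n x \<and>
          (\<forall>z d. int p dvd (\<Sum>c<n. x' c * z c) - d \<longleftrightarrow> int p dvd (\<Sum>c<n. x c * z c) - d)"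
        using reduce_vector[OF p x(1)] ..
      note x' = x'(1) conjunct1[OF x'(2)] conjunct2[OF x'(2), rule_format]
      have "M \<in> ?E x'" using d x'(3)[of "M _" 0] by simp
      moreover have "x' \<in> ?Y" using x'(1,2) x by (simp add: sparse_def)
      ultimately show "M \<in> (\<Union>u\<in>?Y. ?E u)" by (rule UN_I[rotated])
    qed
  qed simp
  also have "\<dots> \<le> (\<Sum>u\<in>?Y. measure_pmf.prob (col_law {..<k}) (?E u))"
    using finY by (intro measure_pmf.finite_measure_subadditive_finite) auto
  also have "\<dots> \<le> (\<Sum>u\<in>?Y. \<gamma> ^ k)"
  proof (rule sum_mono)
    fix x assume x: "x \<in> ?Y"
    have "(1 / real p + (1 - 1 / real p) * \<beta> ^ weight (int p) n x) ^ k \<le> \<gamma> ^ k"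
      using x by (intro power_mono linear_form_sparse[OF p] linear_form_nonneg[OF p]) auto
    then show "measure_pmf.prob (col_law {..<k}) (?E x) \<le> \<gamma> ^ k"
      using prob_annihilated_le[OF p k, of x] by linarith
  qed
  also have "\<dots> = real (card ?Y) * \<gamma> ^ k" by simp
  also have "\<dots> \<le> real (card (sparse n p s)) * \<gamma> ^ k"
    using beta(1) by (intro mult_right_mono) (auto simp: \<gamma>_def intro!: card_mono finite_sparse)
  finally show ?thesis .
qed

end

section \<open>One step of the chain\<close>

text \<open>With one such surjection \<open>F0\<close> and a section \<open>v\<close> of it fixed,
  any other one is determined by its values on the section, which form a map from \<open>G\<close>
  to itself. The crude bound controls the contribution of exceptional columns.\<close>

lemma card_surj_with_kernel_le:
  assumes G: "comm_group G" "finite (carrier G)"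
  shows "card {F \<in> Hom n G. F ` carrier_vec n = carrier G \<and> ker G n F = U} \<le> card (carrier G) ^ card (carrier G)"
    and "finite {F \<in> Hom n G. F ` carrier_vec n = carrier G \<and> ker G n F = U}"
proof -
  let ?S = "{F \<in> Hom n G. F ` carrier_vec n = carrier G \<and> ker G n F = U}"
  have "card ?S \<le> card (carrier G) ^ card (carrier G) \<and> finite ?S"
  proof (cases "?S = {}")
    case True
    then show ?thesis by (simp only: card.empty finite.emptyI) simp
  next
    case False
    interpret comm_group G by (rule G(1))
    obtain F0 where F0: "F0 \<in> Hom n G" "F0 ` carrier_vec n = carrier G" "ker G n F0 = U" using False by blast
    interpret F0: Zn_hom G n F0 using F0(1) G(1) by (auto simp: Hom_def intro: Zn_homI)
    define v where "v x = inv_into (carrier_vec n) F0 x" for x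
    have v: "v x \<in> carrier_vec n" "F0 (v x) = x" if "x \<in> carrier G" for x
      using that unfolding v_def F0(2)[symmetric] by (auto intro: inv_into_into f_inv_into_f)
    let ?\<sigma> = "\<lambda>F. restrict (\<lambda>x. F (v x)) (carrier G)"
    have im: "?\<sigma> ` ?S \<subseteq> carrier G \<rightarrow>\<^sub>E carrier G"
      using v by (auto simp: Hom_def hom_def)
    have inj: "inj_on ?\<sigma> ?S"
    proof (rule inj_onI)
      fix F F' assume F: "F \<in> ?S" "F' \<in> ?S" and eq: "?\<sigma> F = ?\<sigma> F'"
      have *: "F'' u = F'' (v (F0 u))" if F'': "F'' \<in> ?S" and u: "u \<in> carrier_vec n" for F'' u
      proof -
        interpret F'': Zn_hom G n F'' using F'' G(1) by (auto simp: Hom_def intro: Zn_homI)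
        have vu: "v (F0 u) \<in> carrier_vec n" "F0 (v (F0 u)) = F0 u" using v[of "F0 u"] u by auto
        let ?w = "u - v (F0 u)"
        have "F0 ?w = \<one>\<^bsub>G\<^esub>" using F0.minus[OF u vu(1)] vu u by simp
        then have "?w \<in> ker G n F''" using F0(3) F'' u vu by (auto simp: ker_def)
        then have 1: "F'' ?w = \<one>\<^bsub>G\<^esub>" by (simp add: ker_def)
        have "u = ?w + v (F0 u)" using u vu(1) by (intro eq_vecI) auto
        then have "F'' u = F'' ?w \<otimes>\<^bsub>G\<^esub> F'' (v (F0 u))"
          using F''.add[of ?w "v (F0 u)"] u vu(1) by simp
        then show ?thesis using 1 vu(1) by simp
      qed
      show "F = F'"
      proof (rule extensionalityI[of _ "carrier_vec n"])
        fix u :: "int vec" assume u: "u \<in> carrier_vec n"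
        have "F (v (F0 u)) = F' (v (F0 u))"
          using fun_cong[OF eq, of "F0 u"] u by simp
        then show "F u = F' u" using *[OF F(1) u] *[OF F(2) u] by simp
      qed (use F in \<open>auto simp: Hom_def\<close>)
    qed
    have fin: "finite (carrier G \<rightarrow>\<^sub>E carrier G)" using G(2) by (simp add: finite_PiE)
    have "card ?S \<le> card (carrier G \<rightarrow>\<^sub>E carrier G)" using inj im fin by (rule card_inj_on_le)
    then show ?thesis
      using inj_on_finite[OF inj im fin] G(2) by (simp add: card_PiE)
  qed
  then show "card ?S \<le> card (carrier G) ^ card (carrier G)" "finite ?S" by blast+
qed

section \<open>One map of the flag and its lifts\<close>

locale flag_step = P_exponent b g + G: comm_group G + G': comm_group G' + \<pi>: group_hom G G' \<pi>
  for b g :: int and G :: "'a monoid" and G' :: "'a monoid" and \<pi> :: "'a \<Rightarrow> 'a" +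
  fixes P :: "nat set" and a :: int
  assumes finite_G: "finite (carrier G)" and finite_G': "finite (carrier G')"
    and \<pi>_surj: "\<pi> ` carrier G = carrier G'"
    and exp: "\<And>x. x \<in> carrier G \<Longrightarrow> x [^]\<^bsub>G\<^esub> g = \<one>\<^bsub>G\<^esub>"
    and abg: "a = b * g"
    and P: "finite P" "\<And>p. p \<in> P \<Longrightarrow> prime p \<and> int p dvd b" "\<And>p. prime p \<Longrightarrow> int p dvd a \<Longrightarrow> p \<in> P"
begin

lemma exp': "x \<in> carrier G' \<Longrightarrow> x [^]\<^bsub>G'\<^esub> g = \<one>\<^bsub>G'\<^esub>"
proof -
  assume "x \<in> carrier G'"
  then obtain y where "y \<in> carrier G" "x = \<pi> y" using \<pi>_surj by blast
  then show ?thesis using exp[of y] \<pi>.hom_int_pow[of y g] by simp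
qed

lemma a_pos: "a > 0" using abg bg by simp

lemma exp_a: "x \<in> carrier G \<Longrightarrow> x [^]\<^bsub>G\<^esub> a = \<one>\<^bsub>G\<^esub>"
  by (simp add: abg mult.commute[of b] G.int_pow_pow[symmetric] exp)

definition K :: nat where "K = card (kernel G G' \<pi>)"

lemma K_pos: "K > 0"
  using finite_G subgroup.one_closed[OF \<pi>.subgroup_kernel] by (auto simp: card_gt_0_iff kernel_def K_def)

text \<open>A lift that is not surjective takes values in a proper subgroup that still surjects onto
  the quotient; such a subgroup meets the kernel in at most half of it.\<close>

lemma card_nonsurjective_lifts_le:
  assumes F': "F' \<in> hom (Zn n) G'" "F' ` carrier_vec n = carrier G'"
    and C: "C \<in> carrier_mat n k" "inj_mod a n k (\<lambda>r c. C $$ (r, c))"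
    and van: "\<And>y. y \<in> carrier_vec k \<Longrightarrow> F' (C *\<^sub>v y) = \<one>\<^bsub>G'\<^esub>" and kn: "k \<le> n"
  shows "real (card {F \<in> Lifts n G \<pi> F'. (\<forall>y\<in>carrier_vec k. F (C *\<^sub>v y) = \<one>\<^bsub>G\<^esub>) \<and> F ` carrier_vec n \<noteq> carrier G})
    \<le> 2 ^ card (carrier G) * (real K / 2) ^ (n - k)"
proof -
  let ?N = "{F \<in> Lifts n G \<pi> F'. (\<forall>y\<in>carrier_vec k. F (C *\<^sub>v y) = \<one>\<^bsub>G\<^esub>) \<and> F ` carrier_vec n \<noteq> carrier G}"
  \<comment> \<open>The possible images of nonsurjective lifts. Bounding their number by that of all
    subsets of \<open>G\<close> gives the constant \<open>2 ^ card (carrier G)\<close>.\<close>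
  define \<U> where "\<U> = {U. subgroup U G \<and> U \<noteq> carrier G \<and> \<pi> ` U = carrier G'}"
  let ?L = "\<lambda>U. {F \<in> Lifts n (G\<lparr>carrier := U\<rparr>) \<pi> F'. \<forall>y\<in>carrier_vec k. F (C *\<^sub>v y) = \<one>\<^bsub>G\<lparr>carrier := U\<rparr>\<^esub>}"
  have U_sub: "\<U> \<subseteq> Pow (carrier G)" by (auto simp: \<U>_def dest: subgroup.subset)
  have fin\<U>: "finite \<U>" by (rule finite_subset[OF U_sub]) (simp add: finite_G)
  have cardL: "card (?L U) \<le> (K div 2) ^ (n - k)" and finL: "finite (?L U)" if U: "U \<in> \<U>" for U
  proof -
    have U': "subgroup U G" "U \<noteq> carrier G" "\<pi> ` U = carrier G'" using U by (auto simp: \<U>_def)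
    have Uc: "U \<subseteq> carrier G" using U'(1) by (rule subgroup.subset)
    interpret GU: comm_group "G\<lparr>carrier := U\<rparr>" using U'(1) by (rule G.subgroup_comm_group)
    have hom: "group_hom (G\<lparr>carrier := U\<rparr>) G' \<pi>"
      by (intro group_hom.intro group_hom_axioms.intro GU.is_group G'.is_group homI) (auto simp: subsetD[OF Uc])
    have finU: "finite (carrier (G\<lparr>carrier := U\<rparr>))" using Uc finite_G by (simp add: finite_subset)
    have pow: "x [^]\<^bsub>G\<lparr>carrier := U\<rparr>\<^esub> a = \<one>\<^bsub>G\<lparr>carrier := U\<rparr>\<^esub>" if "x \<in> carrier (G\<lparr>carrier := U\<rparr>)" for x
      using that Uc exp_a[of x] G.int_pow_consistent[OF U'(1), of x a] by auto
    have "card (?L U) = card (kernel (G\<lparr>carrier := U\<rparr>) G' \<pi>) ^ (n - k)"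
      by (rule card_Lifts_vanishing[OF GU.comm_group_axioms finU hom _ G'.comm_group_axioms F'(1) pow C a_pos van kn])
        (use U'(3) in auto)
    also have "\<dots> \<le> (K div 2) ^ (n - k)"
    proof (rule power_mono)
      let ?KU = "kernel (G\<lparr>carrier := U\<rparr>) G' \<pi>" and ?K = "kernel G G' \<pi>"
      have KU: "?KU = U \<inter> ?K" using Uc by (auto simp: kernel_def)
      have sub: "subgroup ?KU (G\<lparr>carrier := ?K\<rparr>)"
      proof -
        have "subgroup ?KU G" unfolding KU using U'(1) \<pi>.subgroup_kernel by (rule G.subgroups_Inter_pair)
        then show ?thesis by (rule G.subgroup_incl[OF _ \<pi>.subgroup_kernel]) (auto simp: KU)
      qed
      have "?KU \<noteq> ?K"
      proof
        assume eq: "?KU = ?K"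
        have "x \<in> U" if x: "x \<in> carrier G" for x
        proof -
          have "\<pi> x \<in> \<pi> ` U" unfolding U'(3) using x by simp
          then obtain u where u: "u \<in> U" "\<pi> x = \<pi> u" by blast
          then have uc: "u \<in> carrier G" using Uc by blast
          have "inv\<^bsub>G\<^esub> u \<otimes>\<^bsub>G\<^esub> x \<in> ?K" using u x uc by (simp add: kernel_def)
          then have "inv\<^bsub>G\<^esub> u \<otimes>\<^bsub>G\<^esub> x \<in> U" using eq KU by blast
          then have "u \<otimes>\<^bsub>G\<^esub> (inv\<^bsub>G\<^esub> u \<otimes>\<^bsub>G\<^esub> x) \<in> U" using u(1) subgroup.m_closed[OF U'(1)] by blast
          then show ?thesis using x uc by (simp add: G.m_assoc[symmetric])
        qed
        then show False using U'(2) Uc by blast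
      qed
      have finK: "finite ?K" using finite_G by (auto simp: kernel_def)
      interpret GK: group "G\<lparr>carrier := ?K\<rparr>"
        using \<pi>.subgroup_kernel G.is_group by (rule subgroup.subgroup_is_group)
      \<comment> \<open>Lagrange inside the kernel of \<open>\<pi>\<close>: the index of a proper
        subgroup is at least 2.\<close>
      have "card (rcosets\<^bsub>G\<lparr>carrier := ?K\<rparr>\<^esub> ?KU) * card ?KU = Coset.order (G\<lparr>carrier := ?K\<rparr>)"
        using GK.lagrange[OF sub] by (simp add: mult.commute)
      then have lag: "card (rcosets\<^bsub>G\<lparr>carrier := ?K\<rparr>\<^esub> ?KU) * card ?KU = K"
        by (simp add: Coset.order_def K_def)
      have "card (rcosets\<^bsub>G\<lparr>carrier := ?K\<rparr>\<^esub> ?KU) \<noteq> 1"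
      proof
        assume "card (rcosets\<^bsub>G\<lparr>carrier := ?K\<rparr>\<^esub> ?KU) = 1"
        then have "card ?KU = card ?K" using lag by (simp add: K_def)
        moreover have "?KU \<subseteq> ?K" using KU by blast
        ultimately show False using finK \<open>?KU \<noteq> ?K\<close> card_subset_eq by blast
      qed
      moreover have "card (rcosets\<^bsub>G\<lparr>carrier := ?K\<rparr>\<^esub> ?KU) \<noteq> 0" using lag K_pos by (metis mult_zero_left less_irrefl)
      ultimately have "2 \<le> card (rcosets\<^bsub>G\<lparr>carrier := ?K\<rparr>\<^esub> ?KU)" by linarith
      then have "2 * card ?KU \<le> K" using lag by (metis mult_le_mono1)
      then show "card ?KU \<le> K div 2" by linarith
    qed simp
    finally show "card (?L U) \<le> (K div 2) ^ (n - k)" .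
    have "finite (Lifts n (G\<lparr>carrier := U\<rparr>) \<pi> F')"
      by (rule card_Lifts(2)[OF GU.comm_group_axioms finU hom _ G'.comm_group_axioms F'(1)]) (use U'(3) in auto)
    then show "finite (?L U)" by (rule finite_subset[OF Collect_restrict])
  qed
  have "?N \<subseteq> (\<Union>U\<in>\<U>. ?L U)"
  proof
    fix F assume F: "F \<in> ?N"
    then have FH: "F \<in> hom (Zn n) G" "F \<in> extensional (carrier_vec n)" "\<And>v. v \<in> carrier_vec n \<Longrightarrow> \<pi> (F v) = F' v"
      by (auto simp: Lifts_def Hom_def)
    interpret F: Zn_hom G n F using G.comm_group_axioms FH(1) by (rule Zn_homI)
    define U where "U = F ` carrier_vec n"
    have "subgroup U G" unfolding U_def using group_hom.img_is_subgroup[OF F.group_hom] by simp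
    moreover have "\<pi> ` U = carrier G'" unfolding U_def F'(2)[symmetric] image_image using FH(3) by (intro image_cong) auto
    ultimately have "U \<in> \<U>" using F by (simp add: \<U>_def U_def)
    moreover have "F \<in> ?L U" using F FH by (auto simp: Lifts_def Hom_def hom_def U_def)
    ultimately show "F \<in> (\<Union>U\<in>\<U>. ?L U)" by (rule UN_I)
  qed
  then have "card ?N \<le> card (\<Union>U\<in>\<U>. ?L U)" using fin\<U> finL by (intro card_mono finite_UN_I)
  also have "\<dots> \<le> (\<Sum>U\<in>\<U>. card (?L U))" using fin\<U> by (rule card_UN_le)
  also have "\<dots> \<le> (\<Sum>U\<in>\<U>. (K div 2) ^ (n - k))" by (rule sum_mono) (rule cardL)
  also have "\<dots> = card \<U> * (K div 2) ^ (n - k)" by simp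
  also have "\<dots> \<le> 2 ^ card (carrier G) * (K div 2) ^ (n - k)"
    using card_mono[OF _ U_sub] finite_G by (intro mult_right_mono) (auto simp: card_Pow)
  finally have "real (card ?N) \<le> real (2 ^ card (carrier G) * (K div 2) ^ (n - k))"
    by (simp only: of_nat_le_iff)
  also have "\<dots> = 2 ^ card (carrier G) * real (K div 2) ^ (n - k)" by simp
  also have "\<dots> \<le> 2 ^ card (carrier G) * (real K / 2) ^ (n - k)"
    by (intro mult_left_mono power_mono) auto
  finally show ?thesis .
qed

end

text \<open>The sum is the expected number of events that occur.\<close>

lemma sum_prob_le_overlap:
  fixes C :: real
  assumes "finite I" and le: "\<And>x. real (card {i \<in> I. x \<in> E i}) \<le> C"
  shows "(\<Sum>i\<in>I. measure_pmf.prob p (E i)) \<le> C"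
proof -
  have "(\<Sum>i\<in>I. measure_pmf.prob p (E i)) = (\<Sum>i\<in>I. measure_pmf.expectation p (indicator (E i)))"
    by simp
  also have "\<dots> = measure_pmf.expectation p (\<lambda>x. \<Sum>i\<in>I. indicator (E i) x)"
    by (subst Bochner_Integration.integral_sum)
      (auto intro!: measure_pmf.integrable_const_bound[where B=1])
  also have "\<dots> \<le> C"
  proof (rule measure_pmf.integral_le_const)
    show "integrable p (\<lambda>x. \<Sum>i\<in>I. indicator (E i) x :: real)"
      by (intro Bochner_Integration.integrable_sum measure_pmf.integrable_const_bound[where B=1]) auto
    show "AE x in p. (\<Sum>i\<in>I. indicator (E i) x) \<le> C"
    proof (rule AE_I2)
      fix x
      have "(\<Sum>i\<in>I. indicator (E i) x :: real) = real (card {i \<in> I. x \<in> E i})"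
        using assms(1) by (simp add: indicator_def Int_def)
      then show "(\<Sum>i\<in>I. indicator (E i) x) \<le> C" using le by simp
    qed
  qed
  finally show ?thesis .
qed

lemma mult_in_lat:
  assumes "B \<in> carrier_mat n l" "y \<in> carrier_vec l" shows "B *\<^sub>v y \<in> lat n B a"
proof -
  have "B *\<^sub>v y = B *\<^sub>v y + a \<cdot>\<^sub>v 0\<^sub>v n" using assms by auto
  then show ?thesis unfolding lat_def mem_Collect_eq using assms
    by (intro exI[of _ y] exI[of _ "0\<^sub>v n"]) simp
qed

lemma col_in_lat: "B \<in> carrier_mat n l \<Longrightarrow> c < l \<Longrightarrow> col B c \<in> lat n B a"
  using mult_in_lat[of B n l "unit_vec l c"] by (simp add: mult_mat_unit_vec)

section \<open>Conditioning on the first columns of the new matrix\<close>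

locale step_instance = flag_step b g G G' \<pi> P a + RC: random_columns n a \<alpha> P q
  for b g :: int and G G' :: "'a monoid" and \<pi> :: "'a \<Rightarrow> 'a" and P :: "nat set" and a :: int
    and n :: nat and \<alpha> :: real and q :: "nat \<Rightarrow> nat \<Rightarrow> int pmf" +
  fixes R :: "int mat" and F' :: "int vec \<Rightarrow> 'a" and k m s :: nat
  assumes R: "R \<in> carrier_mat n n" and F': "F' \<in> hom (Zn n) G'" "F' ` carrier_vec n = carrier G'"
    and kerF': "ker G' n F' = lat n R a" and fin_q: "\<And>c r. c < n \<Longrightarrow> r < n \<Longrightarrow> finite (set_pmf (q c r))"
    and kn: "k \<le> n" and m: "m = n - k"
begin

definition SurLifts where
  "SurLifts = {F \<in> Lifts n G \<pi> F'. F ` carrier_vec n = carrier G}"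

definition mat_of :: "(nat \<Rightarrow> nat \<Rightarrow> int) \<Rightarrow> int mat" where
  "mat_of M = mat n n (\<lambda>(r, c). M c r)"

definition c_m :: real where "c_m = (\<Prod>p\<in>P. \<Prod>i<m. 1 - 1 / real p ^ Suc i)"

lemma mat_of: "mat_of M \<in> carrier_mat n n"
  by (simp add: mat_of_def)

lemma c_m_bounds: "0 \<le> c_m" "c_m \<le> 1"
proof -
  have *: "0 \<le> 1 - 1 / real p ^ Suc i \<and> 1 - 1 / real p ^ Suc i \<le> 1" if "p \<in> P" for p i
  proof -
    have "real p \<ge> 1" using RC.p_bounds[OF that] by simp
    then have "real p ^ Suc i \<ge> 1" by (rule one_le_power)
    then show ?thesis by simp
  qed
  show "0 \<le> c_m" unfolding c_m_def using * by (intro prod_nonneg) auto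
  show "c_m \<le> 1" unfolding c_m_def using * by (intro prod_le_1 conjI prod_nonneg) auto
qed

lemma finite_SurLifts: "finite SurLifts"
  unfolding SurLifts_def
  by (rule finite_subset[OF Collect_restrict
    card_Lifts(2)[OF G.comm_group_axioms finite_G \<pi>.group_hom_axioms \<pi>_surj G'.comm_group_axioms F'(1)]])

lemma LiftsD:
  assumes "F \<in> Lifts n G \<pi> F'"
  shows "F \<in> hom (Zn n) G" "\<And>v. v \<in> carrier_vec n \<Longrightarrow> \<pi> (F v) = F' v"
  using assms by (auto simp: Lifts_def Hom_def)

lemma event_iff:
  assumes F: "F \<in> Lifts n G \<pi> F'" and M: "M \<in> carrier_mat n n"
  shows "ker G n F = lat n (R * M) a \<longleftrightarrow> ker G n (\<lambda>v. F (R *\<^sub>v v)) = lat n M a"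
proof -
  have "ker G' n (\<lambda>v. \<pi> (F v)) = ker G' n F'"
    using LiftsD(2)[OF F] by (auto simp: ker_def)
  then have "ker G' n (\<lambda>v. \<pi> (F v)) = lat n R (b * g)" using kerF' abg by simp
  from sat_mult_iff[OF G.comm_group_axioms exp G'.comm_group_axioms exp' LiftsD(1)[OF F] \<pi>.homh R M this]
  show ?thesis by (simp add: abg)
qed

definition join :: "(nat \<Rightarrow> nat \<Rightarrow> int) \<Rightarrow> (nat \<Rightarrow> nat \<Rightarrow> int) \<Rightarrow> nat \<Rightarrow> nat \<Rightarrow> int" where
  "join A B c = (if c \<in> {..<k} then A c else B c)"

lemma mat_of_join: "mat_of (join A B) = mat n n (\<lambda>(r, c). if c < k then A c r else B c r)"
  unfolding mat_of_def join_def by (rule cong_mat) auto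

definition PB :: "(nat \<Rightarrow> nat \<Rightarrow> int) \<Rightarrow> (int vec \<Rightarrow> 'a) \<Rightarrow> real" where
  "PB A F = measure_pmf.prob (RC.col_law {k..<n}) {B. ker G n F = lat n (R * mat_of (join A B)) a}"

lemma finite_support: "finite (set_pmf (RC.col_law {..<k}))"
proof -
  have col: "finite (set_pmf (Pi_pmf {..<n} 0 (q c)))" if "c < n" for c
    unfolding set_Pi_pmf[OF finite_lessThan]
    by (rule finite_PiE_dflt[OF finite_lessThan]) (simp only: comp_apply fin_q[OF that] lessThan_iff)
  show ?thesis
    unfolding RC.col_law_def set_Pi_pmf[OF finite_lessThan]
  proof (rule finite_PiE_dflt[OF finite_lessThan])
    fix c assume "c \<in> {..<k}"
    then have "c < n" using kn by auto
    from col[OF this] show "finite ((set_pmf \<circ> (\<lambda>c. Pi_pmf {..<n} 0 (q c))) c)"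
      by (simp only: comp_apply)
  qed
qed

lemma prob_split:
  "measure_pmf.prob (RC.col_law {..<n}) {M. ker G n F = lat n (R * mat_of M) a} =
    (\<Sum>A\<in>set_pmf (RC.col_law {..<k}). pmf (RC.col_law {..<k}) A * PB A F)"
proof -
  have "{..<n} = {..<k} \<union> {k..<n}" using kn by auto
  then have "RC.col_law {..<n} = RC.col_law ({..<k} \<union> {k..<n})" by (rule arg_cong)
  also have "\<dots> = map_pmf (\<lambda>(f, h) x. if x \<in> {..<k} then f x else h x)
      (pair_pmf (RC.col_law {..<k}) (RC.col_law {k..<n}))"
    unfolding RC.col_law_def by (rule Pi_pmf_union) auto
  finally have "measure_pmf.prob (RC.col_law {..<n}) {M. ker G n F = lat n (R * mat_of M) a} =
      measure_pmf.prob (pair_pmf (RC.col_law {..<k}) (RC.col_law {k..<n}))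
        {z. ker G n F = lat n (R * mat_of (join (fst z) (snd z))) a}"
    by (simp add: vimage_def join_def[abs_def] case_prod_unfold)
  also have "\<dots> = (\<Sum>A\<in>set_pmf (RC.col_law {..<k}). pmf (RC.col_law {..<k}) A * PB A F)"
    unfolding PB_def by (rule prob_pair_pmf_finite[OF finite_support])
  finally show ?thesis .
qed

definition Am :: "(nat \<Rightarrow> nat \<Rightarrow> int) \<Rightarrow> int mat" where
  "Am A = mat n k (\<lambda>(r, c). A c r)"

lemma Am: "Am A \<in> carrier_mat n k" by (simp add: Am_def)

text \<open>Injectivity is asked of \<open>R * Am A\<close> because the lifts to be counted are
  those vanishing on its columns. It implies injectivity of \<open>Am A\<close>, on which the
  analysis of the remaining columns rests.\<close>

definition good :: "(nat \<Rightarrow> nat \<Rightarrow> int) \<Rightarrow> bool" where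
  "good A \<longleftrightarrow> (\<forall>p\<in>P. inj_mod (int p) n k (\<lambda>r c. (R * Am A) $$ (r, c)) \<and>
    (\<forall>x. 0 < weight (int p) n x \<longrightarrow> (\<forall>c<k. int p dvd (\<Sum>r<n. x r * A c r)) \<longrightarrow> s \<le> weight (int p) n x))"

lemma RA: "R * Am A \<in> carrier_mat n k" using R Am by simp

lemma RA_vec: "y \<in> carrier_vec k \<Longrightarrow> (R * Am A) *\<^sub>v y = R *\<^sub>v (Am A *\<^sub>v y)"
  using R Am by (rule assoc_mult_mat_vec)

lemma RA_index:
  assumes r: "r < n"
  shows "(\<Sum>c<k. (R * Am A) $$ (r, c) * y c) = (\<Sum>l<n. R $$ (r, l) * (\<Sum>c<k. y c * A c l))"
proof -
  have "(\<Sum>c<k. (R * Am A) $$ (r, c) * y c) = (\<Sum>c<k. (\<Sum>l<n. R $$ (r, l) * A c l) * y c)"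
  proof (rule sum.cong)
    fix c assume "c \<in> {..<k}"
    then have "(R * Am A) $$ (r, c) = (\<Sum>l<n. R $$ (r, l) * A c l)"
      using r R by (auto simp: Am_def scalar_prod_def atLeast0LessThan intro!: sum.cong)
    then show "(R * Am A) $$ (r, c) * y c = (\<Sum>l<n. R $$ (r, l) * A c l) * y c" by simp
  qed simp
  also have "\<dots> = (\<Sum>c<k. \<Sum>l<n. R $$ (r, l) * (y c * A c l))"
    unfolding sum_distrib_right by (simp only: mult_ac)
  also have "\<dots> = (\<Sum>l<n. \<Sum>c<k. R $$ (r, l) * (y c * A c l))" by (rule sum.swap)
  finally show ?thesis by (simp add: sum_distrib_left)
qed

text \<open>If the kernel is the required lattice, then \<open>F\<close> composed with
  \<open>R\<close> vanishes on all columns of the new matrix, in particular on those already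
  fixed.\<close>

lemma PB_eq_0:
  assumes F: "F \<in> Lifts n G \<pi> F'" and y: "y \<in> carrier_vec k" "F ((R * Am A) *\<^sub>v y) \<noteq> \<one>\<^bsub>G\<^esub>"
  shows "PB A F = 0"
proof -
  have "ker G n F \<noteq> lat n (R * mat_of (join A B)) a" for B
  proof
    let ?M = "mat_of (join A B)"
    assume "ker G n F = lat n (R * ?M) a"
    then have eq: "ker G n (\<lambda>v. F (R *\<^sub>v v)) = lat n ?M a" using event_iff[OF F mat_of] by simp
    have "Am A *\<^sub>v y \<in> lat n ?M a"
    proof (rule mat_mult_in_subgroup[OF lat_subgroup[OF mat_of] Am _ y(1)])
      fix c assume c: "c < k"
      have "col (Am A) c = col ?M c"
        using c kn unfolding mat_of_join Am_def by (intro eq_vecI) auto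
      then show "col (Am A) c \<in> lat n ?M a" using col_in_lat[OF mat_of, of c] c kn by simp
    qed
    then show False using y RA_vec[OF y(1)] unfolding eq[symmetric] by (simp add: ker_def)
  qed
  then show ?thesis unfolding PB_def by simp
qed

text \<open>For every completion \<open>B\<close> of the columns, the surjections counted share one
  prescribed kernel, so boundedly many of the events occur together. No property of \<open>A\<close>
  enters.\<close>

lemma sum_PB_le: "(\<Sum>F\<in>SurLifts. PB A F) \<le> real (card (carrier G)) ^ card (carrier G)"
  unfolding PB_def
proof (rule sum_prob_le_overlap[OF finite_SurLifts])
  fix B
  let ?U = "lat n (R * mat_of (join A B)) a"
  have "{F \<in> SurLifts. B \<in> {B. ker G n F = lat n (R * mat_of (join A B)) a}} \<subseteq>
      {F \<in> Hom n G. F ` carrier_vec n = carrier G \<and> ker G n F = ?U}"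
    by (auto simp: SurLifts_def Lifts_def)
  then have "card {F \<in> SurLifts. B \<in> {B. ker G n F = lat n (R * mat_of (join A B)) a}} \<le>
      card {F \<in> Hom n G. F ` carrier_vec n = carrier G \<and> ker G n F = ?U}"
    by (rule card_mono[OF card_surj_with_kernel_le(2)[OF G.comm_group_axioms finite_G]])
  also have "\<dots> \<le> card (carrier G) ^ card (carrier G)"
    by (rule card_surj_with_kernel_le(1)[OF G.comm_group_axioms finite_G])
  finally have "real (card {F \<in> SurLifts. B \<in> {B. ker G n F = lat n (R * mat_of (join A B)) a}}) \<le>
      real (card (carrier G) ^ card (carrier G))"
    by (simp only: of_nat_le_iff)
  then show "real (card {F \<in> SurLifts. B \<in> {B. ker G n F = lat n (R * mat_of (join A B)) a}}) \<le>
      real (card (carrier G)) ^ card (carrier G)"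
    by (simp only: of_nat_power)
qed

text \<open>An element of the kernel of \<open>\<pi>\<close> is \<open>F v\<close> with
  \<open>v\<close> in \<open>ker F' = R Z^n + a Z^n\<close>, and \<open>a\<close> kills
  \<open>G\<close>. So the image of the homomorphism handed to \<open>column_hom\<close> has order
  \<open>K\<close> for every lift.\<close>

lemma image_eq_kernel:
  assumes F: "F \<in> SurLifts"
  shows "(\<lambda>v. F (R *\<^sub>v v)) ` carrier_vec n = kernel G G' \<pi>"
proof (intro equalityI subsetI)
  have FL: "F \<in> Lifts n G \<pi> F'" using F by (simp add: SurLifts_def)
  interpret F: Zn_hom G n F using G.comm_group_axioms LiftsD(1)[OF FL] by (rule Zn_homI)
  {
    fix x assume "x \<in> (\<lambda>v. F (R *\<^sub>v v)) ` carrier_vec n"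
    then obtain v where v: "v \<in> carrier_vec n" "x = F (R *\<^sub>v v)" by blast
    have Rv: "R *\<^sub>v v \<in> carrier_vec n" using R v by auto
    have "R *\<^sub>v v \<in> ker G' n F'" unfolding kerF' using R v(1) by (rule mult_in_lat)
    then show "x \<in> kernel G G' \<pi>" using v Rv LiftsD(2)[OF FL Rv] by (simp add: kernel_def ker_def)
  next
    fix x assume x: "x \<in> kernel G G' \<pi>"
    then have "x \<in> F ` carrier_vec n" using F by (simp add: SurLifts_def kernel_def)
    then obtain v where v: "v \<in> carrier_vec n" "x = F v" by blast
    have "v \<in> ker G' n F'" using x v LiftsD(2)[OF FL v(1)] by (simp add: kernel_def ker_def)
    then obtain y z where yz: "v = R *\<^sub>v y + a \<cdot>\<^sub>v z" "y \<in> carrier_vec n" "z \<in> carrier_vec n"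
      unfolding kerF' using R by (auto simp: lat_def)
    have Ry: "R *\<^sub>v y \<in> carrier_vec n" using R yz by auto
    have "F v = F (R *\<^sub>v y)" unfolding yz(1) using Ry yz(3) by (simp add: exp_a)
    then show "x \<in> (\<lambda>v. F (R *\<^sub>v v)) ` carrier_vec n" using v yz(2) by blast
  }
qed

text \<open>Exactly \<open>K ^ m\<close> lifts kill the fixed columns and each surjective one
  contributes about \<open>c_m / K ^ m\<close>, so the main term no longer depends on the flag.
  Discarding the nonsurjective lifts costs a share of at most
  \<open>2 ^ card (carrier G) / 2 ^ m\<close>.\<close>

lemma good_bound:
  assumes A: "good A"
  shows "\<bar>(\<Sum>F\<in>SurLifts. PB A F) - c_m\<bar> \<le>
    real K ^ m * ((of_int a ^ m) ^ m * (real m * RC.\<beta> ^ s)) + 2 ^ card (carrier G) * (1 / 2) ^ m"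
proof -
  let ?C = "R * Am A"
  let ?van = "\<lambda>F. \<forall>y\<in>carrier_vec k. F (?C *\<^sub>v y) = \<one>\<^bsub>G\<^esub>"
  have inj_p: "inj_mod (int p) n k (\<lambda>r c. ?C $$ (r, c))" if "p \<in> P" for p
    using A that by (auto simp: good_def)
  have dense: "s \<le> weight (int p) n x"
    if "p \<in> P" "0 < weight (int p) n x" "\<And>c. c < k \<Longrightarrow> int p dvd (\<Sum>r<n. x r * A c r)" for p x
    using A that unfolding good_def by blast
  have "inj_mod (int (nat a)) n k (\<lambda>r c. ?C $$ (r, c))"
  proof (rule inj_mod_primes)
    show "nat a > 0" using a_pos by simp
    fix p assume p: "prime p" "p dvd nat a"
    then have "int p dvd a" using a_pos by (metis int_dvd_int_iff nat_0_le less_imp_le)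
    then show "inj_mod (int p) n k (\<lambda>r c. ?C $$ (r, c))" using P(3) p(1) inj_p by blast
  qed
  then have inj_a: "inj_mod a n k (\<lambda>r c. ?C $$ (r, c))" using a_pos by simp
  have inj_A: "inj_mod (int p) n k (\<lambda>r c. Am A $$ (r, c))" if p: "p \<in> P" for p
    unfolding inj_mod_def
  proof (intro allI impI)
    fix y c assume y: "\<forall>r<n. int p dvd (\<Sum>c<k. Am A $$ (r, c) * y c)" and c: "c < k"
    have Ay: "int p dvd (\<Sum>c<k. y c * A c r)" if "r < n" for r
    proof -
      have "(\<Sum>c<k. Am A $$ (r, c) * y c) = (\<Sum>c<k. y c * A c r)"
        using that by (intro sum.cong) (auto simp: Am_def)
      then show ?thesis using y that by metis
    qed
    have "int p dvd (\<Sum>c<k. ?C $$ (r, c) * y c)" if "r < n" for r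
      unfolding RA_index[OF that] by (intro dvd_sum dvd_mult Ay) simp
    then show "int p dvd y c" by (rule inj_modD[OF inj_p[OF p] _ c])
  qed
  have van': "F' (?C *\<^sub>v y) = \<one>\<^bsub>G'\<^esub>" if y: "y \<in> carrier_vec k" for y
  proof -
    have Ay: "Am A *\<^sub>v y \<in> carrier_vec n" using Am[of A] y by auto
    have "R *\<^sub>v (Am A *\<^sub>v y) \<in> ker G' n F'" unfolding kerF' using R Ay by (rule mult_in_lat)
    then show ?thesis unfolding RA_vec[OF y] by (simp add: ker_def)
  qed
  let ?X = "{F \<in> Lifts n G \<pi> F'. ?van F}"
  let ?Xs = "{F \<in> SurLifts. ?van F}"
  let ?N = "{F \<in> Lifts n G \<pi> F'. ?van F \<and> F ` carrier_vec n \<noteq> carrier G}"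
  have finX: "finite ?X"
    by (rule finite_subset[OF Collect_restrict
      card_Lifts(2)[OF G.comm_group_axioms finite_G \<pi>.group_hom_axioms \<pi>_surj G'.comm_group_axioms F'(1)]])
  have finXs: "finite ?Xs" by (rule finite_subset[OF Collect_restrict finite_SurLifts])
  have cardX: "card ?X = K ^ m"
    unfolding K_def m
    by (rule card_Lifts_vanishing[OF G.comm_group_axioms finite_G \<pi>.group_hom_axioms \<pi>_surj
      G'.comm_group_axioms F'(1) exp_a RA inj_a a_pos van' kn])
  have cardN: "real (card ?N) \<le> 2 ^ card (carrier G) * (real K / 2) ^ m"
    unfolding m by (rule card_nonsurjective_lifts_le[OF F' RA inj_a van' kn])
  have un: "?X = ?Xs \<union> ?N" "?Xs \<inter> ?N = {}" by (auto simp: SurLifts_def)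
  have finN: "finite ?N" by (rule finite_subset[OF _ finX]) blast
  have "card ?X = card ?Xs + card ?N"
    unfolding un(1) by (rule card_Un_disjoint[OF finXs finN un(2)])
  then have "real (K ^ m) = real (card ?Xs) + real (card ?N)"
    unfolding cardX by (simp only: of_nat_add)
  then have cardXs: "real (card ?Xs) = real K ^ m - real (card ?N)" by simp
  have near: "\<bar>PB A F - c_m / real K ^ m\<bar> \<le> (of_int a ^ m) ^ m * (real m * RC.\<beta> ^ s)" if F: "F \<in> ?Xs" for F
  proof -
    have FL: "F \<in> Lifts n G \<pi> F'" and FS: "F \<in> SurLifts" and Fv: "?van F" using F by (auto simp: SurLifts_def)
    interpret F: Zn_hom G n F using G.comm_group_axioms LiftsD(1)[OF FL] by (rule Zn_homI)
    have H: "(\<lambda>v. F (R *\<^sub>v v)) \<in> hom (Zn n) G"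
      using R by (auto simp: hom_def mult_add_distrib_mat_vec[of _ n n])
    interpret H: column_hom n k a "Am A" G b g "\<lambda>v. F (R *\<^sub>v v)" P
    proof unfold_locales
      show "inj_mod (int p) n k (\<lambda>r c. Am A $$ (r, c))" if "prime p" "int p dvd a" for p
        using inj_A P(3)[OF that] .
      show "F (R *\<^sub>v (Am A *\<^sub>v y)) = \<one>\<^bsub>G\<^esub>" if "y \<in> carrier_vec k" for y
        using Fv that unfolding RA_vec[OF that, symmetric] by blast
    qed (use Am kn a_pos finite_G exp abg bg H P in auto)
    have "PB A F = measure_pmf.prob (Pi_pmf {k..<n} (\<lambda>_. 0) (\<lambda>c. Pi_pmf {..<n} 0 (q c)))
        {B. ker G n (\<lambda>v. F (R *\<^sub>v v)) = lat n (mat n n (\<lambda>(r, c). if c < k then A c r else B c r)) a}"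
      by (simp only: PB_def RC.col_law_def event_iff[OF FL mat_of]) (simp only: mat_of_join)
    moreover have "K = card ((\<lambda>v. F (R *\<^sub>v v)) ` carrier_vec n)"
      unfolding image_eq_kernel[OF FS] K_def ..
    moreover have "\<bar>measure_pmf.prob (Pi_pmf {k..<n} (\<lambda>_. 0) (\<lambda>c. Pi_pmf {..<n} 0 (q c)))
        {B. ker G n (\<lambda>v. F (R *\<^sub>v v)) = lat n (mat n n (\<lambda>(r, c). if c < k then A c r else B c r)) a}
      - (\<Prod>p\<in>P. \<Prod>i<m. 1 - 1 / real p ^ Suc i) / real (card ((\<lambda>v. F (R *\<^sub>v v)) ` carrier_vec n)) ^ m\<bar>
      \<le> (of_int a ^ m) ^ m * (real m * decay \<alpha> a ^ s)"
    proof (rule H.prob_ker_eq_lat)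
      show "balanced_pmf \<alpha> (int p) (q c r)" if "prime p" "int p dvd a" "c \<in> {k..<n}" "r < n" for p c r
        using RC.q[OF P(3)[OF that(1,2)]] that by simp
      show "s \<le> weight (int p) n x"
        if "prime p" "int p dvd a" "0 < weight (int p) n x" "\<forall>c<k. int p dvd (\<Sum>r<n. x r * Am A $$ (r, c))" for p x
      proof (rule dense[OF P(3)[OF that(1,2)] that(3)])
        fix c assume c: "c < k"
        have "(\<Sum>r<n. x r * Am A $$ (r, c)) = (\<Sum>r<n. x r * A c r)"
          using c by (intro sum.cong) (auto simp: Am_def)
        then show "int p dvd (\<Sum>r<n. x r * A c r)" using that(4) c by metis
      qed
    qed (use RC.\<alpha> m in \<open>auto simp: Am_def\<close>)
    ultimately show ?thesis by (simp only: c_m_def)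
  qed
  have K0: "real K ^ m > 0" using K_pos by simp
  have "(\<Sum>F\<in>SurLifts. PB A F) = (\<Sum>F\<in>?Xs. PB A F)"
  proof (rule sum.mono_neutral_right[OF finite_SurLifts])
    show "\<forall>F\<in>SurLifts - ?Xs. PB A F = 0"
      using PB_eq_0 by (auto simp: SurLifts_def)
  qed auto
  also have "\<dots> = (\<Sum>F\<in>?Xs. PB A F - c_m / real K ^ m) + real (card ?Xs) * (c_m / real K ^ m)"
    by (simp add: sum_subtractf)
  also have "real (card ?Xs) * (c_m / real K ^ m) = c_m - real (card ?N) * (c_m / real K ^ m)"
    unfolding cardXs using K0 by (simp add: field_simps)
  finally have "\<bar>(\<Sum>F\<in>SurLifts. PB A F) - c_m\<bar> \<le>
      \<bar>\<Sum>F\<in>?Xs. PB A F - c_m / real K ^ m\<bar> + \<bar>real (card ?N) * (c_m / real K ^ m)\<bar>"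
    by linarith
  also have "\<bar>\<Sum>F\<in>?Xs. PB A F - c_m / real K ^ m\<bar> \<le> (\<Sum>F\<in>?Xs. (of_int a ^ m) ^ m * (real m * RC.\<beta> ^ s))"
    by (rule order.trans[OF sum_abs], rule sum_mono) (rule near)
  also have "\<dots> = real (card ?Xs) * ((of_int a ^ m) ^ m * (real m * RC.\<beta> ^ s))" by simp
  also have "\<dots> \<le> real K ^ m * ((of_int a ^ m) ^ m * (real m * RC.\<beta> ^ s))"
    using cardXs a_pos RC.beta(1) by (intro mult_right_mono) auto
  also have "\<bar>real (card ?N) * (c_m / real K ^ m)\<bar> = real (card ?N) / real K ^ m * c_m"
    using K0 c_m_bounds(1) by simp
  also have "\<dots> \<le> (2 ^ card (carrier G) * (real K / 2) ^ m) / real K ^ m * 1"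
    using cardN K0 c_m_bounds by (intro mult_mono divide_right_mono) auto
  also have "\<dots> = 2 ^ card (carrier G) * (1 / 2) ^ m"
    using K0 by (simp add: power_divide)
  finally show ?thesis by simp
qed

text \<open>A square matrix has kernel and left kernel of the same size modulo \<open>p\<close>. A
  vector of the left kernel defines a character that vanishes on \<open>R Z^n + a Z^n\<close>, which
  is the kernel of \<open>F'\<close>, so it factors through \<open>G'\<close> and is determined by
  its values there.\<close>

lemma card_kernel_mod_le:
  assumes p: "p \<in> P"
  shows "card {d \<in> residues_fun n (int p). \<forall>r<n. int p dvd (\<Sum>l<n. R $$ (r, l) * d l)} \<le> p ^ card (carrier G')"
proof -
  let ?D = "{d \<in> residues_fun n (int p). \<forall>r<n. int p dvd (\<Sum>l<n. R $$ (r, l) * d l)}"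
  let ?X = "{x \<in> residues_fun n (int p). \<forall>c<n. int p dvd (\<Sum>r<n. x r * R $$ (r, c))}"
  interpret F': Zn_hom G' n F' using G'.comm_group_axioms F'(1) by (rule Zn_homI)
  have p0: "int p > 0" using RC.p_bounds[OF p] by simp
  have pa: "int p dvd a" using RC.P[OF p] by simp
  have "of_nat (card ?D) * (of_int (int p) :: complex) ^ n = of_int (int p) ^ n * of_nat (card ?X)"
    using count_solutions[OF p0, of n n "\<lambda>r c. R $$ (r, c)" "\<lambda>_. 0"] by simp
  then have "card ?D = card ?X" using p0 by simp
  define v where "v x = inv_into (carrier_vec n) F' x" for x
  have v: "v x \<in> carrier_vec n" "F' (v x) = x" if "x \<in> carrier G'" for x
    using that unfolding v_def F'(2)[symmetric] by (auto intro: inv_into_into f_inv_into_f)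
  let ?\<sigma> = "\<lambda>x. restrict (\<lambda>u. (\<Sum>r<n. x r * v u $ r) mod int p) (carrier G')"
  have inj: "inj_on ?\<sigma> ?X"
  proof (rule inj_onI)
    fix x x' assume x: "x \<in> ?X" "x' \<in> ?X" and eq: "?\<sigma> x = ?\<sigma> x'"
    have *: "y i mod int p = (\<Sum>r<n. y r * v (F' (unit_vec n i)) $ r) mod int p"
      if y: "y \<in> ?X" and i: "i < n" for y i
    proof -
      let ?w = "unit_vec n i - v (F' (unit_vec n i))"
      have vc: "v (F' (unit_vec n i)) \<in> carrier_vec n" "F' (v (F' (unit_vec n i))) = F' (unit_vec n i)"
        using v[of "F' (unit_vec n i)"] by auto
      have "?w \<in> ker G' n F'"
        using F'.minus[of "unit_vec n i" "v (F' (unit_vec n i))"] vc by (simp add: ker_def)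
      then obtain y' z where yz: "?w = R *\<^sub>v y' + a \<cdot>\<^sub>v z" "y' \<in> carrier_vec n" "z \<in> carrier_vec n"
        unfolding kerF' using R by (auto simp: lat_def)
      have w: "?w $ r = (\<Sum>l<n. R $$ (r, l) * y' $ l) + a * z $ r" if "r < n" for r
        unfolding yz(1) using that R yz(2,3) by (auto simp: scalar_prod_def atLeast0LessThan intro!: sum.cong)
      have "(\<Sum>r<n. y r * ?w $ r) = (\<Sum>r<n. \<Sum>l<n. y r * R $$ (r, l) * y' $ l) + a * (\<Sum>r<n. y r * z $ r)"
        unfolding sum_distrib_left sum.distrib[symmetric]
        by (intro sum.cong refl) (simp add: w ring_distribs sum_distrib_left mult_ac)
      also have "(\<Sum>r<n. \<Sum>l<n. y r * R $$ (r, l) * y' $ l) = (\<Sum>l<n. (\<Sum>r<n. y r * R $$ (r, l)) * y' $ l)"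
        unfolding sum_distrib_right by (rule sum.swap)
      finally have e: "(\<Sum>r<n. y r * ?w $ r) = (\<Sum>l<n. (\<Sum>r<n. y r * R $$ (r, l)) * y' $ l) + a * (\<Sum>r<n. y r * z $ r)" .
      have "int p dvd (\<Sum>r<n. y r * R $$ (r, l))" if "l < n" for l
        using y that by blast
      then have "int p dvd (\<Sum>l<n. (\<Sum>r<n. y r * R $$ (r, l)) * y' $ l)"
        by (rule dvd_sum[OF dvd_mult2]) (simp only: lessThan_iff)
      then have "int p dvd (\<Sum>r<n. y r * ?w $ r)"
        unfolding e using pa by (intro dvd_add dvd_mult2)
      also have "(\<Sum>r<n. y r * ?w $ r) = (\<Sum>r<n. y r * (if r = i then 1 else 0)) - (\<Sum>r<n. y r * v (F' (unit_vec n i)) $ r)"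
        unfolding sum_subtractf[symmetric] right_diff_distrib[symmetric]
        using vc(1) i by (intro sum.cong refl) auto
      also have "(\<Sum>r<n. y r * (if r = i then 1 else 0)) = y i"
        using i by (simp add: if_distrib[of "\<lambda>t. _ * t"] sum.delta cong: if_cong)
      finally show ?thesis by (simp add: mod_eq_dvd_iff)
    qed
    show "x = x'"
    proof (rule PiE_ext[of x "{..<n}" "\<lambda>_. {0..<int p}"])
      show "x \<in> residues_fun n (int p)" "x' \<in> residues_fun n (int p)" using x by simp_all
      fix i assume i: "i \<in> {..<n}"
      have "x i mod int p = x' i mod int p"
        using *[OF x(1), of i] *[OF x(2), of i] fun_cong[OF eq, of "F' (unit_vec n i)"] i by simp
      moreover have "x i \<in> {0..<int p}" "x' i \<in> {0..<int p}"
        using PiE_mem[of x "{..<n}" "\<lambda>_. {0..<int p}" i] PiE_mem[of x' "{..<n}" "\<lambda>_. {0..<int p}" i] x i by simp_all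
      ultimately show "x i = x' i" by (metis atLeastLessThan_iff mod_pos_pos_trivial)
    qed
  qed
  have "?\<sigma> ` ?X \<subseteq> carrier G' \<rightarrow>\<^sub>E {0..<int p}" using p0 by auto
  then have "card ?X \<le> card (carrier G' \<rightarrow>\<^sub>E {0..<int p})"
    by (intro card_inj_on_le[OF inj]) (simp_all add: finite_PiE finite_G')
  also have "\<dots> = p ^ card (carrier G')" using finite_G' by (simp add: card_PiE)
  finally show ?thesis using \<open>card ?D = card ?X\<close> by simp
qed

definition bad_bound :: real where
  "bad_bound = (\<Sum>p\<in>P. real p ^ card (carrier G') *
      (real (card (RC.sparse k p s)) * RC.\<gamma> ^ n + real p ^ k * (1 / real p + RC.\<beta> ^ s) ^ n)
    + real (card (RC.sparse n p s)) * RC.\<gamma> ^ k)"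

text \<open>\<open>R A y = 0\<close> modulo \<open>p\<close> means that \<open>A y\<close> is
  congruent to one of the boundedly many \<open>d\<close> in the kernel of \<open>R\<close>. This
  puts the failure of injectivity into the form treated by \<open>prob_kernel_le\<close>.\<close>

lemma prob_bad_le: "measure_pmf.prob (RC.col_law {..<k}) {A. \<not> good A} \<le> bad_bound"
proof -
  let ?D = "\<lambda>p. {d \<in> residues_fun n (int p). \<forall>r<n. int p dvd (\<Sum>l<n. R $$ (r, l) * d l)}"
  let ?B1 = "\<lambda>p. {A. \<exists>y. weight (int p) k y > 0 \<and> (\<exists>d\<in>?D p. \<forall>r<n. int p dvd (\<Sum>c<k. y c * A c r) - d r)}"
  let ?B2 = "\<lambda>p. {A. \<exists>x. 0 < weight (int p) n x \<and> weight (int p) n x < s \<and> (\<forall>c<k. int p dvd (\<Sum>r<n. x r * A c r))}"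
  have finD: "finite (?D p)" for p by (rule finite_subset[OF Collect_restrict finite_residues_fun])
  have B1: "A \<in> ?B1 p" if p: "p \<in> P" and n: "\<not> inj_mod (int p) n k (\<lambda>r c. (R * Am A) $$ (r, c))" for A p
  proof -
    obtain y c where y: "\<And>r. r < n \<Longrightarrow> int p dvd (\<Sum>c<k. (R * Am A) $$ (r, c) * y c)" and c: "c < k" "\<not> int p dvd y c"
      using n unfolding inj_mod_def by blast
    have "c \<in> {r \<in> {..<k}. \<not> int p dvd y r}" using c by simp
    then have "weight (int p) k y > 0" unfolding weight_def by (subst card_gt_0_iff) auto
    define d where "d = restrict (\<lambda>r. (\<Sum>c<k. y c * A c r) mod int p) {..<n}"
    have p0: "int p > 0" using RC.p_bounds[OF p] by simp
    have diff: "int p dvd (\<Sum>c<k. y c * A c r) - d r" if "r < n" for r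
      using that by (simp add: d_def minus_mod_eq_mult_div)
    have "int p dvd (\<Sum>l<n. R $$ (r, l) * d l)" if r: "r < n" for r
    proof -
      have "int p dvd (\<Sum>l<n. R $$ (r, l) * ((\<Sum>c<k. y c * A c l) - d l))"
        by (intro dvd_sum dvd_mult diff) simp
      also have "(\<Sum>l<n. R $$ (r, l) * ((\<Sum>c<k. y c * A c l) - d l)) =
          (\<Sum>c<k. (R * Am A) $$ (r, c) * y c) - (\<Sum>l<n. R $$ (r, l) * d l)"
        unfolding RA_index[OF r] by (simp only: right_diff_distrib sum_subtractf)
      finally have "int p dvd (\<Sum>c<k. (R * Am A) $$ (r, c) * y c) - (\<Sum>l<n. R $$ (r, l) * d l)" .
      then show ?thesis using y[OF r] by (metis dvd_diff diff_diff_eq2 add_diff_cancel_left')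
    qed
    moreover have "d \<in> residues_fun n (int p)" using p0 by (simp add: d_def)
    ultimately have "d \<in> ?D p" by simp
    with \<open>weight (int p) k y > 0\<close> diff show ?thesis by blast
  qed
  have "{A. \<not> good A} \<subseteq> (\<Union>p\<in>P. ?B1 p \<union> ?B2 p)"
  proof
    fix A assume "A \<in> {A. \<not> good A}"
    then obtain p where p: "p \<in> P" and or: "\<not> inj_mod (int p) n k (\<lambda>r c. (R * Am A) $$ (r, c)) \<or>
        (\<exists>x. 0 < weight (int p) n x \<and> (\<forall>c<k. int p dvd (\<Sum>r<n. x r * A c r)) \<and> \<not> s \<le> weight (int p) n x)"
      unfolding good_def by blast
    from or have "A \<in> ?B1 p \<union> ?B2 p"
    proof
      assume "\<not> inj_mod (int p) n k (\<lambda>r c. (R * Am A) $$ (r, c))"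
      then show ?thesis using B1[OF p] by blast
    next
      assume "\<exists>x. 0 < weight (int p) n x \<and> (\<forall>c<k. int p dvd (\<Sum>r<n. x r * A c r)) \<and> \<not> s \<le> weight (int p) n x"
      then obtain x where "0 < weight (int p) n x" "\<forall>c<k. int p dvd (\<Sum>r<n. x r * A c r)" "weight (int p) n x < s"
        by (auto simp: not_le)
      then have "A \<in> ?B2 p" unfolding mem_Collect_eq by (intro exI[of _ x] conjI)
      then show ?thesis by (rule UnI2)
    qed
    then show "A \<in> (\<Union>p\<in>P. ?B1 p \<union> ?B2 p)" using p by (rule UN_I[rotated])
  qed
  then have "measure_pmf.prob (RC.col_law {..<k}) {A. \<not> good A} \<le> measure_pmf.prob (RC.col_law {..<k}) (\<Union>p\<in>P. ?B1 p \<union> ?B2 p)"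
    by (rule measure_pmf.finite_measure_mono) simp
  also have "\<dots> \<le> (\<Sum>p\<in>P. measure_pmf.prob (RC.col_law {..<k}) (?B1 p \<union> ?B2 p))"
    by (rule measure_pmf.finite_measure_subadditive_finite) (use P(1) in auto)
  also have "\<dots> \<le> bad_bound"
    unfolding bad_bound_def
  proof (rule sum_mono)
    fix p assume p: "p \<in> P"
    let ?E = "real (card (RC.sparse k p s)) * RC.\<gamma> ^ n + real p ^ k * (1 / real p + RC.\<beta> ^ s) ^ n"
    have E0: "0 \<le> ?E" using RC.beta(1) by (simp add: RC.\<gamma>_def)
    have "measure_pmf.prob (RC.col_law {..<k}) (?B1 p \<union> ?B2 p) \<le>
        measure_pmf.prob (RC.col_law {..<k}) (?B1 p) + measure_pmf.prob (RC.col_law {..<k}) (?B2 p)"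
      by (rule measure_Un_le) auto
    also have "\<dots> \<le> real (card (?D p)) * ?E + real (card (RC.sparse n p s)) * RC.\<gamma> ^ k"
      by (intro add_mono RC.prob_kernel_le[OF p kn finD] RC.prob_not_dense_le[OF p kn])
    also have "\<dots> \<le> real p ^ card (carrier G') * ?E + real (card (RC.sparse n p s)) * RC.\<gamma> ^ k"
    proof (intro add_right_mono mult_right_mono E0)
      have "real (card (?D p)) \<le> real (p ^ card (carrier G'))"
        using card_kernel_mod_le[OF p] by (simp only: of_nat_le_iff)
      then show "real (card (?D p)) \<le> real p ^ card (carrier G')" by (simp only: of_nat_power)
    qed
    finally show "measure_pmf.prob (RC.col_law {..<k}) (?B1 p \<union> ?B2 p) \<le>
        real p ^ card (carrier G') * ?E + real (card (RC.sparse n p s)) * RC.\<gamma> ^ k" .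
  qed
  finally show ?thesis .
qed

text \<open>Average over the fixed columns. Where they are not good, the crude bound for the sum and
  \<open>c_m \<le> 1\<close> for the target account for the two summands of the factor in front of
  \<open>bad_bound\<close>.\<close>

theorem step_bound:
  "\<bar>(\<Sum>F\<in>SurLifts. measure_pmf.prob (RC.col_law {..<n}) {M. ker G n F = lat n (R * mat_of M) a}) - c_m\<bar>
    \<le> real K ^ m * ((of_int a ^ m) ^ m * (real m * RC.\<beta> ^ s)) + 2 ^ card (carrier G) * (1 / 2) ^ m
      + (real (card (carrier G)) ^ card (carrier G) + 1) * bad_bound"
proof -
  let ?Q = "RC.col_law {..<k}"
  let ?S = "\<lambda>A. \<Sum>F\<in>SurLifts. PB A F"
  let ?\<eta> = "real K ^ m * ((of_int a ^ m) ^ m * (real m * RC.\<beta> ^ s)) + 2 ^ card (carrier G) * (1 / 2) ^ m"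
  let ?C = "real (card (carrier G)) ^ card (carrier G) + 1"
  have sum1: "(\<Sum>A\<in>set_pmf ?Q. pmf ?Q A) = 1" by (rule sum_pmf_eq_1[OF finite_support]) simp
  have "(\<Sum>F\<in>SurLifts. measure_pmf.prob (RC.col_law {..<n}) {M. ker G n F = lat n (R * mat_of M) a}) =
      (\<Sum>A\<in>set_pmf ?Q. pmf ?Q A * ?S A)"
    unfolding prob_split by (subst sum.swap) (simp only: sum_distrib_left)
  then have "\<bar>(\<Sum>F\<in>SurLifts. measure_pmf.prob (RC.col_law {..<n}) {M. ker G n F = lat n (R * mat_of M) a}) - c_m\<bar> =
      \<bar>\<Sum>A\<in>set_pmf ?Q. pmf ?Q A * (?S A - c_m)\<bar>"
    by (simp add: right_diff_distrib sum_subtractf sum_distrib_right[symmetric] sum1)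
  also have "\<dots> \<le> (\<Sum>A\<in>set_pmf ?Q. pmf ?Q A * (?\<eta> + (if \<not> good A then ?C else 0)))"
  proof (rule order.trans[OF sum_abs], rule sum_mono)
    fix A
    have "\<bar>?S A - c_m\<bar> \<le> ?\<eta> + (if \<not> good A then ?C else 0)"
    proof (cases "good A")
      case True
      then show ?thesis using good_bound by simp
    next
      case False
      have "0 \<le> ?S A" by (intro sum_nonneg) (simp add: PB_def)
      moreover have "0 \<le> ?\<eta>" using a_pos RC.beta(1) by simp
      ultimately show ?thesis using False sum_PB_le[of A] c_m_bounds by (simp add: abs_le_iff)
    qed
    then show "\<bar>pmf ?Q A * (?S A - c_m)\<bar> \<le> pmf ?Q A * (?\<eta> + (if \<not> good A then ?C else 0))"
      by (simp add: abs_mult mult_left_mono)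
  qed
  also have "\<dots> = ?\<eta> + ?C * (\<Sum>A\<in>set_pmf ?Q. if \<not> good A then pmf ?Q A else 0)"
  proof -
    have "(\<Sum>A\<in>set_pmf ?Q. pmf ?Q A * (?\<eta> + (if \<not> good A then ?C else 0))) =
        (\<Sum>A\<in>set_pmf ?Q. pmf ?Q A * ?\<eta>) + (\<Sum>A\<in>set_pmf ?Q. ?C * (if \<not> good A then pmf ?Q A else 0))"
      unfolding sum.distrib[symmetric] by (intro sum.cong refl) (simp add: ring_distribs)
    then show ?thesis
      unfolding sum_distrib_right[symmetric] sum_distrib_left[symmetric] sum1 by simp
  qed
  also have "(\<Sum>A\<in>set_pmf ?Q. if \<not> good A then pmf ?Q A else 0) = measure_pmf.prob ?Q {A. \<not> good A}"
  proof -
    have "measure_pmf.prob ?Q {A. \<not> good A} = measure_pmf.prob ?Q ({A. \<not> good A} \<inter> set_pmf ?Q)"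
      by (rule measure_Int_set_pmf[symmetric])
    also have "{A. \<not> good A} \<inter> set_pmf ?Q = {A \<in> set_pmf ?Q. \<not> good A}" by auto
    also have "measure_pmf.prob ?Q \<dots> = (\<Sum>A\<in>{A \<in> set_pmf ?Q. \<not> good A}. pmf ?Q A)"
      using finite_support by (intro measure_measure_pmf_finite) auto
    also have "\<dots> = (\<Sum>A\<in>set_pmf ?Q. if \<not> good A then pmf ?Q A else 0)"
      by (rule sum.inter_filter[OF finite_support])
    finally show ?thesis ..
  qed
  also have "?\<eta> + ?C * measure_pmf.prob ?Q {A. \<not> good A} \<le> ?\<eta> + ?C * bad_bound"
    by (intro add_left_mono mult_left_mono prob_bad_le) simp
  finally show ?thesis .
qed

end

section \<open>The limit of one step\<close>

lemma convergent_prod_euler: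
  assumes "prime p" shows "convergent_prod (\<lambda>i. 1 - 1 / real p ^ Suc i)"
proof -
  have p: "real p \<ge> 2" using prime_ge_2_nat[OF assms] by simp
  have "summable (\<lambda>i. (1 / real p) * (1 / real p) ^ i)"
    using p by (intro summable_mult summable_geometric) simp
  then have "summable (\<lambda>i. \<bar>- (1 / real p ^ Suc i)\<bar>)"
    by (simp add: power_divide)
  moreover have "- (1 / real p ^ Suc i) \<noteq> - 1" for i
  proof -
    have "1 < real p ^ Suc i" using p by (intro one_less_power) auto
    then have "1 / real p ^ Suc i < 1" by (subst divide_less_eq_1_pos) linarith+
    then show ?thesis by linarith
  qed
  ultimately have "convergent_prod (\<lambda>i. 1 + - (1 / real p ^ Suc i))"
    by (rule summable_imp_convergent_prod_real)
  then show ?thesis by simp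
qed

lemma euler_products_tendsto:
  assumes "\<And>p. p \<in> P \<Longrightarrow> prime p"
  shows "(\<lambda>m. \<Prod>p\<in>P. \<Prod>i<m. 1 - 1 / real p ^ Suc i) \<longlonglongrightarrow> (\<Prod>p\<in>P. prodinf (\<lambda>i. 1 - 1 / real p ^ Suc i))"
proof (rule tendsto_prod)
  fix p assume "p \<in> P"
  from convergent_prod_LIMSEQ[OF convergent_prod_euler[OF assms[OF this]]]
  show "(\<lambda>m. \<Prod>i<m. 1 - 1 / real p ^ Suc i) \<longlonglongrightarrow> prodinf (\<lambda>i. 1 - 1 / real p ^ Suc i)"
    using LIMSEQ_lessThan_iff_atMost[of "\<lambda>A. \<Prod>i\<in>A. 1 - 1 / real p ^ Suc i"] by simp
qed

text \<open>The sparseness threshold \<open>\<delta> n\<close> is chosen so small that the entropy of the sparse vectors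
  is beaten by the decay \<open>\<gamma> ^ n\<close>.\<close>

lemma sparseness_threshold:
  fixes \<gamma> A :: real
  assumes "0 < \<gamma>" "\<gamma> < 1" "A \<ge> 1"
  obtains l \<delta> \<theta> where "0 < l" "l \<le> 1" "\<delta> > 0" "0 < \<theta>" "\<theta> < 1"
    "l powr (- \<delta>) * (1 + A * l) * \<gamma> = \<theta>"
proof -
  \<comment> \<open>Gives \<open>A * l = (1 - \<gamma>) / 2\<close>, small enough for
    \<open>Q\<close> to stay below 1.\<close>
  define l where "l = (1 - \<gamma>) / (2 * A)"
  have l: "0 < l" "l < 1" using assms by (auto simp: l_def field_simps)
  define Q where "Q = (1 + A * l) * \<gamma>"
  have "Q = \<gamma> + (1 - \<gamma>) * (\<gamma> / 2)" using assms by (simp add: Q_def l_def field_simps)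
  also have "\<dots> < \<gamma> + (1 - \<gamma>) * 1" using assms by (intro add_strict_left_mono mult_strict_left_mono) auto
  finally have Q1: "Q < 1" by simp
  have Q0: "0 < Q" using assms l by (auto simp: Q_def intro!: mult_pos_pos add_pos_pos)
  \<comment> \<open>Makes \<open>l powr (- \<delta>)\<close> equal to \<open>1 / sqrt Q\<close>, so
    half of the exponential gain is spent on the threshold and the rate
    \<open>\<theta> = sqrt Q\<close> is left.\<close>
  define \<delta> where "\<delta> = ln Q / (2 * ln l)"
  have "ln l < 0" "ln Q < 0" using l Q0 Q1 by auto
  then have \<delta>: "\<delta> > 0" by (simp add: \<delta>_def divide_neg_neg)
  have "l powr (- \<delta>) = exp (- (ln Q / 2))"
    using l \<open>ln l < 0\<close> by (simp add: powr_def \<delta>_def)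
  then have "l powr (- \<delta>) * Q = exp (- (ln Q / 2)) * exp (ln Q)" using Q0 by simp
  also have "\<dots> = exp (ln Q / 2)" by (simp add: exp_add[symmetric])
  finally have e: "l powr (- \<delta>) * (1 + A * l) * \<gamma> = exp (ln Q / 2)" by (simp add: Q_def mult.assoc)
  show ?thesis
    by (rule that[OF l(1) _ \<delta> _ _ e]) (use l \<open>ln Q < 0\<close> in auto)
qed

text \<open>The factor \<open>1 / l\<close> absorbs the rounding of the threshold to an integer, and
  \<open>p\<close> is replaced by \<open>a\<close> to have one bound for all primes.\<close>

lemma (in random_columns) card_sparse_threshold:
  assumes p: "p \<in> P" and l: "0 < l" "l \<le> 1" and \<delta>: "\<delta> > 0" and k: "k \<le> n'"
  shows "real (card (sparse k p (nat \<lceil>\<delta> * real n'\<rceil>))) \<le> (1 / l) * (l powr (- \<delta>) * (1 + of_int a * l)) ^ n'"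
proof -
  let ?s = "nat \<lceil>\<delta> * real n'\<rceil>"
  have s: "real ?s \<le> \<delta> * real n' + 1" using \<delta> by simp
  have pa: "real p \<le> real_of_int a" "1 \<le> real p" using p_bounds[OF p] by linarith+
  have "real (card (sparse k p ?s)) = real (card {y \<in> residues_fun k (int p). real (weight (int p) k y) < real ?s})"
    by (simp only: sparse_def of_nat_less_iff)
  also have "\<dots> \<le> l powr (- real ?s) * (1 + of_int (int p) * l) ^ k"
    using p_bounds[OF p] by (intro card_sparse_le[OF l]) linarith
  also have "\<dots> \<le> l powr (- (\<delta> * real n' + 1)) * (1 + of_int a * l) ^ n'"
  proof (intro mult_mono)
    show "l powr (- real ?s) \<le> l powr (- (\<delta> * real n' + 1))"
      using s l by (intro powr_mono') auto
    have "(1 + of_int (int p) * l) ^ k \<le> (1 + of_int a * l) ^ k"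
      using pa l by (intro power_mono add_left_mono mult_right_mono) auto
    also have "\<dots> \<le> (1 + of_int a * l) ^ n'"
      using a_pos l k by (intro power_increasing) auto
    finally show "(1 + of_int (int p) * l) ^ k \<le> (1 + of_int a * l) ^ n'" .
  qed (use l in auto)
  also have "l powr (- (\<delta> * real n' + 1)) = (1 / l) * (l powr (- \<delta>)) ^ n'"
  proof -
    have "l powr (- (\<delta> * real n' + 1)) = l powr (- \<delta> * real n') * l powr (- 1)"
      by (simp only: powr_add[symmetric]) simp
    also have "l powr (- \<delta> * real n') = (l powr (- \<delta>)) ^ n'"
      using l by (simp only: powr_powr[symmetric]) (simp add: powr_realpow)
    also have "l powr (- 1) = 1 / l" using l by (simp add: powr_minus_divide)
    finally show ?thesis by simp
  qed
  finally show ?thesis by (simp add: power_mult_distrib)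
qed

lemma power_threshold_le:
  fixes \<beta> \<gamma> :: real
  assumes "0 \<le> \<beta>" "\<beta> \<le> \<gamma>" "0 < \<gamma>" "\<gamma> < 1" "\<delta> > 0"
  shows "\<beta> ^ nat \<lceil>\<delta> * real n\<rceil> \<le> (\<gamma> powr \<delta>) ^ n"
proof -
  have "\<beta> ^ nat \<lceil>\<delta> * real n\<rceil> \<le> \<gamma> ^ nat \<lceil>\<delta> * real n\<rceil>" using assms by (intro power_mono) auto
  also have "\<dots> = \<gamma> powr real (nat \<lceil>\<delta> * real n\<rceil>)" using assms by (simp only: powr_realpow)
  also have "\<dots> \<le> \<gamma> powr (\<delta> * real n)" using assms by (intro powr_mono') (auto simp: real_nat_ceiling_ge)
  also have "\<dots> = (\<gamma> powr \<delta>) ^ n" using assms by (simp add: powr_powr[symmetric] powr_realpow)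
  finally show ?thesis .
qed

text \<open>By \<open>1 + x \<le> exp x\<close> it is enough that \<open>n * \<kappa> ^ n\<close>
  tends to 0.\<close>

lemma power_near_1_tendsto:
  fixes \<kappa> A :: real
  assumes "0 < \<kappa>" "\<kappa> < 1" "A \<ge> 0"
  shows "(\<lambda>n. (1 + A * \<kappa> ^ n) ^ n) \<longlonglongrightarrow> 1"
proof (rule tendsto_sandwich[OF _ _ tendsto_const])
  have "(\<lambda>n. A * (real n * \<kappa> ^ n)) \<longlonglongrightarrow> A * 0"
    using assms by (intro tendsto_mult_left powser_times_n_limit_0) auto
  then have "(\<lambda>n. exp (A * (real n * \<kappa> ^ n))) \<longlonglongrightarrow> exp 0" by (intro tendsto_exp) simp
  then show "(\<lambda>n. exp (A * (real n * \<kappa> ^ n))) \<longlonglongrightarrow> 1" by simp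
  show "\<forall>\<^sub>F n in sequentially. (1 + A * \<kappa> ^ n) ^ n \<le> exp (A * (real n * \<kappa> ^ n))"
  proof (rule always_eventually, rule allI)
    fix n
    have "(1 + A * \<kappa> ^ n) ^ n \<le> exp (A * \<kappa> ^ n) ^ n"
      using assms by (intro power_mono exp_ge_add_one_self) auto
    then show "(1 + A * \<kappa> ^ n) ^ n \<le> exp (A * (real n * \<kappa> ^ n))"
      by (simp add: exp_of_nat_mult[symmetric] mult_ac)
  qed
  show "\<forall>\<^sub>F n in sequentially. 1 \<le> (1 + A * \<kappa> ^ n) ^ n"
    using assms by (intro always_eventually allI one_le_power) auto
qed

definition law :: "nat \<Rightarrow> (nat \<Rightarrow> nat \<Rightarrow> int pmf) \<Rightarrow> (nat \<Rightarrow> nat \<Rightarrow> int) pmf" where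
  "law n q = Pi_pmf {..<n} (\<lambda>_. 0) (\<lambda>c. Pi_pmf {..<n} 0 (q c))"

context flag_step
begin

text \<open>With the threshold \<open>\<delta> * n\<close> inserted, the error becomes an expression
  in \<open>m\<close> and \<open>n\<close> in which \<open>q\<close>, \<open>R\<close> and
  \<open>F'\<close> no longer occur; this is the source of uniformity.\<close>

lemma step_error:
  fixes l \<delta> \<theta> :: real
  assumes inst: "step_instance b g G G' \<pi> P a n \<alpha> q R F' (n - m) m"
    and mn: "m \<le> n" and ne: "P \<noteq> {}"
    and l: "0 < l" "l \<le> 1" "\<delta> > 0" and \<gamma>: "\<gamma> = (1 + decay \<alpha> a) / 2"
    and \<theta>: "l powr (- \<delta>) * (1 + of_int a * l) * \<gamma> = \<theta>"
  shows "\<bar>(\<Sum>F\<in>{F \<in> Lifts n G \<pi> F'. F ` carrier_vec n = carrier G}.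
        measure_pmf.prob (law n q) {M. ker G n F = lat n (R * mat n n (\<lambda>(r, c). M c r)) a})
      - (\<Prod>p\<in>P. \<Prod>i<m. 1 - 1 / real p ^ Suc i)\<bar>
    \<le> real K ^ m * ((of_int a ^ m) ^ m * (real m * (\<gamma> powr \<delta>) ^ n)) + 2 ^ card (carrier G) * (1 / 2) ^ m
      + (real (card (carrier G)) ^ card (carrier G) + 1) * (real (card P) *
        (of_int a ^ card (carrier G') * ((1 / l) * \<theta> ^ n + (1 / 2) ^ m * (1 + of_int a * (\<gamma> powr \<delta>) ^ n) ^ n)
          + (1 / l) * \<theta> ^ n / \<gamma> ^ m))"
proof -
  let ?s = "nat \<lceil>\<delta> * real n\<rceil>"
  interpret S: step_instance b g G G' \<pi> P a n \<alpha> q R F' "n - m" m ?s by (rule inst)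
  have \<beta>: "0 \<le> S.RC.\<beta>" "S.RC.\<beta> < 1" using S.RC.beta ne by auto
  have \<gamma>': "S.RC.\<gamma> = \<gamma>" "0 < \<gamma>" "\<gamma> < 1" "S.RC.\<beta> \<le> \<gamma>"
    using \<beta> by (auto simp: S.RC.\<gamma>_def \<gamma>)
  define \<kappa> where "\<kappa> = \<gamma> powr \<delta>"
  have \<kappa>: "S.RC.\<beta> ^ ?s \<le> \<kappa> ^ n" "0 \<le> \<kappa>"
    using power_threshold_le[OF \<beta>(1) \<gamma>'(4,2,3) l(3)] by (auto simp: \<kappa>_def)
  have a1: "real_of_int a \<ge> 1" using a_pos by simp
  have sp: "real (card (S.RC.sparse j p ?s)) * \<gamma> ^ n \<le> (1 / l) * \<theta> ^ n" if "p \<in> P" "j \<le> n" for p j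
  proof -
    have "real (card (S.RC.sparse j p ?s)) * \<gamma> ^ n \<le> (1 / l) * (l powr (- \<delta>) * (1 + of_int a * l)) ^ n * \<gamma> ^ n"
      using S.RC.card_sparse_threshold[OF that(1) l that(2)] \<gamma>' by (intro mult_right_mono) auto
    also have "\<dots> = (1 / l) * \<theta> ^ n" unfolding \<theta>[symmetric] by (simp add: power_mult_distrib)
    finally show ?thesis .
  qed
  have "S.bad_bound \<le> (\<Sum>p\<in>P. of_int a ^ card (carrier G') *
        ((1 / l) * \<theta> ^ n + (1 / 2) ^ m * (1 + of_int a * \<kappa> ^ n) ^ n) + (1 / l) * \<theta> ^ n / \<gamma> ^ m)"
    unfolding S.bad_bound_def
  proof (intro sum_mono)
    fix p assume p: "p \<in> P"
    have pb: "2 \<le> real p" "real p \<le> of_int a" using S.RC.p_bounds[OF p] by linarith+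
    \<comment> \<open>Factoring out \<open>p ^ -n\<close> leaves \<open>p ^ -m\<close> times the
      \<open>n\<close>-th power of a number exponentially close to 1, so the dense kernel vectors
      cost about \<open>2 ^ -m\<close>.\<close>
    have t2: "real p ^ (n - m) * (1 / real p + S.RC.\<beta> ^ ?s) ^ n \<le> (1 / 2) ^ m * (1 + of_int a * \<kappa> ^ n) ^ n"
    proof -
      have "real p ^ (n - m) * (1 / real p + S.RC.\<beta> ^ ?s) ^ n = (1 / real p) ^ m * (1 + real p * S.RC.\<beta> ^ ?s) ^ n"
      proof -
        have "real p ^ (n - m) = (1 / real p) ^ m * real p ^ n"
          using mn pb by (simp add: power_divide power_diff)
        moreover have "real p ^ n * (1 / real p + S.RC.\<beta> ^ ?s) ^ n = (1 + real p * S.RC.\<beta> ^ ?s) ^ n"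
          using pb by (simp add: power_mult_distrib[symmetric] ring_distribs)
        ultimately show ?thesis by simp
      qed
      also have "\<dots> \<le> (1 / 2) ^ m * (1 + of_int a * \<kappa> ^ n) ^ n"
        using pb \<kappa> \<beta> by (intro mult_mono power_mono add_left_mono) (auto simp: field_simps)
      finally show ?thesis .
    qed
    have t3: "real (card (S.RC.sparse n p ?s)) * \<gamma> ^ (n - m) \<le> (1 / l) * \<theta> ^ n / \<gamma> ^ m"
    proof -
      have "\<gamma> ^ (n - m) = \<gamma> ^ n / \<gamma> ^ m" using mn \<gamma>' by (simp add: power_diff)
      then have "real (card (S.RC.sparse n p ?s)) * \<gamma> ^ (n - m) = real (card (S.RC.sparse n p ?s)) * \<gamma> ^ n / \<gamma> ^ m"
        by simp
      also have "\<dots> \<le> (1 / l) * \<theta> ^ n / \<gamma> ^ m"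
        using sp[OF p order_refl] \<gamma>' by (intro divide_right_mono) auto
      finally show ?thesis .
    qed
    show "real p ^ card (carrier G') * (real (card (S.RC.sparse (n - m) p ?s)) * S.RC.\<gamma> ^ n +
          real p ^ (n - m) * (1 / real p + S.RC.\<beta> ^ ?s) ^ n) + real (card (S.RC.sparse n p ?s)) * S.RC.\<gamma> ^ (n - m)
      \<le> of_int a ^ card (carrier G') *
        ((1 / l) * \<theta> ^ n + (1 / 2) ^ m * (1 + of_int a * \<kappa> ^ n) ^ n) + (1 / l) * \<theta> ^ n / \<gamma> ^ m"
      unfolding \<gamma>'(1)
    proof (rule add_mono[OF mult_mono[OF power_mono add_mono] t3])
      show "real (card (S.RC.sparse (n - m) p ?s)) * \<gamma> ^ n \<le> 1 / l * \<theta> ^ n"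
        by (rule sp[OF p]) simp
    qed (use pb t2 \<gamma>' \<beta> a1 in auto)
  qed
  also have "\<dots> = real (card P) *
        (of_int a ^ card (carrier G') * ((1 / l) * \<theta> ^ n + (1 / 2) ^ m * (1 + of_int a * \<kappa> ^ n) ^ n)
          + (1 / l) * \<theta> ^ n / \<gamma> ^ m)" by simp
  finally have bad: "S.bad_bound \<le> \<dots>" .
  have "S.SurLifts = {F \<in> Lifts n G \<pi> F'. F ` carrier_vec n = carrier G}" by (simp add: S.SurLifts_def)
  moreover have "S.RC.col_law {..<n} = law n q" by (simp add: S.RC.col_law_def law_def)
  ultimately have "\<bar>(\<Sum>F\<in>{F \<in> Lifts n G \<pi> F'. F ` carrier_vec n = carrier G}.
        measure_pmf.prob (law n q) {M. ker G n F = lat n (R * mat n n (\<lambda>(r, c). M c r)) a})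
      - (\<Prod>p\<in>P. \<Prod>i<m. 1 - 1 / real p ^ Suc i)\<bar>
     \<le> real K ^ m * ((of_int a ^ m) ^ m * (real m * S.RC.\<beta> ^ ?s)) + 2 ^ card (carrier G) * (1 / 2) ^ m
      + (real (card (carrier G)) ^ card (carrier G) + 1) * S.bad_bound"
    using S.step_bound by (simp only: S.c_m_def S.mat_of_def)
  also have "\<dots> \<le> real K ^ m * ((of_int a ^ m) ^ m * (real m * \<kappa> ^ n)) + 2 ^ card (carrier G) * (1 / 2) ^ m
      + (real (card (carrier G)) ^ card (carrier G) + 1) * (real (card P) *
        (of_int a ^ card (carrier G') * ((1 / l) * \<theta> ^ n + (1 / 2) ^ m * (1 + of_int a * \<kappa> ^ n) ^ n)
          + (1 / l) * \<theta> ^ n / \<gamma> ^ m))"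
    using bad \<kappa> a1 by (intro add_mono mult_left_mono order_refl) auto
  finally show ?thesis unfolding \<kappa>_def .
qed

definition step_hyp :: "real \<Rightarrow> nat \<Rightarrow> (nat \<Rightarrow> nat \<Rightarrow> int pmf) \<Rightarrow> int mat \<Rightarrow> (int vec \<Rightarrow> 'a) \<Rightarrow> bool" where
  "step_hyp \<alpha> n q R F' \<longleftrightarrow> R \<in> carrier_mat n n \<and> F' \<in> hom (Zn n) G' \<and> F' ` carrier_vec n = carrier G' \<and>
    ker G' n F' = lat n R a \<and>
    (\<forall>c<n. \<forall>r<n. finite (set_pmf (q c r)) \<and> (\<forall>p\<in>P. balanced_pmf \<alpha> (int p) (q c r)))"

lemma step_instanceI:
  assumes "0 < \<alpha>" "\<alpha> \<le> 1/2" "step_hyp \<alpha> n q R F'" "m \<le> n"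
  shows "step_instance b g G G' \<pi> P a n \<alpha> q R F' (n - m) m"
proof (unfold_locales, goal_cases)
  case (3)
  show ?case by (rule a_pos)
next
  case (4)
  show ?case by (rule P(1))
next
  case (5 p)
  then show ?case using P(2)[of p] abg by auto
qed (use assms in \<open>auto simp: step_hyp_def\<close>)

text \<open>For fixed \<open>m\<close> the error does not vanish as \<open>n\<close> grows but tends
  to \<open>D / 2 ^ m\<close>, which collects the nonsurjective lifts and the dense kernel vectors.
  So \<open>m\<close> is chosen first, large enough for this limit and for the truncation of the
  Euler products.\<close>

lemma step_limit_nontrivial:
  assumes \<alpha>: "0 < \<alpha>" "\<alpha> \<le> 1/2" and ne: "P \<noteq> {}" and e: "e > 0"
  shows "\<exists>N. \<forall>n\<ge>N. \<forall>q R F'. step_hyp \<alpha> n q R F' \<longrightarrow>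
    \<bar>(\<Sum>F\<in>{F \<in> Lifts n G \<pi> F'. F ` carrier_vec n = carrier G}.
        measure_pmf.prob (law n q) {M. ker G n F = lat n (R * mat n n (\<lambda>(r, c). M c r)) a})
      - (\<Prod>p\<in>P. prodinf (\<lambda>i. 1 - 1 / real p ^ Suc i))\<bar> \<le> e"
proof -
  define \<gamma> where "\<gamma> = (1 + decay \<alpha> a) / 2"
  have a1: "real_of_int a \<ge> 1" using a_pos by simp
  obtain p where p: "p \<in> P" using ne by blast
  have "int p \<ge> 2" "int p dvd a" using P(2)[OF p] abg prime_ge_2_nat[of p] by auto
  then have "a \<ge> 2" using a_pos by (auto dest: zdvd_imp_le)
  then have \<gamma>: "0 < \<gamma>" "\<gamma> < 1"
    using decay_less_1[OF \<alpha>(1), of a] decay_nonneg[OF _ \<alpha>(2), of a] \<alpha> by (auto simp: \<gamma>_def)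
  obtain l \<delta> \<theta> where l: "0 < l" "l \<le> 1" "\<delta> > 0" and \<theta>: "0 < \<theta>" "\<theta> < 1"
    "l powr (- \<delta>) * (1 + of_int a * l) * \<gamma> = \<theta>"
    using sparseness_threshold[OF \<gamma> a1] by metis
  have \<kappa>: "0 < \<gamma> powr \<delta>" "\<gamma> powr \<delta> < 1" using \<gamma> l powr_less_mono2[of \<delta> \<gamma> 1] by auto
  define err where "err m n = real K ^ m * ((of_int a ^ m) ^ m * (real m * (\<gamma> powr \<delta>) ^ n)) + 2 ^ card (carrier G) * (1 / 2) ^ m
      + (real (card (carrier G)) ^ card (carrier G) + 1) * (real (card P) *
        (of_int a ^ card (carrier G') * ((1 / l) * \<theta> ^ n + (1 / 2) ^ m * (1 + of_int a * (\<gamma> powr \<delta>) ^ n) ^ n)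
          + (1 / l) * \<theta> ^ n / \<gamma> ^ m))" for m n
  define D where "D = 2 ^ card (carrier G) + (real (card (carrier G)) ^ card (carrier G) + 1) *
    (real (card P) * of_int a ^ card (carrier G'))"
  have err: "err m \<longlonglongrightarrow> D * (1 / 2) ^ m" for m
  proof -
    have "err m \<longlonglongrightarrow> real K ^ m * ((of_int a ^ m) ^ m * (real m * 0)) + 2 ^ card (carrier G) * (1 / 2) ^ m
      + (real (card (carrier G)) ^ card (carrier G) + 1) * (real (card P) *
        (of_int a ^ card (carrier G') * ((1 / l) * 0 + (1 / 2) ^ m * 1) + (1 / l) * 0 / \<gamma> ^ m))"
      unfolding err_def using \<kappa> \<theta> \<gamma> a1
      by (intro tendsto_intros LIMSEQ_power_zero power_near_1_tendsto) auto
    then show ?thesis by (simp add: D_def algebra_simps)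
  qed
  let ?c = "\<lambda>m. \<Prod>p\<in>P. \<Prod>i<m. 1 - 1 / real p ^ Suc i"
  let ?cP = "\<Prod>p\<in>P. prodinf (\<lambda>i. 1 - 1 / real p ^ Suc i)"
  have "(\<lambda>m. D * (1 / 2) ^ m) \<longlonglongrightarrow> D * 0" by (intro tendsto_mult_left LIMSEQ_power_zero) auto
  then have "\<forall>\<^sub>F m in sequentially. D * (1 / 2) ^ m < e / 2"
    using e by (intro order_tendstoD(2)[where y="D * 0"]) auto
  moreover have "\<forall>\<^sub>F m in sequentially. dist (?c m) ?cP < e / 2"
    using e P(2) by (intro tendstoD[OF euler_products_tendsto]) auto
  ultimately have "\<forall>\<^sub>F m in sequentially. D * (1 / 2) ^ m < e / 2 \<and> dist (?c m) ?cP < e / 2"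
    by (rule eventually_conj)
  then obtain m where m: "D * (1 / 2) ^ m < e / 2" "dist (?c m) ?cP < e / 2"
    unfolding eventually_sequentially by blast
  have "\<forall>\<^sub>F n in sequentially. err m n < e / 2"
    using order_tendstoD(2)[OF err m(1)] .
  then obtain N where N: "\<And>n. n \<ge> N \<Longrightarrow> err m n < e / 2"
    unfolding eventually_sequentially by blast
  show ?thesis
  proof (intro exI[of _ "max N m"] allI impI)
    fix n q R F' assume n: "n \<ge> max N m" and h: "step_hyp \<alpha> n q R F'"
    have mn: "m \<le> n" using n by simp
    from step_error[OF step_instanceI[OF \<alpha> h mn] mn ne l \<gamma>_def \<theta>(3)]
    have "\<bar>(\<Sum>F\<in>{F \<in> Lifts n G \<pi> F'. F ` carrier_vec n = carrier G}.
        measure_pmf.prob (law n q) {M. ker G n F = lat n (R * mat n n (\<lambda>(r, c). M c r)) a}) - ?c m\<bar> \<le> err m n"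
      unfolding err_def .
    moreover have "err m n < e / 2" using N n by simp
    ultimately show "\<bar>(\<Sum>F\<in>{F \<in> Lifts n G \<pi> F'. F ` carrier_vec n = carrier G}.
        measure_pmf.prob (law n q) {M. ker G n F = lat n (R * mat n n (\<lambda>(r, c). M c r)) a}) - ?cP\<bar> \<le> e"
      using m(2) unfolding dist_real_def by linarith
  qed
qed

lemma lat_one: "A \<in> carrier_mat n n \<Longrightarrow> lat n A 1 = carrier_vec n"
proof
  assume A: "A \<in> carrier_mat n n"
  show "lat n A 1 \<subseteq> carrier_vec n" using A by (auto simp: lat_def)
  show "carrier_vec n \<subseteq> lat n A 1"
  proof
    fix v :: "int vec" assume "v \<in> carrier_vec n"
    then show "v \<in> lat n A 1"
      unfolding lat_def mem_Collect_eq using A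
      by (intro exI[of _ "0\<^sub>v n"] exI[of _ v]) auto
  qed
qed

text \<open>Without primes the modulus is 1 and \<open>decay \<alpha> 1 = 1\<close> yields no
  estimate; but then both groups are trivial, there is one lift, and its kernel condition always
  holds.\<close>

lemma step_trivial:
  assumes P0: "P = {}" and h: "step_hyp \<alpha> n q R F'"
  shows "(\<Sum>F\<in>{F \<in> Lifts n G \<pi> F'. F ` carrier_vec n = carrier G}.
        measure_pmf.prob (law n q) {M. ker G n F = lat n (R * mat n n (\<lambda>(r, c). M c r)) a}) = 1"
proof -
  have "\<bar>a\<bar> = 1"
  proof (rule ccontr)
    assume "\<bar>a\<bar> \<noteq> 1"
    then have "nat \<bar>a\<bar> \<noteq> 1" by simp
    then obtain p where "prime p" "p dvd nat \<bar>a\<bar>" using prime_factor_nat by blast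
    then show False using P(3)[of p] P0 by simp
  qed
  then have a: "a = 1" using a_pos by simp
  then have g: "g = 1" using abg bg by (simp add: pos_zmult_eq_1_iff)
  have G1: "carrier G = {\<one>\<^bsub>G\<^esub>}" using exp unfolding g by auto
  have G1': "carrier G' = {\<one>\<^bsub>G'\<^esub>}" using \<pi>_surj G1 by auto
  have R: "R \<in> carrier_mat n n" using h by (simp add: step_hyp_def)
  let ?F = "restrict (\<lambda>v :: int vec. \<one>\<^bsub>G\<^esub>) (carrier_vec n)"
  have "{F \<in> Lifts n G \<pi> F'. F ` carrier_vec n = carrier G} = {?F}"
  proof (intro equalityI subsetI)
    fix F assume "F \<in> {F \<in> Lifts n G \<pi> F'. F ` carrier_vec n = carrier G}"
    then have F: "F \<in> extensional (carrier_vec n)" "F ` carrier_vec n = {\<one>\<^bsub>G\<^esub>}"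
      using G1 by (auto simp: Lifts_def Hom_def)
    have "F = ?F" by (rule extensionalityI[OF F(1)]) (use F(2) in auto)
    then show "F \<in> {?F}" by simp
  next
    fix F :: "int vec \<Rightarrow> 'a" assume F: "F \<in> {?F}"
    have "?F \<in> Hom n G" by (auto simp: Hom_def hom_def)
    moreover have "\<pi> (?F v) = F' v" if "v \<in> carrier_vec n" for v
    proof -
      have "F' v \<in> carrier G'" using h that unfolding step_hyp_def by blast
      then show ?thesis using that G1' by simp
    qed
    moreover have "?F ` carrier_vec n = {\<one>\<^bsub>G\<^esub>}"
    proof (intro equalityI subsetI)
      fix x assume "x \<in> {\<one>\<^bsub>G\<^esub>}"
      then show "x \<in> ?F ` carrier_vec n"
        by (intro image_eqI[of _ _ "0\<^sub>v n"]) simp_all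
    qed auto
    ultimately show "F \<in> {F \<in> Lifts n G \<pi> F'. F ` carrier_vec n = carrier G}"
      using F G1 by (auto simp: Lifts_def)
  qed
  moreover have "ker G n ?F = lat n (R * mat n n (\<lambda>(r, c). M c r)) a" for M
    unfolding a using lat_one[of "R * mat n n (\<lambda>(r, c). M c r)" n] R by (auto simp: ker_def)
  ultimately show ?thesis by simp
qed

theorem step_limit:
  assumes \<alpha>: "0 < \<alpha>" "\<alpha> \<le> 1/2" and e: "e > 0"
  shows "\<exists>N. \<forall>n\<ge>N. \<forall>q R F'. step_hyp \<alpha> n q R F' \<longrightarrow>
    \<bar>(\<Sum>F\<in>{F \<in> Lifts n G \<pi> F'. F ` carrier_vec n = carrier G}.
        measure_pmf.prob (law n q) {M. ker G n F = lat n (R * mat n n (\<lambda>(r, c). M c r)) a})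
      - (\<Prod>p\<in>P. prodinf (\<lambda>i. 1 - 1 / real p ^ Suc i))\<bar> \<le> e"
proof (cases "P = {}")
  case True
  show ?thesis using step_trivial[OF True] e True by (intro exI[of _ 0]) simp
next
  case False
  then show ?thesis by (rule step_limit_nontrivial[OF \<alpha> _ e])
qed

end

section \<open>Localisation and tensor products\<close>

lemma loc_denoms_mult: "s \<in> loc_denoms P \<Longrightarrow> t \<in> loc_denoms P \<Longrightarrow> s * t \<in> loc_denoms P"
  by (simp add: loc_denoms_def)

lemma loc_denoms_one: "1 \<in> loc_denoms P"
  by (simp add: loc_denoms_def)

lemma loc_rel_iff: "((c, s), (d, t)) \<in> loc_rel P \<longleftrightarrow>
    s \<in> loc_denoms P \<and> t \<in> loc_denoms P \<and> (\<exists>u\<in>loc_denoms P. u * (c * t - d * s) = 0)"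
  unfolding loc_rel_def by blast

lemma equiv_loc_rel: "equiv (UNIV \<times> loc_denoms P) (loc_rel P)"
proof (rule equivI)
  show "loc_rel P \<subseteq> (UNIV \<times> loc_denoms P) \<times> (UNIV \<times> loc_denoms P)"
    by (auto simp: loc_rel_def)
  show "refl_on (UNIV \<times> loc_denoms P) (loc_rel P)"
    unfolding refl_on_def
    by (auto simp: loc_rel_iff intro!: bexI[of _ 1] loc_denoms_one)
  show "sym (loc_rel P)"
  proof (rule symI, clarify)
    fix c s d t assume "((c, s), (d, t)) \<in> loc_rel P"
    then obtain u where "s \<in> loc_denoms P" "t \<in> loc_denoms P" "u \<in> loc_denoms P" "u * (c * t - d * s) = 0"
      unfolding loc_rel_iff by blast
    moreover from this have "u * (d * s - c * t) = 0" by (auto simp: algebra_simps)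
    ultimately show "((d, t), (c, s)) \<in> loc_rel P" unfolding loc_rel_iff by blast
  qed
  show "trans (loc_rel P)"
  proof (rule transI, clarify)
    fix c s d t e r assume "((c, s), (d, t)) \<in> loc_rel P" "((d, t), (e, r)) \<in> loc_rel P"
    then obtain u w where st: "s \<in> loc_denoms P" "t \<in> loc_denoms P" "r \<in> loc_denoms P"
      and uw: "u \<in> loc_denoms P" "w \<in> loc_denoms P" "u * (c * t - d * s) = 0" "w * (d * r - e * t) = 0"
      unfolding loc_rel_iff by blast
    \<comment> \<open>The multiplier witnessing transitivity has to contain the middle denominator
      \<open>t\<close> besides \<open>u\<close> and \<open>w\<close>.\<close>
    have "(u * w * t) * (c * r - e * s) = (w * r) * (u * (c * t - d * s)) + (u * s) * (w * (d * r - e * t))"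
      by (simp add: algebra_simps)
    also have "\<dots> = 0" unfolding uw by simp
    finally show "((c, s), (e, r)) \<in> loc_rel P"
      unfolding loc_rel_iff using st uw by (intro conjI bexI[of _ "u * w * t"] loc_denoms_mult)
  qed
qed

definition fraction :: "nat set \<Rightarrow> int \<Rightarrow> int \<Rightarrow> (int \<times> int) set" where
  "fraction P c s = loc_rel P `` {(c, s)}"

lemma mem_fraction: "(d, t) \<in> fraction P c s \<longleftrightarrow>
    s \<in> loc_denoms P \<and> t \<in> loc_denoms P \<and> (\<exists>u\<in>loc_denoms P. u * (c * t - d * s) = 0)"
  by (simp add: fraction_def loc_rel_iff)

lemma fraction_self: "s \<in> loc_denoms P \<Longrightarrow> (c, s) \<in> fraction P c s"
  unfolding mem_fraction by (auto intro: bexI[of _ 1] loc_denoms_one)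

lemma fraction_eq_iff:
  assumes "s \<in> loc_denoms P" "t \<in> loc_denoms P"
  shows "fraction P c s = fraction P d t \<longleftrightarrow> (\<exists>u\<in>loc_denoms P. u * (c * t - d * s) = 0)"
  unfolding fraction_def using assms
  by (subst eq_equiv_class_iff[OF equiv_loc_rel]) (auto simp: loc_rel_iff)

lemma fraction_eqI:
  assumes "s \<in> loc_denoms P" "t \<in> loc_denoms P" "c * t = d * s"
  shows "fraction P c s = fraction P d t"
  unfolding fraction_eq_iff[OF assms(1,2)] using assms by (intro bexI[of _ 1] loc_denoms_one) simp

lemma loc_int_carrier: "q \<in> carrier (loc_int P) \<longleftrightarrow> (\<exists>c s. s \<in> loc_denoms P \<and> q = fraction P c s)"
  by (auto simp: loc_int_def fraction_def quotient_def)

lemma fraction_closed: "s \<in> loc_denoms P \<Longrightarrow> fraction P c s \<in> carrier (loc_int P)"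
  unfolding loc_int_carrier by blast

lemma fraction_mult:
  assumes s: "s \<in> loc_denoms P" and t: "t \<in> loc_denoms P"
  shows "fraction P c s \<otimes>\<^bsub>loc_int P\<^esub> fraction P d t = fraction P (c * t + d * s) (s * t)"
proof -
  have *: "loc_rel P `` {(c' * t' + d' * s', s' * t')} = fraction P (c * t + d * s) (s * t)"
    if q: "(c', s') \<in> fraction P c s" "(d', t') \<in> fraction P d t" for c' s' d' t'
  proof -
    obtain u w where s': "s' \<in> loc_denoms P" "t' \<in> loc_denoms P"
      and uw: "u \<in> loc_denoms P" "w \<in> loc_denoms P" "u * (c * s' - c' * s) = 0" "w * (d * t' - d' * t) = 0"
      using q unfolding mem_fraction by blast
    have "(u * w) * ((c' * t' + d' * s') * (s * t) - (c * t + d * s) * (s' * t')) =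
        - (w * t * t') * (u * (c * s' - c' * s)) - (u * s * s') * (w * (d * t' - d' * t))"
      by (simp add: algebra_simps)
    also have "\<dots> = 0" unfolding uw by simp
    finally show ?thesis
      unfolding fraction_def[symmetric] using s t s' uw
      by (subst fraction_eq_iff) (auto intro!: bexI[of _ "u * w"] loc_denoms_mult simp del: mult_eq_0_iff)
  qed
  have "fraction P c s \<otimes>\<^bsub>loc_int P\<^esub> fraction P d t =
      (\<Union>(c', s')\<in>fraction P c s. \<Union>(d', t')\<in>fraction P d t. loc_rel P `` {(c' * t' + d' * s', s' * t')})"
    by (simp add: loc_int_def)
  also have "\<dots> = (\<Union>x\<in>fraction P c s. \<Union>y\<in>fraction P d t. fraction P (c * t + d * s) (s * t))"
  proof (rule SUP_cong[OF refl])
    fix x assume x: "x \<in> fraction P c s"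
    obtain c' s' where x': "x = (c', s')" by (cases x)
    show "(case x of (c', s') \<Rightarrow> \<Union>(d', t')\<in>fraction P d t. loc_rel P `` {(c' * t' + d' * s', s' * t')}) =
        (\<Union>y\<in>fraction P d t. fraction P (c * t + d * s) (s * t))"
      unfolding x' prod.case
    proof (rule SUP_cong[OF refl])
      fix y assume y: "y \<in> fraction P d t"
      obtain d' t' where y': "y = (d', t')" by (cases y)
      show "(case y of (d', t') \<Rightarrow> loc_rel P `` {(c' * t' + d' * s', s' * t')}) = fraction P (c * t + d * s) (s * t)"
        unfolding y' prod.case using x y unfolding x' y' by (rule *)
    qed
  qed
  also have "\<dots> = fraction P (c * t + d * s) (s * t)"
    using fraction_self[OF s, of c] fraction_self[OF t, of d] by blast
  finally show ?thesis .
qed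

lemma fraction_add:
  assumes s: "s \<in> loc_denoms P"
  shows "fraction P c s \<otimes>\<^bsub>loc_int P\<^esub> fraction P d s = fraction P (c + d) s"
  unfolding fraction_mult[OF s s] using s by (intro fraction_eqI loc_denoms_mult) (auto simp: algebra_simps)

lemma loc_int_closed:
  "q \<in> carrier (loc_int P) \<Longrightarrow> q' \<in> carrier (loc_int P) \<Longrightarrow> q \<otimes>\<^bsub>loc_int P\<^esub> q' \<in> carrier (loc_int P)"
  unfolding loc_int_carrier using fraction_mult loc_denoms_mult by metis

text \<open>A representative of the image of a fraction in the integers modulo \<open>a\<close>, where all
  denominators are units.\<close>

definition loc_mod :: "int \<Rightarrow> (int \<times> int) set \<Rightarrow> int" where
  "loc_mod a q = (SOME e. \<forall>(c, s)\<in>q. a dvd e * s - c)"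

lemma loc_mod:
  assumes unit: "\<And>s. s \<in> loc_denoms P \<Longrightarrow> coprime s a" and s: "s \<in> loc_denoms P"
  shows "a dvd loc_mod a (fraction P c s) * s - c"
proof -
  obtain x y where xy: "x * s + y * a = 1"
    using unit[OF s] by (metis bezout_int coprime_imp_gcd_eq_1)
  have "c * x * s - c = c * (x * s + y * a) - c * y * a - c" by (simp add: algebra_simps)
  also have "\<dots> = a * (- c * y)" unfolding xy by simp
  finally have e: "a dvd c * x * s - c" by (rule dvdI)
  \<comment> \<open>The witness is \<open>c\<close> times an inverse \<open>x\<close> of
    \<open>s\<close> modulo \<open>a\<close>. It works for every representative of the fraction
    because \<open>u\<close> and \<open>s\<close> are units modulo \<open>a\<close> and can be
    cancelled.\<close>
  have "\<forall>(d, t)\<in>fraction P c s. a dvd c * x * t - d"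
  proof clarify
    fix d t assume "(d, t) \<in> fraction P c s"
    then obtain u where u: "u \<in> loc_denoms P" "u * (c * t - d * s) = 0" by (auto simp only: mem_fraction)
    have eq: "(u * s) * (c * x * t - d) = (u * t) * (c * x * s - c) + u * (c * t - d * s)"
      by (simp add: algebra_simps)
    have "a dvd (u * s) * (c * x * t - d)" unfolding eq u(2) add_0_right using e by (rule dvd_mult)
    moreover have "coprime a (u * s)" using unit[OF u(1)] unit[OF s] by (simp add: coprime_commute)
    ultimately show "a dvd c * x * t - d" by (simp only: coprime_dvd_mult_right_iff)
  qed
  then have "\<forall>(d, t)\<in>fraction P c s. a dvd loc_mod a (fraction P c s) * t - d"
    unfolding loc_mod_def by (rule someI)
  from bspec[OF this fraction_self[OF s, of c]] show ?thesis by simp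
qed

text \<open>Both sides agree after multiplication by the unit \<open>s * t\<close>.\<close>

lemma loc_mod_mult:
  assumes unit: "\<And>s. s \<in> loc_denoms P \<Longrightarrow> coprime s a"
    and q: "q \<in> carrier (loc_int P)" "q' \<in> carrier (loc_int P)"
  shows "a dvd loc_mod a (q \<otimes>\<^bsub>loc_int P\<^esub> q') - (loc_mod a q + loc_mod a q')"
proof -
  obtain c s d t where st: "s \<in> loc_denoms P" "q = fraction P c s" "t \<in> loc_denoms P" "q' = fraction P d t"
    using q unfolding loc_int_carrier by blast
  let ?e = "loc_mod a (q \<otimes>\<^bsub>loc_int P\<^esub> q')"
  have h: "a dvd ?e * (s * t) - (c * t + d * s)" "a dvd loc_mod a q * s - c" "a dvd loc_mod a q' * t - d"
    unfolding st fraction_mult[OF st(1,3)] using st(1,3) by (auto intro!: loc_mod[OF unit] loc_denoms_mult)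
  have "a dvd (?e * (s * t) - (c * t + d * s)) - t * (loc_mod a q * s - c) - s * (loc_mod a q' * t - d)"
    by (rule dvd_diff[OF dvd_diff[OF h(1) dvd_mult[OF h(2)]] dvd_mult[OF h(3)]])
  also have "\<dots> = (s * t) * (?e - (loc_mod a q + loc_mod a q'))" by (simp add: algebra_simps)
  finally have "a dvd (s * t) * (?e - (loc_mod a q + loc_mod a q'))" .
  moreover have "coprime a (s * t)" using unit[OF st(1)] unit[OF st(3)] by (simp add: coprime_commute)
  ultimately show ?thesis by (simp only: coprime_dvd_mult_right_iff)
qed

lemma (in comm_group) coset_eqI:
  assumes "subgroup N G" "x \<in> carrier G" "y \<in> carrier G" "x \<otimes> inv y \<in> N"
  shows "N #> x = N #> y"
proof (rule repr_independence[symmetric])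
  show "x \<in> N #> y"
    unfolding r_coset_def using assms by (auto simp: m_assoc intro!: bexI[of _ "x \<otimes> inv y"])
qed (use assms in auto)

text \<open>Representatives of one coset differ by elements that \<open>f\<close> sends into
  \<open>N'\<close>, so the union defining \<open>quot_map\<close> collapses to a single
  coset.\<close>

lemma quot_map_coset:
  assumes G: "group G" "subgroup N G" and G': "group G'" "subgroup N' G'"
    and f: "f \<in> hom G G'" "f ` N \<subseteq> N'" and x: "x \<in> carrier G"
  shows "quot_map G' N' f (N #>\<^bsub>G\<^esub> x) = N' #>\<^bsub>G'\<^esub> f x"
proof -
  interpret G: group G by (rule G(1))
  interpret G': group G' by (rule G'(1))
  have fx: "f x \<in> carrier G'" using f x by (auto simp: hom_def)
  have "N' #>\<^bsub>G'\<^esub> f y = N' #>\<^bsub>G'\<^esub> f x" if "y \<in> N #>\<^bsub>G\<^esub> x" for y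
  proof -
    obtain h where h: "h \<in> N" "y = h \<otimes>\<^bsub>G\<^esub> x" using \<open>y \<in> N #>\<^bsub>G\<^esub> x\<close> by (auto simp: r_coset_def)
    have hG: "h \<in> carrier G" using h G(2) by (meson subgroup.mem_carrier)
    have h': "f h \<in> N'" "f h \<in> carrier G'" using h f(2) G'(2) by (auto dest: subgroup.mem_carrier)
    have "f y = f h \<otimes>\<^bsub>G'\<^esub> f x" unfolding h(2) using f(1) hG x by (simp add: hom_def)
    then have "N' #>\<^bsub>G'\<^esub> f y = (N' #>\<^bsub>G'\<^esub> f h) #>\<^bsub>G'\<^esub> f x"
      using G'.coset_mult_assoc[of N' "f h" "f x"] h' fx subgroup.subset[OF G'(2)] by simp
    also have "N' #>\<^bsub>G'\<^esub> f h = N'" using G'.coset_join2[OF h'(2) G'(2) h'(1)] .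
    finally show ?thesis .
  qed
  moreover have "x \<in> N #>\<^bsub>G\<^esub> x" using G.rcos_self[OF x G(2)] .
  ultimately show ?thesis unfolding quot_map_def by blast
qed

section \<open>Tensor products by generators and relations\<close>

definition pure :: "('a, 'm) monoid_scheme \<Rightarrow> ('b, 'l) monoid_scheme \<Rightarrow> 'a \<Rightarrow> 'b \<Rightarrow> ('a \<times> 'b \<Rightarrow>\<^sub>0 int) set" where
  "pure A B x q = tensor_rels A B #>\<^bsub>free_Abelian_group (carrier A \<times> carrier B)\<^esub> frag_of (x, q)"

text \<open>Closure of the second factor keeps the biadditivity relations inside the free
  group.\<close>

locale tensor_setup = A: comm_group A
  for A :: "('a, 'm) monoid_scheme" and B :: "('b, 'l) monoid_scheme" +
  assumes B_closed: "\<And>q q'. q \<in> carrier B \<Longrightarrow> q' \<in> carrier B \<Longrightarrow> q \<otimes>\<^bsub>B\<^esub> q' \<in> carrier B"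
begin

abbreviation "FA \<equiv> free_Abelian_group (carrier A \<times> carrier B)"
abbreviation "N \<equiv> tensor_rels A B"

definition rels where "rels =
  {frag_of (a \<otimes>\<^bsub>A\<^esub> a', b) - frag_of (a, b) - frag_of (a', b) | a a' b.
         a \<in> carrier A \<and> a' \<in> carrier A \<and> b \<in> carrier B} \<union>
  {frag_of (a, b \<otimes>\<^bsub>B\<^esub> b') - frag_of (a, b) - frag_of (a, b') | a b b'.
         a \<in> carrier A \<and> b \<in> carrier B \<and> b' \<in> carrier B}"

lemma N_eq: "N = generate FA rels"
  unfolding tensor_rels_def rels_def ..

lemma frag_of_closed: "x \<in> carrier A \<Longrightarrow> q \<in> carrier B \<Longrightarrow> frag_of (x, q) \<in> carrier FA"
  by simp

lemma diff_closed: "x \<in> carrier FA \<Longrightarrow> y \<in> carrier FA \<Longrightarrow> x - y \<in> carrier FA"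
  using keys_diff[of x y] by auto

lemma rels_closed: "rels \<subseteq> carrier FA"
proof
  fix r assume "r \<in> rels"
  then consider (1) a a' b where "r = frag_of (a \<otimes>\<^bsub>A\<^esub> a', b) - frag_of (a, b) - frag_of (a', b)"
      "a \<in> carrier A" "a' \<in> carrier A" "b \<in> carrier B"
    | (2) a b b' where "r = frag_of (a, b \<otimes>\<^bsub>B\<^esub> b') - frag_of (a, b) - frag_of (a, b')"
      "a \<in> carrier A" "b \<in> carrier B" "b' \<in> carrier B"
    unfolding rels_def by blast
  then show "r \<in> carrier FA"
    by cases (simp_all only: diff_closed frag_of_closed A.m_closed B_closed)
qed

lemma FA: "comm_group FA" "group FA"
  using abelian_free_Abelian_group group_free_Abelian_group by auto

lemma N: "subgroup N FA"
  unfolding N_eq using FA(2) rels_closed by (rule group.generate_is_subgroup)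

lemma normal_N: "N \<lhd> FA"
  using comm_group.normal_iff_subgroup[OF FA(1)] N by simp

lemma comm_group_tensor: "comm_group (tensor A B)"
  unfolding tensor_def using comm_group.abelian_FactGroup[OF FA(1) N] .

lemma coset_mult:
  assumes "x \<in> carrier FA" "y \<in> carrier FA"
  shows "(N #>\<^bsub>FA\<^esub> x) \<otimes>\<^bsub>tensor A B\<^esub> (N #>\<^bsub>FA\<^esub> y) = N #>\<^bsub>FA\<^esub> (x + y)"
  using normal.rcos_sum[OF normal_N assms] by (simp add: tensor_def)

lemma coset_eq:
  assumes "x \<in> carrier FA" "y \<in> carrier FA" "x - y \<in> N"
  shows "N #>\<^bsub>FA\<^esub> x = N #>\<^bsub>FA\<^esub> y"
proof (rule comm_group.coset_eqI[OF FA(1) N assms(1,2)])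
  have "x \<otimes>\<^bsub>FA\<^esub> inv\<^bsub>FA\<^esub> y = x - y" using assms(2) by simp
  then show "x \<otimes>\<^bsub>FA\<^esub> inv\<^bsub>FA\<^esub> y \<in> N" using assms(3) by (simp only:)
qed

lemma coset_closed: "x \<in> carrier FA \<Longrightarrow> N #>\<^bsub>FA\<^esub> x \<in> carrier (tensor A B)"
  unfolding tensor_def carrier_FactGroup by (rule imageI)

lemma pure_closed: "x \<in> carrier A \<Longrightarrow> q \<in> carrier B \<Longrightarrow> pure A B x q \<in> carrier (tensor A B)"
  unfolding pure_def by (intro coset_closed frag_of_closed)

lemma plus_closed: "x \<in> carrier FA \<Longrightarrow> y \<in> carrier FA \<Longrightarrow> x + y \<in> carrier FA"
  using keys_add[of x y] by auto

lemma pure_mult_left: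
  assumes "x \<in> carrier A" "x' \<in> carrier A" "q \<in> carrier B"
  shows "pure A B (x \<otimes>\<^bsub>A\<^esub> x') q = pure A B x q \<otimes>\<^bsub>tensor A B\<^esub> pure A B x' q"
proof -
  have "frag_of (x \<otimes>\<^bsub>A\<^esub> x', q) - frag_of (x, q) - frag_of (x', q) \<in> N"
    unfolding N_eq by (rule generate.incl) (use assms in \<open>auto simp: rels_def\<close>)
  then have "frag_of (x \<otimes>\<^bsub>A\<^esub> x', q) - (frag_of (x, q) + frag_of (x', q)) \<in> N"
    by (simp only: diff_diff_eq)
  from coset_eq[OF _ _ this] show ?thesis
    unfolding pure_def using assms
    by (subst coset_mult) (simp_all only: frag_of_closed plus_closed A.m_closed)
qed

lemma pure_mult_right:
  assumes "x \<in> carrier A" "q \<in> carrier B" "q' \<in> carrier B"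
  shows "pure A B x (q \<otimes>\<^bsub>B\<^esub> q') = pure A B x q \<otimes>\<^bsub>tensor A B\<^esub> pure A B x q'"
proof -
  have "frag_of (x, q \<otimes>\<^bsub>B\<^esub> q') - frag_of (x, q) - frag_of (x, q') \<in> N"
    unfolding N_eq by (rule generate.incl) (use assms in \<open>auto simp: rels_def\<close>)
  then have "frag_of (x, q \<otimes>\<^bsub>B\<^esub> q') - (frag_of (x, q) + frag_of (x, q')) \<in> N"
    by (simp only: diff_diff_eq)
  from coset_eq[OF _ _ this] show ?thesis
    unfolding pure_def using assms
    by (subst coset_mult) (simp_all only: frag_of_closed plus_closed B_closed)
qed

lemma pure_hom: "q \<in> carrier B \<Longrightarrow> (\<lambda>x. pure A B x q) \<in> hom A (tensor A B)"
  by (rule homI) (simp_all add: pure_closed pure_mult_left)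

lemma tensor_induct [consumes 1, case_names pure mult inv one]:
  assumes t: "t \<in> carrier (tensor A B)"
    and pure: "\<And>x q. x \<in> carrier A \<Longrightarrow> q \<in> carrier B \<Longrightarrow> R (pure A B x q)"
    and mult: "\<And>t u. t \<in> carrier (tensor A B) \<Longrightarrow> u \<in> carrier (tensor A B) \<Longrightarrow> R t \<Longrightarrow> R u \<Longrightarrow> R (t \<otimes>\<^bsub>tensor A B\<^esub> u)"
    and inv: "\<And>t. t \<in> carrier (tensor A B) \<Longrightarrow> R t \<Longrightarrow> R (inv\<^bsub>tensor A B\<^esub> t)"
    and one: "R \<one>\<^bsub>tensor A B\<^esub>"
  shows "R t"
proof -
  interpret T: comm_group "tensor A B" by (rule comm_group_tensor)
  obtain x where x: "x \<in> carrier FA" "t = N #>\<^bsub>FA\<^esub> x"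
    using t unfolding tensor_def carrier_FactGroup by blast
  have keys: "Poly_Mapping.keys x \<subseteq> carrier A \<times> carrier B" using x(1) by simp
  have "R (N #>\<^bsub>FA\<^esub> x)"
    using keys
  proof (induction rule: free_Abelian_group_induct[consumes 1, case_names 1 2 3])
    case 1
    have "N #>\<^bsub>FA\<^esub> 0 = N" using group.coset_mult_one[OF FA(2)] subgroup.subset[OF N] by simp
    then show ?case using one by (simp add: tensor_def)
  next
    \<comment> \<open>Induction on the free abelian group proceeds through differences, hence the
      case of inverses in this rule.\<close>
    case (2 x y)
    then have xy: "x \<in> carrier FA" "y \<in> carrier FA" by simp_all
    have "(N #>\<^bsub>FA\<^esub> (x - y)) \<otimes>\<^bsub>tensor A B\<^esub> (N #>\<^bsub>FA\<^esub> y) = N #>\<^bsub>FA\<^esub> x"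
      unfolding coset_mult[OF diff_closed[OF xy] xy(2)] by simp
    then have "N #>\<^bsub>FA\<^esub> (x - y) = (N #>\<^bsub>FA\<^esub> x) \<otimes>\<^bsub>tensor A B\<^esub> inv\<^bsub>tensor A B\<^esub> (N #>\<^bsub>FA\<^esub> y)"
      using coset_closed[OF diff_closed[OF xy]] coset_closed[OF xy(1)] coset_closed[OF xy(2)]
      by (metis T.inv_solve_right)
    then show ?case
      using 2 coset_closed[OF xy(1)] coset_closed[OF xy(2)] by (simp add: mult inv)
  next
    case (3 p)
    then show ?case using pure[of "fst p" "snd p"] by (auto simp: pure_def)
  qed
  then show ?thesis by (simp add: x)
qed

lemma tensor_universal:
  assumes H: "comm_group H" and \<phi>: "\<And>x q. x \<in> carrier A \<Longrightarrow> q \<in> carrier B \<Longrightarrow> \<phi> x q \<in> carrier H"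
    and left: "\<And>x x' q. x \<in> carrier A \<Longrightarrow> x' \<in> carrier A \<Longrightarrow> q \<in> carrier B \<Longrightarrow>
      \<phi> (x \<otimes>\<^bsub>A\<^esub> x') q = \<phi> x q \<otimes>\<^bsub>H\<^esub> \<phi> x' q"
    and right: "\<And>x q q'. x \<in> carrier A \<Longrightarrow> q \<in> carrier B \<Longrightarrow> q' \<in> carrier B \<Longrightarrow>
      \<phi> x (q \<otimes>\<^bsub>B\<^esub> q') = \<phi> x q \<otimes>\<^bsub>H\<^esub> \<phi> x q'"
  obtains g where "g \<in> hom (tensor A B) H"
    "\<And>x q. x \<in> carrier A \<Longrightarrow> q \<in> carrier B \<Longrightarrow> g (pure A B x q) = \<phi> x q"
proof -
  interpret H: comm_group H by (rule H)
  have "case_prod \<phi> ` (carrier A \<times> carrier B) \<subseteq> carrier H" using \<phi> by auto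
  then obtain h where h: "h \<in> hom FA H" "\<And>x. x \<in> carrier A \<times> carrier B \<Longrightarrow> h (frag_of x) = case_prod \<phi> x"
    using H.free_Abelian_group_universal by blast
  interpret h: group_hom FA H h
    using FA(2) h(1) H.is_group by (simp add: group_hom_def group_hom_axioms_def)
  have hd: "h (x - y) = h x \<otimes>\<^bsub>H\<^esub> inv\<^bsub>H\<^esub> h y" if xy: "x \<in> carrier FA" "y \<in> carrier FA" for x y
  proof -
    have "h ((x - y) \<otimes>\<^bsub>FA\<^esub> y) = h (x - y) \<otimes>\<^bsub>H\<^esub> h y"
      by (rule h.hom_mult[OF diff_closed[OF xy] xy(2)])
    then have "h x = h (x - y) \<otimes>\<^bsub>H\<^esub> h y" by simp
    then show ?thesis
      using h.hom_closed[OF diff_closed[OF xy]] h.hom_closed[OF xy(1)] h.hom_closed[OF xy(2)]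
      by (metis H.inv_solve_right)
  qed
  have one: "u \<otimes>\<^bsub>H\<^esub> v \<otimes>\<^bsub>H\<^esub> inv\<^bsub>H\<^esub> u \<otimes>\<^bsub>H\<^esub> inv\<^bsub>H\<^esub> v = \<one>\<^bsub>H\<^esub>"
    if "u \<in> carrier H" "v \<in> carrier H" for u v
    using that by (metis H.inv_closed H.inv_mult H.m_assoc H.m_closed H.r_inv)
  have "rels \<subseteq> kernel FA H h"
  proof
    fix r assume r: "r \<in> rels"
    then have rF: "r \<in> carrier FA" using rels_closed by blast
    from r consider (1) a a' b where "r = frag_of (a \<otimes>\<^bsub>A\<^esub> a', b) - frag_of (a, b) - frag_of (a', b)"
        "a \<in> carrier A" "a' \<in> carrier A" "b \<in> carrier B"
      | (2) a b b' where "r = frag_of (a, b \<otimes>\<^bsub>B\<^esub> b') - frag_of (a, b) - frag_of (a, b')"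
        "a \<in> carrier A" "b \<in> carrier B" "b' \<in> carrier B"
      unfolding rels_def by blast
    then have "h r = \<one>\<^bsub>H\<^esub>"
    proof cases
      case 1
      have "h r = \<phi> (a \<otimes>\<^bsub>A\<^esub> a') b \<otimes>\<^bsub>H\<^esub> inv\<^bsub>H\<^esub> \<phi> a b \<otimes>\<^bsub>H\<^esub> inv\<^bsub>H\<^esub> \<phi> a' b"
        unfolding 1(1) using 1(2-) by (simp only: hd diff_closed frag_of_closed A.m_closed h(2) SigmaI prod.case)
      then show ?thesis using left[OF 1(2-4)] one \<phi> 1(2-4) by simp
    next
      case 2
      have "h r = \<phi> a (b \<otimes>\<^bsub>B\<^esub> b') \<otimes>\<^bsub>H\<^esub> inv\<^bsub>H\<^esub> \<phi> a b \<otimes>\<^bsub>H\<^esub> inv\<^bsub>H\<^esub> \<phi> a b'"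
        unfolding 2(1) using 2(2-) by (simp only: hd diff_closed frag_of_closed B_closed h(2) SigmaI prod.case)
      then show ?thesis using right[OF 2(2-4)] one \<phi> 2(2-4) by simp
    qed
    then show "r \<in> kernel FA H h" using rF by (simp add: kernel_def)
  qed
  then have "N \<subseteq> kernel FA H h"
    unfolding N_eq by (rule group.generate_subgroup_incl[OF FA(2) _ h.subgroup_kernel])
  then obtain g where g: "g \<in> hom (FA Mod N) H" "\<And>x. x \<in> carrier FA \<Longrightarrow> g (N #>\<^bsub>FA\<^esub> x) = h x"
    using h.FactGroup_universal_kernel[OF normal_N] by blast
  show thesis
  proof (rule that[of g])
    show "g \<in> hom (tensor A B) H" using g(1) by (simp add: tensor_def)
    show "g (pure A B x q) = \<phi> x q" if "x \<in> carrier A" "q \<in> carrier B" for x q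
      unfolding pure_def using g(2)[OF frag_of_closed[OF that]] h(2)[of "(x, q)"] that by simp
  qed
qed

lemma tensor_map_pure:
  assumes A': "comm_group A'" and f: "f \<in> hom A A'" and x: "x \<in> carrier A" and q: "q \<in> carrier B"
  shows "tensor_map A' B f (pure A B x q) = pure A' B (f x) q"
proof -
  interpret A': tensor_setup A' B
    by (rule tensor_setup.intro[OF A']) (unfold_locales, rule B_closed)
  let ?f = "frag_extend (\<lambda>(a, b). frag_of (f a, b))"
  have fc: "f a \<in> carrier A'" if "a \<in> carrier A" for a using f that by (auto simp: hom_def)
  have f_hom: "?f \<in> hom FA A'.FA"
  proof (rule homI)
    fix u assume u: "u \<in> carrier FA"
    have "Poly_Mapping.keys (?f u) \<subseteq> (\<Union>x\<in>Poly_Mapping.keys u. Poly_Mapping.keys (case x of (a, b) \<Rightarrow> frag_of (f a, b)))"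
      by (rule keys_frag_extend)
    also have "\<dots> \<subseteq> carrier A' \<times> carrier B"
    proof (rule UN_least)
      fix p assume "p \<in> Poly_Mapping.keys u"
      then have "fst p \<in> carrier A" "snd p \<in> carrier B" using u by auto
      then show "Poly_Mapping.keys (case p of (a, b) \<Rightarrow> frag_of (f a, b)) \<subseteq> carrier A' \<times> carrier B"
        using fc by (simp add: split_beta)
    qed
    finally show "?f u \<in> carrier A'.FA" by simp
  next
    fix u v assume "u \<in> carrier FA" "v \<in> carrier FA"
    show "?f (u \<otimes>\<^bsub>FA\<^esub> v) = ?f u \<otimes>\<^bsub>A'.FA\<^esub> ?f v" by (simp add: frag_extend_add)
  qed
  interpret f: group_hom FA A'.FA ?f
    using FA(2) A'.FA(2) f_hom by (simp add: group_hom_def group_hom_axioms_def)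
  \<comment> \<open>The elements sent into the relations of the target form a subgroup, so it
    suffices to check the generating relations.\<close>
  have sub: "subgroup {u \<in> carrier FA. ?f u \<in> A'.N} FA"
  proof (rule group.subgroupI[OF FA(2)])
    show "{u \<in> carrier FA. ?f u \<in> A'.N} \<noteq> {}"
      using f.hom_one subgroup.one_closed[OF A'.N] f.G.one_closed by auto
  next
    fix u assume "u \<in> {u \<in> carrier FA. ?f u \<in> A'.N}"
    then have u: "u \<in> carrier FA" "?f u \<in> A'.N" by simp_all
    show "inv\<^bsub>FA\<^esub> u \<in> {u \<in> carrier FA. ?f u \<in> A'.N}"
      unfolding mem_Collect_eq f.hom_inv[OF u(1)]
      by (intro conjI f.G.inv_closed[OF u(1)] subgroup.m_inv_closed[OF A'.N u(2)])
  next
    fix u v assume "u \<in> {u \<in> carrier FA. ?f u \<in> A'.N}" "v \<in> {u \<in> carrier FA. ?f u \<in> A'.N}"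
    then have u: "u \<in> carrier FA" "?f u \<in> A'.N" "v \<in> carrier FA" "?f v \<in> A'.N" by simp_all
    show "u \<otimes>\<^bsub>FA\<^esub> v \<in> {u \<in> carrier FA. ?f u \<in> A'.N}"
      unfolding mem_Collect_eq f.hom_mult[OF u(1,3)]
      by (intro conjI f.G.m_closed[OF u(1,3)] subgroup.m_closed[OF A'.N u(2,4)])
  qed auto
  have "rels \<subseteq> {u \<in> carrier FA. ?f u \<in> A'.N}"
  proof
    fix r assume r: "r \<in> rels"
    then have rF: "r \<in> carrier FA" using rels_closed by blast
    have incl: "s \<in> A'.N" if "s \<in> A'.rels" for s unfolding A'.N_eq using that by (rule generate.incl)
    from r consider (1) a a' b where "r = frag_of (a \<otimes>\<^bsub>A\<^esub> a', b) - frag_of (a, b) - frag_of (a', b)"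
        "a \<in> carrier A" "a' \<in> carrier A" "b \<in> carrier B"
      | (2) a b b' where "r = frag_of (a, b \<otimes>\<^bsub>B\<^esub> b') - frag_of (a, b) - frag_of (a, b')"
        "a \<in> carrier A" "b \<in> carrier B" "b' \<in> carrier B"
      unfolding rels_def by blast
    then have "?f r \<in> A'.N"
    proof cases
      case 1
      have "?f r = frag_of (f a \<otimes>\<^bsub>A'\<^esub> f a', b) - frag_of (f a, b) - frag_of (f a', b)"
        unfolding 1(1) using f 1(2-) by (simp add: frag_extend_diff frag_extend_of hom_def)
      then show ?thesis using fc 1(2-) by (intro incl) (auto simp: A'.rels_def)
    next
      case 2
      have "?f r = frag_of (f a, b \<otimes>\<^bsub>B\<^esub> b') - frag_of (f a, b) - frag_of (f a, b')"
        unfolding 2(1) by (simp add: frag_extend_diff frag_extend_of)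
      then show ?thesis using fc 2(2-) by (intro incl) (auto simp: A'.rels_def)
    qed
    then show "r \<in> {u \<in> carrier FA. ?f u \<in> A'.N}" using rF by simp
  qed
  then have "N \<subseteq> {u \<in> carrier FA. ?f u \<in> A'.N}"
    unfolding N_eq by (rule group.generate_subgroup_incl[OF FA(2) _ sub])
  then have "?f ` N \<subseteq> A'.N" by blast
  from quot_map_coset[OF FA(2) N A'.FA(2) A'.N f_hom this frag_of_closed[OF x q]]
  show ?thesis unfolding tensor_map_def pure_def by (simp add: frag_extend_of)
qed

end

section \<open>Localised cokernels\<close>

lemma (in group) int_pow_cong:
  assumes "x \<in> carrier G" "x [^] (a::int) = \<one>" "a dvd e - e'"
  shows "x [^] e = x [^] e'"
proof -
  obtain c where "e - e' = a * c" using assms(3) by (rule dvdE)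
  then have "e = e' + a * c" by simp
  then have "x [^] e = x [^] e' \<otimes> (x [^] a) [^] c"
    using assms(1) by (simp only: int_pow_mult int_pow_pow)
  then show ?thesis using assms(1,2) by simp
qed

lemma mat_image_subgroup:
  assumes "A \<in> carrier_mat n n" shows "subgroup (mat_image n A) (Zn n)"
proof -
  have "(\<lambda>v. A *\<^sub>v v) \<in> hom (Zn n) (Zn n)"
    using assms by (auto simp: hom_def mult_add_distrib_mat_vec[of _ n n])
  then have "group_hom (Zn n) (Zn n) (\<lambda>v. A *\<^sub>v v)"
    using group_Zn by (simp add: group_hom_def group_hom_axioms_def)
  from group_hom.img_is_subgroup[OF this] show ?thesis by (simp add: mat_image_def)
qed

definition coset_of :: "nat \<Rightarrow> int mat \<Rightarrow> int vec \<Rightarrow> int vec set" where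
  "coset_of n A v = mat_image n A #>\<^bsub>Zn n\<^esub> v"

locale localised_cok = P_exponent b g for b g :: int +
  fixes P :: "nat set" and n :: nat and A :: "int mat" and a :: int
  assumes A: "A \<in> carrier_mat n n" and denoms: "\<And>s. s \<in> loc_denoms P \<longleftrightarrow> coprime s b" and abg: "a = b * g"
begin

lemma cok_comm_group: "comm_group (cok n A)"
  unfolding cok_def by (rule comm_group.abelian_FactGroup[OF comm_group_Zn mat_image_subgroup[OF A]])

sublocale TS: tensor_setup "cok n A" "loc_int P"
  by (intro tensor_setup.intro tensor_setup_axioms.intro cok_comm_group loc_int_closed)

abbreviation "T \<equiv> tensor (cok n A) (loc_int P)"

sublocale T: comm_group T by (rule TS.comm_group_tensor)

lemma normal_image: "mat_image n A \<lhd> Zn n"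
  using comm_group.normal_iff_subgroup[OF comm_group_Zn] mat_image_subgroup[OF A] by blast

lemma coset_of_hom: "coset_of n A \<in> hom (Zn n) (cok n A)"
  using normal.r_coset_hom_Mod[OF normal_image] by (simp add: coset_of_def[abs_def] cok_def)

lemma carrier_cok: "carrier (cok n A) = coset_of n A ` carrier_vec n"
  by (simp add: cok_def carrier_FactGroup coset_of_def[abs_def])

lemma coset_of_closed: "v \<in> carrier_vec n \<Longrightarrow> coset_of n A v \<in> carrier (cok n A)"
  unfolding carrier_cok by (rule imageI)

lemma coset_of_eq_one: "v \<in> mat_image n A \<Longrightarrow> coset_of n A v = \<one>\<^bsub>cok n A\<^esub>"
  using group.coset_join2[OF group_Zn _ mat_image_subgroup[OF A], of v]
    subgroup.subset[OF mat_image_subgroup[OF A]]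
  by (auto simp: coset_of_def cok_def)

text \<open>The element \<open>v / s\<close> of the localised cokernel.\<close>

definition j :: "int \<Rightarrow> int vec \<Rightarrow> (int vec set \<times> (int \<times> int) set \<Rightarrow>\<^sub>0 int) set" where
  "j s v = pure (cok n A) (loc_int P) (coset_of n A v) (fraction P 1 s)"

lemma j_hom: "s \<in> loc_denoms P \<Longrightarrow> j s \<in> hom (Zn n) T"
  using hom_compose[OF coset_of_hom TS.pure_hom[OF fraction_closed[of s P 1]]]
  by (simp add: j_def[abs_def] comp_def)

lemma j_Zn_hom: "s \<in> loc_denoms P \<Longrightarrow> Zn_hom T n (j s)"
  by (rule Zn_homI[OF TS.comm_group_tensor j_hom])

lemma pure_coset_of:
  assumes v: "v \<in> carrier_vec n" and s: "s \<in> loc_denoms P"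
  shows "pure (cok n A) (loc_int P) (coset_of n A v) (fraction P c s) = j s (c \<cdot>\<^sub>v v)"
proof -
  let ?\<psi> = "\<lambda>c. pure (cok n A) (loc_int P) (coset_of n A v) (fraction P c s)"
  have "?\<psi> \<in> hom integer_group T"
    using TS.pure_closed[OF coset_of_closed[OF v] fraction_closed[OF s]]
      TS.pure_mult_right[OF coset_of_closed[OF v] fraction_closed[OF s] fraction_closed[OF s]]
    by (intro homI) (simp_all add: fraction_add[OF s])
  then have "group_hom integer_group T ?\<psi>"
    using group_integer_group T.is_group by (simp add: group_hom_def group_hom_axioms_def)
  from group_hom.hom_int_pow[OF this, of 1 c]
  have "?\<psi> c = ?\<psi> 1 [^]\<^bsub>T\<^esub> c" by simp
  also have "\<dots> = j s (c \<cdot>\<^sub>v v)"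
    using Zn_hom.smult[OF j_Zn_hom[OF s] v, of c] by (simp add: j_def)
  finally show ?thesis .
qed

lemma j_expand:
  assumes "v \<in> carrier_vec n" "s \<in> loc_denoms P" "t \<in> loc_denoms P"
  shows "j s v = j (s * t) (t \<cdot>\<^sub>v v)"
proof -
  have "fraction P 1 s = fraction P t (s * t)"
    using assms by (intro fraction_eqI loc_denoms_mult) (auto simp: mult.commute)
  then show ?thesis
    using pure_coset_of[OF assms(1) loc_denoms_mult[OF assms(2,3)], of t] by (simp add: j_def)
qed

text \<open>A sum of pure tensors is brought to a common denominator by \<open>j_expand\<close>, so
  it is again a single fraction.\<close>

lemma j_surj:
  assumes "t \<in> carrier T"
  shows "\<exists>s v. s \<in> loc_denoms P \<and> v \<in> carrier_vec n \<and> t = j s v"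
  using assms
proof (induction rule: TS.tensor_induct)
  case (pure x q)
  then obtain v c s where "v \<in> carrier_vec n" "x = coset_of n A v" "s \<in> loc_denoms P" "q = fraction P c s"
    unfolding carrier_cok loc_int_carrier by blast
  then show ?case using pure_coset_of[of v s c] by (intro exI[of _ s] exI[of _ "c \<cdot>\<^sub>v v"]) simp
next
  case (mult t u)
  then obtain s v r w where sv: "s \<in> loc_denoms P" "v \<in> carrier_vec n" "t = j s v"
    and rw: "r \<in> loc_denoms P" "w \<in> carrier_vec n" "u = j r w" by blast
  have "t = j (s * r) (r \<cdot>\<^sub>v v)" unfolding sv(3) by (rule j_expand[OF sv(2,1) rw(1)])
  moreover have "u = j (s * r) (s \<cdot>\<^sub>v w)"
    unfolding rw(3) using j_expand[OF rw(2,1) sv(1)] by (simp add: mult.commute)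
  ultimately have "t \<otimes>\<^bsub>T\<^esub> u = j (s * r) (r \<cdot>\<^sub>v v + s \<cdot>\<^sub>v w)"
    using Zn_hom.add[OF j_Zn_hom[OF loc_denoms_mult[OF sv(1) rw(1)]], of "r \<cdot>\<^sub>v v" "s \<cdot>\<^sub>v w"] sv(2) rw(2)
    by simp
  then show ?case using sv rw loc_denoms_mult[OF sv(1) rw(1)]
    by (intro exI[of _ "s * r"] exI[of _ "r \<cdot>\<^sub>v v + s \<cdot>\<^sub>v w"]) simp
next
  case (inv t)
  then obtain s v where sv: "s \<in> loc_denoms P" "v \<in> carrier_vec n" "t = j s v" by blast
  have "j s ((- 1) \<cdot>\<^sub>v v) = j s v [^]\<^bsub>T\<^esub> (- 1 :: int)" by (rule Zn_hom.smult[OF j_Zn_hom[OF sv(1)] sv(2)])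
  also have "\<dots> = inv\<^bsub>T\<^esub> t" using inv(1) T.int_pow_neg[of t 1] by (simp add: sv(3))
  finally show ?case using sv by (intro exI[of _ s] exI[of _ "(- 1) \<cdot>\<^sub>v v"]) simp
next
  case one
  show ?case using Zn_hom.zero[OF j_Zn_hom[OF loc_denoms_one]]
    by (intro exI[of _ 1] exI[of _ "0\<^sub>v n"]) (simp add: loc_denoms_one)
qed

lemma denoms_iff: "s \<in> loc_denoms P \<longleftrightarrow> coprime s a"
  unfolding denoms abg using coprime_iff by blast

text \<open>If \<open>u v\<close> lies in the image of \<open>A\<close>, then \<open>v / s\<close>
  equals \<open>(u v) / (s u)\<close>, which vanishes.\<close>

lemma j_eq_one:
  assumes s: "s \<in> loc_denoms P" and v: "v \<in> sat n A a"
  shows "j s v = \<one>\<^bsub>T\<^esub>"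
proof -
  obtain u where u: "v \<in> carrier_vec n" "coprime u a" "u \<cdot>\<^sub>v v \<in> mat_image n A"
    using v by (auto simp: sat_def)
  then have u': "u \<in> loc_denoms P" by (simp add: denoms_iff)
  have "group_hom (cok n A) T (\<lambda>x. pure (cok n A) (loc_int P) x q)" if "q \<in> carrier (loc_int P)" for q
    using TS.pure_hom[OF that] T.is_group TS.A.is_group by (simp add: group_hom_def group_hom_axioms_def)
  from group_hom.hom_one[OF this[OF fraction_closed[OF loc_denoms_mult[OF s u'], of 1]]]
  have "j (s * u) (u \<cdot>\<^sub>v v) = \<one>\<^bsub>T\<^esub>" by (simp add: j_def coset_of_eq_one[OF u(3)])
  then show ?thesis using j_expand[OF u(1) s u'] by simp
qed

text \<open>A group killed by \<open>a\<close> is a module over the localisation, with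
  \<open>1 / s\<close> acting as the inverse of \<open>s\<close> modulo \<open>a\<close>.
  \<open>loc_mod\<close> describes this action and makes the pairing biadditive, so \<open>H\<close>
  extends by the universal property.\<close>

lemma extend:
  assumes K: "comm_group K" "\<And>x. x \<in> carrier K \<Longrightarrow> x [^]\<^bsub>K\<^esub> a = \<one>\<^bsub>K\<^esub>"
    and H: "H \<in> hom (Zn n) K" and im: "mat_image n A \<subseteq> ker K n H"
  obtains \<theta> where "\<theta> \<in> hom T K"
    "\<And>v q. v \<in> carrier_vec n \<Longrightarrow> q \<in> carrier (loc_int P) \<Longrightarrow>
      \<theta> (pure (cok n A) (loc_int P) (coset_of n A v) q) = H v [^]\<^bsub>K\<^esub> loc_mod a q"
proof -
  interpret K: comm_group K by (rule K(1))
  interpret H: group_hom "Zn n" K H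
    using group_Zn K.is_group H by (simp add: group_hom_def group_hom_axioms_def)
  have "mat_image n A \<subseteq> kernel (Zn n) K H" using im by (auto simp: kernel_def ker_def)
  then obtain h where h: "h \<in> hom (cok n A) K" "\<And>v. v \<in> carrier_vec n \<Longrightarrow> h (coset_of n A v) = H v"
    using H.FactGroup_universal_kernel[OF normal_image] unfolding cok_def coset_of_def
    by (metis Zn_simps(1))
  interpret h: group_hom "cok n A" K h
    using TS.A.is_group K.is_group h(1) by (simp add: group_hom_def group_hom_axioms_def)
  have unit: "coprime s a" if "s \<in> loc_denoms P" for s using that by (simp add: denoms_iff)
  obtain \<theta> where \<theta>: "\<theta> \<in> hom T K" "\<And>x q. x \<in> carrier (cok n A) \<Longrightarrow> q \<in> carrier (loc_int P) \<Longrightarrow>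
      \<theta> (pure (cok n A) (loc_int P) x q) = h x [^]\<^bsub>K\<^esub> loc_mod a q"
  proof (rule TS.tensor_universal[OF K(1), of "\<lambda>x q. h x [^]\<^bsub>K\<^esub> loc_mod a q"])
    fix x q q' assume x: "x \<in> carrier (cok n A)" and q: "q \<in> carrier (loc_int P)" "q' \<in> carrier (loc_int P)"
    show "h x [^]\<^bsub>K\<^esub> loc_mod a (q \<otimes>\<^bsub>loc_int P\<^esub> q') = h x [^]\<^bsub>K\<^esub> loc_mod a q \<otimes>\<^bsub>K\<^esub> h x [^]\<^bsub>K\<^esub> loc_mod a q'"
      using x K.int_pow_cong[OF _ K(2) loc_mod_mult[OF unit q], of "h x"] by (simp add: K.int_pow_mult)
  qed (simp_all add: K.int_pow_distrib)
  show thesis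
    by (rule that[OF \<theta>(1)]) (simp add: \<theta>(2) coset_of_closed h(2))
qed

text \<open>The extension of \<open>H\<close> sends \<open>v / s\<close> to a unit multiple of
  \<open>H v\<close>. If this vanishes, \<open>v\<close> lies in the kernel of \<open>H\<close>,
  which is the saturation, and there \<open>v / s\<close> vanishes by \<open>j_eq_one\<close>.
  Surjectivity is visible already on the elements \<open>v / 1\<close>.\<close>

lemma iso_of_marking:
  assumes K: "comm_group K" "\<And>x. x \<in> carrier K \<Longrightarrow> x [^]\<^bsub>K\<^esub> g = \<one>\<^bsub>K\<^esub>"
    and H: "H \<in> hom (Zn n) K" "H ` carrier_vec n = carrier K" and kerH: "ker K n H = lat n A a"
  obtains \<theta> where "\<theta> \<in> iso T K"
    "\<And>v q. v \<in> carrier_vec n \<Longrightarrow> q \<in> carrier (loc_int P) \<Longrightarrow>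
      \<theta> (pure (cok n A) (loc_int P) (coset_of n A v) q) = H v [^]\<^bsub>K\<^esub> loc_mod a q"
proof -
  interpret K: comm_group K by (rule K(1))
  have sat: "ker K n H = sat n A a"
    using ker_eq_lat_iff_sat[OF K H(1) A] kerH by (simp add: abg)
  have Ka: "x [^]\<^bsub>K\<^esub> a = \<one>\<^bsub>K\<^esub>" if "x \<in> carrier K" for x
    using that K(2)[OF that] by (simp add: abg mult.commute[of b] K.int_pow_pow[symmetric])
  have "mat_image n A \<subseteq> ker K n H"
    unfolding kerH using A by (auto simp: mat_image_iff mult_in_lat)
  then obtain \<theta> where \<theta>: "\<theta> \<in> hom T K"
    "\<And>v q. v \<in> carrier_vec n \<Longrightarrow> q \<in> carrier (loc_int P) \<Longrightarrow>
      \<theta> (pure (cok n A) (loc_int P) (coset_of n A v) q) = H v [^]\<^bsub>K\<^esub> loc_mod a q"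
    using extend[OF K(1) Ka H(1)] by blast
  have unit: "coprime s a" if "s \<in> loc_denoms P" for s using that by (simp add: denoms_iff)
  have Hc: "H v \<in> carrier K" if "v \<in> carrier_vec n" for v using H(2) that by blast
  have e: "a dvd loc_mod a (fraction P 1 s) * s - 1" if "s \<in> loc_denoms P" for s
    by (rule loc_mod[OF unit that])
  interpret \<theta>: group_hom T K \<theta>
    using T.is_group K.is_group \<theta>(1) by (simp add: group_hom_def group_hom_axioms_def)
  have inj: "inj_on \<theta> (carrier T)"
  proof (rule \<theta>.trivial_ker_imp_inj)
    have "t = \<one>\<^bsub>T\<^esub>" if t: "t \<in> carrier T" "\<theta> t = \<one>\<^bsub>K\<^esub>" for t
    proof -
      from t(1) obtain s v where sv: "s \<in> loc_denoms P" "v \<in> carrier_vec n" "t = j s v" using j_surj by blast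
      have "H v [^]\<^bsub>K\<^esub> loc_mod a (fraction P 1 s) = \<one>\<^bsub>K\<^esub>"
        using t(2) \<theta>(2)[OF sv(2) fraction_closed[OF sv(1), of 1]] by (simp add: sv(3) j_def)
      moreover have "coprime (loc_mod a (fraction P 1 s)) a"
      proof -
        obtain c where c: "loc_mod a (fraction P 1 s) * s - 1 = a * c" using e[OF sv(1)] by (rule dvdE)
        show ?thesis
        proof (rule coprimeI)
          fix d assume d: "d dvd loc_mod a (fraction P 1 s)" "d dvd a"
          have "1 = loc_mod a (fraction P 1 s) * s - a * c" using c by simp
          then show "is_unit d" using d by (metis dvd_diff dvd_mult2)
        qed
      qed
      ultimately have "H v = \<one>\<^bsub>K\<^esub>"
        using K.pow_eq_one_coprime[of "H v" "loc_mod a (fraction P 1 s)" a] Hc[OF sv(2)] Ka by simp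
      then have "v \<in> sat n A a" unfolding sat[symmetric] using sv(2) by (simp add: ker_def)
      then show ?thesis unfolding sv(3) by (rule j_eq_one[OF sv(1)])
    qed
    then show "kernel T K \<theta> = {\<one>\<^bsub>T\<^esub>}" by (auto simp: kernel_def)
  qed
  have surj: "\<theta> ` carrier T = carrier K"
  proof (intro equalityI subsetI)
    fix x assume "x \<in> carrier K"
    then obtain v where v: "v \<in> carrier_vec n" "x = H v" using H(2) by blast
    have "H v [^]\<^bsub>K\<^esub> loc_mod a (fraction P 1 1) = H v [^]\<^bsub>K\<^esub> (1 :: int)"
      using e[OF loc_denoms_one] by (intro K.int_pow_cong[OF Hc[OF v(1)] Ka[OF Hc[OF v(1)]]]) simp
    then have "H v [^]\<^bsub>K\<^esub> loc_mod a (fraction P 1 1) = H v" using Hc[OF v(1)] by simp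
    then have "x = \<theta> (j 1 v)"
      using \<theta>(2)[OF v(1) fraction_closed[OF loc_denoms_one, where c=1]] by (simp add: v(2) j_def)
    moreover have "j 1 v \<in> carrier T" by (rule Zn_hom.closed[OF j_Zn_hom[OF loc_denoms_one] v(1)])
    ultimately show "x \<in> \<theta> ` carrier T" by (rule image_eqI)
  qed auto
  have "\<theta> \<in> iso T K" using \<theta>(1) inj surj by (simp add: iso_def bij_betw_def)
  then show thesis using that \<theta>(2) by blast
qed

text \<open>The tensor product inherits the exponent \<open>g\<close> from \<open>K\<close>, so
  denominators can be inverted and every element is of the form \<open>v / 1\<close>. For the
  kernel, the projection of \<open>Z^n\<close> onto its quotient by the lattice extends to the
  localised cokernel by \<open>extend\<close>; a vector that dies in the cokernel therefore dies in
  that quotient.\<close>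

lemma marking_of_iso:
  assumes K: "comm_group K" "\<And>x. x \<in> carrier K \<Longrightarrow> x [^]\<^bsub>K\<^esub> g = \<one>\<^bsub>K\<^esub>" and \<theta>: "\<theta> \<in> iso T K"
  shows "(\<lambda>v. \<theta> (j 1 v)) \<in> hom (Zn n) K" "(\<lambda>v. \<theta> (j 1 v)) ` carrier_vec n = carrier K"
    "ker K n (\<lambda>v. \<theta> (j 1 v)) = lat n A a"
proof -
  interpret K: comm_group K by (rule K(1))
  have \<theta>': "\<theta> \<in> hom T K" "\<theta> ` carrier T = carrier K" "inj_on \<theta> (carrier T)"
    using \<theta> by (auto simp: iso_def bij_betw_def)
  interpret \<theta>: group_hom T K \<theta>
    using T.is_group K.is_group \<theta>'(1) by (simp add: group_hom_def group_hom_axioms_def)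
  interpret j: Zn_hom T n "j 1" by (rule j_Zn_hom[OF loc_denoms_one])
  have killed: "t [^]\<^bsub>T\<^esub> g = \<one>\<^bsub>T\<^esub>" if t: "t \<in> carrier T" for t
  proof -
    have "\<theta> (t [^]\<^bsub>T\<^esub> g) = \<theta> \<one>\<^bsub>T\<^esub>" using t K(2)[of "\<theta> t"] by (simp add: \<theta>.hom_int_pow)
    from inj_onD[OF \<theta>'(3) this] show ?thesis using t by simp
  qed
  have surj_j: "\<exists>v\<in>carrier_vec n. t = j 1 v" if t: "t \<in> carrier T" for t
  proof -
    obtain s v where sv: "s \<in> loc_denoms P" "v \<in> carrier_vec n" "t = j s v" using j_surj[OF t] by blast
    have "coprime s g" using sv(1) unfolding denoms by (rule coprime_bg)
    then obtain x y where xy: "x * s + y * g = 1" by (metis bezout_int coprime_imp_gcd_eq_1)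
    then have "t = t [^]\<^bsub>T\<^esub> (x * s + g * y)" using t by (metis T.int_pow_1 mult.commute)
    also have "\<dots> = t [^]\<^bsub>T\<^esub> (x * s)"
      by (rule T.int_pow_cong[OF t killed[OF t]]) simp
    also have "\<dots> = j s ((x * s) \<cdot>\<^sub>v v)"
      unfolding sv(3) by (rule Zn_hom.smult[OF j_Zn_hom[OF sv(1)] sv(2), symmetric])
    also have "(x * s) \<cdot>\<^sub>v v = s \<cdot>\<^sub>v (x \<cdot>\<^sub>v v)" by (simp add: smult_smult_assoc mult.commute)
    also have "j s (s \<cdot>\<^sub>v (x \<cdot>\<^sub>v v)) = j 1 (x \<cdot>\<^sub>v v)"
      using j_expand[of "x \<cdot>\<^sub>v v" 1 s] sv loc_denoms_one by simp
    finally show ?thesis using sv(2) by (intro bexI[of _ "x \<cdot>\<^sub>v v"]) auto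
  qed
  show hom: "(\<lambda>v. \<theta> (j 1 v)) \<in> hom (Zn n) K"
    using hom_compose[OF j_hom[OF loc_denoms_one] \<theta>'(1)] by (simp add: comp_def)
  show "(\<lambda>v. \<theta> (j 1 v)) ` carrier_vec n = carrier K"
  proof (intro equalityI subsetI)
    fix x assume "x \<in> carrier K"
    then obtain t where "t \<in> carrier T" "x = \<theta> t" using \<theta>'(2) by blast
    then show "x \<in> (\<lambda>v. \<theta> (j 1 v)) ` carrier_vec n" using surj_j by blast
  qed auto
  show "ker K n (\<lambda>v. \<theta> (j 1 v)) = lat n A a"
  proof (intro equalityI subsetI)
    fix v assume v: "v \<in> ker K n (\<lambda>v. \<theta> (j 1 v))"
    then have vc: "v \<in> carrier_vec n" by (simp add: ker_def)
    have "\<theta> (j 1 v) = \<theta> \<one>\<^bsub>T\<^esub>" using v by (simp add: ker_def)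
    from inj_onD[OF \<theta>'(3) this] have jv: "j 1 v = \<one>\<^bsub>T\<^esub>" using vc by simp
    let ?L = "lat n A a"
    let ?K = "Zn n Mod ?L"
    have L: "subgroup ?L (Zn n)" by (rule lat_subgroup[OF A])
    have nL: "?L \<lhd> Zn n" using comm_group.normal_iff_subgroup[OF comm_group_Zn] L by blast
    have cK: "comm_group ?K" by (rule comm_group.abelian_FactGroup[OF comm_group_Zn L])
    interpret Q: comm_group ?K by (rule cK)
    let ?q = "\<lambda>v. ?L #>\<^bsub>Zn n\<^esub> v"
    have q: "?q \<in> hom (Zn n) ?K" by (rule normal.r_coset_hom_Mod[OF nL])
    interpret q: Zn_hom ?K n ?q by (rule Zn_homI[OF cK q])
    have q1: "?q w = \<one>\<^bsub>?K\<^esub> \<longleftrightarrow> w \<in> ?L" if "w \<in> carrier_vec n" for w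
      using coset_eq_iff[OF L zero_carrier_vec that] that group.coset_mult_one[OF group_Zn subgroup.subset[OF L]]
      by simp
    have Ka: "x [^]\<^bsub>?K\<^esub> a = \<one>\<^bsub>?K\<^esub>" if x: "x \<in> carrier ?K" for x
    proof -
      obtain w where w: "w \<in> carrier_vec n" "x = ?q w" using x by (auto simp: carrier_FactGroup)
      have "a \<cdot>\<^sub>v w = A *\<^sub>v 0\<^sub>v n + a \<cdot>\<^sub>v w" using A w by auto
      then have "a \<cdot>\<^sub>v w \<in> ?L" unfolding lat_def mem_Collect_eq using A w(1)
        by (intro exI[of _ "0\<^sub>v n"] exI[of _ w]) auto
      then have "?q (a \<cdot>\<^sub>v w) = \<one>\<^bsub>?K\<^esub>"
        using q1[of "a \<cdot>\<^sub>v w"] w(1) by (simp del: q.smult)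
      then show ?thesis unfolding w(2) by (simp only: q.smult[OF w(1)])
    qed
    have "mat_image n A \<subseteq> ker ?K n ?q"
    proof
      fix w assume "w \<in> mat_image n A"
      then obtain y where y: "y \<in> carrier_vec n" "w = A *\<^sub>v y" by (auto simp: mat_image_iff)
      then have "w \<in> ?L" using mult_in_lat[OF A y(1)] by simp
      moreover have "w \<in> carrier_vec n" using A y by auto
      ultimately show "w \<in> ker ?K n ?q" using q1 by (simp add: ker_def)
    qed
    then obtain \<theta>' where \<theta>': "\<theta>' \<in> hom T ?K"
      "\<And>v q. v \<in> carrier_vec n \<Longrightarrow> q \<in> carrier (loc_int P) \<Longrightarrow>
        \<theta>' (pure (cok n A) (loc_int P) (coset_of n A v) q) = ?q v [^]\<^bsub>?K\<^esub> loc_mod a q"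
      using extend[OF cK Ka q] by blast
    have "\<theta>' \<one>\<^bsub>T\<^esub> = \<one>\<^bsub>?K\<^esub>" by (rule hom_one[OF \<theta>'(1) T.is_group Q.is_group])
    then have e1: "?q v [^]\<^bsub>?K\<^esub> loc_mod a (fraction P 1 1) = \<one>\<^bsub>?K\<^esub>"
      using \<theta>'(2)[OF vc fraction_closed[OF loc_denoms_one, where c=1]] jv by (simp add: j_def)
    have "a dvd loc_mod a (fraction P 1 1) * 1 - 1"
      by (rule loc_mod[OF _ loc_denoms_one]) (simp add: denoms_iff)
    then have "?q v [^]\<^bsub>?K\<^esub> loc_mod a (fraction P 1 1) = ?q v [^]\<^bsub>?K\<^esub> (1 :: int)"
      by (intro Q.int_pow_cong[OF q.closed[OF vc] Ka[OF q.closed[OF vc]]]) simp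
    then have "?q v = \<one>\<^bsub>?K\<^esub>" using e1 q.closed[OF vc] by simp
    then show "v \<in> ?L" using q1[OF vc] by simp
  next
    fix v assume "v \<in> lat n A a"
    then obtain y z where yz: "v = A *\<^sub>v y + a \<cdot>\<^sub>v z" "y \<in> carrier_vec n" "z \<in> carrier_vec n"
      using A by (auto simp: lat_def)
    have Ay: "A *\<^sub>v y \<in> carrier_vec n" using A yz by auto
    have "A *\<^sub>v y \<in> sat n A a"
      unfolding sat_def mat_image_iff using Ay yz by (auto intro!: exI[of _ 1] bexI[of _ y])
    then have "j 1 (A *\<^sub>v y) = \<one>\<^bsub>T\<^esub>" by (rule j_eq_one[OF loc_denoms_one])
    moreover have "j 1 (a \<cdot>\<^sub>v z) = \<one>\<^bsub>T\<^esub>"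
    proof -
      have "j 1 (a \<cdot>\<^sub>v z) = (j 1 z [^]\<^bsub>T\<^esub> g) [^]\<^bsub>T\<^esub> b"
        using yz(3) by (simp add: abg mult.commute[of b] T.int_pow_pow)
      then show ?thesis using killed[of "j 1 z"] yz(3) by simp
    qed
    ultimately have "j 1 v = \<one>\<^bsub>T\<^esub>" unfolding yz(1) using Ay yz by (simp del: j.smult)
    then show "v \<in> ker K n (\<lambda>v. \<theta> (j 1 v))"
      using Ay yz by (simp add: ker_def)
  qed
qed

lemma proj_pure:
  assumes B: "B \<in> carrier_mat n n" and sub: "mat_image n B \<subseteq> mat_image n A"
    and v: "v \<in> carrier_vec n" and q: "q \<in> carrier (loc_int P)"
  shows "tensor_map (cok n A) (loc_int P) (quot_map (Zn n) (mat_image n A) (\<lambda>v. v))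
      (pure (cok n B) (loc_int P) (coset_of n B v) q) = pure (cok n A) (loc_int P) (coset_of n A v) q"
proof -
  interpret B: localised_cok b g P n B a by unfold_locales (use B denoms abg in auto)
  have id_hom: "(\<lambda>v. v) \<in> hom (Zn n) (Zn n)" by (auto simp: hom_def)
  have coset: "quot_map (Zn n) (mat_image n A) (\<lambda>v. v) (coset_of n B w) = coset_of n A w"
    if "w \<in> carrier_vec n" for w
    unfolding coset_of_def
    using quot_map_coset[OF group_Zn mat_image_subgroup[OF B] group_Zn mat_image_subgroup[OF A] id_hom, of w]
      that sub by simp
  have "quot_map (Zn n) (mat_image n A) (\<lambda>v. v) \<in> hom (cok n B) (cok n A)"
  proof (rule homI)
    fix x assume "x \<in> carrier (cok n B)"
    then obtain w where "w \<in> carrier_vec n" "x = coset_of n B w" unfolding B.carrier_cok by blast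
    then show "quot_map (Zn n) (mat_image n A) (\<lambda>v. v) x \<in> carrier (cok n A)"
      using coset coset_of_closed by simp
  next
    fix x y assume "x \<in> carrier (cok n B)" "y \<in> carrier (cok n B)"
    then obtain w u where w: "w \<in> carrier_vec n" "x = coset_of n B w" and u: "u \<in> carrier_vec n" "y = coset_of n B u"
      unfolding B.carrier_cok by blast
    have "x \<otimes>\<^bsub>cok n B\<^esub> y = coset_of n B (w + u)"
      using hom_mult[OF B.coset_of_hom, of w u] w u by simp
    moreover have "coset_of n A (w + u) = coset_of n A w \<otimes>\<^bsub>cok n A\<^esub> coset_of n A u"
      using hom_mult[OF coset_of_hom, of w u] w u by simp
    ultimately show "quot_map (Zn n) (mat_image n A) (\<lambda>v. v) (x \<otimes>\<^bsub>cok n B\<^esub> y) =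
        quot_map (Zn n) (mat_image n A) (\<lambda>v. v) x \<otimes>\<^bsub>cok n A\<^esub> quot_map (Zn n) (mat_image n A) (\<lambda>v. v) y"
      using coset w u by simp
  qed
  from B.TS.tensor_map_pure[OF cok_comm_group this B.coset_of_closed[OF v] q]
  show ?thesis by (simp add: coset[OF v])
qed

end

section \<open>Families of surjections\<close>

lemma Zn_hom_factor:
  assumes F: "Zn_hom K n F" "F ` carrier_vec n = carrier K"
    and F': "Zn_hom K' n F'" "F' ` carrier_vec n = carrier K'" and ker: "ker K n F = ker K' n F'"
  shows "\<exists>\<sigma>. \<sigma> \<in> iso K K' \<and> \<sigma> \<in> extensional (carrier K) \<and> (\<forall>v\<in>carrier_vec n. \<sigma> (F v) = F' v)"
proof -
  interpret F: Zn_hom K n F by (rule F(1))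
  interpret F': Zn_hom K' n F' by (rule F'(1))
  have eq: "F v = F w \<longleftrightarrow> F' v = F' w" if v: "v \<in> carrier_vec n" "w \<in> carrier_vec n" for v w
  proof -
    have "v - w \<in> ker K n F \<longleftrightarrow> F v = F w"
      using v F.minus[OF v] F.right_cancel[of "inv\<^bsub>K\<^esub> F w" "F v" "F w"] by (simp add: ker_def)
    moreover have "v - w \<in> ker K' n F' \<longleftrightarrow> F' v = F' w"
      using v F'.minus[OF v] F'.right_cancel[of "inv\<^bsub>K'\<^esub> F' w" "F' v" "F' w"] by (simp add: ker_def)
    ultimately show ?thesis using ker by simp
  qed
  define \<sigma> where "\<sigma> = restrict (\<lambda>x. F' (inv_into (carrier_vec n) F x)) (carrier K)"
  have \<sigma>: "\<sigma> (F v) = F' v" if v: "v \<in> carrier_vec n" for v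
  proof -
    have im: "F v \<in> F ` carrier_vec n" using v by (rule imageI)
    have "F (inv_into (carrier_vec n) F (F v)) = F v" by (rule f_inv_into_f[OF im])
    then have "F' (inv_into (carrier_vec n) F (F v)) = F' v"
      using eq[OF inv_into_into[OF im] v] by simp
    then show ?thesis using v by (simp add: \<sigma>_def)
  qed
  have rep: "\<exists>v\<in>carrier_vec n. x = F v" if "x \<in> carrier K" for x using that F(2) by blast
  have "\<sigma> \<in> hom K K'"
  proof (rule homI)
    fix x assume "x \<in> carrier K"
    then show "\<sigma> x \<in> carrier K'" using rep \<sigma> by fastforce
  next
    fix x y assume "x \<in> carrier K" "y \<in> carrier K"
    then obtain v w where vw: "v \<in> carrier_vec n" "x = F v" "w \<in> carrier_vec n" "y = F w" using rep by blast
    have "\<sigma> (F (v + w)) = F' v \<otimes>\<^bsub>K'\<^esub> F' w" using vw by (subst \<sigma>) simp_all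
    then show "\<sigma> (x \<otimes>\<^bsub>K\<^esub> y) = \<sigma> x \<otimes>\<^bsub>K'\<^esub> \<sigma> y" using vw \<sigma> by simp
  qed
  moreover have "bij_betw \<sigma> (carrier K) (carrier K')"
    unfolding bij_betw_def
  proof
    show "inj_on \<sigma> (carrier K)"
    proof (rule inj_onI)
      fix x y assume "x \<in> carrier K" "y \<in> carrier K" and e: "\<sigma> x = \<sigma> y"
      then obtain v w where vw: "v \<in> carrier_vec n" "x = F v" "w \<in> carrier_vec n" "y = F w" using rep by blast
      then show "x = y" using e \<sigma> eq by simp
    qed
    show "\<sigma> ` carrier K = carrier K'"
      unfolding F(2)[symmetric] F'(2)[symmetric] image_image using \<sigma> by (rule image_cong[OF refl])
  qed
  ultimately show ?thesis using \<sigma> by (intro exI[of _ \<sigma>]) (simp add: iso_def \<sigma>_def)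
qed

text \<open>Together with \<open>mat_prod_cong_mod\<close>, allows the random matrices to be
  replaced by their residues modulo \<open>a\<close>, which take finitely many values.\<close>

lemma lat_cong:
  assumes A: "A \<in> carrier_mat n n" "A' \<in> carrier_mat n n"
    and cong: "\<And>r c. r < n \<Longrightarrow> c < n \<Longrightarrow> a dvd A $$ (r, c) - A' $$ (r, c)"
  shows "lat n A a = lat n A' a"
proof -
  have sub: "lat n A a \<subseteq> lat n A' a" if A: "A \<in> carrier_mat n n" "A' \<in> carrier_mat n n"
    and cong: "\<And>r c. r < n \<Longrightarrow> c < n \<Longrightarrow> a dvd A $$ (r, c) - A' $$ (r, c)" for A A' :: "int mat"
  proof
    fix v assume "v \<in> lat n A a"
    then obtain y z where yz: "v = A *\<^sub>v y + a \<cdot>\<^sub>v z" "y \<in> carrier_vec n" "z \<in> carrier_vec n"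
      using A by (auto simp: lat_def)
    define D where "D = mat n n (\<lambda>(r, c). (A $$ (r, c) - A' $$ (r, c)) div a)"
    have D: "D \<in> carrier_mat n n" by (simp add: D_def)
    have "A = A' + a \<cdot>\<^sub>m D"
    proof (rule eq_matI)
      fix r c assume "r < dim_row (A' + a \<cdot>\<^sub>m D)" "c < dim_col (A' + a \<cdot>\<^sub>m D)"
      then have rc: "r < n" "c < n" using D by auto
      then show "A $$ (r, c) = (A' + a \<cdot>\<^sub>m D) $$ (r, c)" using D cong[OF rc] by (simp add: D_def)
    qed (use A D in auto)
    moreover have "(a \<cdot>\<^sub>m D) *\<^sub>v y = a \<cdot>\<^sub>v (D *\<^sub>v y)"
      using D yz by (intro eq_vecI) (auto simp: scalar_prod_def sum_distrib_left mult.assoc)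
    then have "(A' + a \<cdot>\<^sub>m D) *\<^sub>v y = A' *\<^sub>v y + a \<cdot>\<^sub>v (D *\<^sub>v y)"
      using A D yz by (subst add_mult_distrib_mat_vec[of _ n n]) auto
    ultimately have "v = A' *\<^sub>v y + a \<cdot>\<^sub>v (D *\<^sub>v y + z)"
      unfolding yz(1) using A D yz(2,3)
      by (simp add: smult_add_distrib_vec[of _ n] assoc_add_vec[of _ n])
    moreover have "y \<in> carrier_vec (dim_col A')" "D *\<^sub>v y + z \<in> carrier_vec n" using A D yz by auto
    ultimately show "v \<in> lat n A' a" unfolding lat_def by blast
  qed
  show ?thesis
    by (rule equalityI[OF sub[OF A cong] sub[OF A(2,1)]]) (use cong in \<open>auto simp: dvd_diff_commute\<close>)
qed

lemma mat_prod_carrier: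
  "(\<And>i. i \<in> {1..j} \<Longrightarrow> A i \<in> carrier_mat n n) \<Longrightarrow> mat_prod n A j \<in> carrier_mat n n"
  by (induction j) (auto intro!: mult_carrier_mat)

lemma mat_prod_cong_mod:
  assumes A: "\<And>i. i \<in> {1..j} \<Longrightarrow> A i \<in> carrier_mat n n" "\<And>i. i \<in> {1..j} \<Longrightarrow> A' i \<in> carrier_mat n n"
    and cong: "\<And>i r c. i \<in> {1..j} \<Longrightarrow> r < n \<Longrightarrow> c < n \<Longrightarrow> a dvd A i $$ (r, c) - A' i $$ (r, c)"
    and rc: "r < n" "c < n"
  shows "a dvd mat_prod n A j $$ (r, c) - mat_prod n A' j $$ (r, c)"
  using A cong rc
proof (induction j arbitrary: r c)
  case (Suc j)
  have B: "mat_prod n A j \<in> carrier_mat n n" "mat_prod n A' j \<in> carrier_mat n n"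
    using Suc.prems by (auto intro!: mat_prod_carrier)
  have S: "A (Suc j) \<in> carrier_mat n n" "A' (Suc j) \<in> carrier_mat n n" using Suc.prems by auto
  have e: "(C * D) $$ (r, c) = (\<Sum>l<n. C $$ (r, l) * D $$ (l, c))"
    if "C \<in> carrier_mat n n" "D \<in> carrier_mat n n" for C D :: "int mat"
    using that Suc.prems by (auto simp: scalar_prod_def atLeast0LessThan intro!: sum.cong)
  have "a dvd mat_prod n A j $$ (r, l) * A (Suc j) $$ (l, c) - mat_prod n A' j $$ (r, l) * A' (Suc j) $$ (l, c)"
    if l: "l < n" for l
  proof -
    have 1: "a dvd mat_prod n A j $$ (r, l) - mat_prod n A' j $$ (r, l)" using Suc l by auto
    have 2: "a dvd A (Suc j) $$ (l, c) - A' (Suc j) $$ (l, c)" using Suc.prems l by auto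
    have "x * y - x' * y' = (x - x') * y + x' * (y - y')" for x y x' y' :: int by (simp add: algebra_simps)
    then show ?thesis using dvd_add[OF dvd_mult2[OF 1] dvd_mult[OF 2]] by (simp only:)
  qed
  then show ?case
    unfolding mat_prod.simps e[OF B(1) S(1)] e[OF B(2) S(2)] sum_subtractf[symmetric]
    by (intro dvd_sum) simp
qed simp

section \<open>The flag, its exponent and its families of surjections\<close>

locale finite_flag =
  fixes P :: "nat set" and k :: nat and G :: "'a flag"
  assumes k: "k \<ge> 1" and finite_P: "finite P" and prime_P: "\<And>p. p \<in> P \<Longrightarrow> prime p"
    and flag: "surjective_P_flag P k G"
begin

text \<open>The chain is prolonged by a trivial group in degree \<open>0\<close>, where the induction on the
  length starts.\<close>

definition Gr :: "nat \<Rightarrow> 'a monoid" where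
  "Gr i = (if i = 0 then \<lparr>carrier = {\<one>\<^bsub>grp G 1\<^esub>}, monoid.mult = (\<lambda>_ _. \<one>\<^bsub>grp G 1\<^esub>), one = \<one>\<^bsub>grp G 1\<^esub>\<rparr> else grp G i)"

definition pr :: "nat \<Rightarrow> 'a \<Rightarrow> 'a" where
  "pr i = (if i = 0 then (\<lambda>_. \<one>\<^bsub>grp G 1\<^esub>) else proj G i)"

definition b :: int where "b = int (\<Prod>p\<in>P. p)"
definition g :: int where "g = int (Coset.order (grp G k))"
definition a :: int where "a = b * g"

lemma Gr_0: "carrier (Gr 0) = {\<one>\<^bsub>Gr 0\<^esub>}" "comm_group (Gr 0)"
proof -
  show "carrier (Gr 0) = {\<one>\<^bsub>Gr 0\<^esub>}" by (simp add: Gr_def)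
  show "comm_group (Gr 0)" by (rule comm_groupI) (auto simp: Gr_def)
qed

lemma Gr_pos: "i \<noteq> 0 \<Longrightarrow> Gr i = grp G i" "i \<noteq> 0 \<Longrightarrow> pr i = proj G i"
  by (simp_all add: Gr_def pr_def)

lemma P_group: "i \<in> {1..k} \<Longrightarrow> finite_abelian_P_group P (grp G i)"
  using flag by (simp add: surjective_P_flag_def)

lemma comm_group_Gr: "i \<le> k \<Longrightarrow> comm_group (Gr i)"
  using Gr_0 P_group[of i] by (cases "i = 0") (auto simp: Gr_pos finite_abelian_P_group_def)

lemma finite_Gr: "i \<le> k \<Longrightarrow> finite (carrier (Gr i))"
  using Gr_0 P_group[of i] by (cases "i = 0") (auto simp: Gr_pos finite_abelian_P_group_def)

lemma pr_hom: "i < k \<Longrightarrow> group_hom (Gr (Suc i)) (Gr i) (pr i)"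
  and pr_surj: "i < k \<Longrightarrow> pr i ` carrier (Gr (Suc i)) = carrier (Gr i)"
proof -
  assume i: "i < k"
  interpret S: comm_group "Gr (Suc i)" using comm_group_Gr[of "Suc i"] i by simp
  interpret I: comm_group "Gr i" using comm_group_Gr[of i] i by simp
  have "pr i \<in> epi (Gr (Suc i)) (Gr i)"
  proof (cases "i = 0")
    case True
    have ne: "carrier (Gr (Suc 0)) \<noteq> {}" using True S.one_closed by auto
    show ?thesis unfolding True using ne by (auto simp: epi_def hom_def pr_def Gr_def)
  next
    case False
    then show ?thesis using flag i by (auto simp: surjective_P_flag_def Gr_pos)
  qed
  then show "group_hom (Gr (Suc i)) (Gr i) (pr i)" "pr i ` carrier (Gr (Suc i)) = carrier (Gr i)"
    by (auto simp: epi_def group_hom_def group_hom_axioms_def)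
qed

text \<open>Downward induction: the order of the top group kills it, and an exponent passes to
  quotients.\<close>

lemma killed: "i \<le> k \<Longrightarrow> x \<in> carrier (Gr i) \<Longrightarrow> x [^]\<^bsub>Gr i\<^esub> g = \<one>\<^bsub>Gr i\<^esub>"
proof (induction i arbitrary: x rule: inc_induct)
  case base
  interpret K: comm_group "Gr k" using comm_group_Gr by simp
  have "x [^]\<^bsub>Gr k\<^esub> Coset.order (Gr k) = \<one>\<^bsub>Gr k\<^esub>" by (rule K.pow_order_eq_1[OF base])
  then show ?case using k by (simp add: g_def Gr_pos int_pow_int)
next
  case (step i)
  interpret h: group_hom "Gr (Suc i)" "Gr i" "pr i" using pr_hom step by simp
  obtain y where y: "y \<in> carrier (Gr (Suc i))" "x = pr i y" using step pr_surj[of i] by blast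
  show ?case unfolding y(2) h.hom_int_pow[OF y(1), symmetric] step.IH[OF y(1)] by (rule h.hom_one)
qed

lemma prime_dvd_a: "prime p \<Longrightarrow> int p dvd a \<Longrightarrow> p \<in> P"
proof -
  assume p: "prime p" "int p dvd a"
  then have "int p dvd b \<or> int p dvd g" by (simp add: a_def prime_dvd_mult_iff)
  then show "p \<in> P"
  proof
    assume "int p dvd b"
    then have "p dvd (\<Prod>p\<in>P. p)" unfolding b_def by (simp only: int_dvd_int_iff)
    then obtain q where q: "q \<in> P" "p dvd q"
      unfolding prime_dvd_prod_iff[OF finite_P p(1)] by (rule bexE)
    then show "p \<in> P" using primes_dvd_imp_eq[OF p(1) prime_P[OF q(1)] q(2)] by simp
  next
    assume "int p dvd g"
    then show "p \<in> P" using p(1) P_group[of k] k by (simp add: g_def finite_abelian_P_group_def)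
  qed
qed

lemma P_exponent: "P_exponent b g"
proof
  show "b > 0" unfolding b_def using prime_P by (simp add: prod_pos prime_gt_0_nat)
  interpret K: comm_group "Gr k" using comm_group_Gr by simp
  have "Coset.order (Gr k) > 0" using finite_Gr[of k] K.order_gt_0_iff_finite by simp
  then show g0: "g > 0" using k by (simp add: g_def Gr_pos)
  fix s :: int assume s: "coprime s b"
  show "coprime s g"
  proof (rule ccontr)
    assume "\<not> coprime s g"
    then have "gcd s g \<noteq> 1" by (simp add: coprime_iff_gcd_eq_1)
    then have "nat (gcd s g) \<noteq> 1" by (metis gcd_ge_0_int int_nat_eq of_nat_1)
    then obtain p where p: "prime p" "p dvd nat (gcd s g)" using prime_factor_nat by blast
    then have "int p dvd gcd s g" by (metis gcd_ge_0_int int_dvd_int_iff int_nat_eq)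
    then have d: "int p dvd s" "int p dvd g" by auto
    then have "p \<in> P" using prime_dvd_a[OF p(1)] by (simp add: a_def)
    then have "p dvd (\<Prod>p\<in>P. p)" using finite_P by (rule dvd_prodI[rotated])
    then have "int p dvd b" unfolding b_def by (simp only: int_dvd_int_iff)
    then have "is_unit (int p)" using s d(1) by (meson not_coprimeI)
    then show False using p(1) by (simp add: prime_nat_iff)
  qed
qed

lemma flag_step: "j < k \<Longrightarrow> flag_step b g (Gr (Suc j)) (Gr j) (pr j) P a"
proof -
  assume j: "j < k"
  show ?thesis
  proof (intro flag_step.intro flag_step_axioms.intro P_exponent pr_hom)
    show "comm_group (Gr (Suc j))" "comm_group (Gr j)" using comm_group_Gr j by simp_all
    show "finite (carrier (Gr (Suc j)))" "finite (carrier (Gr j))" using finite_Gr j by simp_all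
    show "pr j ` carrier (Gr (Suc j)) = carrier (Gr j)" by (rule pr_surj[OF j])
    show "x [^]\<^bsub>Gr (Suc j)\<^esub> g = \<one>\<^bsub>Gr (Suc j)\<^esub>" if "x \<in> carrier (Gr (Suc j))" for x
      using killed that j by simp
    show "prime p \<and> int p dvd b" if p: "p \<in> P" for p
    proof -
      have "p dvd (\<Prod>p\<in>P. p)" using finite_P p by (rule dvd_prodI)
      then have "int p dvd b" unfolding b_def by (simp only: int_dvd_int_iff)
      then show ?thesis using prime_P[OF p] by simp
    qed
  qed (use finite_P a_def prime_dvd_a j in auto)
qed

text \<open>The families of surjections up to level \<open>j\<close>. Beyond \<open>j\<close> the
  value is fixed to \<open>undefined\<close>, so that each family is counted once.\<close>

definition Marks :: "nat \<Rightarrow> nat \<Rightarrow> (nat \<Rightarrow> int mat) \<Rightarrow> (nat \<Rightarrow> int vec \<Rightarrow> 'a) set" where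
  "Marks j n A = {H. (\<forall>i\<le>j. H i \<in> Hom n (Gr i) \<and> H i ` carrier_vec n = carrier (Gr i) \<and>
      ker (Gr i) n (H i) = lat n (mat_prod n A i) a) \<and>
    (\<forall>i<j. \<forall>v\<in>carrier_vec n. pr i (H (Suc i) v) = H i v) \<and> (\<forall>i>j. H i = undefined)}"

lemma MarksD:
  assumes "H \<in> Marks j n A" "i \<le> j" "j \<le> k"
  shows "Zn_hom (Gr i) n (H i)" "H i ` carrier_vec n = carrier (Gr i)" "ker (Gr i) n (H i) = lat n (mat_prod n A i) a"
    "H i \<in> hom (Zn n) (Gr i)" "H i \<in> extensional (carrier_vec n)"
proof -
  have h: "H i \<in> Hom n (Gr i)" "H i ` carrier_vec n = carrier (Gr i)" "ker (Gr i) n (H i) = lat n (mat_prod n A i) a"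
    using assms(1,2) by (auto simp: Marks_def)
  then show "H i \<in> hom (Zn n) (Gr i)" "H i \<in> extensional (carrier_vec n)" by (auto simp: Hom_def)
  then show "Zn_hom (Gr i) n (H i)" using comm_group_Gr[of i] assms by (intro Zn_homI) auto
  show "H i ` carrier_vec n = carrier (Gr i)" "ker (Gr i) n (H i) = lat n (mat_prod n A i) a" by fact+
qed

lemma Marks_cong_prod:
  assumes "\<And>i. i \<le> j \<Longrightarrow> lat n (mat_prod n A i) a = lat n (mat_prod n A' i) a"
  shows "Marks j n A = Marks j n A'"
  unfolding Marks_def using assms by (intro Collect_cong) auto

lemma Marks_cong:
  assumes A: "\<And>i. i \<in> {1..j} \<Longrightarrow> A i \<in> carrier_mat n n" "\<And>i. i \<in> {1..j} \<Longrightarrow> A' i \<in> carrier_mat n n"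
    and cong: "\<And>i r c. i \<in> {1..j} \<Longrightarrow> r < n \<Longrightarrow> c < n \<Longrightarrow> a dvd A i $$ (r, c) - A' i $$ (r, c)"
  shows "Marks j n A = Marks j n A'"
proof (rule Marks_cong_prod)
  show "lat n (mat_prod n A i) a = lat n (mat_prod n A' i) a" if "i \<le> j" for i
    using that A cong by (intro lat_cong mat_prod_carrier mat_prod_cong_mod) auto
qed

definition mark0 :: "nat \<Rightarrow> int vec \<Rightarrow> 'a" where
  "mark0 n = restrict (\<lambda>_. \<one>\<^bsub>Gr 0\<^esub>) (carrier_vec n)"

lemma lat_one_mat: "lat n (1\<^sub>m n) c = carrier_vec n"
proof (intro equalityI subsetI)
  fix v :: "int vec" assume v: "v \<in> carrier_vec n"
  have "v = 1\<^sub>m n *\<^sub>v v + c \<cdot>\<^sub>v 0\<^sub>v n" using v by auto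
  then show "v \<in> lat n (1\<^sub>m n) c" unfolding lat_def mem_Collect_eq using v
    by (intro exI[of _ v] exI[of _ "0\<^sub>v n"]) auto
qed (auto simp: lat_def)

lemma mark0: "mark0 n \<in> Hom n (Gr 0)" "mark0 n ` carrier_vec n = carrier (Gr 0)"
  "ker (Gr 0) n (mark0 n) = lat n (mat_prod n A 0) a"
proof -
  show "mark0 n \<in> Hom n (Gr 0)" by (auto simp: Hom_def hom_def mark0_def Gr_def)
  show "mark0 n ` carrier_vec n = carrier (Gr 0)"
  proof (intro equalityI subsetI)
    fix x assume "x \<in> carrier (Gr 0)"
    then show "x \<in> mark0 n ` carrier_vec n"
      unfolding Gr_0 by (intro image_eqI[of _ _ "0\<^sub>v n"]) (simp_all add: mark0_def)
  qed (auto simp: mark0_def Gr_0)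
  show "ker (Gr 0) n (mark0 n) = lat n (mat_prod n A 0) a"
    unfolding mat_prod.simps lat_one_mat by (auto simp: ker_def mark0_def)
qed

lemma mark0_unique: "F \<in> Hom n (Gr 0) \<Longrightarrow> F = mark0 n"
proof -
  assume F: "F \<in> Hom n (Gr 0)"
  have "F \<in> extensional (carrier_vec n)" using F by (simp add: Hom_def)
  moreover have "F v = mark0 n v" if "v \<in> carrier_vec n" for v
  proof -
    have "F v \<in> carrier (Gr 0)" using F that by (auto simp: Hom_def hom_def)
    then show ?thesis using that by (simp add: Gr_0 mark0_def)
  qed
  ultimately show ?thesis by (intro extensionalityI[of _ "carrier_vec n"]) (auto simp: mark0_def)
qed

text \<open>Base of the induction: the empty product spans everything and the group in degree 0 is
  trivial.\<close>

lemma Marks_0: "Marks 0 n A = {\<lambda>i. if i = 0 then mark0 n else undefined}"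
proof (intro equalityI subsetI)
  fix H assume "H \<in> Marks 0 n A"
  then have "H 0 = mark0 n" "\<forall>i>0. H i = undefined" by (auto simp: Marks_def intro: mark0_unique)
  then show "H \<in> {\<lambda>i. if i = 0 then mark0 n else undefined}" by (auto simp: fun_eq_iff)
next
  fix H :: "nat \<Rightarrow> int vec \<Rightarrow> 'a" assume "H \<in> {\<lambda>i. if i = 0 then mark0 n else undefined}"
  then have "H = (\<lambda>i. if i = 0 then mark0 n else undefined)" by (rule singletonD)
  then show "H \<in> Marks 0 n A" unfolding Marks_def using mark0[of n] by simp
qed

definition next_marks :: "nat \<Rightarrow> nat \<Rightarrow> (nat \<Rightarrow> int mat) \<Rightarrow> (nat \<Rightarrow> int vec \<Rightarrow> 'a) \<Rightarrow> (int vec \<Rightarrow> 'a) set" where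
  "next_marks j n A H = {F \<in> Lifts n (Gr (Suc j)) (pr j) (H j). F ` carrier_vec n = carrier (Gr (Suc j)) \<and>
      ker (Gr (Suc j)) n F = lat n (mat_prod n A j * A (Suc j)) a}"

lemma finite_Lifts_marks:
  assumes "j < k" "H \<in> Marks j n A" shows "finite (Lifts n (Gr (Suc j)) (pr j) (H j))"
  by (rule card_Lifts(2)[OF comm_group_Gr finite_Gr pr_hom pr_surj comm_group_Gr MarksD(4)[OF assms(2) order_refl]])
    (use assms(1) in auto)

lemma Marks_Suc_bij:
  "bij_betw (\<lambda>(H, F). H(Suc j := F)) (Sigma (Marks j n A) (next_marks j n A)) (Marks (Suc j) n A)"
proof (rule bij_betw_byWitness[where f' = "\<lambda>H. (H(Suc j := undefined), H (Suc j))"])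
  have undef: "H (Suc j) = undefined" if "H \<in> Marks j n A" for H using that by (auto simp: Marks_def)
  show "\<forall>x\<in>Sigma (Marks j n A) (next_marks j n A).
      ((case x of (H, F) \<Rightarrow> H(Suc j := F))(Suc j := undefined), (case x of (H, F) \<Rightarrow> H(Suc j := F)) (Suc j)) = x"
    using undef by (auto simp: fun_eq_iff)
  show "\<forall>H\<in>Marks (Suc j) n A. (case (H(Suc j := undefined), H (Suc j)) of (H, F) \<Rightarrow> H(Suc j := F)) = H"
    by simp
  show "(\<lambda>(H, F). H(Suc j := F)) ` Sigma (Marks j n A) (next_marks j n A) \<subseteq> Marks (Suc j) n A"
  proof clarify
    fix H F assume "H \<in> Marks j n A" "F \<in> next_marks j n A H"
    then show "H(Suc j := F) \<in> Marks (Suc j) n A"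
      unfolding Marks_def next_marks_def Lifts_def by (auto simp: le_Suc_eq less_Suc_eq)
  qed
  show "(\<lambda>H. (H(Suc j := undefined), H (Suc j))) ` Marks (Suc j) n A \<subseteq> Sigma (Marks j n A) (next_marks j n A)"
  proof (rule image_subsetI)
    fix H assume H: "H \<in> Marks (Suc j) n A"
    then have "H(Suc j := undefined) \<in> Marks j n A"
      unfolding Marks_def mem_Collect_eq
      by (auto simp: nat_neq_iff)
    moreover have "H (Suc j) \<in> next_marks j n A (H(Suc j := undefined))"
      using H unfolding Marks_def next_marks_def Lifts_def by auto
    ultimately show "(H(Suc j := undefined), H (Suc j)) \<in> Sigma (Marks j n A) (next_marks j n A)" by blast
  qed
qed

lemma finite_Marks: "j \<le> k \<Longrightarrow> finite (Marks j n A)"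
proof (induction j)
  case (Suc j)
  have "finite (next_marks j n A H)" if "H \<in> Marks j n A" for H
    unfolding next_marks_def using finite_Lifts_marks[OF _ that] Suc.prems
    by (intro finite_subset[OF Collect_restrict]) simp
  then have "finite (Sigma (Marks j n A) (next_marks j n A))" using Suc by (intro finite_SigmaI) auto
  then show ?case using bij_betw_finite[OF Marks_Suc_bij] by blast
qed (simp add: Marks_0)

lemma card_Marks_Suc:
  assumes "j < k"
  shows "card (Marks (Suc j) n A) = (\<Sum>H\<in>Marks j n A. card (next_marks j n A H))"
proof -
  have "finite (next_marks j n A H)" if "H \<in> Marks j n A" for H
    unfolding next_marks_def by (rule finite_subset[OF Collect_restrict finite_Lifts_marks[OF assms that]])
  then have "card (Sigma (Marks j n A) (next_marks j n A)) = (\<Sum>H\<in>Marks j n A. card (next_marks j n A H))"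
    using finite_Marks assms by (intro card_SigmaI) auto
  then show ?thesis using bij_betw_same_card[OF Marks_Suc_bij, of j n A] by simp
qed

end

section \<open>Isomorphisms of flags against families of surjections\<close>

context finite_flag
begin

lemma localised_cok:
  assumes "\<And>i. i \<in> {1..k} \<Longrightarrow> A i \<in> carrier_mat n n" "i \<le> k"
  shows "localised_cok b g P n (mat_prod n A i) a"
proof (intro localised_cok.intro localised_cok_axioms.intro P_exponent)
  show "mat_prod n A i \<in> carrier_mat n n" using assms by (intro mat_prod_carrier) auto
  show "s \<in> loc_denoms P \<longleftrightarrow> coprime s b" for s unfolding loc_denoms_def b_def by (rule mem_Collect_eq)
qed (rule a_def)

lemma image_mat_prod_Suc:
  assumes "\<And>i. i \<in> {1..k} \<Longrightarrow> A i \<in> carrier_mat n n" "i < k"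
  shows "mat_image n (mat_prod n A (Suc i)) \<subseteq> mat_image n (mat_prod n A i)"
proof
  fix v assume "v \<in> mat_image n (mat_prod n A (Suc i))"
  then obtain y where y: "y \<in> carrier_vec n" "v = mat_prod n A (Suc i) *\<^sub>v y" by (auto simp: mat_image_iff)
  have "mat_prod n A i \<in> carrier_mat n n" "A (Suc i) \<in> carrier_mat n n"
    using assms by (auto intro!: mat_prod_carrier)
  then have "v = mat_prod n A i *\<^sub>v (A (Suc i) *\<^sub>v y)" "A (Suc i) *\<^sub>v y \<in> carrier_vec n"
    using y by auto
  then show "v \<in> mat_image n (mat_prod n A i)" unfolding mat_image_iff by blast
qed

text \<open>\<open>iso_of_marking\<close> and \<open>marking_of_iso\<close> translate between the
  two sides at each level. Compatibility with the maps of the flags is checked on fractions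
  \<open>v / s\<close>, since the projections between localised cokernels keep \<open>v\<close> and
  \<open>s\<close>.\<close>

lemma flag_isomorphic_iff_Marks:
  assumes A: "\<And>i. i \<in> {1..k} \<Longrightarrow> A i \<in> carrier_mat n n"
  shows "flag_isomorphic k (cok_flag P n A) G \<longleftrightarrow> Marks k n A \<noteq> {}"
proof
  let ?L = "loc_int P"
  have proj_eq: "proj (cok_flag P n A) i (pure (cok n (mat_prod n A (Suc i))) ?L (coset_of n (mat_prod n A (Suc i)) v) q) =
      pure (cok n (mat_prod n A i)) ?L (coset_of n (mat_prod n A i) v) q"
    if "i < k" "v \<in> carrier_vec n" "q \<in> carrier ?L" for i v q
  proof -
    interpret C: localised_cok b g P n "mat_prod n A i" a by (rule localised_cok[OF A]) (use that in auto)
    show ?thesis unfolding cok_flag_def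
      using C.proj_pure[OF _ image_mat_prod_Suc[OF A that(1)] that(2,3)] mat_prod_carrier[of "Suc i" A n] A that(1)
      by (simp del: mat_prod.simps)
  qed
  {
    assume "Marks k n A \<noteq> {}"
    then obtain H where H: "H \<in> Marks k n A" by blast
    have "\<exists>\<theta>. \<theta> \<in> iso (grp (cok_flag P n A) i) (grp G i) \<and>
        (\<forall>v\<in>carrier_vec n. \<forall>q\<in>carrier ?L.
          \<theta> (pure (cok n (mat_prod n A i)) ?L (coset_of n (mat_prod n A i) v) q) = H i v [^]\<^bsub>grp G i\<^esub> loc_mod a q)"
      if i: "i \<in> {1..k}" for i
    proof -
      interpret C: localised_cok b g P n "mat_prod n A i" a by (rule localised_cok[OF A]) (use i in auto)
      have i': "i \<le> k" "Gr i = grp G i" using i Gr_pos(1)[of i] by auto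
      from C.iso_of_marking[OF comm_group_Gr[OF i'(1)] killed[OF i'(1)] MarksD(4,2,3)[OF H i'(1) order_refl]]
      obtain \<theta> where "\<theta> \<in> iso C.T (Gr i)" "\<And>v q. v \<in> carrier_vec n \<Longrightarrow> q \<in> carrier ?L \<Longrightarrow>
        \<theta> (pure (cok n (mat_prod n A i)) ?L (coset_of n (mat_prod n A i) v) q) = H i v [^]\<^bsub>Gr i\<^esub> loc_mod a q"
        by blast
      then show ?thesis by (intro exI[of _ \<theta>]) (simp add: cok_flag_def i'(2))
    qed
    then obtain \<theta> where iso: "\<And>i. i \<in> {1..k} \<Longrightarrow> \<theta> i \<in> iso (grp (cok_flag P n A) i) (grp G i)"
      and \<theta>: "\<And>i v q. i \<in> {1..k} \<Longrightarrow> v \<in> carrier_vec n \<Longrightarrow> q \<in> carrier ?L \<Longrightarrow>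
          \<theta> i (pure (cok n (mat_prod n A i)) ?L (coset_of n (mat_prod n A i) v) q) = H i v [^]\<^bsub>grp G i\<^esub> loc_mod a q"
      by metis
    have "\<theta> i (proj (cok_flag P n A) i x) = proj G i (\<theta> (Suc i) x)"
      if i: "i \<in> {1..<k}" and x: "x \<in> carrier (grp (cok_flag P n A) (Suc i))" for i x
    proof -
      interpret C: localised_cok b g P n "mat_prod n A (Suc i)" a by (rule localised_cok[OF A]) (use i in auto)
      interpret h: group_hom "Gr (Suc i)" "Gr i" "pr i" using pr_hom i by simp
      have "x \<in> carrier C.T" using x unfolding cok_flag_def by simp
      then obtain s v where sv: "s \<in> loc_denoms P" "v \<in> carrier_vec n" "x = C.j s v" using C.j_surj by blast
      let ?q = "fraction P 1 s"
      have q: "?q \<in> carrier ?L" by (rule fraction_closed[OF sv(1)])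
      have x': "x = pure (cok n (mat_prod n A (Suc i))) ?L (coset_of n (mat_prod n A (Suc i)) v) ?q"
        unfolding sv(3) C.j_def ..
      have "\<theta> i (proj (cok_flag P n A) i x) = H i v [^]\<^bsub>grp G i\<^esub> loc_mod a ?q"
        using proj_eq[of i v ?q] \<theta>[of i v ?q] i sv(2) q by (simp add: x' del: mat_prod.simps)
      also have "\<dots> = pr i (H (Suc i) v [^]\<^bsub>Gr (Suc i)\<^esub> loc_mod a ?q)"
      proof -
        have "H (Suc i) v \<in> carrier (Gr (Suc i))"
          using MarksD(2)[OF H, of "Suc i"] i sv(2) by auto
        moreover have "pr i (H (Suc i) v) = H i v" using H i sv(2) by (auto simp: Marks_def)
        ultimately have "pr i (H (Suc i) v [^]\<^bsub>Gr (Suc i)\<^esub> loc_mod a ?q) = H i v [^]\<^bsub>Gr i\<^esub> loc_mod a ?q"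
          by (simp only: h.hom_int_pow)
        then show ?thesis using i by (simp add: Gr_pos)
      qed
      also have "\<dots> = proj G i (\<theta> (Suc i) x)"
        using \<theta>[of "Suc i" v ?q] i sv(2) q by (simp add: x' Gr_pos del: mat_prod.simps)
      finally show ?thesis .
    qed
    then have "\<theta> \<in> flag_iso k (cok_flag P n A) G"
      using iso by (auto simp: flag_iso_def flag_hom_def iso_def)
    then show "flag_isomorphic k (cok_flag P n A) G" by (auto simp: flag_isomorphic_def)
  }
  assume "flag_isomorphic k (cok_flag P n A) G"
  then obtain \<theta> where "\<theta> \<in> flag_iso k (cok_flag P n A) G" unfolding flag_isomorphic_def by blast
  then have iso: "\<And>i. i \<in> {1..k} \<Longrightarrow> \<theta> i \<in> iso (grp (cok_flag P n A) i) (grp G i)"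
    and comm: "\<And>i x. i \<in> {1..<k} \<Longrightarrow> x \<in> carrier (grp (cok_flag P n A) (Suc i)) \<Longrightarrow>
      \<theta> i (proj (cok_flag P n A) i x) = proj G i (\<theta> (Suc i) x)"
    by (auto simp: flag_iso_def flag_hom_def)
  define x where "x i v = pure (cok n (mat_prod n A i)) ?L (coset_of n (mat_prod n A i) v) (fraction P 1 1)" for i v
  \<comment> \<open>In degree 0, where the isomorphism of flags says nothing, there is only one
    surjection to choose.\<close>
  define H where "H i = (if i = 0 then mark0 n else if i \<le> k then restrict (\<lambda>v. \<theta> i (x i v)) (carrier_vec n) else undefined)" for i
  have lvl: "H i \<in> Hom n (Gr i) \<and> H i ` carrier_vec n = carrier (Gr i) \<and> ker (Gr i) n (H i) = lat n (mat_prod n A i) a"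
    if i: "i \<le> k" for i
  proof (cases "i = 0")
    case True
    then show ?thesis using mark0(1,2)[of n] mark0(3)[of n A] by (simp add: H_def)
  next
    case False
    interpret C: localised_cok b g P n "mat_prod n A i" a by (rule localised_cok[OF A]) (use i in auto)
    have j: "C.j 1 v = x i v" for v by (simp add: C.j_def x_def)
    have "\<theta> i \<in> iso C.T (Gr i)" using iso[of i] i False by (simp add: cok_flag_def Gr_pos)
    then have m: "(\<lambda>v. \<theta> i (x i v)) \<in> hom (Zn n) (Gr i)" "(\<lambda>v. \<theta> i (x i v)) ` carrier_vec n = carrier (Gr i)"
      "ker (Gr i) n (\<lambda>v. \<theta> i (x i v)) = lat n (mat_prod n A i) a"
      using C.marking_of_iso[OF comm_group_Gr[OF i] killed[OF i]] by (simp_all add: j)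
    have Hi: "H i = restrict (\<lambda>v. \<theta> i (x i v)) (carrier_vec n)" using i False by (simp add: H_def)
    have "H i \<in> Hom n (Gr i)" using m(1) by (auto simp: Hi Hom_def hom_def)
    moreover have "H i ` carrier_vec n = carrier (Gr i)" using m(2) by (simp add: Hi)
    moreover have "ker (Gr i) n (H i) = lat n (mat_prod n A i) a"
      unfolding m(3)[symmetric] by (auto simp: Hi ker_def)
    ultimately show ?thesis by blast
  qed
  have "pr i (H (Suc i) v) = H i v" if i: "i < k" and v: "v \<in> carrier_vec n" for i v
  proof (cases "i = 0")
    case True
    then show ?thesis using v by (simp add: pr_def H_def mark0_def Gr_def)
  next
    case False
    interpret C: localised_cok b g P n "mat_prod n A (Suc i)" a by (rule localised_cok[OF A]) (use i in auto)
    have "C.j 1 v \<in> carrier C.T" by (rule Zn_hom.closed[OF C.j_Zn_hom[OF loc_denoms_one] v])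
    then have "x (Suc i) v \<in> carrier (grp (cok_flag P n A) (Suc i))"
      unfolding C.j_def x_def cok_flag_def by simp
    then have "proj G i (\<theta> (Suc i) (x (Suc i) v)) = \<theta> i (proj (cok_flag P n A) i (x (Suc i) v))"
      using comm[of i "x (Suc i) v"] i False by simp
    also have "proj (cok_flag P n A) i (x (Suc i) v) = x i v"
      unfolding x_def by (rule proj_eq[OF i v fraction_closed[OF loc_denoms_one]])
    finally show ?thesis using i v False by (simp add: H_def Gr_pos)
  qed
  then have "H \<in> Marks k n A" unfolding Marks_def using lvl by (simp add: H_def)
  then show "Marks k n A \<noteq> {}" by blast
qed

text \<open>Composition of one family \<open>H\<close> with automorphisms is injective because each
  \<open>H i\<close> is onto. It reaches every other family because surjections with the same kernel
  differ by an isomorphism (\<open>Zn_hom_factor\<close>), and these isomorphisms commute with the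
  maps of the flag since both families do.\<close>

lemma card_Marks_eq_card_auto:
  assumes ne: "Marks k n A \<noteq> {}"
  shows "card (Marks k n A) = card (flag_auto k G)"
proof -
  obtain H where H: "H \<in> Marks k n A" using ne by blast
  have Hi: "H i v \<in> carrier (Gr i)" if "i \<le> k" "v \<in> carrier_vec n" for i v
    using MarksD(2)[OF H that(1) order_refl] that(2) by blast
  have rep: "\<exists>v\<in>carrier_vec n. x = H i v" if "i \<le> k" "x \<in> carrier (Gr i)" for i x
    using MarksD(2)[OF H that(1) order_refl] that(2) by blast
  define act where "act \<sigma> = (\<lambda>i. if i = 0 then H 0 else if i \<le> k then restrict (\<lambda>v. \<sigma> i (H i v)) (carrier_vec n) else undefined)"
    for \<sigma> :: "nat \<Rightarrow> 'a \<Rightarrow> 'a"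
  have act_i: "act \<sigma> i v = \<sigma> i (H i v)" if "i \<in> {1..k}" "v \<in> carrier_vec n" for \<sigma> i v
    using that by (simp add: act_def)
  have autoD: "\<sigma> i \<in> iso (Gr i) (Gr i)" "\<sigma> i \<in> extensional (carrier (Gr i))"
    if "\<sigma> \<in> flag_auto k G" "i \<in> {1..k}" for \<sigma> i
    using that by (auto simp: flag_auto_def flag_iso_def Gr_pos)
  have autoC: "\<sigma> i (pr i x) = pr i (\<sigma> (Suc i) x)"
    if "\<sigma> \<in> flag_auto k G" "i \<in> {1..<k}" "x \<in> carrier (Gr (Suc i))" for \<sigma> i x
    using that by (auto simp: flag_auto_def flag_iso_def flag_hom_def Gr_pos)
  have inj: "inj_on act (flag_auto k G)"
  proof (rule inj_onI)
    fix \<sigma> \<tau> assume \<sigma>: "\<sigma> \<in> flag_auto k G" and \<tau>: "\<tau> \<in> flag_auto k G" and eq: "act \<sigma> = act \<tau>"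
    show "\<sigma> = \<tau>"
    proof (rule extensionalityI[of _ "{1..k}"])
      show "\<sigma> \<in> extensional {1..k}" "\<tau> \<in> extensional {1..k}" using \<sigma> \<tau> by (auto simp: flag_auto_def)
      fix i assume i: "i \<in> {1..k}"
      show "\<sigma> i = \<tau> i"
      proof (rule extensionalityI[OF autoD(2)[OF \<sigma> i] autoD(2)[OF \<tau> i]])
        fix x assume "x \<in> carrier (Gr i)"
        then obtain v where v: "v \<in> carrier_vec n" "x = H i v" using rep[of i x] i by auto
        show "\<sigma> i x = \<tau> i x"
          using act_i[OF i v(1), of \<sigma>] act_i[OF i v(1), of \<tau>] eq v(2) by simp
      qed
    qed
  qed
  have "act ` flag_auto k G = Marks k n A"
  proof (intro equalityI subsetI)
    fix H' assume "H' \<in> act ` flag_auto k G"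
    then obtain \<sigma> where \<sigma>: "\<sigma> \<in> flag_auto k G" "H' = act \<sigma>" by blast
    have lvl: "H' i \<in> Hom n (Gr i) \<and> H' i ` carrier_vec n = carrier (Gr i) \<and> ker (Gr i) n (H' i) = lat n (mat_prod n A i) a"
      if i: "i \<le> k" for i
    proof (cases "i = 0")
      case True
      then show ?thesis using H unfolding \<sigma>(2) act_def Marks_def by simp
    next
      case False
      then have i': "i \<in> {1..k}" using i by simp
      have s: "\<sigma> i \<in> hom (Gr i) (Gr i)" "bij_betw (\<sigma> i) (carrier (Gr i)) (carrier (Gr i))"
        using autoD(1)[OF \<sigma>(1) i'] by (auto simp: iso_def)
      interpret s: group_hom "Gr i" "Gr i" "\<sigma> i"
        using comm_group_Gr[OF i] s(1) by (simp add: group_hom_def group_hom_axioms_def comm_group.axioms)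
      interpret h: Zn_hom "Gr i" n "H i" by (rule MarksD(1)[OF H i order_refl])
      have H'i: "H' i = restrict (\<lambda>v. \<sigma> i (H i v)) (carrier_vec n)" using i False by (simp add: \<sigma>(2) act_def)
      have "H' i \<in> Hom n (Gr i)" by (auto simp: H'i Hom_def hom_def)
      moreover have "H' i ` carrier_vec n = carrier (Gr i)"
      proof -
        have "H' i ` carrier_vec n = \<sigma> i ` (H i ` carrier_vec n)" by (simp add: H'i image_image)
        then show ?thesis using s(2) MarksD(2)[OF H i order_refl] by (simp add: bij_betw_def)
      qed
      moreover have "ker (Gr i) n (H' i) = ker (Gr i) n (H i)"
      proof -
        have "\<sigma> i (H i v) = \<one>\<^bsub>Gr i\<^esub> \<longleftrightarrow> H i v = \<one>\<^bsub>Gr i\<^esub>" if "v \<in> carrier_vec n" for v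
          using inj_onD[OF bij_betw_imp_inj_on[OF s(2)], of "H i v" "\<one>\<^bsub>Gr i\<^esub>"] that by auto
        then show ?thesis by (auto simp: ker_def H'i)
      qed
      ultimately show ?thesis using MarksD(3)[OF H i order_refl] by simp
    qed
    have "pr i (H' (Suc i) v) = H' i v" if i: "i < k" and v: "v \<in> carrier_vec n" for i v
    proof (cases "i = 0")
      case True
      have "H 0 v = \<one>\<^bsub>grp G 1\<^esub>" using Hi[of 0 v] v Gr_0 by (simp add: Gr_def)
      then show ?thesis using True by (simp add: pr_def \<sigma>(2) act_def)
    next
      case False
      have "pr i (H (Suc i) v) = H i v" using H i v by (simp add: Marks_def)
      then show ?thesis
        using autoC[OF \<sigma>(1), of i "H (Suc i) v"] Hi[of "Suc i" v] act_i[of i v \<sigma>] act_i[of "Suc i" v \<sigma>] i v False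
        by (simp add: \<sigma>(2))
    qed
    then show "H' \<in> Marks k n A" unfolding Marks_def using lvl by (simp add: \<sigma>(2) act_def)
  next
    fix H' assume H': "H' \<in> Marks k n A"
    have "\<exists>\<sigma>. \<sigma> \<in> iso (Gr i) (Gr i) \<and> \<sigma> \<in> extensional (carrier (Gr i)) \<and> (\<forall>v\<in>carrier_vec n. \<sigma> (H i v) = H' i v)"
      if i: "i \<in> {1..k}" for i
      using MarksD(1-3)[OF H, of i] MarksD(1-3)[OF H', of i] i by (intro Zn_hom_factor) auto
    then obtain \<sigma>' where \<sigma>': "\<And>i. i \<in> {1..k} \<Longrightarrow> \<sigma>' i \<in> iso (Gr i) (Gr i) \<and> \<sigma>' i \<in> extensional (carrier (Gr i)) \<and>
        (\<forall>v\<in>carrier_vec n. \<sigma>' i (H i v) = H' i v)"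
      by metis
    define \<sigma> where "\<sigma> = restrict \<sigma>' {1..k}"
    have \<sigma>: "\<sigma> i \<in> iso (Gr i) (Gr i)" "\<sigma> i \<in> extensional (carrier (Gr i))" "\<And>v. v \<in> carrier_vec n \<Longrightarrow> \<sigma> i (H i v) = H' i v"
      if "i \<in> {1..k}" for i
      using \<sigma>'[OF that] that by (auto simp: \<sigma>_def)
    have comm: "\<sigma> i (pr i x) = pr i (\<sigma> (Suc i) x)" if i: "i \<in> {1..<k}" and x: "x \<in> carrier (Gr (Suc i))" for i x
    proof -
      obtain v where v: "v \<in> carrier_vec n" "x = H (Suc i) v" using rep[of "Suc i" x] x i by auto
      have "pr i (H (Suc i) v) = H i v" "pr i (H' (Suc i) v) = H' i v"
        using H H' i v(1) by (simp_all add: Marks_def)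
      then show ?thesis using \<sigma>(3)[of i v] \<sigma>(3)[of "Suc i" v] i v by simp
    qed
    have "\<sigma> \<in> flag_auto k G"
      unfolding flag_auto_def flag_iso_def flag_hom_def using \<sigma>(1,2) comm
      by (auto simp: Gr_pos iso_def \<sigma>_def)
    moreover have "H' = act \<sigma>"
    proof
      fix i
      consider "i = 0" | "i \<in> {1..k}" | "i > k" by fastforce
      then show "H' i = act \<sigma> i"
      proof cases
        case 1
        have "H' 0 \<in> Hom n (Gr 0)" "H 0 \<in> Hom n (Gr 0)" using H H' by (auto simp: Marks_def)
        then show ?thesis using mark0_unique[of "H' 0" n] mark0_unique[of "H 0" n] by (simp add: 1 act_def)
      next
        case 2
        have "act \<sigma> i \<in> extensional (carrier_vec n)" using 2 by (simp add: act_def)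
        then show ?thesis
          using MarksD(5)[OF H', of i] 2 \<sigma>(3)[OF 2] act_i[OF 2]
          by (intro extensionalityI[of _ "carrier_vec n"]) auto
      next
        case 3
        then show ?thesis using H' by (simp add: Marks_def act_def)
      qed
    qed
    ultimately show "H' \<in> act ` flag_auto k G" by blast
  qed
  then show ?thesis using card_image[OF inj] by simp
qed

end

section \<open>The expected number of families\<close>

abbreviation to_mat :: "nat \<Rightarrow> (nat \<Rightarrow> nat \<Rightarrow> int) \<Rightarrow> int mat" where
  "to_mat n M \<equiv> mat n n (\<lambda>(r, c). M c r)"

lemma mat_prod_cong: "(\<And>i. i \<in> {1..j} \<Longrightarrow> A i = A' i) \<Longrightarrow> mat_prod n A j = mat_prod n A' j"
  by (induction j) auto

definition laws :: "nat \<Rightarrow> nat \<Rightarrow> (nat \<Rightarrow> nat \<Rightarrow> nat \<Rightarrow> int pmf) \<Rightarrow> (nat \<Rightarrow> nat \<Rightarrow> nat \<Rightarrow> int) pmf" where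
  "laws j n q = Pi_pmf {1..j} (\<lambda>_ _. 0) (\<lambda>i. law n (q i))"

lemma finite_law:
  assumes "\<And>c r. c < n \<Longrightarrow> r < n \<Longrightarrow> finite (set_pmf (q c r))"
  shows "finite (set_pmf (law n q))"
proof -
  have col: "finite (set_pmf (Pi_pmf {..<n} 0 (q c)))" if "c < n" for c
    unfolding set_Pi_pmf[OF finite_lessThan]
    by (rule finite_PiE_dflt[OF finite_lessThan]) (simp only: comp_apply assms[OF that] lessThan_iff)
  show ?thesis
    unfolding law_def set_Pi_pmf[OF finite_lessThan]
    by (rule finite_PiE_dflt[OF finite_lessThan]) (simp only: comp_apply col lessThan_iff)
qed

lemma finite_laws:
  assumes "\<And>i c r. i \<in> {1..j} \<Longrightarrow> c < n \<Longrightarrow> r < n \<Longrightarrow> finite (set_pmf (q i c r))"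
  shows "finite (set_pmf (laws j n q))"
  unfolding laws_def set_Pi_pmf[OF finite_atLeastAtMost]
  by (rule finite_PiE_dflt[OF finite_atLeastAtMost]) (simp only: comp_apply finite_law assms)

lemma expectation_finite:
  fixes f :: "'b \<Rightarrow> real"
  assumes "finite (set_pmf p)"
  shows "measure_pmf.expectation p f = (\<Sum>x\<in>set_pmf p. pmf p x * f x)"
  using assms by (subst integral_measure_pmf_real[of "set_pmf p"]) (auto simp: mult.commute)

lemma expectation_laws_Suc:
  fixes h :: "(nat \<Rightarrow> nat \<Rightarrow> nat \<Rightarrow> int) \<Rightarrow> real"
  assumes fin: "\<And>i c r. i \<in> {1..Suc j} \<Longrightarrow> c < n \<Longrightarrow> r < n \<Longrightarrow> finite (set_pmf (q i c r))"
  shows "measure_pmf.expectation (laws (Suc j) n q) h =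
    measure_pmf.expectation (laws j n q) (\<lambda>f. measure_pmf.expectation (law n (q (Suc j))) (\<lambda>M. h (f(Suc j := M))))"
proof -
  have finL: "finite (set_pmf (laws j n q))" by (rule finite_laws) (use fin in auto)
  have fin1: "finite (set_pmf (law n (q (Suc j))))" by (rule finite_law) (use fin in auto)
  have ins: "{1..Suc j} = insert (Suc j) {1..j}" by auto
  have "laws (Suc j) n q = law n (q (Suc j)) \<bind> (\<lambda>M. laws j n q \<bind> (\<lambda>f. return_pmf (f(Suc j := M))))"
    unfolding laws_def ins by (rule Pi_pmf_insert') auto
  also have "\<dots> = laws j n q \<bind> (\<lambda>f. map_pmf (\<lambda>M. f(Suc j := M)) (law n (q (Suc j))))"
    unfolding map_pmf_def by (rule bind_commute_pmf)
  finally have "measure_pmf.expectation (laws (Suc j) n q) h =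
      (\<Sum>f\<in>set_pmf (laws j n q). pmf (laws j n q) f *\<^sub>R
        measure_pmf.expectation (map_pmf (\<lambda>M. f(Suc j := M)) (law n (q (Suc j)))) h)"
    using finL fin1 by (simp only:) (rule pmf_expectation_bind, auto)
  also have "\<dots> = (\<Sum>f\<in>set_pmf (laws j n q). pmf (laws j n q) f *
        measure_pmf.expectation (law n (q (Suc j))) (\<lambda>M. h (f(Suc j := M))))"
    by (simp only: integral_map_pmf real_scaleR_def)
  finally show ?thesis unfolding expectation_finite[OF finL] .
qed

context finite_flag
begin

definition mean_marks :: "nat \<Rightarrow> nat \<Rightarrow> (nat \<Rightarrow> nat \<Rightarrow> nat \<Rightarrow> int pmf) \<Rightarrow> real" where
  "mean_marks j n q = measure_pmf.expectation (laws j n q) (\<lambda>f. real (card (Marks j n (\<lambda>i. to_mat n (f i)))))"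

definition admissible :: "real \<Rightarrow> nat \<Rightarrow> (nat \<Rightarrow> nat \<Rightarrow> nat \<Rightarrow> int pmf) \<Rightarrow> bool" where
  "admissible \<alpha> n q \<longleftrightarrow> (\<forall>i\<in>{1..k}. \<forall>c<n. \<forall>r<n. finite (set_pmf (q i c r)) \<and> (\<forall>p\<in>P. balanced_pmf \<alpha> (int p) (q i c r)))"

definition euler :: real where
  "euler = (\<Prod>p\<in>P. prodinf (\<lambda>i. 1 - 1 / real p ^ Suc i))"

lemma mean_marks_0: "mean_marks 0 n q = 1"
  by (simp add: mean_marks_def Marks_0)

text \<open>Linearity of expectation: once the first \<open>j\<close> matrices are fixed, a family
  of length \<open>Suc j\<close> is a shorter family with a surjective lift of its last member, and
  the new matrix is averaged separately by independence.\<close>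

lemma mean_marks_Suc:
  assumes j: "j < k" and q: "admissible \<alpha> n q"
  shows "mean_marks (Suc j) n q = measure_pmf.expectation (laws j n q) (\<lambda>f.
    \<Sum>H\<in>Marks j n (\<lambda>i. to_mat n (f i)). \<Sum>F\<in>{F \<in> Lifts n (Gr (Suc j)) (pr j) (H j). F ` carrier_vec n = carrier (Gr (Suc j))}.
      measure_pmf.prob (law n (q (Suc j))) {M. ker (Gr (Suc j)) n F = lat n (mat_prod n (\<lambda>i. to_mat n (f i)) j * to_mat n M) a})"
proof -
  have fin: "finite (set_pmf (q i c r))" if "i \<in> {1..Suc j}" "c < n" "r < n" for i c r
    using q that j by (auto simp: admissible_def)
  have finl: "finite (set_pmf (law n (q (Suc j))))" by (rule finite_law) (use fin in auto)
  have "measure_pmf.expectation (law n (q (Suc j))) (\<lambda>M. real (card (Marks (Suc j) n (\<lambda>i. to_mat n ((f(Suc j := M)) i))))) =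
     (\<Sum>H\<in>Marks j n (\<lambda>i. to_mat n (f i)). \<Sum>F\<in>{F \<in> Lifts n (Gr (Suc j)) (pr j) (H j). F ` carrier_vec n = carrier (Gr (Suc j))}.
      measure_pmf.prob (law n (q (Suc j))) {M. ker (Gr (Suc j)) n F = lat n (mat_prod n (\<lambda>i. to_mat n (f i)) j * to_mat n M) a})"
    for f :: "nat \<Rightarrow> nat \<Rightarrow> nat \<Rightarrow> int"
  proof -
    let ?A = "\<lambda>i. to_mat n (f i)"
    let ?B = "\<lambda>M i. to_mat n ((f(Suc j := M)) i)"
    let ?S = "\<lambda>H. {F \<in> Lifts n (Gr (Suc j)) (pr j) (H j). F ` carrier_vec n = carrier (Gr (Suc j))}"
    let ?E = "\<lambda>F. {M. ker (Gr (Suc j)) n F = lat n (mat_prod n ?A j * to_mat n M) a}"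
    have finS: "finite (?S H)" if "H \<in> Marks j n ?A" for H
      by (rule finite_subset[OF Collect_restrict finite_Lifts_marks[OF j that]])
    have e: "real (card (Marks (Suc j) n (?B M))) = (\<Sum>H\<in>Marks j n ?A. \<Sum>F\<in>?S H. indicator (?E F) M)" for M
    proof -
      have prod: "mat_prod n (?B M) i = mat_prod n ?A i" if "i \<le> j" for i
        using that by (intro mat_prod_cong) auto
      have marks: "Marks j n (?B M) = Marks j n ?A"
        by (rule Marks_cong_prod) (simp only: prod)
      have "real (card (next_marks j n (?B M) H)) = (\<Sum>F\<in>?S H. indicator (?E F) M)" if H: "H \<in> Marks j n ?A" for H
      proof -
        have "next_marks j n (?B M) H = {F \<in> ?S H. M \<in> ?E F}"
          unfolding next_marks_def prod[OF order_refl] fun_upd_same by auto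
        then show ?thesis using finS[OF H] by (simp add: indicator_def Int_def)
      qed
      then show ?thesis unfolding card_Marks_Suc[OF j] marks of_nat_sum by (rule sum.cong[OF refl])
    qed
    have int: "integrable (measure_pmf (law n (q (Suc j)))) h" for h :: "_ \<Rightarrow> real"
      by (rule integrable_measure_pmf_finite[OF finl])
    show ?thesis
      unfolding e by (simp only: Bochner_Integration.integral_sum[OF int]) simp
  qed
  then show ?thesis unfolding mean_marks_def by (subst expectation_laws_Suc) (simp_all only: fin)
qed

text \<open>\<open>step_limit\<close> is uniform in the earlier matrices and surjections, so it
  applies to each family with \<open>R\<close> the product so far. Summation over the families makes
  the error relative to \<open>mean_marks j n q\<close>.\<close>

lemma mean_marks_step:
  assumes \<alpha>: "0 < \<alpha>" "\<alpha> \<le> 1/2" and j: "j < k" and e: "e > 0"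
  shows "\<exists>N. \<forall>n\<ge>N. \<forall>q. admissible \<alpha> n q \<longrightarrow> \<bar>mean_marks (Suc j) n q - euler * mean_marks j n q\<bar> \<le> e * mean_marks j n q"
proof -
  interpret S: flag_step b g "Gr (Suc j)" "Gr j" "pr j" P a by (rule flag_step[OF j])
  obtain N where N: "\<And>n q R F'. n \<ge> N \<Longrightarrow> S.step_hyp \<alpha> n q R F' \<Longrightarrow>
    \<bar>(\<Sum>F\<in>{F \<in> Lifts n (Gr (Suc j)) (pr j) F'. F ` carrier_vec n = carrier (Gr (Suc j))}.
        measure_pmf.prob (law n q) {M. ker (Gr (Suc j)) n F = lat n (R * to_mat n M) a}) - euler\<bar> \<le> e"
    using S.step_limit[OF \<alpha> e] unfolding euler_def by blast
  show ?thesis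
  proof (intro exI[of _ N] allI impI)
    fix n q assume n: "n \<ge> N" and q: "admissible \<alpha> n q"
    have finL: "finite (set_pmf (laws j n q))" by (rule finite_laws) (use q j in \<open>auto simp: admissible_def\<close>)
    let ?A = "\<lambda>f i. to_mat n (f i)"
    let ?s = "\<lambda>f H. \<Sum>F\<in>{F \<in> Lifts n (Gr (Suc j)) (pr j) (H j). F ` carrier_vec n = carrier (Gr (Suc j))}.
      measure_pmf.prob (law n (q (Suc j))) {M. ker (Gr (Suc j)) n F = lat n (mat_prod n (?A f) j * to_mat n M) a}"
    have le: "\<bar>?s f H - euler\<bar> \<le> e" if H: "H \<in> Marks j n (?A f)" for f H
    proof (rule N[OF n])
      show "S.step_hyp \<alpha> n (q (Suc j)) (mat_prod n (?A f) j) (H j)"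
        unfolding S.step_hyp_def
        using MarksD(2,3,4)[OF H order_refl] mat_prod_carrier[of j "?A f" n] q j by (auto simp: admissible_def)
    qed
    have "\<bar>mean_marks (Suc j) n q - euler * mean_marks j n q\<bar> =
        \<bar>\<Sum>f\<in>set_pmf (laws j n q). pmf (laws j n q) f * (\<Sum>H\<in>Marks j n (?A f). ?s f H - euler)\<bar>"
      unfolding mean_marks_Suc[OF j q] unfolding mean_marks_def expectation_finite[OF finL]
      by (simp add: sum_subtractf sum_distrib_left right_diff_distrib mult_ac)
    also have "\<dots> \<le> (\<Sum>f\<in>set_pmf (laws j n q). pmf (laws j n q) f * (\<Sum>H\<in>Marks j n (?A f). e))"
    proof (rule order.trans[OF sum_abs], rule sum_mono)
      fix f
      have "\<bar>\<Sum>H\<in>Marks j n (?A f). ?s f H - euler\<bar> \<le> (\<Sum>H\<in>Marks j n (?A f). e)"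
        by (rule order.trans[OF sum_abs], rule sum_mono) (rule le)
      then show "\<bar>pmf (laws j n q) f * (\<Sum>H\<in>Marks j n (?A f). ?s f H - euler)\<bar> \<le> pmf (laws j n q) f * (\<Sum>H\<in>Marks j n (?A f). e)"
        by (simp only: abs_mult abs_of_nonneg[OF pmf_nonneg]) (rule mult_left_mono, assumption, rule pmf_nonneg)
    qed
    also have "\<dots> = e * mean_marks j n q"
      unfolding mean_marks_def expectation_finite[OF finL] by (simp add: sum_distrib_left mult_ac)
    finally show "\<bar>mean_marks (Suc j) n q - euler * mean_marks j n q\<bar> \<le> e * mean_marks j n q" .
  qed
qed

theorem mean_marks_limit:
  assumes \<alpha>: "0 < \<alpha>" "\<alpha> \<le> 1/2"
  shows "j \<le> k \<Longrightarrow> e > 0 \<Longrightarrow> \<exists>N. \<forall>n\<ge>N. \<forall>q. admissible \<alpha> n q \<longrightarrow> \<bar>mean_marks j n q - euler ^ j\<bar> \<le> e"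
proof (induction j arbitrary: e)
  case 0
  then show ?case by (simp add: mean_marks_0)
next
  case (Suc j)
  \<comment> \<open>\<open>C\<close> bounds the Euler product and, as \<open>e2 \<le> 1\<close>,
    \<open>B\<close> bounds the mean at level \<open>j\<close>; so the error of the new step and the
    error inherited from level \<open>j\<close> are at most \<open>e / 2\<close> each.\<close>
  define C where "C = \<bar>euler\<bar> + 1"
  define B where "B = \<bar>euler ^ j\<bar> + 1"
  have CB: "C > 0" "B > 0" by (auto simp: C_def B_def add_nonneg_pos)
  define e1 where "e1 = e / (2 * B)"
  define e2 where "e2 = min 1 (e / (2 * C))"
  have e12: "e1 > 0" "e2 > 0" using Suc.prems CB by (auto simp: e1_def e2_def)
  obtain N1 where N1: "\<And>n q. n \<ge> N1 \<Longrightarrow> admissible \<alpha> n q \<Longrightarrow>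
      \<bar>mean_marks (Suc j) n q - euler * mean_marks j n q\<bar> \<le> e1 * mean_marks j n q"
    using mean_marks_step[OF \<alpha> _ e12(1), of j] Suc.prems by auto
  obtain N2 where N2: "\<And>n q. n \<ge> N2 \<Longrightarrow> admissible \<alpha> n q \<Longrightarrow> \<bar>mean_marks j n q - euler ^ j\<bar> \<le> e2"
    using Suc.IH[OF _ e12(2)] Suc.prems by auto
  show ?case
  proof (intro exI[of _ "max N1 N2"] allI impI)
    fix n q assume n: "n \<ge> max N1 N2" and q: "admissible \<alpha> n q"
    let ?m = "mean_marks j n q"
    have 1: "\<bar>mean_marks (Suc j) n q - euler * ?m\<bar> \<le> e1 * ?m" and 2: "\<bar>?m - euler ^ j\<bar> \<le> e2"
      using N1 N2 n q by auto
    have "?m \<le> B" using 2 unfolding B_def e2_def by (auto simp: min_def split: if_splits)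
    then have "e1 * ?m \<le> e1 * B" using e12 by (intro mult_left_mono) auto
    also have "\<dots> = e / 2" using CB by (simp add: e1_def)
    finally have 3: "e1 * ?m \<le> e / 2" .
    have "\<bar>euler * ?m - euler ^ Suc j\<bar> = \<bar>euler\<bar> * \<bar>?m - euler ^ j\<bar>"
      by (simp add: abs_mult[symmetric] right_diff_distrib)
    also have "\<dots> \<le> C * (e / (2 * C))"
      using 2 CB Suc.prems by (intro mult_mono) (auto simp: C_def e2_def)
    also have "\<dots> = e / 2" using CB by simp
    finally show "\<bar>mean_marks (Suc j) n q - euler ^ Suc j\<bar> \<le> e" using 1 3 by linarith
  qed
qed

lemma finite_flag_auto: "finite (flag_auto k G)"
proof -
  have "flag_auto k G \<subseteq> PiE {1..k} (\<lambda>i. PiE (carrier (Gr i)) (\<lambda>_. carrier (Gr i)))"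
  proof
    fix f assume f: "f \<in> flag_auto k G"
    show "f \<in> PiE {1..k} (\<lambda>i. PiE (carrier (Gr i)) (\<lambda>_. carrier (Gr i)))"
    proof (rule PiE_I)
      fix i assume i: "i \<in> {1..k}"
      then have "f i \<in> hom (grp G i) (grp G i)" "f i \<in> extensional (carrier (grp G i))"
        using f by (auto simp: flag_auto_def flag_iso_def flag_hom_def)
      then show "f i \<in> carrier (Gr i) \<rightarrow>\<^sub>E carrier (Gr i)"
        using i by (auto simp: Gr_pos hom_def PiE_def)
    next
      fix i assume "i \<notin> {1..k}"
      then show "f i = undefined" using f by (auto simp: flag_auto_def extensional_def)
    qed
  qed
  then show ?thesis by (rule finite_subset) (intro finite_PiE; simp add: finite_Gr)
qed

lemma card_flag_auto_pos: "card (flag_auto k G) > 0"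
proof -
  let ?id = "restrict (\<lambda>i. restrict (\<lambda>x. x) (carrier (grp G i))) {1..k}"
  have cl: "x \<otimes>\<^bsub>grp G i\<^esub> y \<in> carrier (grp G i)"
    if "i \<in> {1..k}" "x \<in> carrier (grp G i)" "y \<in> carrier (grp G i)" for i x y
    using comm_group_Gr[of i] that by (auto simp: Gr_pos intro: monoid.m_closed comm_group.axioms group.is_monoid)
  have pc: "proj G i x \<in> carrier (grp G i)" if "i \<in> {1..<k}" "x \<in> carrier (grp G (Suc i))" for i x
    using pr_surj[of i] that by (auto simp: Gr_pos)
  have "?id i \<in> iso (grp G i) (grp G i)" if "i \<in> {1..k}" for i
    using that cl[OF that] by (auto simp: iso_def hom_def bij_betw_def inj_on_def)
  moreover have "?id i (proj G i x) = proj G i (?id (Suc i) x)"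
    if "i \<in> {1..<k}" "x \<in> carrier (grp G (Suc i))" for i x
    using that pc[OF that] by auto
  ultimately have "?id \<in> flag_auto k G"
    unfolding flag_auto_def flag_iso_def flag_hom_def iso_def by auto
  then show ?thesis using finite_flag_auto by (auto simp: card_gt_0_iff)
qed

text \<open>The number of families is either 0 or the number of automorphisms, so its mean is that
  number times the probability of the second case.\<close>

lemma prob_Marks_nonempty:
  assumes "admissible \<alpha> n q"
  shows "measure_pmf.prob (laws k n q) {f. Marks k n (\<lambda>i. to_mat n (f i)) \<noteq> {}} = mean_marks k n q / real (card (flag_auto k G))"
proof -
  let ?E = "{f. Marks k n (\<lambda>i. to_mat n (f i)) \<noteq> {}}"
  have "real (card (Marks k n (\<lambda>i. to_mat n (f i)))) = real (card (flag_auto k G)) * indicator ?E f" for f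
    using card_Marks_eq_card_auto[of n "\<lambda>i. to_mat n (f i)"] by (auto simp: indicator_def)
  then have "mean_marks k n q = real (card (flag_auto k G)) * measure_pmf.prob (laws k n q) ?E"
    unfolding mean_marks_def by simp
  then show ?thesis using card_flag_auto_pos by simp
qed

end

section \<open>Random integer matrices\<close>

context prob_space
begin

lemma sum_prob_eq:
  assumes S: "finite S" and R: "\<And>x. x \<in> S \<Longrightarrow> {\<omega> \<in> space M. R \<omega> = x} \<in> events"
  shows "prob {\<omega> \<in> space M. R \<omega> \<in> S} = (\<Sum>x\<in>S. prob {\<omega> \<in> space M. R \<omega> = x})"
proof -
  have "prob (\<Union>x\<in>S. {\<omega> \<in> space M. R \<omega> = x}) = (\<Sum>x\<in>S. prob {\<omega> \<in> space M. R \<omega> = x})"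
    using S R by (intro finite_measure_finite_Union) (auto simp: disjoint_family_on_def)
  moreover have "(\<Union>x\<in>S. {\<omega> \<in> space M. R \<omega> = x}) = {\<omega> \<in> space M. R \<omega> \<in> S}" by auto
  ultimately show ?thesis by simp
qed

lemma prob_eq_pmf:
  assumes S: "finite S" "\<And>\<omega>. \<omega> \<in> space M \<Longrightarrow> R \<omega> \<in> S"
    and R: "\<And>x. x \<in> S \<Longrightarrow> {\<omega> \<in> space M. R \<omega> = x} \<in> events"
    and eq: "\<And>x. x \<in> S \<Longrightarrow> prob {\<omega> \<in> space M. R \<omega> = x} = pmf p x"
  shows "prob {\<omega> \<in> space M. Q (R \<omega>)} = measure_pmf.prob p {x. Q x}"
proof -
  have *: "prob {\<omega> \<in> space M. R \<omega> \<in> T} = measure_pmf.prob p T" if "T \<subseteq> S" for T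
  proof -
    have "finite T" using that S(1) by (rule finite_subset)
    then have "prob {\<omega> \<in> space M. R \<omega> \<in> T} = (\<Sum>x\<in>T. pmf p x)"
      using that R eq by (subst sum_prob_eq) (auto intro!: sum.cong)
    then show ?thesis using \<open>finite T\<close> by (simp add: measure_measure_pmf_finite)
  qed
  have "{\<omega> \<in> space M. R \<omega> \<in> S} = space M" using S(2) by auto
  then have "measure_pmf.prob p S = 1" using *[OF order_refl] prob_space by simp
  then have "set_pmf p \<subseteq> S" using measure_pmf.prob_eq_1[of S p] by (auto simp: AE_measure_pmf_iff)
  then have "measure_pmf.prob p {x. Q x} = measure_pmf.prob p {x \<in> S. Q x}"
    by (intro measure_prob_cong_0) (auto simp: set_pmf_iff)
  also have "\<dots> = prob {\<omega> \<in> space M. R \<omega> \<in> {x \<in> S. Q x}}" by (subst *) auto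
  also have "{\<omega> \<in> space M. R \<omega> \<in> {x \<in> S. Q x}} = {\<omega> \<in> space M. Q (R \<omega>)}" using S(2) by auto
  finally show ?thesis ..
qed

lemma finite_law_pmf:
  assumes S: "finite S" "\<And>\<omega>. \<omega> \<in> space M \<Longrightarrow> R \<omega> \<in> S"
    and R: "\<And>x. x \<in> S \<Longrightarrow> {\<omega> \<in> space M. R \<omega> = x} \<in> events"
  obtains p where "set_pmf p \<subseteq> S" "\<And>x. pmf p x = prob {\<omega> \<in> space M. R \<omega> = x}"
proof -
  let ?f = "\<lambda>x. prob {\<omega> \<in> space M. R \<omega> = x}"
  have zero: "?f x = 0" if "x \<notin> S" for x
  proof -
    have "{\<omega> \<in> space M. R \<omega> = x} = {}" using that S(2) by auto
    then show ?thesis by (simp only: measure_empty)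
  qed
  have "(\<Sum>x\<in>S. ?f x) = prob {\<omega> \<in> space M. R \<omega> \<in> S}" by (rule sum_prob_eq[OF S(1) R, symmetric])
  also have "{\<omega> \<in> space M. R \<omega> \<in> S} = space M" using S(2) by auto
  finally have sum1: "(\<Sum>x\<in>S. ?f x) = 1" using prob_space by simp
  have "(\<integral>\<^sup>+ x. ennreal (?f x) \<partial>count_space UNIV) = (\<Sum>x\<in>S. ennreal (?f x))"
    using S(1) zero by (intro nn_integral_count_space'[of S]) auto
  also have "\<dots> = 1" using sum1 by (simp add: sum_ennreal)
  finally have pmf: "pmf (embed_pmf ?f) x = ?f x" for x by (intro pmf_embed_pmf) auto
  have "set_pmf (embed_pmf ?f) \<subseteq> S"
  proof
    fix x assume "x \<in> set_pmf (embed_pmf ?f)"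
    then have "pmf (embed_pmf ?f) x \<noteq> 0" unfolding set_pmf_iff .
    then have "?f x \<noteq> 0" unfolding pmf .
    then show "x \<in> S" using zero by blast
  qed
  then show thesis using pmf by (rule that)
qed

end

text \<open>Indexed with the column first and padded by 0 outside the square, to match the samples
  of \<open>law\<close>.\<close>

definition mat_residues :: "int \<Rightarrow> nat \<Rightarrow> int mat \<Rightarrow> nat \<Rightarrow> nat \<Rightarrow> int" where
  "mat_residues a n A c r = (if c < n \<and> r < n then A $$ (r, c) mod a else 0)"

lemma (in finite_flag) a_pos: "a > 0"
  using P_exponent unfolding P_exponent_def a_def by simp

lemma (in finite_flag) P_dvd_a: "p \<in> P \<Longrightarrow> int p dvd a"
proof -
  assume "p \<in> P"
  then have "p dvd (\<Prod>p\<in>P. p)" using finite_P by (rule dvd_prodI[rotated])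
  then have "int p dvd b" unfolding b_def by (simp only: int_dvd_int_iff)
  then show ?thesis by (simp add: a_def)
qed

section \<open>From random integer matrices to residues modulo \<open>a\<close>\<close>

locale random_flag = finite_flag P k G + prob_space W
  for P :: "nat set" and k :: nat and G :: "'a flag" and W :: "'w measure" +
  fixes M :: "nat \<Rightarrow> 'w \<Rightarrow> int mat" and n :: nat and \<alpha> :: real
  assumes n: "n \<ge> 1" and indep: "indep_vars (\<lambda>_. count_space UNIV) M {1..k}"
    and balanced: "\<And>i. i \<in> {1..k} \<Longrightarrow> balanced_matrix \<alpha> P n (M i)"
begin

abbreviation res :: "int mat \<Rightarrow> nat \<Rightarrow> nat \<Rightarrow> int" where "res \<equiv> mat_residues a n"

lemma M_carrier: "i \<in> {1..k} \<Longrightarrow> \<omega> \<in> space W \<Longrightarrow> M i \<omega> \<in> carrier_mat n n"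
  using balanced unfolding balanced_matrix_def by blast

lemma indep_entries: "i \<in> {1..k} \<Longrightarrow>
    indep_vars (\<lambda>_. count_space UNIV) (\<lambda>(r, c) \<omega>. M i \<omega> $$ (r, c)) ({..<n} \<times> {..<n})"
  using balanced unfolding balanced_matrix_def by blast

lemma event_M: "i \<in> {1..k} \<Longrightarrow> {\<omega> \<in> space W. Q (M i \<omega>)} \<in> events"
proof -
  assume "i \<in> {1..k}"
  then have "random_variable (count_space UNIV) (M i)" using indep unfolding indep_vars_def2 by blast
  from measurable_sets[OF this, of "{B. Q B}"] show ?thesis by (simp add: vimage_def Int_def conj_commute)
qed

text \<open>Since every \<open>p\<close> in \<open>P\<close> divides \<open>a\<close>, reduction
  modulo \<open>a\<close> does not change residues modulo \<open>p\<close>, and balancedness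
  survives.\<close>

lemma entry_law:
  assumes i: "i \<in> {1..k}" and rc: "c < n" "r < n"
  shows "\<exists>q. set_pmf q \<subseteq> {0..<a} \<and> (\<forall>x. pmf q x = prob {\<omega> \<in> space W. M i \<omega> $$ (r, c) mod a = x}) \<and>
    (\<forall>p\<in>P. balanced_pmf \<alpha> (int p) q)"
proof -
  let ?R = "\<lambda>\<omega>. M i \<omega> $$ (r, c) mod a"
  have R: "?R \<omega> \<in> {0..<a}" for \<omega> using a_pos by simp
  obtain q where q: "set_pmf q \<subseteq> {0..<a}" "\<And>x. pmf q x = prob {\<omega> \<in> space W. ?R \<omega> = x}"
    by (rule finite_law_pmf[of "{0..<a}" ?R, OF _ R]) (auto intro: event_M[OF i])
  have "balanced_pmf \<alpha> (int p) q" if p: "p \<in> P" for p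
    unfolding balanced_pmf_def
  proof (intro conjI allI)
    show "finite (set_pmf q)" by (rule finite_subset[OF q(1)]) simp
    fix s :: int
    have pa: "int p dvd a" "int p > 0" using P_dvd_a[OF p] prime_P[OF p] by (auto simp: prime_gt_0_nat)
    have "measure_pmf.prob q {v. int p dvd v - s} = prob {\<omega> \<in> space W. int p dvd ?R \<omega> - s}"
      by (rule prob_eq_pmf[of "{0..<a}", OF _ R, symmetric]) (auto simp: q(2) intro: event_M[OF i])
    also have "{\<omega> \<in> space W. int p dvd ?R \<omega> - s} = {\<omega> \<in> space W. M i \<omega> $$ (r, c) mod int p = s mod int p}"
    proof -
      have "int p dvd x mod a - s \<longleftrightarrow> x mod int p = s mod int p" for x
        using mod_mod_cancel[OF pa(1), of x] by (simp add: mod_eq_dvd_iff[symmetric])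
      then show ?thesis by simp
    qed
    also have "prob \<dots> \<le> (MAX t\<in>{0..<int p}. prob {\<omega> \<in> space W. M i \<omega> $$ (r, c) mod int p = t})"
      using pa(2) by (intro Max_ge) auto
    also have "\<dots> \<le> 1 - \<alpha>"
      using balanced[OF i] rc p unfolding balanced_matrix_def balanced_def by blast
    finally show "measure_pmf.prob q {v. int p dvd v - s} \<le> 1 - \<alpha>" .
  qed
  then show ?thesis using q by blast
qed

lemma matrix_law:
  assumes i: "i \<in> {1..k}"
    and q: "\<And>c r x. c < n \<Longrightarrow> r < n \<Longrightarrow> pmf (q c r) x = prob {\<omega> \<in> space W. M i \<omega> $$ (r, c) mod a = x}"
  shows "prob {\<omega> \<in> space W. res (M i \<omega>) = f} = pmf (law n q) f"
proof (cases "(\<forall>c. c \<notin> {..<n} \<longrightarrow> f c = (\<lambda>_. 0)) \<and> (\<forall>c<n. \<forall>r. r \<notin> {..<n} \<longrightarrow> f c r = 0)")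
  case True
  have "pmf (law n q) f = (\<Prod>c<n. pmf (Pi_pmf {..<n} 0 (q c)) (f c))"
    unfolding law_def using True by (subst pmf_Pi) auto
  also have "\<dots> = (\<Prod>c<n. \<Prod>r<n. pmf (q c r) (f c r))"
    using True by (intro prod.cong refl) (subst pmf_Pi, auto)
  \<comment> \<open>The samples of \<open>law\<close> are indexed by column, the independent entries
    of the matrix by row first, hence the exchange of products.\<close>
  also have "\<dots> = (\<Prod>r<n. \<Prod>c<n. prob {\<omega> \<in> space W. M i \<omega> $$ (r, c) mod a = f c r})"
    by (subst prod.swap) (intro prod.cong refl, simp add: q)
  also have "\<dots> = (\<Prod>rc\<in>{..<n} \<times> {..<n}. prob ((case rc of (r, c) \<Rightarrow> \<lambda>\<omega>. M i \<omega> $$ (r, c)) -`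
      {x. x mod a = f (snd rc) (fst rc)} \<inter> space W))"
    unfolding prod.cartesian_product
    by (intro prod.cong refl arg_cong[where f=prob]) (auto simp: vimage_def Int_def conj_commute)
  also have "\<dots> = prob (\<Inter>rc\<in>{..<n} \<times> {..<n}. (case rc of (r, c) \<Rightarrow> \<lambda>\<omega>. M i \<omega> $$ (r, c)) -`
      {x. x mod a = f (snd rc) (fst rc)} \<inter> space W)"
    using n by (intro indep_varsD[OF indep_entries[OF i], symmetric]) (auto simp: lessThan_empty_iff)
  also have "(\<Inter>rc\<in>{..<n} \<times> {..<n}. (case rc of (r, c) \<Rightarrow> \<lambda>\<omega>. M i \<omega> $$ (r, c)) -`
      {x. x mod a = f (snd rc) (fst rc)} \<inter> space W) = {\<omega> \<in> space W. res (M i \<omega>) = f}"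
  proof -
    have "res B = f \<longleftrightarrow> (\<forall>r<n. \<forall>c<n. B $$ (r, c) mod a = f c r)" for B
    proof
      assume *: "\<forall>r<n. \<forall>c<n. B $$ (r, c) mod a = f c r"
      show "res B = f"
      proof (intro ext)
        fix c r
        show "res B c r = f c r" using * True by (cases "c < n"; cases "r < n") (auto simp: mat_residues_def)
      qed
    qed (auto simp: mat_residues_def)
    moreover have "({..<n} :: nat set) \<times> {..<n} \<noteq> {}" using n by (auto simp: lessThan_empty_iff)
    ultimately show ?thesis by (auto simp: INT_iff)
  qed
  finally show ?thesis ..
next
  case False
  then obtain c r where cr: "\<not> (c < n \<and> r < n)" "f c r \<noteq> 0" by (auto simp: fun_eq_iff)
  then have "{\<omega> \<in> space W. res (M i \<omega>) = f} = {}" by (auto simp: mat_residues_def)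
  moreover have "pmf (law n q) f = 0"
  proof (cases "\<forall>c. c \<notin> {..<n} \<longrightarrow> f c = (\<lambda>_. 0)")
    case T: True
    then obtain c where "c < n" "\<exists>r. r \<notin> {..<n} \<and> f c r \<noteq> 0" using False by blast
    then have "pmf (Pi_pmf {..<n} 0 (q c)) (f c) = 0" by (subst pmf_Pi) auto
    then show ?thesis unfolding law_def using \<open>c < n\<close> T by (subst pmf_Pi) auto
  next
    case F: False
    then show ?thesis unfolding law_def by (subst pmf_Pi) auto
  qed
  ultimately show ?thesis by (simp only: measure_empty)
qed

text \<open>By \<open>Marks_cong\<close> the event depends only on the residues of the matrices
  modulo \<open>a\<close>, and these have the product law \<open>laws k n q\<close>. The laws
  \<open>q\<close> change with \<open>n\<close>; all that is passed on is their admissibility, over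
  which \<open>mean_marks_limit\<close> is uniform.\<close>

theorem prob_flag_isomorphic:
  "\<exists>q. admissible \<alpha> n q \<and>
    prob {\<omega> \<in> space W. flag_isomorphic k (cok_flag P n (\<lambda>i. M i \<omega>)) G} = mean_marks k n q / real (card (flag_auto k G))"
proof -
  have "\<forall>i\<in>{1..k}. \<forall>c\<in>{..<n}. \<forall>r\<in>{..<n}. \<exists>q. set_pmf q \<subseteq> {0..<a} \<and>
      (\<forall>x. pmf q x = prob {\<omega> \<in> space W. M i \<omega> $$ (r, c) mod a = x}) \<and> (\<forall>p\<in>P. balanced_pmf \<alpha> (int p) q)"
    using entry_law by simp
  then obtain q where "\<forall>i\<in>{1..k}. \<forall>c\<in>{..<n}. \<forall>r\<in>{..<n}. set_pmf (q i c r) \<subseteq> {0..<a} \<and>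
      (\<forall>x. pmf (q i c r) x = prob {\<omega> \<in> space W. M i \<omega> $$ (r, c) mod a = x}) \<and> (\<forall>p\<in>P. balanced_pmf \<alpha> (int p) (q i c r))"
    unfolding bchoice_iff by (elim exE)
  then have q: "\<And>i c r. i \<in> {1..k} \<Longrightarrow> c < n \<Longrightarrow> r < n \<Longrightarrow> set_pmf (q i c r) \<subseteq> {0..<a} \<and>
      (\<forall>x. pmf (q i c r) x = prob {\<omega> \<in> space W. M i \<omega> $$ (r, c) mod a = x}) \<and> (\<forall>p\<in>P. balanced_pmf \<alpha> (int p) (q i c r))"
    by auto
  have adm: "admissible \<alpha> n q"
    unfolding admissible_def using q by (meson finite_subset finite_atLeastLessThan_int)
  define R where "R \<omega> = (\<lambda>i. if i \<in> {1..k} then res (M i \<omega>) else (\<lambda>_ _. 0))" for \<omega>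
  define S where "S = PiE_dflt {1..k} (\<lambda>_ _. 0) (\<lambda>_. PiE_dflt {..<n} (\<lambda>_. 0) (\<lambda>_. PiE_dflt {..<n} 0 (\<lambda>_. {0..<a})))"
  have finS: "finite S" unfolding S_def by (intro finite_PiE_dflt) auto
  have RS: "R \<omega> \<in> S" for \<omega>
    unfolding S_def R_def PiE_dflt_def mat_residues_def using a_pos by auto
  have event: "{\<omega> \<in> space W. res (M i \<omega>) = f} \<in> events" if "i \<in> {1..k}" for i f
    using event_M[OF that, of "\<lambda>B. res B = f"] .
  have R_eq: "{\<omega> \<in> space W. R \<omega> = f} = (\<Inter>i\<in>{1..k}. M i -` {B. res B = f i} \<inter> space W)" if f: "f \<in> S" for f
  proof -
    have "R \<omega> = f \<longleftrightarrow> (\<forall>i\<in>{1..k}. res (M i \<omega>) = f i)" for \<omega>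
    proof
      assume *: "\<forall>i\<in>{1..k}. res (M i \<omega>) = f i"
      show "R \<omega> = f"
      proof
        fix i show "R \<omega> i = f i"
          using * f by (cases "i \<in> {1..k}") (auto simp: R_def S_def PiE_dflt_def)
      qed
    qed (auto simp: R_def)
    then show ?thesis using k by auto
  qed
  have ev: "{\<omega> \<in> space W. R \<omega> = f} \<in> events" if f: "f \<in> S" for f
    unfolding R_eq[OF f] using k event
    by (intro sets.finite_INT) (auto simp: vimage_def Int_def conj_commute)
  have pr: "prob {\<omega> \<in> space W. R \<omega> = f} = pmf (laws k n q) f" if f: "f \<in> S" for f
  proof -
    have "prob {\<omega> \<in> space W. R \<omega> = f} = (\<Prod>i\<in>{1..k}. prob (M i -` {B. res B = f i} \<inter> space W))"
      unfolding R_eq[OF f] using k by (intro indep_varsD[OF indep]) auto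
    also have "\<dots> = (\<Prod>i\<in>{1..k}. pmf (law n (q i)) (f i))"
    proof (rule prod.cong[OF refl])
      fix i assume i: "i \<in> {1..k}"
      have "M i -` {B. res B = f i} \<inter> space W = {\<omega> \<in> space W. res (M i \<omega>) = f i}" by auto
      then show "prob (M i -` {B. res B = f i} \<inter> space W) = pmf (law n (q i)) (f i)"
        using matrix_law[OF i, of "q i" "f i"] q[OF i] by simp
    qed
    also have "\<dots> = pmf (laws k n q) f"
    proof -
      have "f i = (\<lambda>_ _. 0)" if "i \<notin> {1..k}" for i using f that by (simp add: S_def PiE_dflt_def)
      then show ?thesis unfolding laws_def by (subst pmf_Pi) auto
    qed
    finally show ?thesis .
  qed
  have "{\<omega> \<in> space W. flag_isomorphic k (cok_flag P n (\<lambda>i. M i \<omega>)) G} =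
      {\<omega> \<in> space W. Marks k n (\<lambda>i. to_mat n (R \<omega> i)) \<noteq> {}}"
  proof (intro Collect_cong conj_cong refl)
    fix \<omega> assume w: "\<omega> \<in> space W"
    have "Marks k n (\<lambda>i. M i \<omega>) = Marks k n (\<lambda>i. to_mat n (R \<omega> i))"
    proof (rule Marks_cong)
      fix i r c assume i: "i \<in> {1..k}" and rc: "r < n" "c < n"
      have "to_mat n (R \<omega> i) $$ (r, c) = M i \<omega> $$ (r, c) mod a"
        using i rc by (simp add: R_def mat_residues_def)
      then show "a dvd M i \<omega> $$ (r, c) - to_mat n (R \<omega> i) $$ (r, c)"
        by (simp add: minus_mod_eq_mult_div)
    qed (use w in \<open>auto intro: M_carrier\<close>)
    then show "flag_isomorphic k (cok_flag P n (\<lambda>i. M i \<omega>)) G \<longleftrightarrow> Marks k n (\<lambda>i. to_mat n (R \<omega> i)) \<noteq> {}"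
      using flag_isomorphic_iff_Marks[of "\<lambda>i. M i \<omega>" n] M_carrier w by simp
  qed
  also have "prob \<dots> = measure_pmf.prob (laws k n q) {f. Marks k n (\<lambda>i. to_mat n (f i)) \<noteq> {}}"
    by (rule prob_eq_pmf[OF finS RS ev pr])
  also have "\<dots> = mean_marks k n q / real (card (flag_auto k G))" by (rule prob_Marks_nonempty[OF adm])
  finally show ?thesis using adm by blast
qed

end

theorem theorem1p1:
  fixes k :: nat and \<alpha> :: real and P :: "nat set"
    and W :: "nat \<Rightarrow> 'w measure"
    and M :: "nat \<Rightarrow> nat \<Rightarrow> 'w \<Rightarrow> int mat"
    and G :: "'a flag"
  assumes "k \<ge> 1"
    and "0 < \<alpha>" and "\<alpha> \<le> 1 / 2"
    and "finite P" and "\<forall>p\<in>P. prime p"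
    and "\<And>n. n \<ge> 1 \<Longrightarrow> prob_space (W n)"
    and "\<And>n. n \<ge> 1 \<Longrightarrow> prob_space.indep_vars (W n) (\<lambda>_. count_space UNIV) (M n) {1..k}"
    and "\<And>n i. n \<ge> 1 \<Longrightarrow> i \<in> {1..k} \<Longrightarrow> prob_space.balanced_matrix (W n) \<alpha> P n (M n i)"
    and "surjective_P_flag P k G"
  shows "(\<lambda>n. measure (W n)
            {\<omega> \<in> space (W n). flag_isomorphic k (cok_flag P n (\<lambda>i. M n i \<omega>)) G})
         \<longlonglongrightarrow> 1 / real (card (flag_auto k G)) *
             (\<Prod>p\<in>P. prodinf (\<lambda>i. 1 - 1 / real p ^ Suc i)) ^ k"
proof -
  interpret finite_flag P k G using assms by unfold_locales auto
  let ?C = "real (card (flag_auto k G))"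
  have C: "?C > 0" using card_flag_auto_pos by simp
  let ?p = "\<lambda>n. measure (W n) {\<omega> \<in> space (W n). flag_isomorphic k (cok_flag P n (\<lambda>i. M n i \<omega>)) G}"
  have "?p \<longlonglongrightarrow> euler ^ k / ?C"
  proof (rule LIMSEQ_I)
    fix e :: real assume e: "e > 0"
    \<comment> \<open>The tolerance is scaled by the number of automorphisms, by which the mean is
      divided, and halved to end with a strict inequality.\<close>
    then have e': "e / 2 * ?C > 0" using C by simp
    obtain N where N: "\<And>n q. n \<ge> N \<Longrightarrow> admissible \<alpha> n q \<Longrightarrow> \<bar>mean_marks k n q - euler ^ k\<bar> \<le> e / 2 * ?C"
      using mean_marks_limit[OF assms(2,3) order_refl e'] by blast
    have "norm (?p n - euler ^ k / ?C) < e" if n: "n \<ge> max 1 N" for n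
    proof -
      have "random_flag P k G (W n) (M n) n \<alpha>"
        using assms n by (intro random_flag.intro random_flag_axioms.intro finite_flag_axioms) auto
      then obtain q where q: "admissible \<alpha> n q" "?p n = mean_marks k n q / ?C"
        using random_flag.prob_flag_isomorphic by blast
      have "\<bar>?p n - euler ^ k / ?C\<bar> = \<bar>mean_marks k n q - euler ^ k\<bar> / ?C"
        using C by (simp add: q(2) diff_divide_distrib[symmetric])
      also have "\<dots> \<le> (e / 2 * ?C) / ?C" using N[OF _ q(1)] n C by (intro divide_right_mono) auto
      also have "\<dots> < e" using C e by simp
      finally show ?thesis by simp
    qed
    then show "\<exists>N. \<forall>n\<ge>N. norm (?p n - euler ^ k / ?C) < e" by blast
  qed
  then show ?thesis by (simp add: euler_def)
qed

end
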